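(* Let $n\ge2$, $(a_1,a_2)\in\mathbb{R}^2$, and let $\nabla$ be the canonical partial connection of the sub-Riemannian model space $M(n,a_1,a_2)$. Then, for an arbitrary point $x\in M(n,a_1,a_2)$, the horizontal holonomy group $\mathrm{Hol}^\nabla(x)$ is trivial if and only if $a_2=0$.
   Context: A sub-Riemannian manifold $(M,D,g)$ consists of a connected manifold $M$, a subbundle $D\subseteq TM$ and a positive definite metric tensor $g$ on $D$. If $D$ is bracket-generating (its sections and their iterated brackets span $TM$), an isometry is a homeomorphism preserving the Carnot–Carathéodory distance. $(M,D,g)$ is a sub-Riemannian model space if $M$ is connected and simply connected, $D$ is bracket-generating, and for all $x,y\in M$ and every linear isometry $q\in \mathrm{O}(D_x,D_y)$ there is a smooth isometry $\varphi:M\to M$ with $\varphi_*|_{D_x}=q$. The isometries of such a space are smooth, preserve $(D,g)$ and form a Lie group $\mathrm{Isom}(M)$. A partial connection on $D$ in the direction of $D$ is an $\mathbb{R}$-linear map $\nabla:\Gamma(D)\to\Gamma(D^*\otimes D)$ with $\nabla(\phi Y)=d\phi|_D\otimes Y+\phi\nabla Y$. It defines parallel transport along $D$-horizontal curves (absolutely continuous curves tangent to $D$ a.e.). The canonical partial connection of a model space is the unique such $\nabla$ that is compatible with $g$ ($X\langle Y,Z\rangle_g=\langle\nabla_XY,Z\rangle_g+\langle Y,\nabla_XZ\rangle_g$) and invariant under $\mathrm{Isom}(M)$ ($\nabla_{\mathrm{Ad}(\varphi)X}\mathrm{Ad}(\varphi)Y=\mathrm{Ad}(\varphi)\nabla_XY$,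 where $\mathrm{Ad}(\varphi)X(x)=\varphi_*X(\varphi^{-1}(x))$). $\mathrm{Hol}^\nabla(x)\subseteq\mathrm{GL}(D_x)$ is the group of parallel transport maps along horizontal loops based at $x$. Convention: for $x,y\in\mathbb{R}^n$, $x\wedge y=yx^{\top}-xy^{\top}\in\mathfrak{o}(n)$, the Lie algebra of antisymmetric $n\times n$ matrices. $M(n,a_1,a_2)$: let $\mathfrak{g}(n,a_1,a_2)$ be the vector space $\mathfrak a^1\oplus\mathfrak a^2\oplus\mathfrak a^3\oplus\mathfrak k=\mathbb{R}^n\oplus\mathfrak{o}(n)\oplus\mathbb{R}^n\oplus\mathfrak{o}(n)$ with elements $(x,A,u,C)$ and Lie bracket such that $[(x,A,u,0),(y,B,v,0)]$ has components - in $\mathfrak a^1$: $a_2(Av-Bu)$, - in $\mathfrak a^2$: $x\wedge y+a_1(x\wedge v+u\wedge y)+a_1[A,B]+(a_2+a_1^2)\,u\wedge v$, - in $\mathfrak a^3$: $Ay-Bx+a_1(Av-Bu)$, - in $\mathfrak k$: $a_2(x\wedge v+u\wedge y)+a_2[A,B]+a_1a_2\,u\wedge v$, while $[(0,0,0,C),(x,A,u,B)]=(Cx,[C,A],Cu,[C,B])$. Let $G$ be the connected, simply connected Lie group with this Lie algebra and $K$ its connected subgroup with Lie algebra $\mathfrak k=\{(0,0,0,C)\}$. $M(n,a_1,a_2)$ is the sub-Riemannian model space $G/K$ with the sub-Riemannian structure induced from the left translates of $\mathfrak a^1=\{(x,0,0,0)\}$ with the standard Euclidean inner product (which is $K$-invariant).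 *)

theory Defs
  imports "HOL-Analysis.Analysis" "HOL-Algebra.Generated_Groups"
begin

section \<open>Smooth manifolds\<close>

text \<open>A manifold is given by an atlas: a set of charts (U, f) with f mapping U bijectively onto an
  open set of the model space. Its points are the union of the chart domains; maps on a manifold are
  total functions whose values away from the points are irrelevant.\<close>

fun Ck_on :: "nat \<Rightarrow> 'a::euclidean_space set \<Rightarrow> ('a \<Rightarrow> 'b::real_normed_vector) \<Rightarrow> bool" where
  "Ck_on 0 S f \<longleftrightarrow> continuous_on S f"
| "Ck_on (Suc k) S f \<longleftrightarrow> (\<forall>x\<in>S. f differentiable (at x)) \<and>
     (\<forall>v. Ck_on k S (\<lambda>x. frechet_derivative f (at x) v))"

definition smooth_on :: "'a::euclidean_space set \<Rightarrow> ('a \<Rightarrow> 'b::real_normed_vector) \<Rightarrow> bool" where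
  "smooth_on S f \<longleftrightarrow> (\<forall>k. Ck_on k S f)"

type_synonym ('p, 'e) atlas = "('p set \<times> ('p \<Rightarrow> 'e)) set"

definition points :: "('p, 'e) atlas \<Rightarrow> 'p set" where
  "points A = (\<Union>(U, \<phi>)\<in>A. U)"

definition mtop :: "('p, 'e::euclidean_space) atlas \<Rightarrow> 'p topology" where
  "mtop A = topology_generated_by {U \<inter> \<phi> -` W | U \<phi> W. (U, \<phi>) \<in> A \<and> open W}"

definition smooth_manifold :: "('p, 'e::euclidean_space) atlas \<Rightarrow> bool" where
  "smooth_manifold A \<longleftrightarrow>
     (\<forall>(U, \<phi>)\<in>A. inj_on \<phi> U \<and> open (\<phi> ` U)) \<and>
     (\<forall>(U, \<phi>)\<in>A. \<forall>(V, \<psi>)\<in>A. open (\<phi> ` (U \<inter> V)) \<and>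
        smooth_on (\<phi> ` (U \<inter> V)) (\<psi> \<circ> the_inv_into U \<phi>)) \<and>
     Hausdorff_space (mtop A) \<and> second_countable (mtop A)"

definition smooth_fun :: "('p, 'e::euclidean_space) atlas \<Rightarrow> ('p \<Rightarrow> real) \<Rightarrow> bool" where
  "smooth_fun A f \<longleftrightarrow> (\<forall>(U, \<phi>)\<in>A. smooth_on (\<phi> ` U) (f \<circ> the_inv_into U \<phi>))"

definition smooth_map ::
  "('p, 'e::euclidean_space) atlas \<Rightarrow> ('q, 'f::euclidean_space) atlas \<Rightarrow> ('p \<Rightarrow> 'q) \<Rightarrow> bool" where
  "smooth_map A B F \<longleftrightarrow> F ` points A \<subseteq> points B \<and>
     (\<forall>(U, \<phi>)\<in>A. \<forall>(V, \<psi>)\<in>B. open (\<phi> ` (U \<inter> F -` V)) \<and>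
        smooth_on (\<phi> ` (U \<inter> F -` V)) (\<psi> \<circ> F \<circ> the_inv_into U \<phi>))"

definition prod_atlas ::
  "('p, 'e) atlas \<Rightarrow> ('q, 'f) atlas \<Rightarrow> ('p \<times> 'q, 'e \<times> 'f) atlas" where
  "prod_atlas A B = {(U \<times> V, map_prod \<phi> \<psi>) | U \<phi> V \<psi>. (U, \<phi>) \<in> A \<and> (V, \<psi>) \<in> B}"

definition simply_connected_space :: "'p topology \<Rightarrow> bool" where
  "simply_connected_space X \<longleftrightarrow> path_connected_space X \<and>
     (\<forall>c. pathin X c \<and> c 0 = c 1 \<longrightarrow>
        (\<exists>a\<in>topspace X. homotopic_with (\<lambda>r. r 0 = r 1) (top_of_set {0..1::real}) X c (\<lambda>_. a)))"

section \<open>Tangent vectors and vector fields\<close>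

text \<open>A tangent vector at p is a derivation at p of the algebra of smooth functions, set to 0 on
  functions that are not smooth so that equality of derivations is equality of HOL functions.\<close>

type_synonym 'p tvec = "('p \<Rightarrow> real) \<Rightarrow> real"
type_synonym 'p vfield = "'p \<Rightarrow> 'p tvec"

definition tangent_space :: "('p, 'e::euclidean_space) atlas \<Rightarrow> 'p \<Rightarrow> 'p tvec set" where
  "tangent_space A p = {v.
     (\<forall>f. \<not> smooth_fun A f \<longrightarrow> v f = 0) \<and>
     (\<forall>f h. smooth_fun A f \<longrightarrow> smooth_fun A h \<longrightarrow> v (\<lambda>q. f q + h q) = v f + v h) \<and>
     (\<forall>f r. smooth_fun A f \<longrightarrow> v (\<lambda>q. r * f q) = r * v f) \<and>
     (\<forall>f h. smooth_fun A f \<longrightarrow> smooth_fun A h \<longrightarrow> v (\<lambda>q. f q * h q) = v f * h p + f p * v h)}"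

definition push_forward ::
  "('q, 'f::euclidean_space) atlas \<Rightarrow> ('p \<Rightarrow> 'q) \<Rightarrow> 'p tvec \<Rightarrow> 'q tvec" where
  "push_forward B F v = (\<lambda>f. if smooth_fun B f then v (f \<circ> F) else 0)"

definition vfields :: "('p, 'e::euclidean_space) atlas \<Rightarrow> 'p vfield set" where
  "vfields A = {X. (\<forall>p\<in>points A. X p \<in> tangent_space A p) \<and>
     (\<forall>p. p \<notin> points A \<longrightarrow> X p = (\<lambda>_. 0)) \<and>
     (\<forall>f. smooth_fun A f \<longrightarrow> smooth_fun A (\<lambda>p. X p f))}"

definition vf_bracket :: "'p vfield \<Rightarrow> 'p vfield \<Rightarrow> 'p vfield" where
  "vf_bracket X Y = (\<lambda>p f. X p (\<lambda>q. Y q f) - Y p (\<lambda>q. X q f))"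

text \<open>Ad(F)X for a bijection F of the manifold.\<close>

definition vf_Ad :: "('p, 'e::euclidean_space) atlas \<Rightarrow> ('p \<Rightarrow> 'p) \<Rightarrow> 'p vfield \<Rightarrow> 'p vfield" where
  "vf_Ad A F X = (\<lambda>p. if p \<in> points A
     then push_forward A F (X (inv_into (points A) F p)) else (\<lambda>_. 0))"

definition velocity :: "('p, 'e::euclidean_space) atlas \<Rightarrow> (real \<Rightarrow> 'p) \<Rightarrow> real \<Rightarrow> 'p tvec" where
  "velocity A c t = (\<lambda>f. if smooth_fun A f then deriv (f \<circ> c) t else 0)"

section \<open>Sub-Riemannian manifolds\<close>

record ('p, 'e) subriem =
  atl :: "('p, 'e) atlas"
  dst :: "'p \<Rightarrow> 'p tvec set"
  met :: "'p \<Rightarrow> 'p tvec \<Rightarrow> 'p tvec \<Rightarrow> real"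

abbreviation pts :: "('p, 'e) subriem \<Rightarrow> 'p set" where
  "pts M \<equiv> points (atl M)"

text \<open>Smooth subbundle of TM of rank k. Near any point, a local frame can be taken to be the
  restriction of global vector fields on M, by cutting it off.\<close>

definition subbundle ::
  "('p, 'e::euclidean_space) atlas \<Rightarrow> nat \<Rightarrow> ('p \<Rightarrow> 'p tvec set) \<Rightarrow> bool" where
  "subbundle A k D \<longleftrightarrow>
     (\<forall>p\<in>points A. D p \<subseteq> tangent_space A p) \<and>
     (\<forall>p\<in>points A. \<exists>U E. openin (mtop A) U \<and> p \<in> U \<and> (\<forall>i<k. E i \<in> vfields A) \<and>
        (\<forall>q\<in>U. bij_betw (\<lambda>c f. \<Sum>i<k. c i * E i q f) ({..<k} \<rightarrow>\<^sub>E (UNIV :: real set)) (D q)))"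

definition sections :: "('p, 'e::euclidean_space) subriem \<Rightarrow> 'p vfield set" where
  "sections M = {X \<in> vfields (atl M). \<forall>p\<in>pts M. X p \<in> dst M p}"

definition sub_riemannian :: "('p, 'e::euclidean_space) subriem \<Rightarrow> bool" where
  "sub_riemannian M \<longleftrightarrow> smooth_manifold (atl M) \<and> connected_space (mtop (atl M)) \<and>
     (\<exists>k. subbundle (atl M) k (dst M)) \<and>
     (\<forall>p\<in>pts M. \<forall>u\<in>dst M p. \<forall>v\<in>dst M p.
        met M p u v = met M p v u \<and>
        (\<forall>w\<in>dst M p. met M p (\<lambda>f. u f + v f) w = met M p u w + met M p v w) \<and>
        (\<forall>r. met M p (\<lambda>f. r * u f) v = r * met M p u v) \<and>
        (u \<noteq> (\<lambda>_. 0) \<longrightarrow> met M p u u > 0)) \<and>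
     (\<forall>X\<in>sections M. \<forall>Y\<in>sections M. smooth_fun (atl M) (\<lambda>p. met M p (X p) (Y p)))"

inductive_set iterated_brackets :: "('p, 'e::euclidean_space) subriem \<Rightarrow> 'p vfield set"
  for M where
  "X \<in> sections M \<Longrightarrow> X \<in> iterated_brackets M"
| "X \<in> iterated_brackets M \<Longrightarrow> Y \<in> iterated_brackets M \<Longrightarrow> vf_bracket X Y \<in> iterated_brackets M"

definition bracket_generating :: "('p, 'e::euclidean_space) subriem \<Rightarrow> bool" where
  "bracket_generating M \<longleftrightarrow> (\<forall>p\<in>pts M. \<forall>v\<in>tangent_space (atl M) p.
     \<exists>(m::nat) (c::nat \<Rightarrow> real) X. (\<forall>i<m. X i \<in> iterated_brackets M) \<and>
       v = (\<lambda>f. \<Sum>i<m. c i * X i p f))"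

section \<open>Horizontal curves, Carnot--Caratheodory distance, isometries\<close>

definition abs_continuous_on :: "real set \<Rightarrow> (real \<Rightarrow> real) \<Rightarrow> bool" where
  "abs_continuous_on S f \<longleftrightarrow> (\<forall>\<epsilon>>0. \<exists>\<delta>>0. \<forall>(N::nat) a b.
     (\<forall>i<N. a i \<le> b i \<and> {a i..b i} \<subseteq> S) \<longrightarrow>
     disjoint_family_on (\<lambda>i. {a i<..<b i}) {..<N} \<longrightarrow>
     (\<Sum>i<N. b i - a i) < \<delta> \<longrightarrow> (\<Sum>i<N. \<bar>f (b i) - f (a i)\<bar>) < \<epsilon>)"

text \<open>Absolute continuity in charts is the same as absolute continuity of the composition with
  every smooth function. All curves are parametrised by the unit interval.\<close>

definition horizontal_curve :: "('p, 'e::euclidean_space) subriem \<Rightarrow> (real \<Rightarrow> 'p) \<Rightarrow> bool" where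
  "horizontal_curve M c \<longleftrightarrow> pathin (mtop (atl M)) c \<and>
     (\<forall>f. smooth_fun (atl M) f \<longrightarrow> abs_continuous_on {0..1} (f \<circ> c)) \<and>
     (AE t in lebesgue. t \<in> {0..1} \<longrightarrow>
        (\<forall>f. smooth_fun (atl M) f \<longrightarrow> (f \<circ> c) differentiable (at t)) \<and>
        velocity (atl M) c t \<in> dst M (c t))"

definition curve_length :: "('p, 'e::euclidean_space) subriem \<Rightarrow> (real \<Rightarrow> 'p) \<Rightarrow> ennreal" where
  "curve_length M c = (\<integral>\<^sup>+t\<in>{0..1}.
     ennreal (sqrt (met M (c t) (velocity (atl M) c t) (velocity (atl M) c t))) \<partial>lebesgue)"

definition cc_dist :: "('p, 'e::euclidean_space) subriem \<Rightarrow> 'p \<Rightarrow> 'p \<Rightarrow> ennreal" where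
  "cc_dist M p q = (INF c\<in>{c. horizontal_curve M c \<and> c 0 = p \<and> c 1 = q}. curve_length M c)"

definition isom :: "('p, 'e::euclidean_space) subriem \<Rightarrow> ('p \<Rightarrow> 'p) set" where
  "isom M = {F. homeomorphic_map (mtop (atl M)) (mtop (atl M)) F \<and>
     (\<forall>p\<in>pts M. \<forall>q\<in>pts M. cc_dist M (F p) (F q) = cc_dist M p q)}"

definition linear_isometry ::
  "('p, 'e::euclidean_space) subriem \<Rightarrow> 'p \<Rightarrow> 'p \<Rightarrow> ('p tvec \<Rightarrow> 'p tvec) \<Rightarrow> bool" where
  "linear_isometry M x y Q \<longleftrightarrow> bij_betw Q (dst M x) (dst M y) \<and>
     (\<forall>u\<in>dst M x. \<forall>v\<in>dst M x. Q (\<lambda>f. u f + v f) = (\<lambda>f. Q u f + Q v f) \<and>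
        (\<forall>r. Q (\<lambda>f. r * u f) = (\<lambda>f. r * Q u f)) \<and>
        met M y (Q u) (Q v) = met M x u v)"

definition sr_model_space :: "('p, 'e::euclidean_space) subriem \<Rightarrow> bool" where
  "sr_model_space M \<longleftrightarrow> sub_riemannian M \<and> simply_connected_space (mtop (atl M)) \<and>
     bracket_generating M \<and>
     (\<forall>x\<in>pts M. \<forall>y\<in>pts M. \<forall>Q. linear_isometry M x y Q \<longrightarrow>
        (\<exists>F\<in>isom M. smooth_map (atl M) (atl M) F \<and> F x = y \<and>
           (\<forall>v\<in>dst M x. push_forward (atl M) F v = Q v)))"

section \<open>Partial connections and horizontal holonomy\<close>

text \<open>An element of \<open>\<Gamma>(D* \<otimes> D)\<close> is rendered as a fibrewise linear map which sends smooth sections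
  of D to smooth sections of D; \<open>nab Y p v\<close> is the derivative of Y at p in the direction v.\<close>

type_synonym 'p pconn = "'p vfield \<Rightarrow> 'p \<Rightarrow> 'p tvec \<Rightarrow> 'p tvec"

definition partial_connection :: "('p, 'e::euclidean_space) subriem \<Rightarrow> 'p pconn \<Rightarrow> bool" where
  "partial_connection M nab \<longleftrightarrow>
     (\<forall>Y\<in>sections M. \<forall>p\<in>pts M. \<forall>u\<in>dst M p. \<forall>v\<in>dst M p.
        nab Y p (\<lambda>f. u f + v f) = (\<lambda>f. nab Y p u f + nab Y p v f) \<and>
        (\<forall>r. nab Y p (\<lambda>f. r * u f) = (\<lambda>f. r * nab Y p u f))) \<and>
     (\<forall>X\<in>sections M. \<forall>Y\<in>sections M. (\<lambda>p. nab Y p (X p)) \<in> sections M) \<and>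
     (\<forall>Y\<in>sections M. \<forall>Z\<in>sections M. \<forall>p\<in>pts M. \<forall>v\<in>dst M p.
        nab (\<lambda>q f. Y q f + Z q f) p v = (\<lambda>f. nab Y p v f + nab Z p v f)) \<and>
     (\<forall>r. \<forall>Y\<in>sections M. \<forall>p\<in>pts M. \<forall>v\<in>dst M p.
        nab (\<lambda>q f. r * Y q f) p v = (\<lambda>f. r * nab Y p v f)) \<and>
     (\<forall>h. smooth_fun (atl M) h \<longrightarrow> (\<forall>Y\<in>sections M. \<forall>p\<in>pts M. \<forall>v\<in>dst M p.
        nab (\<lambda>q f. h q * Y q f) p v = (\<lambda>f. v h * Y p f + h p * nab Y p v f)))"

definition metric_compatible :: "('p, 'e::euclidean_space) subriem \<Rightarrow> 'p pconn \<Rightarrow> bool" where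
  "metric_compatible M nab \<longleftrightarrow>
     (\<forall>X\<in>sections M. \<forall>Y\<in>sections M. \<forall>Z\<in>sections M. \<forall>p\<in>pts M.
        X p (\<lambda>q. met M q (Y q) (Z q)) =
          met M p (nab Y p (X p)) (Z p) + met M p (Y p) (nab Z p (X p)))"

definition isom_invariant :: "('p, 'e::euclidean_space) subriem \<Rightarrow> 'p pconn \<Rightarrow> bool" where
  "isom_invariant M nab \<longleftrightarrow>
     (\<forall>F\<in>isom M. \<forall>X\<in>sections M. \<forall>Y\<in>sections M. \<forall>p\<in>pts M.
        nab (vf_Ad (atl M) F Y) p (vf_Ad (atl M) F X p) =
          vf_Ad (atl M) F (\<lambda>q. nab Y q (X q)) p)"

definition canonical_partial_connection ::
  "('p, 'e::euclidean_space) subriem \<Rightarrow> 'p pconn \<Rightarrow> bool" where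
  "canonical_partial_connection M nab \<longleftrightarrow> sr_model_space M \<and>
     partial_connection M nab \<and> metric_compatible M nab \<and> isom_invariant M nab"

text \<open>An absolutely continuous section of the pullback of D along c is a combination of sections
  \<open>E i \<circ> c\<close> with absolutely continuous coefficients; by the Leibniz rule its covariant derivative along
  c is \<open>\<Sum>i. c\<^sub>i' E i + c\<^sub>i \<nabla>(E i)\<close>, independently of the chosen representation.\<close>

definition parallel_along ::
  "('p, 'e::euclidean_space) subriem \<Rightarrow> 'p pconn \<Rightarrow> (real \<Rightarrow> 'p) \<Rightarrow> (real \<Rightarrow> 'p tvec) \<Rightarrow> bool" where
  "parallel_along M nab c V \<longleftrightarrow> (\<exists>(m::nat) E a.
     (\<forall>i<m. E i \<in> sections M \<and> abs_continuous_on {0..1} (a i)) \<and>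
     (\<forall>t\<in>{0..1}. V t = (\<lambda>f. \<Sum>i<m. a i t * E i (c t) f)) \<and>
     (AE t in lebesgue. t \<in> {0..1} \<longrightarrow> (\<exists>a'. \<forall>i<m. (a i has_real_derivative a' i) (at t)) \<and>
        (\<forall>f. (\<Sum>i<m. deriv (a i) t * E i (c t) f +
                     a i t * nab (E i) (c t) (velocity (atl M) c t) f) = 0)))"

definition parallel_transport ::
  "('p, 'e::euclidean_space) subriem \<Rightarrow> 'p pconn \<Rightarrow> (real \<Rightarrow> 'p) \<Rightarrow> 'p tvec \<Rightarrow> 'p tvec \<Rightarrow> bool" where
  "parallel_transport M nab c v w \<longleftrightarrow> (\<exists>V. parallel_along M nab c V \<and> V 0 = v \<and> V 1 = w)"

text \<open>Elements of \<open>GL(D\<^sub>x)\<close> are functions on \<open>D\<^sub>x\<close>, extended by \<open>undefined\<close>.\<close>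

definition horizontal_holonomy ::
  "('p, 'e::euclidean_space) subriem \<Rightarrow> 'p pconn \<Rightarrow> 'p \<Rightarrow> ('p tvec \<Rightarrow> 'p tvec) set" where
  "horizontal_holonomy M nab x = {P \<in> dst M x \<rightarrow>\<^sub>E dst M x.
     \<exists>c. horizontal_curve M c \<and> c 0 = x \<and> c 1 = x \<and>
       (\<forall>v\<in>dst M x. parallel_transport M nab c v (P v))}"

section \<open>Lie groups\<close>

definition lie_group :: "'g monoid \<Rightarrow> ('g, 'e::euclidean_space) atlas \<Rightarrow> bool" where
  "lie_group G A \<longleftrightarrow> group G \<and> smooth_manifold A \<and> points A = carrier G \<and>
     smooth_map (prod_atlas A A) A (\<lambda>(g, h). g \<otimes>\<^bsub>G\<^esub> h) \<and> smooth_map A A (\<lambda>g. inv\<^bsub>G\<^esub> g)"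

definition left_invariant_fields :: "'g monoid \<Rightarrow> ('g, 'e::euclidean_space) atlas \<Rightarrow> 'g vfield set" where
  "left_invariant_fields G A = {X \<in> vfields A. \<forall>g\<in>carrier G. \<forall>h\<in>carrier G.
     push_forward A (\<lambda>k. g \<otimes>\<^bsub>G\<^esub> k) (X h) = X (g \<otimes>\<^bsub>G\<^esub> h)}"

text \<open>c is the one-parameter subgroup t \<open>\<mapsto>\<close> exp(tX) of a left-invariant field X.\<close>

definition exp_curve ::
  "'g monoid \<Rightarrow> ('g, 'e::euclidean_space) atlas \<Rightarrow> 'g vfield \<Rightarrow> (real \<Rightarrow> 'g) \<Rightarrow> bool" where
  "exp_curve G A X c \<longleftrightarrow> c 0 = \<one>\<^bsub>G\<^esub> \<and> (\<forall>t. c t \<in> carrier G) \<and>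
     (\<forall>t f. smooth_fun A f \<longrightarrow> ((f \<circ> c) has_real_derivative X (c t) f) (at t))"

text \<open>K is the connected Lie subgroup of G with Lie algebra S: it is generated by exp(S), and the
  one-parameter subgroups of G contained in K are exactly those of the elements of S.\<close>

definition connected_lie_subgroup ::
  "'g monoid \<Rightarrow> ('g, 'e::euclidean_space) atlas \<Rightarrow> 'g set \<Rightarrow> 'g vfield set \<Rightarrow> bool" where
  "connected_lie_subgroup G A K S \<longleftrightarrow>
     K = generate G {c 1 | c X. X \<in> S \<and> exp_curve G A X c} \<and>
     S = {X \<in> left_invariant_fields G A. \<exists>c. exp_curve G A X c \<and> range c \<subseteq> K}"

definition coset_proj :: "'g monoid \<Rightarrow> 'g set \<Rightarrow> 'g \<Rightarrow> 'g set" where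
  "coset_proj G K g = g <#\<^bsub>G\<^esub> K"

text \<open>B is an atlas for the homogeneous space G/K of left cosets: the quotient map is a smooth
  surjective submersion, which determines the smooth structure.\<close>

definition homogeneous_space ::
  "'g monoid \<Rightarrow> ('g, 'e::euclidean_space) atlas \<Rightarrow> 'g set \<Rightarrow> ('g set, 'm::euclidean_space) atlas \<Rightarrow> bool"
  where
  "homogeneous_space G A K B \<longleftrightarrow> smooth_manifold B \<and> points B = coset_proj G K ` carrier G \<and>
     smooth_map A B (coset_proj G K) \<and>
     (\<forall>g\<in>carrier G. push_forward B (coset_proj G K) ` tangent_space A g =
        tangent_space B (coset_proj G K g))"

section \<open>The Lie algebras g(n, a1, a2) and the spaces M(n, a1, a2)\<close>

text \<open>The dimension n is \<open>CARD('n)\<close>. The Lie algebra is the subspace \<open>galg\<close> of the quadruples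
  (x, A, u, C) in which A and C are antisymmetric.\<close>

type_synonym 'n quad =
  "(real ^ 'n) \<times> (real ^ 'n ^ 'n) \<times> (real ^ 'n) \<times> (real ^ 'n ^ 'n)"

definition skew :: "(real ^ 'n ^ 'n) set" where
  "skew = {A. transpose A = - A}"

definition galg :: "('n::finite) quad set" where
  "galg = UNIV \<times> skew \<times> UNIV \<times> skew"

definition wedge :: "real ^ 'n \<Rightarrow> real ^ 'n \<Rightarrow> real ^ 'n ^ 'n" where
  "wedge x y = (\<chi> i j. y $ i * x $ j - x $ i * y $ j)"

definition comm :: "real ^ 'n ^ 'n \<Rightarrow> real ^ 'n ^ 'n \<Rightarrow> real ^ 'n ^ 'n" where
  "comm A B = A ** B - B ** A"

fun bracket_a :: "real \<Rightarrow> real \<Rightarrow> ('n::finite) quad \<Rightarrow> 'n quad \<Rightarrow> 'n quad" where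
  "bracket_a a1 a2 (x, A, u, _) (y, B, v, _) =
     (a2 *\<^sub>R (A *v v - B *v u),
      wedge x y + a1 *\<^sub>R (wedge x v + wedge u y) + a1 *\<^sub>R comm A B + (a2 + a1\<^sup>2) *\<^sub>R wedge u v,
      A *v y - B *v x + a1 *\<^sub>R (A *v v - B *v u),
      a2 *\<^sub>R (wedge x v + wedge u y) + a2 *\<^sub>R comm A B + (a1 * a2) *\<^sub>R wedge u v)"

fun act_k :: "real ^ 'n ^ 'n \<Rightarrow> ('n::finite) quad \<Rightarrow> 'n quad" where
  "act_k C (x, A, u, B) = (C *v x, comm C A, C *v u, comm C B)"

text \<open>Bilinear, antisymmetric extension: the bracket of \<open>(x, A, u, 0) + (0, 0, 0, C)\<close> and
  \<open>(y, B, v, 0) + (0, 0, 0, E)\<close>.\<close>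

fun gbracket :: "real \<Rightarrow> real \<Rightarrow> ('n::finite) quad \<Rightarrow> 'n quad \<Rightarrow> 'n quad" where
  "gbracket a1 a2 (x, A, u, C) (y, B, v, E) =
     bracket_a a1 a2 (x, A, u, 0) (y, B, v, 0)
     + act_k C (y, B, v, E) - act_k E (x, A, u, 0)"

text \<open>L is an isomorphism of g(n, a1, a2) onto the Lie algebra of left-invariant vector fields.\<close>

definition lie_algebra_iso ::
  "real \<Rightarrow> real \<Rightarrow> 'g monoid \<Rightarrow> ('g, 'e::euclidean_space) atlas \<Rightarrow> (('n::finite) quad \<Rightarrow> 'g vfield) \<Rightarrow> bool"
  where
  "lie_algebra_iso a1 a2 G A L \<longleftrightarrow> bij_betw L galg (left_invariant_fields G A) \<and>
     (\<forall>a\<in>galg. \<forall>b\<in>galg. L (a + b) = (\<lambda>p f. L a p f + L b p f) \<and>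
        (\<forall>r. L (r *\<^sub>R a) = (\<lambda>p f. r * L a p f)) \<and>
        L (gbracket a1 a2 a b) = vf_bracket (L a) (L b))"

definition horizontal_push ::
  "'g monoid \<Rightarrow> (('n::finite) quad \<Rightarrow> 'g vfield) \<Rightarrow> 'g set \<Rightarrow> ('g set, 'm::euclidean_space) atlas
     \<Rightarrow> 'g \<Rightarrow> real ^ 'n \<Rightarrow> 'g set tvec" where
  "horizontal_push G L K B g x = push_forward B (coset_proj G K) (L (x, 0, 0, 0) g)"

text \<open>M is the space M(n, a1, a2) = G/K, where G is the connected, simply connected Lie group with
  Lie algebra g(n, a1, a2), identified by L with the left-invariant fields of G.\<close>

definition is_model_M ::
  "real \<Rightarrow> real \<Rightarrow> 'g monoid \<Rightarrow> ('g, 'e::euclidean_space) atlas \<Rightarrow> (('n::finite) quad \<Rightarrow> 'g vfield)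
     \<Rightarrow> 'g set \<Rightarrow> ('g set, 'm::euclidean_space) subriem \<Rightarrow> bool" where
  "is_model_M a1 a2 G A L K M \<longleftrightarrow>
     lie_group G A \<and> connected_space (mtop A) \<and> simply_connected_space (mtop A) \<and>
     lie_algebra_iso a1 a2 G A L \<and>
     connected_lie_subgroup G A K (L ` {(0, 0, 0, C) | C. C \<in> skew}) \<and>
     homogeneous_space G A K (atl M) \<and>
     (\<forall>g\<in>carrier G. dst M (coset_proj G K g) = range (horizontal_push G L K (atl M) g) \<and>
        (\<forall>x y. met M (coset_proj G K g)
            (horizontal_push G L K (atl M) g x) (horizontal_push G L K (atl M) g y) = x \<bullet> y))"

end

theory Submission
 imports Defs
begin

text \<open>Every Lie algebra element \<open>a\<close> yields a section \<open>Y a\<close> whose value at \<open>gK\<close> is the left translate by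
 \<open>g\<close> of the \<open>a\<^sup>1\<close> component of \<open>co g a = Ad (inverse g) a\<close>. Left translations are isometries, so
 metric compatibility and invariance determine \<open>\<nabla> (Y a)\<close> up to an invariant tensor \<open>S\<close> that takes values
 in skew maps. \<open>S\<close> vanishes: for \<open>n = 2\<close> because it commutes with rotations, for \<open>n \<ge> 3\<close>
 because of the isometry that fixes the base point and acts by \<open>-1\<close> on the horizontal space there.

 If \<open>a2 = 0\<close>, the fields \<open>Y (y, 0, 0, 0)\<close> are parallel and span the horizontal bundle, so inner products with
 them are constant along every parallel transport. If \<open>a2 \<noteq> 0\<close>, parallel transport along the
 projection of a horizontal curve \<open>g\<close> in \<open>G\<close> is left translation from \<open>g 0\<close> to \<open>g 1\<close>. The endpoints of
 such curves from 1 fill a neighbourhood of 1, which contains elements of \<open>K\<close> acting nontrivially.\<close>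

section \<open>Calculus of smooth functions on open sets\<close>

text \<open>\<open>K\<close> is connected, so invariance under it alone would allow \<open>S\<close>
  to be the cross product when n = 3. An isometry outside the translations has to be used, and the
  model space property offers one only as a smooth homeomorphism that preserves the distance. That
  its differential respects the horizontal bundle is extracted from the distance: a function whose
  horizontal derivative vanishes at a point changes by o(length) along short horizontal curves from
  there. Its action on the other tangent directions is read off from brackets of related fields.
  Both halves turn on one fact about \<open>gbracket\<close>: horizontal elements generate the whole
  Lie algebra exactly if \<open>a2\<close> is nonzero. The bracket of \<open>a^3\<close> with
  \<open>a^1\<close> reaches \<open>k\<close> with the factor \<open>a2\<close>; for
  \<open>a2 = 0\<close> the \<open>k\<close> component of a bracket is the commutator of the two
  \<open>k\<close> components, so \<open>co g (ix y)\<close> never acquires one. Tangent vectors are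
  derivations, so all geometry is tested on smooth functions; bump functions, Hadamard's lemma and
  dual functions carry the arguments.\<close>

abbreviation fderiv :: "('a::real_normed_vector => 'b::real_normed_vector) => 'a => 'a => 'b" where
 "fderiv f x == frechet_derivative f (at x)"

abbreviation cinv :: "'a set => ('a => 'b) => 'b => 'a" where "cinv == the_inv_into"

lemma has_derivative_frechet:
 "f differentiable (at x) ==> (f has_derivative fderiv f x) (at x)"
 by (simp add: frechet_derivative_works)

lemma frechet_derivative_eqI:
 "(f has_derivative f') (at x) ==> fderiv f x = f'"
 using frechet_derivative_at by metis

lemma frechet_derivative_cong_open:
 assumes "open S" "x \<in> S" "\<And>y. y \<in> S ==> f y = g y"
 shows "f differentiable (at x) \<longleftrightarrow> g differentiable (at x)"
  and "fderiv f x = fderiv g x"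
proof -
 have *: "(f has_derivative D) (at x) \<longleftrightarrow> (g has_derivative D) (at x)" for D
  using has_derivative_transform_within_open[OF _ assms(1,2)] assms(3) by metis
 then show "f differentiable (at x) \<longleftrightarrow> g differentiable (at x)"
  by (simp add: differentiable_def)
 show "fderiv f x = fderiv g x"
  unfolding frechet_derivative_def using * by simp
qed

text \<open>Openness of \<open>S\<close> is what lets agreement on \<open>S\<close> pass to the
  derivatives, which \<open>Ck_on\<close> takes \<open>at x\<close> and not within
  \<open>S\<close>.\<close>

lemma Ck_on_cong_imp:
 fixes f g :: "'a::euclidean_space => 'b::real_normed_vector"
 shows "open S ==> (\<And>x. x \<in> S ==> f x = g x) ==> Ck_on k S f ==> Ck_on k S g"
proof (induction k arbitrary: f g)
 case 0
 then show ?case by (simp add: continuous_on_eq)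
next
 case (Suc k)
 have d: "g differentiable (at x)" if "x \<in> S" for x
  using frechet_derivative_cong_open(1)[OF Suc.prems(1) that, of f g] Suc.prems that by auto
 have "Ck_on k S (\<lambda>x. fderiv g x v)" for v
 proof (rule Suc.IH[OF Suc.prems(1)])
  show "fderiv f x v = fderiv g x v" if "x \<in> S" for x
   using frechet_derivative_cong_open(2)[OF Suc.prems(1) that, of f g] Suc.prems(2) by simp
  show "Ck_on k S (\<lambda>x. fderiv f x v)" using Suc.prems by simp
 qed
 with d show ?case by simp
qed

lemma Ck_on_local:
 fixes f :: "'a::euclidean_space => 'b::real_normed_vector"
 shows "(\<And>x. x \<in> S ==> \<exists>T. open T \<and> x \<in> T \<and> Ck_on k T f) ==> Ck_on k S f"
proof (induction k arbitrary: f)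
 case 0
 have "isCont f x" if "x \<in> S" for x
  using 0[OF that] by (auto simp: continuous_on_eq_continuous_at)
 then show ?case by (simp add: continuous_at_imp_continuous_on)
next
 case (Suc k)
 have d: "f differentiable (at x)" if "x \<in> S" for x
  using Suc.prems[OF that] by auto
 have "Ck_on k S (\<lambda>x. fderiv f x v)" for v
  by (rule Suc.IH) (use Suc.prems in fastforce)
 with d show ?case by simp
qed

lemma Ck_on_subset:
 shows "Ck_on k S f ==> T \<subseteq> S ==> Ck_on k T f"
 by (induction k arbitrary: f) (auto intro: continuous_on_subset)

lemma Ck_on_SucD:
 shows "Ck_on (Suc k) S f ==> Ck_on k S f"
proof (induction k arbitrary: f)
 case 0
 then show ?case
  by (auto intro!: continuous_at_imp_continuous_on differentiable_imp_continuous_within)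
qed simp

lemma Ck_on_SucI:
 fixes f :: "'a::euclidean_space => 'b::real_normed_vector"
 assumes "open S" "\<And>x. x \<in> S ==> (f has_derivative f' x) (at x)" "\<And>v. Ck_on k S (\<lambda>x. f' x v)"
 shows "Ck_on (Suc k) S f"
proof -
 have "Ck_on k S (\<lambda>x. fderiv f x v)" for v
  by (rule Ck_on_cong_imp[OF assms(1) _ assms(3)[of v]]) (simp add: frechet_derivative_eqI[OF assms(2)])
 then show ?thesis using assms(2) by (auto simp: differentiable_def)
qed

lemma Ck_on_Suc_has_derivative:
 fixes f :: "'a::euclidean_space => 'b::real_normed_vector"
 assumes "Ck_on (Suc k) S f" "x \<in> S"
 shows "(f has_derivative fderiv f x) (at x)"
 using assms has_derivative_frechet by auto

lemma Ck_on_const: "Ck_on k S (\<lambda>_::'a::euclidean_space. c::'b::real_normed_vector)"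
proof (induction k arbitrary: c)
 case (Suc k)
 have "fderiv (\<lambda>_::'a. c) x = (\<lambda>_. 0)" for x
  by (rule frechet_derivative_eqI) simp
 then show ?case using Suc by simp
qed simp

lemma Ck_on_linear:
 fixes f :: "'a::euclidean_space => 'b::real_normed_vector"
 assumes "bounded_linear f"
 shows "Ck_on k S f"
proof (cases k)
 case 0 then show ?thesis using assms by (simp add: linear_continuous_on)
next
 case (Suc l)
 have "(f has_derivative f) (at x)" for x
  using assms by (rule bounded_linear_imp_has_derivative)
 then have "fderiv f x = f" "f differentiable (at x)" for x
  using frechet_derivative_eqI differentiable_def by blast+
 then show ?thesis using Suc by (simp add: Ck_on_const)
qed

lemma Ck_on_add:
 fixes p q :: "'a::euclidean_space => 'd::real_normed_vector"
 assumes "open S"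
 shows "Ck_on k S p ==> Ck_on k S q ==> Ck_on k S (\<lambda>x. p x + q x)"
proof (induction k arbitrary: p q)
 case 0 then show ?case by (auto intro: continuous_intros)
next
 case (Suc k)
 show ?case
 proof (rule Ck_on_SucI[OF assms])
  show "((\<lambda>x. p x + q x) has_derivative
   (\<lambda>v. fderiv p x v + fderiv q x v)) (at x)" if "x \<in> S" for x
   using Suc.prems that by (auto intro!: has_derivative_add has_derivative_frechet)
  show "Ck_on k S (\<lambda>x. fderiv p x v + fderiv q x v)" for v
   using Suc by auto
 qed
qed

lemma Ck_on_bilinear:
 fixes f :: "'a::euclidean_space => 'b::real_normed_vector" and g :: "'a => 'c::real_normed_vector"
  and h :: "'b => 'c => 'd::real_normed_vector"
 assumes "bounded_bilinear h" "open S"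
 shows "Ck_on k S f ==> Ck_on k S g ==> Ck_on k S (\<lambda>x. h (f x) (g x))"
proof (induction k arbitrary: f g)
 case 0
 then show ?case using bounded_bilinear.continuous_on[OF assms(1)] by auto
next
 case (Suc k)
 show ?case
 proof (rule Ck_on_SucI[OF assms(2)])
  show "((\<lambda>x. h (f x) (g x)) has_derivative
   (\<lambda>v. h (f x) (fderiv g x v) + h (fderiv f x v) (g x))) (at x)"
   if "x \<in> S" for x
   using Suc.prems that
   by (auto intro!: bounded_bilinear.FDERIV[OF assms(1)] has_derivative_frechet)
  show "Ck_on k S (\<lambda>x. h (f x) (fderiv g x v) + h (fderiv f x v) (g x))" for v
   using Suc.IH Ck_on_SucD[OF Suc.prems(1)] Ck_on_SucD[OF Suc.prems(2)] Suc.prems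
   by (auto intro!: Ck_on_add[OF assms(2)])
 qed
qed

lemma Ck_on_sum:
 fixes f :: "'i => 'a::euclidean_space => 'd::real_normed_vector"
 assumes "open S" "\<And>i. i \<in> I ==> Ck_on k S (f i)"
 shows "Ck_on k S (\<lambda>x. \<Sum>i\<in>I. f i x)"
 using assms(2)
 by (induction I rule: infinite_finite_induct) (auto simp: Ck_on_const intro!: Ck_on_add assms(1))

lemma Ck_on_linear_comp:
 assumes "bounded_linear l" "open S" "Ck_on k S f"
 shows "Ck_on k S (\<lambda>x. l (f x))"
 using Ck_on_bilinear[OF bounded_bilinear.comp[OF bounded_bilinear_scaleR bounded_linear_ident assms(1)]
   assms(2) Ck_on_const[of k S 1] assms(3)] by simp

lemma linear_Basis_sum:
 fixes g :: "'b::euclidean_space => 'c::real_vector"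
 assumes "linear g"
 shows "g w = (\<Sum>b\<in>Basis. (w \<bullet> b) *\<^sub>R g b)"
proof -
 have "g w = g (\<Sum>b\<in>Basis. (w \<bullet> b) *\<^sub>R b)" by (simp add: euclidean_representation)
 also have "\<dots> = (\<Sum>b\<in>Basis. (w \<bullet> b) *\<^sub>R g b)"
  using assms by (simp add: linear_sum linear_scale)
 finally show ?thesis .
qed

lemma Ck_on_comp:
 fixes f :: "'a::euclidean_space => 'b::euclidean_space" and g :: "'b => 'c::real_normed_vector"
 assumes "open S" "open T" "f ` S \<subseteq> T"
 shows "Ck_on k S f ==> Ck_on k T g ==> Ck_on k S (\<lambda>x. g (f x))"
proof (induction k arbitrary: g)
 case 0 then show ?case
  using continuous_on_compose2[of T g S f] assms(3) by auto
next
 case (Suc k)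
 let ?f' = "\<lambda>x. fderiv f x" and ?g' = "\<lambda>x. fderiv g x"
 have g': "(g has_derivative ?g' (f x)) (at (f x))" if "x \<in> S" for x
  using Suc.prems(2) that assms(3) by (auto intro!: has_derivative_frechet)
 show ?case
 proof (rule Ck_on_SucI[OF assms(1)])
  \<comment> \<open>The chain rule value \<open>?g' (f x) (?f' x v)\<close> has a direction that
    moves with x. Expanding it in the basis leaves derivatives of \<open>g\<close> in fixed
    directions, to which the induction hypothesis applies.\<close>
  show "((\<lambda>x. g (f x)) has_derivative (\<lambda>v. \<Sum>b\<in>Basis. (?f' x v \<bullet> b) *\<^sub>R ?g' (f x) b)) (at x)"
   if "x \<in> S" for x
  proof -
   have "linear (?g' (f x))" using g'[OF that] has_derivative_linear by blast
   then have "(\<lambda>v. ?g' (f x) (?f' x v)) = (\<lambda>v. \<Sum>b\<in>Basis. (?f' x v \<bullet> b) *\<^sub>R ?g' (f x) b)"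
    by (intro ext linear_Basis_sum)
   moreover have "((\<lambda>x. g (f x)) has_derivative (\<lambda>v. ?g' (f x) (?f' x v))) (at x)"
    using Ck_on_Suc_has_derivative[OF Suc.prems(1) that] g'[OF that]
    by (rule has_derivative_compose)
   ultimately show ?thesis by metis
  qed
  show "Ck_on k S (\<lambda>x. \<Sum>b\<in>Basis. (?f' x v \<bullet> b) *\<^sub>R ?g' (f x) b)" for v
  proof (rule Ck_on_sum[OF assms(1)], rule Ck_on_bilinear[OF bounded_bilinear_scaleR assms(1)])
   show "Ck_on k S (\<lambda>x. ?f' x v \<bullet> b)" for b
    using Suc.prems(1) by (auto intro!: Ck_on_linear_comp[OF bounded_linear_inner_left assms(1)])
   show "Ck_on k S (\<lambda>x. ?g' (f x) b)" for b
    by (rule Suc.IH[OF Ck_on_SucD[OF Suc.prems(1)]]) (use Suc.prems in simp)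
  qed
 qed
qed

lemma smooth_on_D: "smooth_on S f ==> Ck_on k S f"
 by (simp add: smooth_on_def)

lemma smooth_on_continuous: "smooth_on S f ==> continuous_on S f"
 using smooth_on_D[of S f 0] by simp

lemma smooth_on_differentiable: "smooth_on S f ==> x \<in> S ==> f differentiable (at x)"
 using smooth_on_D[of S f 1] by simp

lemma smooth_on_has_derivative:
 "smooth_on S f ==> x \<in> S ==> (f has_derivative fderiv f x) (at x)"
 by (simp add: has_derivative_frechet smooth_on_differentiable)

lemma smooth_on_frechet: "smooth_on S f ==> smooth_on S (\<lambda>x. fderiv f x v)"
 unfolding smooth_on_def by (metis Ck_on.simps(2))

lemma smooth_on_cong:
 "open S ==> (\<And>x. x \<in> S ==> f x = g x) ==> smooth_on S f \<longleftrightarrow> smooth_on S g"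
 unfolding smooth_on_def using Ck_on_cong_imp[of S f g] Ck_on_cong_imp[of S g f] by auto

lemma smooth_on_eq:
 assumes "open S" "smooth_on S f" "\<And>x. x \<in> S ==> f x = g x"
 shows "smooth_on S g"
 using assms(2) smooth_on_cong[OF assms(1,3)] by simp

lemma smooth_on_subset: "smooth_on S f ==> T \<subseteq> S ==> smooth_on T f"
 unfolding smooth_on_def using Ck_on_subset by blast

lemma smooth_on_local:
 assumes "\<And>x. x \<in> S ==> \<exists>T. open T \<and> x \<in> T \<and> smooth_on T f"
 shows "smooth_on S f"
 unfolding smooth_on_def
proof
 show "Ck_on k S f" for k
  by (rule Ck_on_local) (use assms smooth_on_D in fast)
qed

lemma smooth_on_const: "smooth_on S (\<lambda>_. c)"
 by (simp add: smooth_on_def Ck_on_const)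

lemma smooth_on_linear: "bounded_linear f ==> smooth_on S f"
 by (simp add: smooth_on_def Ck_on_linear)

lemma smooth_on_ident: "smooth_on S (\<lambda>x. x)"
 by (simp add: smooth_on_linear)

lemma smooth_on_add: "open S ==> smooth_on S f ==> smooth_on S g ==> smooth_on S (\<lambda>x. f x + g x)"
 by (simp add: smooth_on_def Ck_on_add)

lemma smooth_on_sum:
 "open S ==> (\<And>i. i \<in> I ==> smooth_on S (f i)) ==> smooth_on S (\<lambda>x. \<Sum>i\<in>I. f i x)"
 by (simp add: smooth_on_def Ck_on_sum)

lemma smooth_on_linear_comp:
 "bounded_linear l ==> open S ==> smooth_on S f ==> smooth_on S (\<lambda>x. l (f x))"
 by (simp add: smooth_on_def Ck_on_linear_comp)

lemma smooth_on_scaleR: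
 "open S ==> smooth_on S f ==> smooth_on S g ==> smooth_on S (\<lambda>x. f x *\<^sub>R g x)"
 by (simp add: smooth_on_def Ck_on_bilinear[OF bounded_bilinear_scaleR])

lemma smooth_on_mult:
 fixes f g :: "'a::euclidean_space => real"
 shows "open S ==> smooth_on S f ==> smooth_on S g ==> smooth_on S (\<lambda>x. f x * g x)"
 by (simp add: smooth_on_def Ck_on_bilinear[OF bounded_bilinear_mult])

lemma smooth_on_inner:
 fixes f g :: "'a::euclidean_space => 'b::real_inner"
 shows "open S ==> smooth_on S f ==> smooth_on S g ==> smooth_on S (\<lambda>x. f x \<bullet> g x)"
 by (simp add: smooth_on_def Ck_on_bilinear[OF bounded_bilinear_inner])

lemma smooth_on_comp:
 fixes f :: "'a::euclidean_space => 'b::euclidean_space" and g :: "'b => 'c::real_normed_vector"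
 shows "open S ==> open T ==> f ` S \<subseteq> T ==> smooth_on S f ==> smooth_on T g ==>
  smooth_on S (\<lambda>x. g (f x))"
 by (simp add: smooth_on_def Ck_on_comp)

lemma smooth_on_componentwise:
 fixes f :: "'a::euclidean_space => 'b::euclidean_space"
 assumes "open S" "\<And>b. b \<in> Basis ==> smooth_on S (\<lambda>x. f x \<bullet> b)"
 shows "smooth_on S f"
proof -
 have "smooth_on S (\<lambda>x. \<Sum>b\<in>Basis. (f x \<bullet> b) *\<^sub>R b)"
  using assms by (intro smooth_on_sum smooth_on_scaleR smooth_on_const)
 then show ?thesis by (simp add: euclidean_representation)
qed

lemma smooth_on_Pair:
 fixes f :: "'a::euclidean_space => 'b::euclidean_space" and g :: "'a => 'c::euclidean_space"
 assumes "open S" "smooth_on S f" "smooth_on S g"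
 shows "smooth_on S (\<lambda>x. (f x, g x))"
proof -
 have 1: "bounded_linear (\<lambda>y::'b. (y, 0::'c))" "bounded_linear (\<lambda>y::'c. (0::'b, y))"
  by (auto intro!: bounded_linear_Pair bounded_linear_ident bounded_linear_zero)
 have "smooth_on S (\<lambda>x. (f x, 0) + (0, g x))"
  by (rule smooth_on_add[OF assms(1) smooth_on_linear_comp[OF 1(1) assms(1,2)]
     smooth_on_linear_comp[OF 1(2) assms(1,3)]])
 then show ?thesis by simp
qed

lemma smooth_on_inverse: "smooth_on {x::real. x \<noteq> 0} inverse"
proof -
 have o: "open {x::real. x \<noteq> 0}" by (intro open_Collect_neq continuous_intros)
 have "Ck_on k {x::real. x \<noteq> 0} inverse" for k
 proof (induction k)
  case 0 then show ?case by (auto intro!: continuous_intros)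
 next
  case (Suc k)
  show ?case
  proof (rule Ck_on_SucI[OF o])
   show "(inverse has_derivative (\<lambda>v. - v *\<^sub>R (inverse x * inverse x))) (at x)"
    if "x \<in> {x::real. x \<noteq> 0}" for x
    using that by (auto intro!: derivative_eq_intros simp: fun_eq_iff)
   have 1: "Ck_on k {x::real. x \<noteq> 0} (\<lambda>x. inverse x * inverse x)"
    by (rule Ck_on_bilinear[OF bounded_bilinear_mult o Suc Suc])
   show "Ck_on k {x::real. x \<noteq> 0} (\<lambda>x. - v *\<^sub>R (inverse x * inverse x))" for v :: real
    by (rule Ck_on_linear_comp[OF bounded_linear_scaleR_right o 1])
  qed
 qed
 then show ?thesis by (simp add: smooth_on_def)
qed

lemma smooth_on_divide:
 fixes f g :: "'a::euclidean_space => real"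
 assumes "open S" "smooth_on S f" "smooth_on S g" "\<And>x. x \<in> S ==> g x \<noteq> 0"
 shows "smooth_on S (\<lambda>x. f x / g x)"
 unfolding divide_inverse
proof (rule smooth_on_mult[OF assms(1,2)])
 have "open {x::real. x \<noteq> 0}" by (intro open_Collect_neq continuous_intros)
 then show "smooth_on S (\<lambda>x. inverse (g x))"
  by (rule smooth_on_comp[OF assms(1) _ _ assms(3) smooth_on_inverse]) (use assms(4) in auto)
qed

subsection \<open>Bump functions\<close>

text \<open>Carrying a polynomial makes the family closed under differentiation, so that one
  argument at 0 serves all orders.\<close>

definition flat_exp :: "real poly => real => real" where
 "flat_exp p x = (if x > 0 then poly p (inverse x) * exp (- inverse x) else 0)"

lemma poly_mult_exp_tendsto_0: "((\<lambda>y::real. poly p y * exp (- y)) \<longlongrightarrow> 0) at_top"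
proof -
 have "((\<lambda>y. coeff p i * (y ^ i / exp y)) \<longlongrightarrow> coeff p i * 0) at_top" for i
  by (intro tendsto_mult tendsto_const tendsto_power_div_exp_0)
 then have "((\<lambda>y. \<Sum>i\<le>degree p. coeff p i * (y ^ i / exp y)) \<longlongrightarrow> (\<Sum>i\<le>degree p. coeff p i * 0)) at_top"
  by (intro tendsto_sum)
 moreover have "(\<Sum>i\<le>degree p. coeff p i * (y ^ i / exp y)) = poly p y * exp (- y)" for y :: real
  by (simp add: poly_altdef sum_distrib_right exp_minus divide_inverse mult.assoc)
 ultimately show ?thesis by simp
qed

lemma flat_exp_tendsto_0: "(flat_exp p \<longlongrightarrow> 0) (at 0)"
proof -
 have "((\<lambda>x. poly p (inverse x) * exp (- inverse x)) \<longlongrightarrow> 0) (at_right 0)"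
  by (rule filterlim_compose[OF poly_mult_exp_tendsto_0 filterlim_inverse_at_top_right])
 then have "(flat_exp p \<longlongrightarrow> 0) (at_right 0)"
  by (rule Lim_transform_eventually)
   (auto simp: flat_exp_def eventually_at_right_field intro!: exI[of _ 1])
 moreover have "(flat_exp p \<longlongrightarrow> 0) (at_left 0)"
  by (rule Lim_transform_eventually[OF tendsto_const])
   (auto simp: flat_exp_def eventually_at_left_field intro!: exI[of _ "-1"])
 ultimately show ?thesis using filterlim_split_at by blast
qed

text \<open>Differentiating p(1/x) exp(-1/x) gives (p - p')(1/x) / x^2 times the exponential;
  multiplication by \<open>[:0, 0, 1:]\<close> is the factor 1/x^2.\<close>

lemma flat_exp_deriv:
 "(flat_exp p has_real_derivative flat_exp ([:0, 0, 1:] * (p - pderiv p)) x) (at x)"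
proof -
 consider "x > 0" | "x < 0" | "x = 0" by linarith
 then show ?thesis
 proof cases
  case 1
  have "((\<lambda>x. poly p (inverse x) * exp (- inverse x)) has_real_derivative
   flat_exp ([:0, 0, 1:] * (p - pderiv p)) x) (at x)"
   using 1 by (auto intro!: derivative_eq_intros DERIV_chain2[OF poly_DERIV]
     simp: flat_exp_def algebra_simps power2_eq_square)
  then show ?thesis
   by (rule has_field_derivative_transform_within_open[of _ _ _ "{0<..}"])
    (use 1 in \<open>auto simp: flat_exp_def\<close>)
 next
  case 2
  have "((\<lambda>x. 0) has_real_derivative 0) (at x)" by simp
  then have "(flat_exp p has_real_derivative 0) (at x)"
   by (rule has_field_derivative_transform_within_open[of _ _ _ "{..<0}"])
    (use 2 in \<open>auto simp: flat_exp_def\<close>)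
  then show ?thesis using 2 by (simp add: flat_exp_def)
 next
  case 3
  \<comment> \<open>The difference quotient at 0 is again a flat function: dividing by h multiplies
    the polynomial by \<open>[:0, 1:]\<close>.\<close>
  have "((\<lambda>h. (flat_exp p (0 + h) - flat_exp p 0) / h) \<longlongrightarrow> 0) (at 0)"
   by (rule Lim_transform_eventually[OF flat_exp_tendsto_0[of "[:0, 1:] * p"]])
    (auto simp: flat_exp_def eventually_at_filter field_simps)
  then have "(flat_exp p has_real_derivative 0) (at 0)"
   by (simp add: DERIV_def)
  then show ?thesis using 3 by (simp add: flat_exp_def)
 qed
qed

lemma smooth_on_flat_exp: "smooth_on UNIV (flat_exp p)"
proof -
 have "Ck_on k UNIV (flat_exp p)" for k
 proof (induction k arbitrary: p)
  case 0
  show ?case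
   by (simp, intro continuous_at_imp_continuous_on ballI)
    (use flat_exp_deriv DERIV_isCont in blast)
 next
  case (Suc k)
  have "(flat_exp p has_derivative (\<lambda>v. v *\<^sub>R flat_exp ([:0, 0, 1:] * (p - pderiv p)) x)) (at x)" for x
   using flat_exp_deriv[of p x] by (simp add: has_field_derivative_def mult.commute[of _ "flat_exp _ _"] mult_commute_abs)
  then show ?case
   by (intro Ck_on_SucI[of _ _ "\<lambda>x v. v *\<^sub>R flat_exp ([:0, 0, 1:] * (p - pderiv p)) x"]
     Ck_on_linear_comp[OF bounded_linear_scaleR_right] Suc) auto
 qed
 then show ?thesis by (simp add: smooth_on_def)
qed

lemma euclidean_bump:
 fixes x0 :: "'a::euclidean_space"
 assumes "r > 0"
 shows "\<exists>\<beta>::'a => real. smooth_on UNIV \<beta> \<and> (\<forall>x. 0 \<le> \<beta> x) \<and> (\<forall>x. \<beta> x \<le> 1) \<and>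
  (\<forall>x\<in>ball x0 r. \<beta> x = 1) \<and> (\<forall>x. x \<notin> cball x0 (2 * r) --> \<beta> x = 0)"
proof -
 let ?e = "flat_exp 1"
 \<comment> \<open>\<open>s\<close> is at least 1 on the ball of radius r and at most 0 outside that
   of radius 2 r. The quotient \<beta> is the usual smooth step in \<open>s\<close>, built from
   exp(-1/t): it is 0 for \<open>s\<close> below 0 and 1 for \<open>s\<close> above 1.\<close>
 define s where "s x = 2 + (- 1 / r\<^sup>2) * ((x - x0) \<bullet> (x - x0))" for x :: 'a
 define \<beta> where "\<beta> x = ?e (s x) / (?e (s x) + ?e (1 + (- 1) * s x))" for x
 have e0: "?e t \<ge> 0" for t by (simp add: flat_exp_def)
 have e1: "?e t = 0 \<longleftrightarrow> t \<le> 0" for t by (auto simp: flat_exp_def)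
 have pos: "?e t + ?e (1 + (- 1) * t) > 0" for t
  using e0[of t] e0[of "1 + (- 1) * t"] e1[of t] e1[of "1 + (- 1) * t"] by linarith
 have d: "smooth_on UNIV (\<lambda>x. x - x0)"
  using smooth_on_add[OF open_UNIV smooth_on_ident smooth_on_const[of UNIV "- x0"]] by simp
 have s: "smooth_on UNIV s"
  unfolding s_def
  by (intro smooth_on_add smooth_on_mult smooth_on_const smooth_on_inner d open_UNIV)
 have s': "smooth_on UNIV (\<lambda>x. 1 + (- 1) * s x)"
  by (intro smooth_on_add smooth_on_mult smooth_on_const s open_UNIV)
 note se = smooth_on_comp[OF open_UNIV open_UNIV subset_UNIV s smooth_on_flat_exp[of 1]]
  smooth_on_comp[OF open_UNIV open_UNIV subset_UNIV s' smooth_on_flat_exp[of 1]]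
 have "smooth_on UNIV \<beta>"
  unfolding \<beta>_def
  by (rule smooth_on_divide[OF open_UNIV se(1) smooth_on_add[OF open_UNIV se]])
   (use pos in \<open>metis less_irrefl\<close>)
 moreover have "0 \<le> \<beta> x" for x using e0 pos by (simp add: \<beta>_def less_imp_le)
 moreover have "\<beta> x \<le> 1" for x using e0[of "1 + (- 1) * s x"] pos[of "s x"] by (simp add: \<beta>_def)
 moreover have "\<beta> x = 1" if "x \<in> ball x0 r" for x
 proof -
  have "(norm (x - x0))\<^sup>2 < r\<^sup>2"
   using that assms by (intro power_strict_mono) (auto simp: dist_norm norm_minus_commute)
  then have "s x \<ge> 1" using assms by (simp add: s_def power2_norm_eq_inner field_simps)
  then show ?thesis using pos[of "s x"] e1[of "1 + (- 1) * s x"] by (simp add: \<beta>_def)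
 qed
 moreover have "\<beta> x = 0" if "x \<notin> cball x0 (2 * r)" for x
 proof -
  have "(norm (x - x0))\<^sup>2 > (2 * r)\<^sup>2"
   using that assms by (intro power_strict_mono) (auto simp: dist_norm norm_minus_commute)
  then have "4 * r\<^sup>2 < (norm (x - x0))\<^sup>2" by (simp add: power_mult_distrib)
  then have "2 * r\<^sup>2 \<le> (norm (x - x0))\<^sup>2"
   using zero_le_power2[of r] by linarith
  then have "s x \<le> 0" using assms by (simp add: s_def power2_norm_eq_inner field_simps)
  then show ?thesis using e1 by (simp add: \<beta>_def)
 qed
 ultimately show ?thesis by blast
qed

subsection \<open>Symmetry of second derivatives\<close>

lemma smooth_on_line_derivative:
 fixes f :: "'a::euclidean_space => real"
 assumes "smooth_on S f" "a + s *\<^sub>R u \<in> S"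
 shows "((\<lambda>s. f (a + s *\<^sub>R u)) has_real_derivative fderiv f (a + s *\<^sub>R u) u) (at s)"
proof -
 let ?D = "fderiv f (a + s *\<^sub>R u)"
 have 1: "(f has_derivative ?D) (at (a + s *\<^sub>R u))"
  using smooth_on_has_derivative assms by blast
 have "((\<lambda>s. a + s *\<^sub>R u) has_derivative (\<lambda>h. h *\<^sub>R u)) (at s)"
  by (auto intro!: derivative_eq_intros)
 from has_derivative_compose[OF this 1] have "((\<lambda>s. f (a + s *\<^sub>R u)) has_derivative (\<lambda>h. ?D (h *\<^sub>R u))) (at s)" .
 moreover have "?D (h *\<^sub>R u) = ?D u * h" for h
  using linear_scale[OF has_derivative_linear[OF 1], of h u] by simp
 ultimately show ?thesis by (simp add: has_field_derivative_def)
qed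

text \<open>The mean value theorem in direction u and then in direction v. The second difference is
  symmetric in u and v, which is what later forces the mixed derivatives to agree.\<close>

lemma second_difference_eq:
 fixes f :: "'a::euclidean_space => real"
 assumes "smooth_on S f" "h > 0"
  and S: "\<And>s t. 0 \<le> s ==> s \<le> h ==> 0 \<le> t ==> t \<le> h ==> x + s *\<^sub>R u + t *\<^sub>R v \<in> S"
 obtains s t where "0 \<le> s" "s \<le> h" "0 \<le> t" "t \<le> h"
  "f (x + h *\<^sub>R u + h *\<^sub>R v) - f (x + h *\<^sub>R u) - f (x + h *\<^sub>R v) + f x =
   h * h * fderiv (\<lambda>y. fderiv f y u) (x + s *\<^sub>R u + t *\<^sub>R v) v"
proof -
 let ?u = "\<lambda>y. fderiv f y u"
 let ?g = "\<lambda>s. f ((x + h *\<^sub>R v) + s *\<^sub>R u) - f (x + s *\<^sub>R u)"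
 have "\<exists>s>0. s < h \<and> ?g h - ?g 0 = (h - 0) * (?u ((x + h *\<^sub>R v) + s *\<^sub>R u) - ?u (x + s *\<^sub>R u))"
 proof (rule MVT2[OF assms(2)])
  fix s assume s: "0 \<le> s" "s \<le> h"
  show "DERIV ?g s :> ?u ((x + h *\<^sub>R v) + s *\<^sub>R u) - ?u (x + s *\<^sub>R u)"
   using S[OF s, of 0] S[OF s, of h] assms(2)
   by (intro DERIV_diff smooth_on_line_derivative[OF assms(1)]) (simp_all add: ac_simps)
 qed
 then obtain s where s: "0 < s" "s < h"
  "?g h - ?g 0 = h * (?u ((x + s *\<^sub>R u) + h *\<^sub>R v) - ?u ((x + s *\<^sub>R u) + 0 *\<^sub>R v))"
  by (auto simp: ac_simps)
 have "\<exists>t>0. t < h \<and> ?u ((x + s *\<^sub>R u) + h *\<^sub>R v) - ?u ((x + s *\<^sub>R u) + 0 *\<^sub>R v) =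
   (h - 0) * fderiv ?u ((x + s *\<^sub>R u) + t *\<^sub>R v) v"
  by (rule MVT2[OF assms(2)], rule smooth_on_line_derivative[OF smooth_on_frechet[OF assms(1)]])
   (use S s in auto)
 then obtain t where t: "0 < t" "t < h"
  "?u ((x + s *\<^sub>R u) + h *\<^sub>R v) - ?u ((x + s *\<^sub>R u) + 0 *\<^sub>R v) =
   h * fderiv ?u ((x + s *\<^sub>R u) + t *\<^sub>R v) v"
  by auto
 show ?thesis
  by (rule that[of s t]) (use s t in \<open>simp_all add: ac_simps\<close>)
qed

lemma isCont_eventually_nhds:
 assumes "isCont f x" "e > 0"
 shows "\<forall>\<^sub>F y in nhds x. dist (f y) (f x) < e"
proof -
 have "(f \<longlongrightarrow> f x) (nhds x)"
  using assms(1) unfolding isCont_def by (rule tendsto_at_iff_tendsto_nhds[THEN iffD1])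
 then show ?thesis using assms(2) by (rule tendstoD)
qed

lemma smooth_on_second_derivative_symmetric:
 fixes f :: "'a::euclidean_space => real"
 assumes "open S" "smooth_on S f" "x \<in> S"
 shows "fderiv (\<lambda>y. fderiv f y u) x v =
  fderiv (\<lambda>y. fderiv f y v) x u"
proof -
 let ?P = "\<lambda>y. fderiv (\<lambda>y. fderiv f y u) y v"
 let ?Q = "\<lambda>y. fderiv (\<lambda>y. fderiv f y v) y u"
 have c: "isCont ?P x" "isCont ?Q x"
  using smooth_on_continuous[OF smooth_on_frechet[OF smooth_on_frechet[OF assms(2)]]] assms(1,3)
  by (simp_all add: continuous_on_eq_continuous_at)
 have "\<bar>?P x - ?Q x\<bar> \<le> e" if "e > 0" for e
 proof -
  have "\<forall>\<^sub>F y in nhds x. dist (?P y) (?P x) < e / 2 \<and> dist (?Q y) (?Q x) < e / 2 \<and> y \<in> S"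
  proof (intro eventually_conj)
   show "\<forall>\<^sub>F y in nhds x. y \<in> S" using assms(1,3) by (rule eventually_nhds_in_open)
   show "\<forall>\<^sub>F y in nhds x. dist (?P y) (?P x) < e / 2" "\<forall>\<^sub>F y in nhds x. dist (?Q y) (?Q x) < e / 2"
    using isCont_eventually_nhds[OF c(1) half_gt_zero[OF that]]
     isCont_eventually_nhds[OF c(2) half_gt_zero[OF that]] by blast+
  qed
  then obtain d where d: "d > 0" "\<And>y. dist y x < d ==> dist (?P y) (?P x) < e / 2 \<and> dist (?Q y) (?Q x) < e / 2 \<and> y \<in> S"
   unfolding eventually_nhds_metric by blast
  define N where "N = norm u + norm v + 1"
  \<comment> \<open>Small enough that the whole parallelogram spanned by h u and h v at x stays
    within distance d of x.\<close>
  define h where "h = d / (2 * N)"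
  have n: "N > 0" using norm_ge_zero[of u] norm_ge_zero[of v] unfolding N_def by linarith
  have h: "h > 0" using d(1) n by (simp add: h_def)
  have near: "dist (x + s *\<^sub>R u + t *\<^sub>R v) x < d" if "0 \<le> s" "s \<le> h" "0 \<le> t" "t \<le> h" for s t
  proof -
   have "dist (x + s *\<^sub>R u + t *\<^sub>R v) x \<le> s * norm u + t * norm v"
    using norm_triangle_ineq[of "s *\<^sub>R u" "t *\<^sub>R v"] that by (simp add: dist_norm)
   also have "\<dots> \<le> h * N"
    using that mult_right_mono[of s h "norm u"] mult_right_mono[of t h "norm v"] h
    by (simp add: algebra_simps N_def)
   also have "\<dots> = d / 2" using n by (simp add: h_def)
   also have "\<dots> < d" using d(1) by simp
   finally show ?thesis .
  qed
  have near': "dist (x + s *\<^sub>R v + t *\<^sub>R u) x < d" if "0 \<le> s" "s \<le> h" "0 \<le> t" "t \<le> h" for s t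
   using near[of t s] that by (simp add: ac_simps)
  obtain s t where st: "0 \<le> s" "s \<le> h" "0 \<le> t" "t \<le> h"
   "f (x + h *\<^sub>R u + h *\<^sub>R v) - f (x + h *\<^sub>R u) - f (x + h *\<^sub>R v) + f x = h * h * ?P (x + s *\<^sub>R u + t *\<^sub>R v)"
   using second_difference_eq[OF assms(2) h, of x u v] near d(2) by blast
  obtain s' t' where st': "0 \<le> s'" "s' \<le> h" "0 \<le> t'" "t' \<le> h"
   "f (x + h *\<^sub>R v + h *\<^sub>R u) - f (x + h *\<^sub>R v) - f (x + h *\<^sub>R u) + f x = h * h * ?Q (x + s' *\<^sub>R v + t' *\<^sub>R u)"
   using second_difference_eq[OF assms(2) h, of x v u] near' d(2) by blast
  have "h * h * ?P (x + s *\<^sub>R u + t *\<^sub>R v) = h * h * ?Q (x + s' *\<^sub>R v + t' *\<^sub>R u)"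
  proof -
   have "x + h *\<^sub>R v + h *\<^sub>R u = x + h *\<^sub>R u + h *\<^sub>R v" by simp
   from st'(5)[unfolded this] st(5) show ?thesis by linarith
  qed
  then have "?P (x + s *\<^sub>R u + t *\<^sub>R v) = ?Q (x + s' *\<^sub>R v + t' *\<^sub>R u)" using h by simp
  moreover have "dist (?P (x + s *\<^sub>R u + t *\<^sub>R v)) (?P x) < e / 2"
   using d(2)[OF near[OF st(1-4)]] by blast
  moreover have "dist (?Q (x + s' *\<^sub>R v + t' *\<^sub>R u)) (?Q x) < e / 2"
   using d(2)[OF near'[OF st'(1-4)]] by blast
  ultimately show ?thesis unfolding dist_real_def by linarith
 qed
 then have "\<bar>?P x - ?Q x\<bar> \<le> 0" by (rule field_le_epsilon[of _ 0, simplified])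
 then show ?thesis by simp
qed

subsection \<open>Smooth families of invertible maps and smooth inverse functions\<close>

text \<open>Differentiability comes from the map (y, z) -> (y, A y z), whose inverse is (y, w) ->
  (y, inv (A y) w): \<open>has_derivative_inverse_strong\<close> applies to it without prior
  continuity of the inverse. The resulting formula - A^-1 A' A^-1 expresses the derivative through
  the inverse itself, so smoothness follows by induction on the order.\<close>

lemma smooth_on_inv_linear:
 fixes A :: "'a::euclidean_space => 'm::euclidean_space => 'm"
 assumes S: "open S" and lin: "\<And>x. x \<in> S ==> linear (A x)" and bij: "\<And>x. x \<in> S ==> bij (A x)"
  and sm: "\<And>b. smooth_on S (\<lambda>x. A x b)"
 shows "smooth_on S (\<lambda>x. Hilbert_Choice.inv (A x) v)"
proof -
 let ?I = "\<lambda>x. Hilbert_Choice.inv (A x)"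
 let ?A' = "\<lambda>b x. fderiv (\<lambda>x. A x b) x"
 have ilin: "linear (?I x)" if "x \<in> S" for x
  using lin[OF that] bij[OF that] by (metis bij_betw_imp_inj_on bij_betw_imp_surj_on inj_linear_imp_inv_linear)
 have A'lin: "linear (?A' b x)" if "x \<in> S" for b x
  using smooth_on_has_derivative[OF sm that] has_derivative_linear by blast
 have der: "((\<lambda>x. ?I x v) has_derivative (\<lambda>h. \<Sum>b\<in>Basis. - ((?I x v \<bullet> b) *\<^sub>R ?I x (?A' b x h)))) (at x)"
  if x: "x \<in> S" for x v
 proof -
  define w where "w = ?I x v"
  have Aw: "A x w = v" using bij[OF x] by (simp add: w_def bij_is_surj surj_f_inv_f)
  \<comment> \<open>In coordinates \<open>f\<close> is a finite sum of products of differentiable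
    functions; over \<open>S\<close> it equals (y, A y z) by linearity of
    \<open>A y\<close>.\<close>
  define f where "f = (\<lambda>(y, z). (y, \<Sum>b\<in>Basis. (z \<bullet> b) *\<^sub>R A y b))"
  define g where "g = (\<lambda>(y, z). (y, ?I y z))"
  define f' where "f' = (\<lambda>(h, k). (h, (\<Sum>b\<in>Basis. (w \<bullet> b) *\<^sub>R ?A' b x h + (k \<bullet> b) *\<^sub>R A x b)))"
  define g' where "g' = (\<lambda>(h, k). (h, ?I x (k - (\<Sum>b\<in>Basis. (w \<bullet> b) *\<^sub>R ?A' b x h))))"
  have fA: "f (y, z) = (y, A y z)" if "y \<in> S" for y z
   using linear_Basis_sum[OF lin[OF that], of z] by (simp add: f_def)
  have d1: "((\<lambda>p. A (fst p) b) has_derivative (\<lambda>h. ?A' b x (fst h))) (at (x, w))" for b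
   using has_derivative_compose[OF has_derivative_fst[OF has_derivative_ident, of "at (x, w)"], of "\<lambda>x. A x b" "?A' b x"]
    smooth_on_has_derivative[OF sm x] by simp
  have "((\<lambda>p. (fst p, \<Sum>b\<in>Basis. (snd p \<bullet> b) *\<^sub>R A (fst p) b)) has_derivative
    (\<lambda>p. (fst p, \<Sum>b\<in>Basis. (snd (x, w) \<bullet> b) *\<^sub>R ?A' b x (fst p) + (snd p \<bullet> b) *\<^sub>R A (fst (x, w)) b))) (at (x, w))"
   by (intro has_derivative_Pair has_derivative_sum has_derivative_scaleR d1 has_derivative_fst
     has_derivative_ident bounded_linear.has_derivative[OF bounded_linear_inner_left] has_derivative_snd)
  then have df: "(f has_derivative f') (at (x, w))"
   by (simp add: f_def f'_def case_prod_unfold)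
  have cont: "continuous_on (S \<times> UNIV) f"
   unfolding f_def case_prod_unfold
   by (intro continuous_intros continuous_on_compose2[OF smooth_on_continuous[OF sm]]) auto
  have "(g has_derivative g') (at (f (x, w)))"
  proof (rule has_derivative_inverse_strong[OF _ _ cont _ df])
   show "open (S \<times> (UNIV :: 'm set))" using S by (simp add: open_Times)
   show "(x, w) \<in> S \<times> UNIV" using x by simp
   show "g (f p) = p" if "p \<in> S \<times> UNIV" for p
    using that bij by (auto simp: fA g_def bij_is_inj)
   have "A x (?I x k) = k" for k using bij[OF x] by (simp add: bij_is_surj surj_f_inv_f)
   moreover have "(\<Sum>b\<in>Basis. (k \<bullet> b) *\<^sub>R A x b) = A x k" for k
    using linear_Basis_sum[OF lin[OF x], of k] by simp
   ultimately show "f' o g' = id"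
    by (auto simp: f'_def g'_def sum.distrib fun_eq_iff)
  qed
  then have "(g has_derivative g') (at (x, v))" by (simp add: fA[OF x] Aw)
  moreover have "((\<lambda>y. (y, v)) has_derivative (\<lambda>h. (h, 0))) (at x)"
   by (auto intro!: derivative_eq_intros)
  ultimately have "((\<lambda>y. g (y, v)) has_derivative (\<lambda>h. g' (h, 0))) (at x)"
   using has_derivative_compose by blast
  from has_derivative_snd[OF this]
  have "((\<lambda>y. ?I y v) has_derivative (\<lambda>h. ?I x (- (\<Sum>b\<in>Basis. (w \<bullet> b) *\<^sub>R ?A' b x h)))) (at x)"
   by (simp add: g_def g'_def)
  moreover have "(\<lambda>h. ?I x (- (\<Sum>b\<in>Basis. (w \<bullet> b) *\<^sub>R ?A' b x h))) =
   (\<lambda>h. \<Sum>b\<in>Basis. - ((?I x v \<bullet> b) *\<^sub>R ?I x (?A' b x h)))"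
   using ilin[OF x] by (simp add: linear_neg linear_sum linear_scale sum_negf w_def)
  ultimately show ?thesis by metis
 qed
 have "Ck_on k S (\<lambda>x. ?I x v)" for k
 proof (induction k arbitrary: v)
  case 0
  show ?case
   using der S by (auto intro!: continuous_at_imp_continuous_on has_derivative_continuous)
 next
  case (Suc k)
  show ?case
  proof (rule Ck_on_SucI[OF S der])
   fix h
   have I: "Ck_on k S (\<lambda>x. ?I x (?A' b x h))" for b
   proof -
    have "Ck_on k S (\<lambda>x. \<Sum>c\<in>Basis. (?A' b x h \<bullet> c) *\<^sub>R ?I x c)"
     by (rule Ck_on_sum[OF S], rule Ck_on_bilinear[OF bounded_bilinear_scaleR S
        Ck_on_linear_comp[OF bounded_linear_inner_left S smooth_on_D[OF smooth_on_frechet[OF sm]]] Suc])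
    then show ?thesis
     by (rule Ck_on_cong_imp[OF S, rotated]) (rule linear_Basis_sum[OF ilin, symmetric])
   qed
   show "Ck_on k S (\<lambda>x. \<Sum>b\<in>Basis. - ((?I x v \<bullet> b) *\<^sub>R ?I x (?A' b x h)))"
    by (rule Ck_on_sum[OF S], rule Ck_on_linear_comp[OF bounded_linear_minus[OF bounded_linear_ident] S],
      rule Ck_on_bilinear[OF bounded_bilinear_scaleR S Ck_on_linear_comp[OF bounded_linear_inner_left S Suc] I])
  qed
 qed
 then show ?thesis by (simp add: smooth_on_def)
qed

text \<open>The inverse function theorem yields a differentiable inverse whose derivative is the
  inverse of \<open>?r'\<close>; that formula upgrades it to a smooth one order by order. The
  identity as derivative at \<open>x0\<close> is the normalisation in which submersions are
  treated.\<close>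

lemma smooth_inverse_function:
 fixes r :: "'a::euclidean_space => 'a"
 assumes U: "open U" and sm: "smooth_on U r" and x0: "x0 \<in> U"
  and id: "fderiv r x0 = (\<lambda>v. v)"
 obtains U' V g where "open U'" "U' \<subseteq> U" "x0 \<in> U'" "open V" "r x0 \<in> V" "homeomorphism U' V r g"
  "smooth_on V g"
proof -
 let ?r' = "\<lambda>x. fderiv r x"
 have bl: "bounded_linear (?r' x)" if "x \<in> U" for x
  using smooth_on_has_derivative[OF sm that] has_derivative_bounded_linear by blast
 have app: "blinfun_apply (Blinfun (?r' x)) = ?r' x" if "x \<in> U" for x
  using bl[OF that] by (rule bounded_linear_Blinfun_apply)
 have der: "(r has_derivative blinfun_apply (Blinfun (?r' x))) (at x)" if "x \<in> U" for x
  using smooth_on_has_derivative[OF sm that] app[OF that] by simp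
 have "continuous_on U (\<lambda>x. Blinfun (?r' x))"
 proof (rule continuous_on_blinfun_componentwise)
  show "continuous_on U (\<lambda>x. blinfun_apply (Blinfun (?r' x)) i)" for i
   using smooth_on_continuous[OF smooth_on_frechet[OF sm, of i]]
   by (rule continuous_on_eq) (simp add: app)
 qed
 note cont = this
 have idl: "id_blinfun o\<^sub>L Blinfun (?r' x0) = id_blinfun"
  by (rule blinfun_eqI) (use app[OF x0] in \<open>simp add: id\<close>)
 show ?thesis
 proof (rule inverse_function_theorem[OF U der cont x0 idl])
 fix U' V g g'
 assume g: "open U'" "U' \<subseteq> U" "x0 \<in> U'" "open V" "r x0 \<in> V" "homeomorphism U' V r g"
  "\<And>y. y \<in> V ==> (g has_derivative (g' y)) (at y)"
  "\<And>y. y \<in> V ==> g' y = Hilbert_Choice.inv (blinfun_apply (Blinfun (?r' (g y))))"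
  "\<And>y. y \<in> V ==> bij (blinfun_apply (Blinfun (?r' (g y))))"
 have gV: "g y \<in> U'" "r (g y) = y" if "y \<in> V" for y
  using g(6) that by (auto simp: homeomorphism_def)
 have gU: "x \<in> U' ==> g (r x) = x \<and> r x \<in> V" for x using g(6) by (auto simp: homeomorphism_def)
 have bij: "bij (?r' x)" if "x \<in> U'" for x
  using g(9)[of "r x"] gU[OF that] app[of x] g(2) that by auto
 have Ism: "smooth_on U' (\<lambda>x. Hilbert_Choice.inv (?r' x) v)" for v
 proof (rule smooth_on_inv_linear[OF g(1) _ bij])
  show "linear (?r' x)" if "x \<in> U'" for x using bl g(2) that bounded_linear.linear by blast
  show "smooth_on U' (\<lambda>x. ?r' x b)" for b by (rule smooth_on_subset[OF smooth_on_frechet[OF sm] g(2)])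
 qed
 have "Ck_on k V g" for k
 proof (induction k)
  case 0
  show ?case using g(6) by (simp add: homeomorphism_def)
 next
  case (Suc k)
  show ?case
  proof (rule Ck_on_SucI[OF g(4)])
   show "(g has_derivative Hilbert_Choice.inv (?r' (g y))) (at y)" if "y \<in> V" for y
    using g(7,8)[OF that] app[of "g y"] gV[OF that] g(2) by auto
   show "Ck_on k V (\<lambda>y. Hilbert_Choice.inv (?r' (g y)) v)" for v
    by (rule Ck_on_comp[OF g(4,1) _ Suc smooth_on_D[OF Ism]]) (use gV in blast)
  qed
 qed
 then have "smooth_on V g" by (simp add: smooth_on_def)
 then show ?thesis by (rule that[OF g(1-6)])
 qed
qed

subsection \<open>Hadamard's lemma\<close>

lemma radial_in_ball:
 fixes x0 :: "'a::real_normed_vector"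
 assumes "x \<in> ball x0 r" "t \<in> {0..1::real}"
 shows "x0 + t *\<^sub>R (x - x0) \<in> ball x0 r"
proof -
 have "norm (t *\<^sub>R (x - x0)) \<le> norm (x - x0)"
  using assms(2) by (simp add: mult_left_le_one_le)
 then show ?thesis using assms(1) by (simp add: dist_norm norm_minus_commute)
qed

lemma Ck_on_0: "Ck_on k S f ==> continuous_on S f"
 by (induction k) (use Ck_on_SucD in \<open>auto simp del: Ck_on.simps(2)\<close>)

lemma radial_image:
 fixes x0 :: "'a::real_normed_vector"
 shows "(\<lambda>p. x0 + snd p *\<^sub>R (fst p - x0)) ` (ball x0 r \<times> cbox 0 (1::real)) \<subseteq> ball x0 r"
proof
 fix y assume "y \<in> (\<lambda>p. x0 + snd p *\<^sub>R (fst p - x0)) ` (ball x0 r \<times> cbox 0 (1::real))"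
 then obtain x t where "x \<in> ball x0 r" "t \<in> {0..1::real}" "y = x0 + t *\<^sub>R (x - x0)"
  by (auto simp del: mem_ball)
 then show "y \<in> ball x0 r" using radial_in_ball by metis
qed

lemma radial_continuous: "continuous_on T (\<lambda>p. x0 + snd p *\<^sub>R (fst p - x0 :: 'a::real_normed_vector))"
 by (intro continuous_intros)

lemma radial_slice_continuous:
 fixes x0 :: "'a::real_normed_vector"
 assumes "continuous_on (ball x0 r) F" "x \<in> ball x0 r"
 shows "continuous_on (cbox 0 (1::real)) (\<lambda>t. F (x0 + t *\<^sub>R (x - x0)))"
proof (rule continuous_on_compose2[OF assms(1)])
 show "continuous_on (cbox 0 (1::real)) (\<lambda>t. x0 + t *\<^sub>R (x - x0))" by (intro continuous_intros)
 show "(\<lambda>t. x0 + t *\<^sub>R (x - x0)) ` cbox 0 1 \<subseteq> ball x0 r"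
  using radial_in_ball[OF assms(2)] by fastforce
qed

text \<open>The power \<open>t ^ j\<close> is there for the induction: each derivative under the
  integral sign contributes one factor t from the inner map.\<close>

lemma Ck_on_radial_integral:
 fixes F :: "'a::euclidean_space => real"
 shows "Ck_on k (ball x0 r) F ==>
  Ck_on k (ball x0 r) (\<lambda>x. integral {0..1} (\<lambda>t::real. t ^ j * F (x0 + t *\<^sub>R (x - x0))))"
proof (induction k arbitrary: F j)
 case (0 F j)
 have F: "continuous_on (ball x0 r) F" using 0 by simp
 have "continuous_on (ball x0 r \<times> cbox 0 1) (\<lambda>p. F (x0 + snd p *\<^sub>R (fst p - x0)))"
  by (rule continuous_on_compose2[OF F radial_continuous radial_image])
 then have "continuous_on (ball x0 r \<times> cbox 0 1) (\<lambda>(x, t). t ^ j * F (x0 + t *\<^sub>R (x - x0)))"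
  unfolding case_prod_unfold by (intro continuous_on_mult continuous_on_power continuous_on_snd continuous_on_id)
 from integral_continuous_on_param[OF this] show ?case by simp
next
 case (Suc k F j)
 let ?B = "ball x0 r"
 let ?F' = "\<lambda>x. fderiv F x"
 let ?D = "\<lambda>x t. Blinfun (\<lambda>v. t ^ Suc j * ?F' (x0 + t *\<^sub>R (x - x0)) v)"
 have F': "(F has_derivative ?F' x) (at x)" if "x \<in> ?B" for x
  using Ck_on_Suc_has_derivative[OF Suc.prems that] .
 have bl: "bounded_linear (\<lambda>v. t ^ Suc j * ?F' (x0 + t *\<^sub>R (x - x0)) v)" if "x \<in> ?B" "t \<in> {0..1}" for x and t :: real
  by (rule bounded_linear_const_mult[OF has_derivative_bounded_linear[OF F'[OF radial_in_ball[OF that]]]])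
 have cont: "continuous_on ?B (\<lambda>x. ?F' x v)" for v
  by (rule Ck_on_0[of k]) (use Suc.prems in simp)
 have 1: "((\<lambda>x. integral (cbox 0 1) (\<lambda>t::real. t ^ j * F (x0 + t *\<^sub>R (x - x0)))) has_derivative
   blinfun_apply (integral (cbox 0 1) (?D x))) (at x within ?B)" if x: "x \<in> ?B" for x
 proof (rule leibniz_rule[OF _ _ _ x convex_ball])
  show "((\<lambda>x. t ^ j * F (x0 + t *\<^sub>R (x - x0))) has_derivative blinfun_apply (?D y t)) (at y within ?B)"
   if "y \<in> ?B" "t \<in> cbox 0 1" for y and t :: real
  proof -
   have t: "t \<in> {0..1}" using that by simp
   have "((\<lambda>x. x0 + t *\<^sub>R (x - x0)) has_derivative (\<lambda>v. t *\<^sub>R v)) (at y)"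
    by (auto intro!: derivative_eq_intros)
   from has_derivative_compose[OF this F'[OF radial_in_ball[OF that(1) t]]]
   have "((\<lambda>x. F (x0 + t *\<^sub>R (x - x0))) has_derivative (\<lambda>v. ?F' (x0 + t *\<^sub>R (y - x0)) (t *\<^sub>R v))) (at y)" .
   from has_derivative_mult_right[OF this, of "t ^ j"]
   have "((\<lambda>x. t ^ j * F (x0 + t *\<^sub>R (x - x0))) has_derivative (\<lambda>v. t ^ Suc j * ?F' (x0 + t *\<^sub>R (y - x0)) v)) (at y)"
    using linear_scale[OF has_derivative_linear[OF F'[OF radial_in_ball[OF that(1) t]]]]
    by (simp add: ac_simps)
   then show ?thesis
    by (simp only: bounded_linear_Blinfun_apply[OF bl[OF that(1) t]] has_derivative_at_withinI)
  qed
  show "(\<lambda>t. t ^ j * F (x0 + t *\<^sub>R (y - x0))) integrable_on cbox 0 1" if "y \<in> ?B" for y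
   by (rule integrable_continuous) (intro continuous_on_mult continuous_on_power continuous_on_id
     radial_slice_continuous[OF Ck_on_0[OF Suc.prems] that])
  show "continuous_on (?B \<times> cbox 0 1) (\<lambda>(x, t). ?D x t)"
  proof (rule continuous_on_blinfun_componentwise)
   fix i :: 'a
   have "continuous_on (?B \<times> cbox 0 1) (\<lambda>p. snd p ^ Suc j * ?F' (x0 + snd p *\<^sub>R (fst p - x0)) i)"
    by (intro continuous_on_mult continuous_on_power continuous_on_snd continuous_on_id
      continuous_on_compose2[OF cont radial_continuous radial_image])
   then show "continuous_on (?B \<times> cbox 0 1) (\<lambda>p. blinfun_apply (case p of (x, t) => ?D x t) i)"
    by (rule continuous_on_eq) (auto simp: bounded_linear_Blinfun_apply[OF bl] simp del: power_Suc)
  qed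
 qed
 have 2: "blinfun_apply (integral (cbox 0 1) (?D x)) v =
   integral {0..1} (\<lambda>t. t ^ Suc j * ?F' (x0 + t *\<^sub>R (x - x0)) v)" if x: "x \<in> ?B" for x v
 proof -
  have "?D x integrable_on cbox 0 1"
  proof (rule integrable_continuous, rule continuous_on_blinfun_componentwise)
   fix i :: 'a
   have "continuous_on (cbox 0 1) (\<lambda>t. t ^ Suc j * ?F' (x0 + t *\<^sub>R (x - x0)) i)"
    by (intro continuous_on_mult continuous_on_power continuous_on_id radial_slice_continuous[OF cont x])
   then show "continuous_on (cbox 0 1) (\<lambda>t. blinfun_apply (?D x t) i)"
    by (rule continuous_on_eq) (auto simp: bounded_linear_Blinfun_apply[OF bl[OF x]] simp del: power_Suc)
  qed
  from integral_linear[OF this blinfun.bounded_linear_left[of v]]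
  have "blinfun_apply (integral (cbox 0 1) (?D x)) v = integral (cbox 0 1) (\<lambda>t. blinfun_apply (?D x t) v)"
   by (simp add: o_def)
  also have "\<dots> = integral (cbox 0 1) (\<lambda>t. t ^ Suc j * ?F' (x0 + t *\<^sub>R (x - x0)) v)"
   by (rule integral_cong) (auto simp: bounded_linear_Blinfun_apply[OF bl[OF x]] simp del: power_Suc)
  finally show ?thesis by simp
 qed
 show ?case
 proof (rule Ck_on_SucI[OF open_ball])
  show "((\<lambda>x. integral {0..1} (\<lambda>t::real. t ^ j * F (x0 + t *\<^sub>R (x - x0)))) has_derivative
   (\<lambda>v. integral {0..1} (\<lambda>t. t ^ Suc j * ?F' (x0 + t *\<^sub>R (x - x0)) v))) (at x)" if "x \<in> ?B" for x
  proof -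
   have "blinfun_apply (integral (cbox 0 1) (?D x)) =
     (\<lambda>v. integral {0..1} (\<lambda>t. t ^ Suc j * ?F' (x0 + t *\<^sub>R (x - x0)) v))"
    by (rule ext) (rule 2[OF that])
   from 1[OF that, unfolded this at_within_open[OF that open_ball]] show ?thesis
    unfolding box_real .
  qed
  show "Ck_on k ?B (\<lambda>x. integral {0..1} (\<lambda>t. t ^ Suc j * ?F' (x0 + t *\<^sub>R (x - x0)) v))" for v
   by (rule Suc.IH) (use Suc.prems in simp)
 qed
qed

text \<open>Integrate the derivative of \<open>F\<close> along the segment from \<open>x0\<close> to
  x; \<open>G b\<close> is the mean of the b-th partial derivative over that segment, which keeps it
  smooth at \<open>x0\<close> itself.\<close>

lemma Hadamard:
 fixes F :: "'a::euclidean_space => real"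
 assumes "smooth_on (ball x0 r) F"
 obtains G where "\<And>b. smooth_on (ball x0 r) (G b)"
  "\<And>b. G b x0 = fderiv F x0 b"
  "\<And>x. x \<in> ball x0 r ==> F x = F x0 + (\<Sum>b\<in>Basis. ((x - x0) \<bullet> b) * G b x)"
proof
 let ?F' = "\<lambda>x. fderiv F x"
 define G where "G b x = integral {0..1} (\<lambda>t. ?F' (x0 + t *\<^sub>R (x - x0)) b)" for b x
 show "smooth_on (ball x0 r) (G b)" for b
  unfolding smooth_on_def
 proof
  show "Ck_on k (ball x0 r) (G b)" for k
   using Ck_on_radial_integral[OF smooth_on_D[OF smooth_on_frechet[OF assms]], of k 0 b]
   by (simp add: G_def[abs_def])
 qed
 show "G b x0 = ?F' x0 b" for b by (simp add: G_def)
 fix x assume x: "x \<in> ball x0 r"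
 have "((\<lambda>t. ?F' (x0 + t *\<^sub>R (x - x0)) (x - x0)) has_integral F (x0 + 1 *\<^sub>R (x - x0)) - F (x0 + 0 *\<^sub>R (x - x0))) {0..1}"
 proof (rule fundamental_theorem_of_calculus)
  show "((\<lambda>t. F (x0 + t *\<^sub>R (x - x0))) has_vector_derivative ?F' (x0 + t *\<^sub>R (x - x0)) (x - x0)) (at t within {0..1})"
   if "t \<in> {0..1}" for t
   using smooth_on_line_derivative[OF assms radial_in_ball[OF x that]]
   by (simp add: has_real_derivative_iff_has_vector_derivative has_vector_derivative_at_within)
 qed simp
 then have "F x - F x0 = integral {0..1} (\<lambda>t. ?F' (x0 + t *\<^sub>R (x - x0)) (x - x0))"
  by (simp add: integral_unique)
 also have "\<dots> = integral {0..1} (\<lambda>t. \<Sum>b\<in>Basis. ((x - x0) \<bullet> b) * ?F' (x0 + t *\<^sub>R (x - x0)) b)"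
  using linear_Basis_sum[OF has_derivative_linear[OF smooth_on_has_derivative[OF assms radial_in_ball[OF x]]]]
  by (intro integral_cong) simp
 also have "\<dots> = (\<Sum>b\<in>Basis. integral {0..1} (\<lambda>t. ((x - x0) \<bullet> b) * ?F' (x0 + t *\<^sub>R (x - x0)) b))"
 proof (rule integral_sum[OF finite_Basis])
  show "(\<lambda>t. ((x - x0) \<bullet> b) * ?F' (x0 + t *\<^sub>R (x - x0)) b) integrable_on {0..1}" for b
   using radial_slice_continuous[OF smooth_on_continuous[OF smooth_on_frechet[OF assms]] x]
   by (intro integrable_continuous_interval continuous_on_mult continuous_on_const) simp
 qed
 finally show "F x = F x0 + (\<Sum>b\<in>Basis. ((x - x0) \<bullet> b) * G b x)"
  by (simp add: G_def)
qed

section \<open>Smooth functions and maps on manifolds\<close>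

text \<open>The chart conditions of \<open>smooth_manifold\<close> alone. They pass to
  \<open>prod_atlas\<close> by working in charts and carry the calculus of smooth functions;
  separation enters with the bump functions.\<close>

definition pre_manifold :: "('p, 'e::euclidean_space) atlas => bool" where
 "pre_manifold A \<longleftrightarrow>
   (\<forall>(U, \<phi>)\<in>A. inj_on \<phi> U \<and> open (\<phi> ` U)) \<and>
   (\<forall>(U, \<phi>)\<in>A. \<forall>(V, \<psi>)\<in>A. open (\<phi> ` (U \<inter> V)) \<and>
    smooth_on (\<phi> ` (U \<inter> V)) (\<psi> o cinv U \<phi>))"

lemma pre_manifoldI:
 assumes "\<And>U \<phi>. (U, \<phi>) \<in> A ==> inj_on \<phi> U \<and> open (\<phi> ` U)"
  "\<And>U \<phi> V \<psi>. (U, \<phi>) \<in> A ==> (V, \<psi>) \<in> A ==>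
   open (\<phi> ` (U \<inter> V)) \<and> smooth_on (\<phi> ` (U \<inter> V)) (\<psi> o cinv U \<phi>)"
 shows "pre_manifold A"
 unfolding pre_manifold_def using assms by fast

lemma smooth_manifold_pre: "smooth_manifold A ==> pre_manifold A"
 by (simp add: smooth_manifold_def pre_manifold_def)

lemma pre_manifoldD:
 assumes "pre_manifold A" "(U, \<phi>) \<in> A"
 shows "inj_on \<phi> U" "open (\<phi> ` U)"
  "\<And>V \<psi>. (V, \<psi>) \<in> A ==> open (\<phi> ` (U \<inter> V))"
  "\<And>V \<psi>. (V, \<psi>) \<in> A ==> smooth_on (\<phi> ` (U \<inter> V)) (\<psi> o cinv U \<phi>)"
 using assms by (auto simp: pre_manifold_def)

lemma pointsI: "(U, \<phi>) \<in> A ==> p \<in> U ==> p \<in> points A"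
 by (auto simp: points_def)

lemma pointsE:
 assumes "p \<in> points A"
 obtains U \<phi> where "(U, \<phi>) \<in> A" "p \<in> U"
 using assms by (auto simp: points_def)

lemma chart_subset_points: "(U, \<phi>) \<in> A ==> U \<subseteq> points A"
 by (auto simp: points_def)

lemma chart_inv:
 assumes "inj_on \<phi> U"
 shows "p \<in> U ==> cinv U \<phi> (\<phi> p) = p"
  and "x \<in> \<phi> ` U ==> cinv U \<phi> x \<in> U"
  and "x \<in> \<phi> ` U ==> \<phi> (cinv U \<phi> x) = x"
 using assms by (auto simp: the_inv_into_f_f)

lemma image_Int_vimage:
 assumes "inj_on \<phi> U"
 shows "\<phi> ` (U \<inter> X) = {x \<in> \<phi> ` U. cinv U \<phi> x \<in> X}"
 using chart_inv[OF assms] by force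

lemma open_chart_preimage:
 assumes "inj_on \<phi> U" "open (\<phi> ` (U \<inter> X))" "continuous_on (\<phi> ` (U \<inter> X)) (h o cinv U \<phi>)" "open W"
 shows "open (\<phi> ` (U \<inter> (X \<inter> h -` W)))"
proof -
 have "\<phi> ` (U \<inter> (X \<inter> h -` W)) = \<phi> ` (U \<inter> X) \<inter> (h o cinv U \<phi>) -` W"
  using chart_inv[OF assms(1)] by auto
 moreover have "open ((h o cinv U \<phi>) -` W \<inter> \<phi> ` (U \<inter> X))"
  using iffD1[OF continuous_on_open_vimage[OF assms(2)] assms(3)] assms(4) by blast
 ultimately show ?thesis by (simp add: inf_commute)
qed

text \<open>The generating sets are chart preimages, and continuous transition maps make their
  images in every other chart open; so openness can be tested chart by chart.\<close>

lemma openin_mtop_iff: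
 assumes "pre_manifold A"
 shows "openin (mtop A) X \<longleftrightarrow> X \<subseteq> points A \<and> (\<forall>(U, \<phi>)\<in>A. open (\<phi> ` (U \<inter> X)))"
proof
 assume "openin (mtop A) X"
 then have "generate_topology_on {U \<inter> \<phi> -` W | U \<phi> W. (U, \<phi>) \<in> A \<and> open W} X"
  by (simp add: mtop_def openin_topology_generated_by_iff)
 then show "X \<subseteq> points A \<and> (\<forall>(U, \<phi>)\<in>A. open (\<phi> ` (U \<inter> X)))"
 proof (induction rule: generate_topology_on.induct)
  case (Int a b)
  have "\<phi> ` (U \<inter> (a \<inter> b)) = \<phi> ` (U \<inter> a) \<inter> \<phi> ` (U \<inter> b)" if "(U, \<phi>) \<in> A" for U \<phi>
   using pre_manifoldD(1)[OF assms that] by (auto simp: inj_on_def)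
  then show ?case using Int by (auto intro!: open_Int)
 next
  case (UN K)
  have "\<phi> ` (U \<inter> \<Union> K) = (\<Union>k\<in>K. \<phi> ` (U \<inter> k))" for U :: "'a set" and \<phi> :: "'a => 'b"
   by auto
  then show ?case using UN by fastforce
 next
  case (Basis s)
  then obtain V \<psi> W where s: "s = V \<inter> \<psi> -` W" "(V, \<psi>) \<in> A" "open W" by auto
  have "open (\<phi> ` (U \<inter> s))" if "(U, \<phi>) \<in> A" for U \<phi>
   unfolding s(1)
   by (rule open_chart_preimage[OF pre_manifoldD(1)[OF assms that] pre_manifoldD(3)[OF assms that s(2)]
      smooth_on_continuous[OF pre_manifoldD(4)[OF assms that s(2)]] s(3)])
  then show ?case using s chart_subset_points by fastforce
 qed simp
next
 assume X: "X \<subseteq> points A \<and> (\<forall>(U, \<phi>)\<in>A. open (\<phi> ` (U \<inter> X)))"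
 have "openin (mtop A) (\<Union>(U, \<phi>)\<in>A. U \<inter> \<phi> -` (\<phi> ` (U \<inter> X)))"
 proof (rule openin_Union, clarify)
  fix U \<phi> assume "(U, \<phi>) \<in> A"
  moreover from this have "open (\<phi> ` (U \<inter> X))" using X by auto
  ultimately show "openin (mtop A) (U \<inter> \<phi> -` (\<phi> ` (U \<inter> X)))"
   unfolding mtop_def by (intro topology_generated_by_Basis) blast
 qed
 moreover have "(\<Union>(U, \<phi>)\<in>A. U \<inter> \<phi> -` (\<phi> ` (U \<inter> X))) = X"
 proof (intro equalityI subsetI)
  fix p assume "p \<in> (\<Union>(U, \<phi>)\<in>A. U \<inter> \<phi> -` (\<phi> ` (U \<inter> X)))"
  then obtain U \<phi> q where q: "(U, \<phi>) \<in> A" "p \<in> U" "q \<in> U" "q \<in> X" "\<phi> p = \<phi> q" by auto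
  from inj_onD[OF pre_manifoldD(1)[OF assms q(1)] q(5,2,3)] q(4) show "p \<in> X" by simp
 next
  fix p assume p: "p \<in> X"
  with X have "p \<in> points A" by blast
  then obtain U \<phi> where "(U, \<phi>) \<in> A" "p \<in> U" by (rule pointsE)
  then show "p \<in> (\<Union>(U, \<phi>)\<in>A. U \<inter> \<phi> -` (\<phi> ` (U \<inter> X)))" using p by auto
 qed
 ultimately show "openin (mtop A) X" by simp
qed

lemma openin_mtopD:
 "pre_manifold A ==> openin (mtop A) X ==> (U, \<phi>) \<in> A ==> open (\<phi> ` (U \<inter> X))"
 using openin_mtop_iff by fastforce

lemma topspace_mtop:
 assumes "pre_manifold A"
 shows "topspace (mtop A) = points A"
proof -
 have "U \<inter> points A = U" if "(U, \<phi>) \<in> A" for U \<phi>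
  using chart_subset_points[OF that] by blast
 then have "openin (mtop A) (points A)"
  unfolding openin_mtop_iff[OF assms] using pre_manifoldD(2)[OF assms] by auto
 moreover have "topspace (mtop A) \<subseteq> points A"
  using openin_mtop_iff[OF assms] openin_topspace by blast
 ultimately show ?thesis using openin_subset by blast
qed

lemma openin_points: "pre_manifold A ==> openin (mtop A) (points A)"
 using topspace_mtop openin_topspace by metis

lemma openin_chart_vimage:
 assumes "pre_manifold A" "(U, \<phi>) \<in> A" "open W"
 shows "openin (mtop A) (U \<inter> \<phi> -` W)"
 unfolding mtop_def using assms by (intro topology_generated_by_Basis) auto

lemma openin_chart: "pre_manifold A ==> (U, \<phi>) \<in> A ==> openin (mtop A) U"
 using openin_chart_vimage[of A U \<phi> UNIV] by simp

lemma continuous_map_chart_inv: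
 assumes "pre_manifold A" "(U, \<phi>) \<in> A"
 shows "continuous_map (top_of_set (\<phi> ` U)) (mtop A) (cinv U \<phi>)"
 unfolding continuous_map_def
proof (intro conjI allI impI)
 note i = pre_manifoldD[OF assms]
 show "cinv U \<phi> \<in> topspace (top_of_set (\<phi> ` U)) \<rightarrow> topspace (mtop A)"
  using chart_inv[OF i(1)] chart_subset_points[OF assms(2)] by (auto simp: topspace_mtop[OF assms(1)])
 fix X assume X: "openin (mtop A) X"
 have "{x \<in> topspace (top_of_set (\<phi> ` U)). cinv U \<phi> x \<in> X} = \<phi> ` (U \<inter> X)"
  using image_Int_vimage[OF i(1)] by auto
 then show "openin (top_of_set (\<phi> ` U)) {x \<in> topspace (top_of_set (\<phi> ` U)). cinv U \<phi> x \<in> X}"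
  using openin_mtopD[OF assms(1) X assms(2)] by (simp add: openin_open_eq[OF i(2)] image_mono)
qed

definition smooth_fun_on :: "('p, 'e::euclidean_space) atlas => 'p set => ('p => real) => bool" where
 "smooth_fun_on A X f \<longleftrightarrow> (\<forall>(U, \<phi>)\<in>A. smooth_on (\<phi> ` (U \<inter> X)) (f o cinv U \<phi>))"

lemma smooth_fun_onD:
 "smooth_fun_on A X f ==> (U, \<phi>) \<in> A ==> smooth_on (\<phi> ` (U \<inter> X)) (f o cinv U \<phi>)"
 by (auto simp: smooth_fun_on_def)

lemma smooth_fun_iff_on: "smooth_fun A f \<longleftrightarrow> smooth_fun_on A (points A) f"
 unfolding smooth_fun_def smooth_fun_on_def
 by (intro ball_cong refl) (auto dest: chart_subset_points simp: Int_absorb2)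

lemma smooth_fun_on_subset: "smooth_fun_on A X f ==> Y \<subseteq> X ==> smooth_fun_on A Y f"
 unfolding smooth_fun_on_def by (auto intro: smooth_on_subset)

lemma smooth_fun_imp_on: "smooth_fun A f ==> smooth_fun_on A X f"
proof -
 assume "smooth_fun A f"
 then have "smooth_on (\<phi> ` U) (f o cinv U \<phi>)" if "(U, \<phi>) \<in> A" for U \<phi>
  using that by (auto simp: smooth_fun_def)
 then show ?thesis unfolding smooth_fun_on_def
  by (auto intro: smooth_on_subset[of "_ ` _"])
qed

lemma smooth_fun_on_local:
 assumes "pre_manifold A"
  "\<And>p. p \<in> X ==> \<exists>Y. openin (mtop A) Y \<and> p \<in> Y \<and> smooth_fun_on A Y f"
 shows "smooth_fun_on A X f"
 unfolding smooth_fun_on_def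
proof (clarify)
 fix U \<phi> assume c: "(U, \<phi>) \<in> A"
 show "smooth_on (\<phi> ` (U \<inter> X)) (f o cinv U \<phi>)"
 proof (rule smooth_on_local)
  fix x assume "x \<in> \<phi> ` (U \<inter> X)"
  then obtain p where p: "p \<in> U" "p \<in> X" "x = \<phi> p" by auto
  then obtain Y where Y: "openin (mtop A) Y" "p \<in> Y" "smooth_fun_on A Y f" using assms(2) by blast
  show "\<exists>T. open T \<and> x \<in> T \<and> smooth_on T (f o cinv U \<phi>)"
   using openin_mtopD[OF assms(1) Y(1) c] smooth_fun_onD[OF Y(3) c] p Y(2) by blast
 qed
qed

lemma smooth_fun_on_cong:
 assumes "pre_manifold A" "openin (mtop A) X" "\<And>p. p \<in> X ==> f p = g p"
 shows "smooth_fun_on A X f \<longleftrightarrow> smooth_fun_on A X g"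
proof -
 have "smooth_on (\<phi> ` (U \<inter> X)) (f o cinv U \<phi>) \<longleftrightarrow> smooth_on (\<phi> ` (U \<inter> X)) (g o cinv U \<phi>)"
  if c: "(U, \<phi>) \<in> A" for U \<phi>
  by (rule smooth_on_cong[OF openin_mtopD[OF assms(1,2) c]])
   (use chart_inv[OF pre_manifoldD(1)[OF assms(1) c]] assms(3) in auto)
 then show ?thesis unfolding smooth_fun_on_def by (intro ball_cong refl) auto
qed

lemma smooth_fun_cong:
 assumes "pre_manifold A" "\<And>p. p \<in> points A ==> f p = g p"
 shows "smooth_fun A f \<longleftrightarrow> smooth_fun A g"
 unfolding smooth_fun_iff_on by (rule smooth_fun_on_cong[OF assms(1) openin_points[OF assms(1)] assms(2)])

lemma smooth_fun_on_const: "smooth_fun_on A X (\<lambda>_. c)"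
 by (auto simp: smooth_fun_on_def o_def smooth_on_const)

lemma smooth_fun_on_add:
 assumes "pre_manifold A" "openin (mtop A) X" "smooth_fun_on A X f" "smooth_fun_on A X g"
 shows "smooth_fun_on A X (\<lambda>p. f p + g p)"
 unfolding smooth_fun_on_def
 using smooth_on_add[OF openin_mtopD[OF assms(1,2)] smooth_fun_onD[OF assms(3)] smooth_fun_onD[OF assms(4)]]
 by (auto simp: o_def)

lemma smooth_fun_on_mult:
 assumes "pre_manifold A" "openin (mtop A) X" "smooth_fun_on A X f" "smooth_fun_on A X g"
 shows "smooth_fun_on A X (\<lambda>p. f p * g p)"
 unfolding smooth_fun_on_def
 using smooth_on_mult[OF openin_mtopD[OF assms(1,2)] smooth_fun_onD[OF assms(3)] smooth_fun_onD[OF assms(4)]]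
 by (auto simp: o_def)

lemma smooth_fun_on_divide:
 assumes "pre_manifold A" "openin (mtop A) X" "smooth_fun_on A X f" "smooth_fun_on A X g"
  "\<And>p. p \<in> X ==> g p \<noteq> 0"
 shows "smooth_fun_on A X (\<lambda>p. f p / g p)"
 unfolding smooth_fun_on_def
proof (clarify)
 fix U \<phi> assume c: "(U, \<phi>) \<in> A"
 have "smooth_on (\<phi> ` (U \<inter> X)) (\<lambda>x. (f o cinv U \<phi>) x / (g o cinv U \<phi>) x)"
  by (rule smooth_on_divide[OF openin_mtopD[OF assms(1,2) c] smooth_fun_onD[OF assms(3) c] smooth_fun_onD[OF assms(4) c]])
   (use chart_inv[OF pre_manifoldD(1)[OF assms(1) c]] assms(5) in auto)
 then show "smooth_on (\<phi> ` (U \<inter> X)) ((\<lambda>p. f p / g p) o cinv U \<phi>)" by (simp add: o_def)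
qed

lemma smooth_fun_on_sum:
 assumes "pre_manifold A" "openin (mtop A) X" "\<And>i. i \<in> I ==> smooth_fun_on A X (f i)"
 shows "smooth_fun_on A X (\<lambda>p. \<Sum>i\<in>I. f i p)"
 using assms(3)
 by (induction I rule: infinite_finite_induct)
  (auto simp: smooth_fun_on_const intro!: smooth_fun_on_add[OF assms(1,2)])

lemma smooth_fun_on_prod:
 assumes "pre_manifold A" "openin (mtop A) X" "\<And>i. i \<in> I ==> smooth_fun_on A X (f i)"
 shows "smooth_fun_on A X (\<lambda>p. \<Prod>i\<in>I. f i p)"
 using assms(3)
 by (induction I rule: infinite_finite_induct)
  (auto simp: smooth_fun_on_const intro!: smooth_fun_on_mult[OF assms(1,2)])

lemma smooth_fun_const: "smooth_fun A (\<lambda>_. c)"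
 by (simp add: smooth_fun_iff_on smooth_fun_on_const)

lemma smooth_fun_add:
 "pre_manifold A ==> smooth_fun A f ==> smooth_fun A g ==> smooth_fun A (\<lambda>p. f p + g p)"
 by (simp add: smooth_fun_iff_on smooth_fun_on_add openin_points)

lemma smooth_fun_mult:
 "pre_manifold A ==> smooth_fun A f ==> smooth_fun A g ==> smooth_fun A (\<lambda>p. f p * g p)"
 by (simp add: smooth_fun_iff_on smooth_fun_on_mult openin_points)

lemma smooth_fun_sum:
 "pre_manifold A ==> (\<And>i. i \<in> I ==> smooth_fun A (f i)) ==> smooth_fun A (\<lambda>p. \<Sum>i\<in>I. f i p)"
 by (simp add: smooth_fun_iff_on smooth_fun_on_sum openin_points)

lemma smooth_fun_diff:
 assumes "pre_manifold A" "smooth_fun A f" "smooth_fun A g"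
 shows "smooth_fun A (\<lambda>p. f p - g p)"
 using smooth_fun_add[OF assms(1,2) smooth_fun_mult[OF assms(1) smooth_fun_const assms(3), of "-1"]] by simp

lemma smooth_fun_on_chart:
 assumes "pre_manifold A" "(V, \<psi>) \<in> A" "open W" "W \<subseteq> \<psi> ` V" "smooth_on W h"
 shows "smooth_fun_on A (V \<inter> \<psi> -` W) (h o \<psi>)"
 unfolding smooth_fun_on_def
proof (clarify)
 fix U \<phi> assume c: "(U, \<phi>) \<in> A"
 have o: "open (\<phi> ` (U \<inter> (V \<inter> \<psi> -` W)))"
  using openin_mtopD[OF assms(1) openin_chart_vimage[OF assms(1-3)] c] .
 have "smooth_on (\<phi> ` (U \<inter> (V \<inter> \<psi> -` W))) (\<lambda>x. h ((\<psi> o cinv U \<phi>) x))"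
 proof (rule smooth_on_comp[OF o assms(3) _ _ assms(5)])
  show "(\<psi> o cinv U \<phi>) ` \<phi> ` (U \<inter> (V \<inter> \<psi> -` W)) \<subseteq> W"
   using chart_inv[OF pre_manifoldD(1)[OF assms(1) c]] by auto
  show "smooth_on (\<phi> ` (U \<inter> (V \<inter> \<psi> -` W))) (\<psi> o cinv U \<phi>)"
   by (rule smooth_on_subset[OF pre_manifoldD(4)[OF assms(1) c assms(2)]]) auto
 qed
 then show "smooth_on (\<phi> ` (U \<inter> (V \<inter> \<psi> -` W))) (h o \<psi> o cinv U \<phi>)"
  by (simp add: o_def)
qed

lemma openin_smooth_fun_on_vimage:
 assumes "pre_manifold A" "openin (mtop A) X" "smooth_fun_on A X f" "open W"
 shows "openin (mtop A) (X \<inter> f -` W)"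
 unfolding openin_mtop_iff[OF assms(1)]
proof (intro conjI ballI, goal_cases)
 case 1
 then show ?case using assms(2) openin_mtop_iff[OF assms(1)] by blast
next
 case (2 c)
 obtain U \<phi> where c: "c = (U, \<phi>)" "(U, \<phi>) \<in> A" using 2 by (cases c) auto
 show ?case unfolding c(1) prod.case
  by (rule open_chart_preimage[OF pre_manifoldD(1)[OF assms(1) c(2)] openin_mtopD[OF assms(1,2) c(2)]
     smooth_on_continuous[OF smooth_fun_onD[OF assms(3) c(2)]] assms(4)])
qed

lemma smooth_fun_continuous_map:
 assumes "pre_manifold A" "smooth_fun A f"
 shows "continuous_map (mtop A) euclideanreal f"
 unfolding continuous_map_def topspace_mtop[OF assms(1)]
proof (intro conjI allI impI)
 fix W :: "real set" assume "openin euclidean W"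
 then have "openin (mtop A) (points A \<inter> f -` W)"
  using openin_smooth_fun_on_vimage[OF assms(1) openin_points[OF assms(1)]] assms(2)
  by (simp add: smooth_fun_iff_on)
 moreover have "points A \<inter> f -` W = {x \<in> points A. f x \<in> W}" by auto
 ultimately show "openin (mtop A) {x \<in> points A. f x \<in> W}" by simp
qed auto

subsection \<open>Smooth maps and product manifolds\<close>

lemma smooth_mapI:
 assumes "\<And>p. p \<in> points A ==> F p \<in> points B"
  "\<And>U \<phi> V \<psi>. (U, \<phi>) \<in> A ==> (V, \<psi>) \<in> B ==> open (\<phi> ` (U \<inter> F -` V)) \<and>
   smooth_on (\<phi> ` (U \<inter> F -` V)) (\<psi> o F o cinv U \<phi>)"
 shows "smooth_map A B F"
 unfolding smooth_map_def using assms by fast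

lemma smooth_mapD:
 assumes "smooth_map A B F" "(U, \<phi>) \<in> A" "(V, \<psi>) \<in> B"
 shows "open (\<phi> ` (U \<inter> F -` V))" "smooth_on (\<phi> ` (U \<inter> F -` V)) (\<psi> o F o cinv U \<phi>)"
 using assms by (auto simp: smooth_map_def)

lemma smooth_map_points: "smooth_map A B F ==> p \<in> points A ==> F p \<in> points B"
 by (auto simp: smooth_map_def)

lemma smooth_map_open_vimage:
 assumes "pre_manifold A" "pre_manifold B" "smooth_map A B F" "openin (mtop B) Y"
 shows "openin (mtop A) (points A \<inter> F -` Y)"
 unfolding openin_mtop_iff[OF assms(1)]
proof (intro conjI ballI, goal_cases)
 case (2 c)
 obtain U \<phi> where c: "c = (U, \<phi>)" "(U, \<phi>) \<in> A" using 2 by (cases c) auto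
 note i = pre_manifoldD(1)[OF assms(1) c(2)]
 have *: "\<phi> ` (U \<inter> (points A \<inter> F -` Y)) = (\<Union>(V, \<psi>)\<in>B. \<phi> ` (U \<inter> (F -` V \<inter> (\<psi> o F) -` (\<psi> ` (V \<inter> Y)))))"
 proof (intro equalityI subsetI)
  fix x assume "x \<in> \<phi> ` (U \<inter> (points A \<inter> F -` Y))"
  then obtain p where p: "x = \<phi> p" "p \<in> U" "F p \<in> Y" by auto
  then obtain V \<psi> where "(V, \<psi>) \<in> B" "F p \<in> V"
   using pointsE[OF smooth_map_points[OF assms(3) pointsI[OF c(2) p(2)]]] by blast
  then show "x \<in> (\<Union>(V, \<psi>)\<in>B. \<phi> ` (U \<inter> (F -` V \<inter> (\<psi> o F) -` (\<psi> ` (V \<inter> Y)))))"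
   using p by force
 next
  fix x assume "x \<in> (\<Union>(V, \<psi>)\<in>B. \<phi> ` (U \<inter> (F -` V \<inter> (\<psi> o F) -` (\<psi> ` (V \<inter> Y)))))"
  then obtain V \<psi> p q where q: "(V, \<psi>) \<in> B" "x = \<phi> p" "p \<in> U" "F p \<in> V" "\<psi> (F p) = \<psi> q" "q \<in> V" "q \<in> Y"
   by auto
  moreover from inj_onD[OF pre_manifoldD(1)[OF assms(2) q(1)] q(5,4,6)] have "F p = q" .
  ultimately show "x \<in> \<phi> ` (U \<inter> (points A \<inter> F -` Y))" using pointsI[OF c(2)] by auto
 qed
 show ?case unfolding c(1) prod.case *
 proof (intro open_UN ballI, clarify)
  fix V \<psi> assume V: "(V, \<psi>) \<in> B"
  show "open (\<phi> ` (U \<inter> (F -` V \<inter> (\<psi> o F) -` (\<psi> ` (V \<inter> Y)))))"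
   by (rule open_chart_preimage[OF i smooth_mapD(1)[OF assms(3) c(2) V]
      smooth_on_continuous[OF smooth_mapD(2)[OF assms(3) c(2) V]] openin_mtopD[OF assms(2,4) V]])
 qed
qed auto

lemma smooth_map_fun_on:
 assumes "pre_manifold A" "pre_manifold B" "smooth_map A B F" "openin (mtop B) Y" "smooth_fun_on B Y f"
 shows "smooth_fun_on A (points A \<inter> F -` Y) (f o F)"
 unfolding smooth_fun_on_def
proof (clarify)
 fix U \<phi> assume c: "(U, \<phi>) \<in> A"
 note i = chart_inv[OF pre_manifoldD(1)[OF assms(1) c]]
 show "smooth_on (\<phi> ` (U \<inter> (points A \<inter> F -` Y))) (f o F o cinv U \<phi>)"
 proof (rule smooth_on_local)
  fix x assume "x \<in> \<phi> ` (U \<inter> (points A \<inter> F -` Y))"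
  then obtain p where p: "x = \<phi> p" "p \<in> U" "F p \<in> Y" by auto
  then obtain V \<psi> where V: "(V, \<psi>) \<in> B" "F p \<in> V"
   using pointsE[OF smooth_map_points[OF assms(3) pointsI[OF c p(2)]]] by blast
  note iV = chart_inv[OF pre_manifoldD(1)[OF assms(2) V(1)]]
  let ?T = "\<phi> ` (U \<inter> (F -` V \<inter> (\<psi> o F) -` (\<psi> ` (V \<inter> Y))))"
  have T: "open ?T"
   by (rule open_chart_preimage[OF pre_manifoldD(1)[OF assms(1) c] smooth_mapD(1)[OF assms(3) c V(1)]
      smooth_on_continuous[OF smooth_mapD(2)[OF assms(3) c V(1)]] openin_mtopD[OF assms(2,4) V(1)]])
  have "smooth_on ?T (\<lambda>x. (f o cinv V \<psi>) ((\<psi> o F o cinv U \<phi>) x))"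
  proof (rule smooth_on_comp[OF T openin_mtopD[OF assms(2,4) V(1)] _ _ smooth_fun_onD[OF assms(5) V(1)]])
   show "(\<psi> o F o cinv U \<phi>) ` ?T \<subseteq> \<psi> ` (V \<inter> Y)" using i by auto
   show "smooth_on ?T (\<psi> o F o cinv U \<phi>)"
    by (rule smooth_on_subset[OF smooth_mapD(2)[OF assms(3) c V(1)]]) auto
  qed
  moreover have "(f o cinv V \<psi>) ((\<psi> o F o cinv U \<phi>) y) = (f o F o cinv U \<phi>) y"
   if y: "y \<in> ?T" for y
  proof -
   obtain z where "y = \<phi> z" "z \<in> U" "F z \<in> V" using y by blast
   then show ?thesis using i(1) iV(1) by simp
  qed
  ultimately have "smooth_on ?T (f o F o cinv U \<phi>)"
   by (rule smooth_on_eq[OF T])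
  moreover have "x \<in> ?T" using p V by auto
  ultimately show "\<exists>T. open T \<and> x \<in> T \<and> smooth_on T (f o F o cinv U \<phi>)"
   using T by blast
 qed
qed

lemma smooth_map_fun:
 assumes "pre_manifold A" "pre_manifold B" "smooth_map A B F" "smooth_fun B f"
 shows "smooth_fun A (f o F)"
proof -
 have "points A \<inter> F -` points B = points A" using smooth_map_points[OF assms(3)] by auto
 then show ?thesis
  using smooth_map_fun_on[OF assms(1-3) openin_points[OF assms(2)]] assms(4) by (simp add: smooth_fun_iff_on)
qed

lemma smooth_map_comp:
 assumes "pre_manifold A" "pre_manifold B" "pre_manifold C" "smooth_map A B F" "smooth_map B C H"
 shows "smooth_map A C (H o F)"
proof (rule smooth_mapI)
 show "(H o F) p \<in> points C" if "p \<in> points A" for p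
  using smooth_map_points[OF assms(4) that] smooth_map_points[OF assms(5)] by auto
next
 fix U \<phi> W \<omega> assume c: "(U, \<phi>) \<in> A" and d: "(W, \<omega>) \<in> C"
 let ?Y = "points B \<inter> H -` W"
 have Y: "openin (mtop B) ?Y"
  by (rule smooth_map_open_vimage[OF assms(2,3,5) openin_chart[OF assms(3) d]])
 have eq: "U \<inter> (H o F) -` W = U \<inter> (points A \<inter> F -` ?Y)"
  using smooth_map_points[OF assms(4)] pointsI[OF c] by auto
 have o: "open (\<phi> ` (U \<inter> (H o F) -` W))"
  unfolding eq by (rule openin_mtopD[OF assms(1) smooth_map_open_vimage[OF assms(1,2,4) Y] c])
 have "smooth_on (\<phi> ` (U \<inter> (H o F) -` W)) (\<omega> o (H o F) o cinv U \<phi>)"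
 proof (rule smooth_on_componentwise[OF o])
  fix b
  have "smooth_fun_on B ?Y (\<lambda>q. \<omega> (H q) \<bullet> b)"
   unfolding smooth_fun_on_def
  proof (clarify)
   fix V \<psi> assume V: "(V, \<psi>) \<in> B"
   have e: "V \<inter> ?Y = V \<inter> H -` W" using pointsI[OF V] by auto
   have "smooth_on (\<psi> ` (V \<inter> H -` W)) (\<lambda>x. (\<omega> o H o cinv V \<psi>) x \<bullet> b)"
    by (rule smooth_on_linear_comp[OF bounded_linear_inner_left smooth_mapD[OF assms(5) V d]])
   then show "smooth_on (\<psi> ` (V \<inter> ?Y)) ((\<lambda>q. \<omega> (H q) \<bullet> b) o cinv V \<psi>)"
    unfolding e by (simp add: o_def)
  qed
  from smooth_fun_onD[OF smooth_map_fun_on[OF assms(1,2,4) Y this] c]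
  show "smooth_on (\<phi> ` (U \<inter> (H o F) -` W)) (\<lambda>x. (\<omega> o (H o F) o cinv U \<phi>) x \<bullet> b)"
   unfolding eq by (simp add: o_def)
 qed
 with o show "open (\<phi> ` (U \<inter> (H o F) -` W)) \<and>
  smooth_on (\<phi> ` (U \<inter> (H o F) -` W)) (\<omega> o (H o F) o cinv U \<phi>)" by blast
qed

lemma smooth_map_id:
 assumes "pre_manifold A"
 shows "smooth_map A A (\<lambda>p. p)"
 unfolding smooth_map_def using pre_manifoldD[OF assms] by (auto simp: o_def)

lemma smooth_map_const:
 assumes "pre_manifold A" "b \<in> points B"
 shows "smooth_map A B (\<lambda>_. b)"
proof -
 have "U \<inter> (\<lambda>_. b) -` V = (if b \<in> V then U else {})" for U :: "'a set" and V by auto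
 then show ?thesis
  unfolding smooth_map_def using pre_manifoldD(2)[OF assms(1)] assms(2)
  by (auto simp: o_def smooth_on_const)
qed

lemma prod_atlasE:
 assumes "c \<in> prod_atlas A B"
 obtains U \<phi> V \<psi> where "c = (U \<times> V, map_prod \<phi> \<psi>)" "(U, \<phi>) \<in> A" "(V, \<psi>) \<in> B"
 using assms unfolding prod_atlas_def by blast

lemma prod_atlasI: "(U, \<phi>) \<in> A ==> (V, \<psi>) \<in> B ==> (U \<times> V, map_prod \<phi> \<psi>) \<in> prod_atlas A B"
 unfolding prod_atlas_def by blast

lemma points_prod_atlas: "points (prod_atlas A B) = points A \<times> points B"
proof (intro equalityI subsetI)
 fix p assume "p \<in> points (prod_atlas A B)"
 then show "p \<in> points A \<times> points B"
  by (elim pointsE prod_atlasE) (auto intro: pointsI)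
next
 fix p assume "p \<in> points A \<times> points B"
 then obtain U \<phi> V \<psi> where "(U, \<phi>) \<in> A" "fst p \<in> U" "(V, \<psi>) \<in> B" "snd p \<in> V"
  by (metis mem_Times_iff pointsE)
 then show "p \<in> points (prod_atlas A B)"
  by (intro pointsI[OF prod_atlasI]) (auto simp: mem_Times_iff)
qed

lemma map_prod_image: "map_prod \<phi> \<psi> ` (U \<times> V) = \<phi> ` U \<times> \<psi> ` V"
 by force

lemma the_inv_into_map_prod:
 assumes "inj_on \<phi> U" "inj_on \<psi> V" "x \<in> \<phi> ` U" "y \<in> \<psi> ` V"
 shows "cinv (U \<times> V) (map_prod \<phi> \<psi>) (x, y) = (cinv U \<phi> x, cinv V \<psi> y)"
proof (rule the_inv_into_f_eq)
 show "inj_on (map_prod \<phi> \<psi>) (U \<times> V)" using assms(1,2) by (rule map_prod_inj_on)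
qed (use chart_inv[OF assms(1)] chart_inv[OF assms(2)] assms(3,4) in auto)

lemma pre_manifold_prod:
 assumes "pre_manifold A" "pre_manifold B"
 shows "pre_manifold (prod_atlas A B)"
proof (rule pre_manifoldI)
 fix X f assume "(X, f) \<in> prod_atlas A B"
 then show "inj_on f X \<and> open (f ` X)"
 proof (rule prod_atlasE)
  fix U \<phi> V \<psi> assume c: "(X, f) = (U \<times> V, map_prod \<phi> \<psi>)" "(U, \<phi>) \<in> A" "(V, \<psi>) \<in> B"
  note pA = pre_manifoldD[OF assms(1) c(2)] and pB = pre_manifoldD[OF assms(2) c(3)]
  from c(1) have X: "X = U \<times> V" "f = map_prod \<phi> \<psi>" by auto
  show ?thesis unfolding X map_prod_image
   using pA(1,2) pB(1,2) by (auto intro: map_prod_inj_on open_Times)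
 qed
next
 fix X f Y h assume 1: "(X, f) \<in> prod_atlas A B" and 2: "(Y, h) \<in> prod_atlas A B"
 show "open (f ` (X \<inter> Y)) \<and> smooth_on (f ` (X \<inter> Y)) (h o cinv X f)"
 proof (rule prod_atlasE[OF 1])
  fix U \<phi> V \<psi> assume c: "(X, f) = (U \<times> V, map_prod \<phi> \<psi>)" "(U, \<phi>) \<in> A" "(V, \<psi>) \<in> B"
  note pA = pre_manifoldD[OF assms(1) c(2)] and pB = pre_manifoldD[OF assms(2) c(3)]
  from c(1) have X: "X = U \<times> V" "f = map_prod \<phi> \<psi>" by auto
  show ?thesis
  proof (rule prod_atlasE[OF 2])
   fix U' \<phi>' V' \<psi>' assume d: "(Y, h) = (U' \<times> V', map_prod \<phi>' \<psi>')" "(U', \<phi>') \<in> A" "(V', \<psi>') \<in> B"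
   from d(1) have Y: "Y = U' \<times> V'" "h = map_prod \<phi>' \<psi>'" by auto
   let ?S = "\<phi> ` (U \<inter> U')" and ?T = "\<psi> ` (V \<inter> V')"
   note o = pA(3)[OF d(2)] pB(3)[OF d(3)]
   have im: "map_prod \<phi> \<psi> ` (U \<times> V \<inter> U' \<times> V') = ?S \<times> ?T"
    unfolding Times_Int_Times map_prod_image ..
   have oS: "open (?S \<times> ?T)" using o by (rule open_Times)
   have "smooth_on (?S \<times> ?T) (\<lambda>p. ((\<phi>' o cinv U \<phi>) (fst p), (\<psi>' o cinv V \<psi>) (snd p)))"
    by (rule smooth_on_Pair[OF oS smooth_on_comp[OF oS o(1) _ smooth_on_linear[OF bounded_linear_fst] pA(4)[OF d(2)]]
       smooth_on_comp[OF oS o(2) _ smooth_on_linear[OF bounded_linear_snd] pB(4)[OF d(3)]]]) auto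
   moreover have "(\<lambda>p. ((\<phi>' o cinv U \<phi>) (fst p), (\<psi>' o cinv V \<psi>) (snd p))) p =
    (map_prod \<phi>' \<psi>' o cinv (U \<times> V) (map_prod \<phi> \<psi>)) p" if "p \<in> ?S \<times> ?T" for p
    using that the_inv_into_map_prod[OF pA(1) pB(1)] by (cases p) auto
   ultimately have "smooth_on (?S \<times> ?T) (map_prod \<phi>' \<psi>' o cinv (U \<times> V) (map_prod \<phi> \<psi>))"
    by (rule smooth_on_eq[OF oS])
   then show ?thesis unfolding X Y im using oS by blast
  qed
 qed
qed

lemma smooth_map_pair:
 assumes "pre_manifold A" "smooth_map A B F" "smooth_map A C H"
 shows "smooth_map A (prod_atlas B C) (\<lambda>p. (F p, H p))"
proof (rule smooth_mapI)
 show "(F p, H p) \<in> points (prod_atlas B C)" if "p \<in> points A" for p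
  using smooth_map_points[OF assms(2) that] smooth_map_points[OF assms(3) that]
  by (auto simp: points_prod_atlas)
next
 fix U \<phi> Y h assume c: "(U, \<phi>) \<in> A" and 2: "(Y, h) \<in> prod_atlas B C"
 show "open (\<phi> ` (U \<inter> (\<lambda>p. (F p, H p)) -` Y)) \<and>
  smooth_on (\<phi> ` (U \<inter> (\<lambda>p. (F p, H p)) -` Y)) (h o (\<lambda>p. (F p, H p)) o cinv U \<phi>)"
 proof (rule prod_atlasE[OF 2])
  fix V \<psi> W \<omega> assume d: "(Y, h) = (V \<times> W, map_prod \<psi> \<omega>)" "(V, \<psi>) \<in> B" "(W, \<omega>) \<in> C"
  from d(1) have Y: "Y = V \<times> W" "h = map_prod \<psi> \<omega>" by auto
  note F = smooth_mapD[OF assms(2) c d(2)] and H = smooth_mapD[OF assms(3) c d(3)]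
  let ?S = "\<phi> ` (U \<inter> (\<lambda>p. (F p, H p)) -` (V \<times> W))"
  have S: "?S = \<phi> ` (U \<inter> F -` V) \<inter> \<phi> ` (U \<inter> H -` W)"
   using pre_manifoldD(1)[OF assms(1) c] by (auto simp: inj_on_def)
  have o: "open ?S" unfolding S using F(1) H(1) by (rule open_Int)
  have "smooth_on ?S (\<lambda>x. ((\<psi> o F o cinv U \<phi>) x, (\<omega> o H o cinv U \<phi>) x))"
   by (rule smooth_on_Pair[OF o smooth_on_subset[OF F(2)] smooth_on_subset[OF H(2)]]) (auto simp: S)
  then show ?thesis using o unfolding Y by (simp add: o_def)
 qed
qed

lemma smooth_map_fst:
 assumes "pre_manifold A" "pre_manifold B"
 shows "smooth_map (prod_atlas A B) A fst"
proof (rule smooth_mapI)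
 show "fst p \<in> points A" if "p \<in> points (prod_atlas A B)" for p
  using that by (auto simp: points_prod_atlas)
next
 fix X f U' \<phi>' assume 1: "(X, f) \<in> prod_atlas A B" and d: "(U', \<phi>') \<in> A"
 show "open (f ` (X \<inter> fst -` U')) \<and> smooth_on (f ` (X \<inter> fst -` U')) (\<phi>' o fst o cinv X f)"
 proof (rule prod_atlasE[OF 1])
  fix U \<phi> V \<psi> assume c: "(X, f) = (U \<times> V, map_prod \<phi> \<psi>)" "(U, \<phi>) \<in> A" "(V, \<psi>) \<in> B"
  from c(1) have X: "X = U \<times> V" "f = map_prod \<phi> \<psi>" by auto
  note pA = pre_manifoldD[OF assms(1) c(2)] and pB = pre_manifoldD[OF assms(2) c(3)]
  let ?S = "\<phi> ` (U \<inter> U')"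
  have e: "U \<times> V \<inter> fst -` U' = (U \<inter> U') \<times> V" by auto
  have o: "open (?S \<times> \<psi> ` V)" using pA(3)[OF d] pB(2) by (rule open_Times)
  have "smooth_on (?S \<times> \<psi> ` V) (\<lambda>p. (\<phi>' o cinv U \<phi>) (fst p))"
   by (rule smooth_on_comp[OF o pA(3)[OF d] _ smooth_on_linear[OF bounded_linear_fst] pA(4)[OF d]]) auto
  moreover have "(\<phi>' o cinv U \<phi>) (fst p) = (\<phi>' o fst o cinv (U \<times> V) (map_prod \<phi> \<psi>)) p"
   if "p \<in> ?S \<times> \<psi> ` V" for p
   using that the_inv_into_map_prod[OF pA(1) pB(1)] by (cases p) auto
  ultimately have "smooth_on (?S \<times> \<psi> ` V) (\<phi>' o fst o cinv (U \<times> V) (map_prod \<phi> \<psi>))"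
   by (rule smooth_on_eq[OF o])
  then show ?thesis unfolding X e map_prod_image using o by blast
 qed
qed

lemma smooth_map_snd:
 assumes "pre_manifold A" "pre_manifold B"
 shows "smooth_map (prod_atlas A B) B snd"
proof (rule smooth_mapI)
 show "snd p \<in> points B" if "p \<in> points (prod_atlas A B)" for p
  using that by (auto simp: points_prod_atlas)
next
 fix X f V' \<psi>' assume 1: "(X, f) \<in> prod_atlas A B" and d: "(V', \<psi>') \<in> B"
 show "open (f ` (X \<inter> snd -` V')) \<and> smooth_on (f ` (X \<inter> snd -` V')) (\<psi>' o snd o cinv X f)"
 proof (rule prod_atlasE[OF 1])
  fix U \<phi> V \<psi> assume c: "(X, f) = (U \<times> V, map_prod \<phi> \<psi>)" "(U, \<phi>) \<in> A" "(V, \<psi>) \<in> B"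
  from c(1) have X: "X = U \<times> V" "f = map_prod \<phi> \<psi>" by auto
  note pA = pre_manifoldD[OF assms(1) c(2)] and pB = pre_manifoldD[OF assms(2) c(3)]
  let ?S = "\<psi> ` (V \<inter> V')"
  have e: "U \<times> V \<inter> snd -` V' = U \<times> (V \<inter> V')" by auto
  have o: "open (\<phi> ` U \<times> ?S)" using pA(2) pB(3)[OF d] by (rule open_Times)
  have "smooth_on (\<phi> ` U \<times> ?S) (\<lambda>p. (\<psi>' o cinv V \<psi>) (snd p))"
   by (rule smooth_on_comp[OF o pB(3)[OF d] _ smooth_on_linear[OF bounded_linear_snd] pB(4)[OF d]]) auto
  moreover have "(\<psi>' o cinv V \<psi>) (snd p) = (\<psi>' o snd o cinv (U \<times> V) (map_prod \<phi> \<psi>)) p"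
   if "p \<in> \<phi> ` U \<times> ?S" for p
   using that the_inv_into_map_prod[OF pA(1) pB(1)] by (cases p) auto
  ultimately have "smooth_on (\<phi> ` U \<times> ?S) (\<psi>' o snd o cinv (U \<times> V) (map_prod \<phi> \<psi>))"
   by (rule smooth_on_eq[OF o])
  then show ?thesis unfolding X e map_prod_image using o by blast
 qed
qed

subsection \<open>Cutting off\<close>

lemma smooth_manifold_Hausdorff: "smooth_manifold A ==> Hausdorff_space (mtop A)"
 by (simp add: smooth_manifold_def)

lemma openin_points_Diff:
 assumes "pre_manifold A" "closedin (mtop A) C"
 shows "openin (mtop A) (points A - C)"
 using assms(2) topspace_mtop[OF assms(1)] by (metis closedin_def)

text \<open>Off the closed set \<open>C\<close> the product is locally zero, so the values of
  \<open>f\<close> outside \<open>X\<close> do not matter.\<close>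

lemma smooth_fun_cutoff:
 assumes A: "pre_manifold A" and X: "openin (mtop A) X" "smooth_fun_on A X f" and b: "smooth_fun A b"
  and C: "closedin (mtop A) C" "C \<subseteq> X" "\<And>q. q \<notin> C ==> b q = 0"
 shows "smooth_fun A (\<lambda>q. b q * f q)"
 unfolding smooth_fun_iff_on
proof (rule smooth_fun_on_local[OF A])
 fix q assume q: "q \<in> points A"
 show "\<exists>Y. openin (mtop A) Y \<and> q \<in> Y \<and> smooth_fun_on A Y (\<lambda>q. b q * f q)"
 proof (cases "q \<in> X")
  case True
  have "smooth_fun_on A X (\<lambda>q. b q * f q)"
   by (rule smooth_fun_on_mult[OF A X(1) smooth_fun_imp_on[OF b] X(2)])
  with True X(1) show ?thesis by blast
 next
  case False
  note o = openin_points_Diff[OF A C(1)]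
  have "smooth_fun_on A (points A - C) (\<lambda>q. b q * f q) \<longleftrightarrow> smooth_fun_on A (points A - C) (\<lambda>q. 0)"
   by (rule smooth_fun_on_cong[OF A o]) (use C(3) in auto)
  then have "smooth_fun_on A (points A - C) (\<lambda>q. b q * f q)" by (simp add: smooth_fun_on_const)
  with False q C(2) o show ?thesis by blast
 qed
qed

text \<open>A Euclidean bump transported through a chart. Its carrier \<open>C\<close> is compact,
  and the Hausdorff property makes it closed in the whole manifold, on which the extension by 0
  rests. Compactness of \<open>C\<close> later bounds derivatives in
  \<open>cc_estimate\<close>.\<close>

lemma manifold_bump:
 assumes M: "smooth_manifold A" and X: "openin (mtop A) X" "p \<in> X"
 obtains b C Y where "smooth_fun A b" "\<And>q. 0 \<le> b q" "\<And>q. b q \<le> 1"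
  "openin (mtop A) Y" "p \<in> Y" "Y \<subseteq> C" "\<And>q. q \<in> Y ==> b q = 1"
  "compactin (mtop A) C" "closedin (mtop A) C" "C \<subseteq> X" "\<And>q. q \<notin> C ==> b q = 0"
proof -
 note A = smooth_manifold_pre[OF M]
 have "p \<in> points A" using X openin_subset topspace_mtop[OF A] by blast
 then obtain U \<phi> where c: "(U, \<phi>) \<in> A" "p \<in> U" by (rule pointsE)
 note i = chart_inv[OF pre_manifoldD(1)[OF A c(1)]]
 let ?S = "\<phi> ` (U \<inter> X)" and ?i = "cinv U \<phi>"
 have S: "open ?S" "\<phi> p \<in> ?S" using openin_mtopD[OF A X(1) c(1)] c(2) X(2) by auto
 then obtain e where e: "e > 0" "cball (\<phi> p) e \<subseteq> ?S" using open_contains_cball by metis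
 \<comment> \<open>A third, because the bump is only known to vanish outside radius 2 r, and the
   ball of that radius has to fit strictly inside the one of radius e.\<close>
 define r where "r = e / 3"
 have r: "r > 0" "2 * r < e" using e by (auto simp: r_def)
 obtain \<beta> :: "'b => real" where \<beta>: "smooth_on UNIV \<beta>" "\<forall>x. 0 \<le> \<beta> x" "\<forall>x. \<beta> x \<le> 1"
  "\<forall>x\<in>ball (\<phi> p) r. \<beta> x = 1" "\<forall>x. x \<notin> cball (\<phi> p) (2 * r) --> \<beta> x = 0"
  using euclidean_bump[OF r(1), of "\<phi> p"] by (elim exE conjE)
 have cb: "cball (\<phi> p) (2 * r) \<subseteq> ball (\<phi> p) e" "ball (\<phi> p) e \<subseteq> cball (\<phi> p) e" "ball (\<phi> p) e \<subseteq> \<phi> ` U"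
 proof -
  show 1: "cball (\<phi> p) (2 * r) \<subseteq> ball (\<phi> p) e" "ball (\<phi> p) e \<subseteq> cball (\<phi> p) e"
   using r by auto
  show "ball (\<phi> p) e \<subseteq> \<phi> ` U" using 1(2) e(2) by blast
 qed
 define C where "C = ?i ` cball (\<phi> p) (2 * r)"
 define b where "b q = (if q \<in> U then \<beta> (\<phi> q) else 0)" for q
 have CX: "C \<subseteq> U \<inter> X"
 proof
  fix q assume "q \<in> C"
  then obtain x where x: "q = ?i x" "x \<in> cball (\<phi> p) (2 * r)" by (auto simp: C_def simp del: mem_cball)
  then obtain z where "x = \<phi> z" "z \<in> U" "z \<in> X" using cb e(2) by blast
  then show "q \<in> U \<inter> X" using i(1) x(1) by simp
 qed
 have b0: "b q = 0" if "q \<notin> C" for q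
 proof (cases "q \<in> U")
  case True
  have "\<phi> q \<notin> cball (\<phi> p) (2 * r)"
   using that i(1)[OF True] unfolding C_def by (metis imageI)
  then show ?thesis using \<beta>(5) by (simp add: b_def)
 qed (simp add: b_def)
 have comp: "compactin (mtop A) C"
  unfolding C_def
 proof (rule image_compactin[OF _ continuous_map_chart_inv[OF A c(1)]])
  show "compactin (top_of_set (\<phi> ` U)) (cball (\<phi> p) (2 * r))"
   using cb by (auto simp: compactin_subtopology)
 qed
 have cl: "closedin (mtop A) C"
  by (rule compactin_imp_closedin[OF smooth_manifold_Hausdorff[OF M] comp])
 let ?B = "U \<inter> \<phi> -` ball (\<phi> p) e"
 have B: "openin (mtop A) ?B" by (rule openin_chart_vimage[OF A c(1) open_ball])
 have smB: "smooth_fun_on A ?B b"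
 proof -
  have "smooth_fun_on A ?B (\<beta> o \<phi>)"
   by (rule smooth_fun_on_chart[OF A c(1) open_ball cb(3) smooth_on_subset[OF \<beta>(1)]]) simp
  moreover have "smooth_fun_on A ?B (\<beta> o \<phi>) \<longleftrightarrow> smooth_fun_on A ?B b"
   by (rule smooth_fun_on_cong[OF A B]) (simp add: b_def)
  ultimately show ?thesis by simp
 qed
 have sm: "smooth_fun A b"
  unfolding smooth_fun_iff_on
 proof (rule smooth_fun_on_local[OF A])
  fix q assume q: "q \<in> points A"
  show "\<exists>Y. openin (mtop A) Y \<and> q \<in> Y \<and> smooth_fun_on A Y b"
  proof (cases "q \<in> C")
   case True
   then have "q \<in> ?B" using CX cb(1) i(3) cb(3) unfolding C_def
    by (auto simp del: mem_ball mem_cball) (metis i(3) subsetD)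
   then show ?thesis using B smB by blast
  next
   case False
   note o = openin_points_Diff[OF A cl]
   have "smooth_fun_on A (points A - C) b \<longleftrightarrow> smooth_fun_on A (points A - C) (\<lambda>q. 0)"
    by (rule smooth_fun_on_cong[OF A o]) (use b0 in auto)
   then have "smooth_fun_on A (points A - C) b" by (simp add: smooth_fun_on_const)
   with False q o show ?thesis by blast
  qed
 qed
 let ?Y = "U \<inter> \<phi> -` ball (\<phi> p) r"
 show ?thesis
 proof (rule that[OF sm _ _ openin_chart_vimage[OF A c(1) open_ball, of "\<phi> p" r] _ _ _ comp cl _ b0])
  show "0 \<le> b q" "b q \<le> 1" for q using \<beta>(2,3) by (auto simp: b_def)
  show "p \<in> ?Y" using c(2) r(1) by simp
  show "?Y \<subseteq> C"
  proof
   fix q assume q: "q \<in> ?Y"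
   then have "\<phi> q \<in> cball (\<phi> p) (2 * r)" using r(1) by (simp add: dist_commute)
   moreover have "q = ?i (\<phi> q)" using q i(1) by simp
   ultimately show "q \<in> C" unfolding C_def by (rule rev_image_eqI)
  qed
  show "b q = 1" if "q \<in> ?Y" for q using that \<beta>(4) by (simp add: b_def)
  show "C \<subseteq> X" using CX by blast
 qed
qed

lemma smooth_fun_local_extension:
 assumes M: "smooth_manifold A" and X: "openin (mtop A) X" "p \<in> X" "smooth_fun_on A X f"
 obtains h Y where "smooth_fun A h" "openin (mtop A) Y" "p \<in> Y" "Y \<subseteq> X" "\<And>q. q \<in> Y ==> h q = f q"
proof (rule manifold_bump[OF M X(1,2)])
 fix b C Y
 assume b: "smooth_fun A b" "openin (mtop A) Y" "p \<in> Y" "Y \<subseteq> C" "\<And>q. q \<in> Y ==> b q = 1"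
  "closedin (mtop A) C" "C \<subseteq> X" "\<And>q. q \<notin> C ==> b q = 0"
 show ?thesis
  by (rule that[OF smooth_fun_cutoff[OF smooth_manifold_pre[OF M] X(1,3) b(1,6,7,8)] b(2,3)])
   (use b(4,5,7) in auto)
qed

text \<open>Bump functions show that the smooth functions generate the topology: positivity of a
  bump is an open condition that implies membership in \<open>Y\<close>.\<close>

lemma continuous_map_by_smooth_functions:
 assumes M: "smooth_manifold B" and F: "\<And>x. x \<in> topspace X ==> F x \<in> points B"
  and cont: "\<And>f. smooth_fun B f ==> continuous_map X euclideanreal (\<lambda>x. f (F x))"
 shows "continuous_map X (mtop B) F"
 unfolding continuous_map_def topspace_mtop[OF smooth_manifold_pre[OF M]]
proof (intro conjI allI impI)
 show "F \<in> topspace X \<rightarrow> points B" using F by auto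
 fix Y assume Y: "openin (mtop B) Y"
 show "openin X {x \<in> topspace X. F x \<in> Y}"
 proof (subst openin_subopen, intro ballI)
  fix x assume x: "x \<in> {x \<in> topspace X. F x \<in> Y}"
  then have "F x \<in> Y" by simp
  show "\<exists>T. openin X T \<and> x \<in> T \<and> T \<subseteq> {x \<in> topspace X. F x \<in> Y}"
  proof (rule manifold_bump[OF M Y \<open>F x \<in> Y\<close>])
   fix b C Z
   assume b: "smooth_fun B b" "F x \<in> Z" "\<And>q. q \<in> Z ==> b q = 1" "C \<subseteq> Y" "\<And>q. q \<notin> C ==> b q = 0"
   have "openin X {y \<in> topspace X. b (F y) \<in> {0<..}}"
    using cont[OF b(1)] by (rule openin_continuous_map_preimage) (simp flip: open_openin)
   moreover have "x \<in> {y \<in> topspace X. b (F y) \<in> {0<..}}" using x b(3)[OF b(2)] by simp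
   moreover have "{y \<in> topspace X. b (F y) \<in> {0<..}} \<subseteq> {x \<in> topspace X. F x \<in> Y}"
    using b(4,5) by force
   ultimately show ?thesis by blast
  qed
 qed
qed

section \<open>Tangent vectors\<close>

lemma tangentD:
 assumes "v \<in> tangent_space A p"
 shows "\<not> smooth_fun A f ==> v f = 0"
  "smooth_fun A f ==> smooth_fun A h ==> v (\<lambda>q. f q + h q) = v f + v h"
  "smooth_fun A f ==> v (\<lambda>q. r * f q) = r * v f"
  "smooth_fun A f ==> smooth_fun A h ==> v (\<lambda>q. f q * h q) = v f * h p + f p * v h"
 using assms unfolding tangent_space_def by auto

lemma tangentI:
 assumes "\<And>f. \<not> smooth_fun A f ==> v f = 0"
  "\<And>f h. smooth_fun A f ==> smooth_fun A h ==> v (\<lambda>q. f q + h q) = v f + v h"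
  "\<And>f r. smooth_fun A f ==> v (\<lambda>q. r * f q) = r * v f"
  "\<And>f h. smooth_fun A f ==> smooth_fun A h ==> v (\<lambda>q. f q * h q) = v f * h p + f p * v h"
 shows "v \<in> tangent_space A p"
 using assms unfolding tangent_space_def by blast

lemma tangent_const:
 assumes "v \<in> tangent_space A p"
 shows "v (\<lambda>_. c) = 0"
proof -
 have "v (\<lambda>_. 1) = 0"
  using tangentD(4)[OF assms smooth_fun_const smooth_fun_const, of 1 1] by simp
 then show ?thesis using tangentD(3)[OF assms smooth_fun_const, of c 1] by simp
qed

lemma tangent_sum:
 assumes "v \<in> tangent_space A p" "pre_manifold A" "\<And>i. i \<in> I ==> smooth_fun A (f i)"
 shows "v (\<lambda>q. \<Sum>i\<in>I. f i q) = (\<Sum>i\<in>I. v (f i))"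
 using assms(3)
proof (induction I rule: infinite_finite_induct)
 case (insert i I)
 have "v (\<lambda>q. f i q + (\<Sum>i\<in>I. f i q)) = v (f i) + v (\<lambda>q. \<Sum>i\<in>I. f i q)"
  by (rule tangentD(2)[OF assms(1)]) (use insert.prems in \<open>auto intro!: smooth_fun_sum[OF assms(2)]\<close>)
 then show ?case using insert by simp
qed (simp_all add: tangent_const[OF assms(1)])

lemma tangent_diff:
 assumes "v \<in> tangent_space A p" "pre_manifold A" "smooth_fun A f" "smooth_fun A h"
 shows "v (\<lambda>q. f q - h q) = v f - v h"
 using tangentD(2)[OF assms(1,3) smooth_fun_mult[OF assms(2) smooth_fun_const assms(4)], of "-1"]
  tangentD(3)[OF assms(1,4), of "-1"] by simp

text \<open>A derivation sees only germs. With k = f - h the product k b is identically 0, and the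
  product rule at p, where k is 0 and the bump b is 1, returns v k.\<close>

lemma tangent_local:
 assumes M: "smooth_manifold A" and v: "v \<in> tangent_space A p" and f: "smooth_fun A f" "smooth_fun A h"
  and X: "openin (mtop A) X" "p \<in> X" "\<And>q. q \<in> X ==> f q = h q"
 shows "v f = v h"
proof (rule manifold_bump[OF M X(1,2)])
 note A = smooth_manifold_pre[OF M]
 fix b C Y
 assume b: "smooth_fun A b" "p \<in> Y" "\<And>q. q \<in> Y ==> b q = 1" "C \<subseteq> X" "\<And>q. q \<notin> C ==> b q = 0"
 define k where "k q = f q - h q" for q
 have k: "smooth_fun A k" unfolding k_def[abs_def] by (rule smooth_fun_diff[OF A f])
 have "k q * b q = 0" for q
 proof (cases "q \<in> C")
  case True
  then show ?thesis using b(4) X(3)[of q] by (auto simp: k_def)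
 next
  case False
  then show ?thesis using b(5) by simp
 qed
 then have "(\<lambda>q. k q * b q) = (\<lambda>_. 0)" by (rule ext)
 then have "v (\<lambda>q. k q * b q) = 0" using tangent_const[OF v, of 0] by simp
 moreover have "k p = 0" using X(2,3) by (simp add: k_def)
 moreover have "b p = 1" using b(2,3) by simp
 ultimately have "v k = 0" using tangentD(4)[OF v k b(1)] by simp
 then show ?thesis using tangent_diff[OF v A f] by (simp add: k_def[abs_def])
qed

text \<open>Tangent vectors act on total functions; this frees them from values away from the
  manifold, also when the functions are not smooth and both sides are 0 by convention.\<close>

lemma tangent_cong:
 assumes M: "smooth_manifold A" and v: "v \<in> tangent_space A p" and p: "p \<in> points A"
  and eq: "\<And>q. q \<in> points A ==> f q = h q"
 shows "v f = v h"
proof (cases "smooth_fun A f")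
 note A = smooth_manifold_pre[OF M]
 case True
 then have "smooth_fun A h" using smooth_fun_cong[OF A eq] by simp
 from tangent_local[OF M v True this openin_points[OF A] p eq] show ?thesis .
next
 note A = smooth_manifold_pre[OF M]
 case False
 then have "\<not> smooth_fun A h" using smooth_fun_cong[OF A eq] by simp
 then show ?thesis using tangentD(1)[OF v] False by simp
qed

lemma push_forward_tangent:
 assumes A: "pre_manifold A" "pre_manifold B" and F: "smooth_map A B F" and v: "v \<in> tangent_space A p"
 shows "push_forward B F v \<in> tangent_space B (F p)"
proof (rule tangentI)
 note s = smooth_map_fun[OF A F]
 show "push_forward B F v (\<lambda>q. f q + h q) = push_forward B F v f + push_forward B F v h"
  if "smooth_fun B f" "smooth_fun B h" for f h
  using that smooth_fun_add[OF A(2) that] tangentD(2)[OF v s s, of f h]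
  by (simp add: push_forward_def o_def)
 show "push_forward B F v (\<lambda>q. r * f q) = r * push_forward B F v f"
  if "smooth_fun B f" for f r
  using that smooth_fun_mult[OF A(2) smooth_fun_const that, of r] tangentD(3)[OF v s, of f r]
  by (simp add: push_forward_def o_def)
 show "push_forward B F v (\<lambda>q. f q * h q) = push_forward B F v f * h (F p) + f (F p) * push_forward B F v h"
  if "smooth_fun B f" "smooth_fun B h" for f h
  using that smooth_fun_mult[OF A(2) that] tangentD(4)[OF v s s, of f h]
  by (simp add: push_forward_def o_def)
qed (simp add: push_forward_def)

definition chart_vec :: "('p, 'e::euclidean_space) atlas => 'p set => ('p => 'e) => 'p => 'e => 'p tvec" where
 "chart_vec A U \<phi> p \<xi> =
  (\<lambda>f. if smooth_fun A f then fderiv (f o cinv U \<phi>) (\<phi> p) \<xi> else 0)"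

lemma smooth_fun_chart_derivative:
 assumes "smooth_fun A f" "(U, \<phi>) \<in> A" "p \<in> U"
 shows "((f o cinv U \<phi>) has_derivative fderiv (f o cinv U \<phi>) (\<phi> p)) (at (\<phi> p))"
proof (rule smooth_on_has_derivative)
 show "smooth_on (\<phi> ` U) (f o cinv U \<phi>)" using assms(1,2) by (auto simp: smooth_fun_def)
qed (use assms(3) in auto)

lemma chart_vec_tangent:
 assumes A: "pre_manifold A" and c: "(U, \<phi>) \<in> A" "p \<in> U"
 shows "chart_vec A U \<phi> p \<xi> \<in> tangent_space A p"
proof (rule tangentI)
 let ?i = "cinv U \<phi>"
 note d = smooth_fun_chart_derivative[OF _ c]
 have ip: "?i (\<phi> p) = p" using chart_inv(1)[OF pre_manifoldD(1)[OF A c(1)] c(2)] .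
 show "chart_vec A U \<phi> p \<xi> f = 0" if "\<not> smooth_fun A f" for f using that by (simp add: chart_vec_def)
 show "chart_vec A U \<phi> p \<xi> (\<lambda>q. f q + h q) = chart_vec A U \<phi> p \<xi> f + chart_vec A U \<phi> p \<xi> h"
  if "smooth_fun A f" "smooth_fun A h" for f h
 proof -
  have "((\<lambda>q. f q + h q) o ?i) = (\<lambda>x. (f o ?i) x + (h o ?i) x)" by auto
  then show ?thesis
   using frechet_derivative_eqI[OF has_derivative_add[OF d[OF that(1)] d[OF that(2)]]] that smooth_fun_add[OF A that]
   by (simp add: chart_vec_def)
 qed
 show "chart_vec A U \<phi> p \<xi> (\<lambda>q. r * f q) = r * chart_vec A U \<phi> p \<xi> f"
  if "smooth_fun A f" for f r
 proof -
  have "((\<lambda>q. r * f q) o ?i) = (\<lambda>x. r * (f o ?i) x)" by auto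
  then show ?thesis
   using frechet_derivative_eqI[OF has_derivative_mult_right[OF d[OF that]], of r] that
    smooth_fun_mult[OF A smooth_fun_const that, of r]
   by (simp add: chart_vec_def)
 qed
 show "chart_vec A U \<phi> p \<xi> (\<lambda>q. f q * h q) = chart_vec A U \<phi> p \<xi> f * h p + f p * chart_vec A U \<phi> p \<xi> h"
  if "smooth_fun A f" "smooth_fun A h" for f h
 proof -
  have "((\<lambda>q. f q * h q) o ?i) = (\<lambda>x. (f o ?i) x * (h o ?i) x)" by auto
  then show ?thesis
   using frechet_derivative_eqI[OF has_derivative_mult[OF d[OF that(1)] d[OF that(2)]]] that smooth_fun_mult[OF A that]
   by (simp add: chart_vec_def ip)
 qed
qed

text \<open>Hadamard's lemma shows that a derivation at p only depends on the first derivatives at p.\<close>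

lemma tangent_chart_vec:
 assumes M: "smooth_manifold A" and v: "v \<in> tangent_space A p" and c: "(U, \<phi>) \<in> A" "p \<in> U"
 obtains \<xi> where "v = chart_vec A U \<phi> p \<xi>"
proof -
 note A = smooth_manifold_pre[OF M]
 note i = chart_inv[OF pre_manifoldD(1)[OF A c(1)]]
 let ?i = "cinv U \<phi>"
 obtain r where r: "r > 0" "ball (\<phi> p) r \<subseteq> \<phi> ` U"
  using pre_manifoldD(2)[OF A c(1)] c(2) open_contains_ball by (metis image_eqI)
 let ?X = "U \<inter> \<phi> -` ball (\<phi> p) r"
 have X: "openin (mtop A) ?X" "p \<in> ?X"
  using openin_chart_vimage[OF A c(1) open_ball] c(2) r(1) by auto
 show ?thesis
 proof (rule manifold_bump[OF M X])
  fix b C Y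
  assume b: "smooth_fun A b" "openin (mtop A) Y" "p \<in> Y" "Y \<subseteq> C" "\<And>q. q \<in> Y ==> b q = 1"
   "closedin (mtop A) C" "C \<subseteq> ?X" "\<And>q. q \<notin> C ==> b q = 0"
  have ext: "smooth_fun A (\<lambda>q. b q * (h o \<phi>) q)" if "smooth_on (ball (\<phi> p) r) h" for h
   by (rule smooth_fun_cutoff[OF A X(1) smooth_fun_on_chart[OF A c(1) open_ball r(2) that] b(1,6,7,8)])
  define x where "x e q = b q * (((\<lambda>y. (y - \<phi> p) \<bullet> e) o \<phi>) q)" for e q
  have x: "smooth_fun A (x e)" for e
   unfolding x_def[abs_def]
  proof (rule ext)
   have "smooth_on (ball (\<phi> p) r) (\<lambda>y. y \<bullet> e + - (\<phi> p \<bullet> e))"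
    by (rule smooth_on_add[OF open_ball smooth_on_linear[OF bounded_linear_inner_left] smooth_on_const])
   then show "smooth_on (ball (\<phi> p) r) (\<lambda>y. (y - \<phi> p) \<bullet> e)" by (simp add: inner_diff_left)
  qed
  define \<xi> where "\<xi> = (\<Sum>e\<in>Basis. v (x e) *\<^sub>R e)"
  have "v f = chart_vec A U \<phi> p \<xi> f" for f
  proof (cases "smooth_fun A f")
   case f: True
   let ?F = "f o ?i"
   have "smooth_on (ball (\<phi> p) r) ?F"
    using f c(1) smooth_on_subset[OF _ r(2)] by (auto simp: smooth_fun_def)
   then show ?thesis
   proof (rule Hadamard)
    fix G assume G: "\<And>e. smooth_on (ball (\<phi> p) r) (G e)"
     "\<And>e. G e (\<phi> p) = fderiv ?F (\<phi> p) e"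
     "\<And>y. y \<in> ball (\<phi> p) r ==> ?F y = ?F (\<phi> p) + (\<Sum>e\<in>Basis. ((y - \<phi> p) \<bullet> e) * G e y)"
    define g where "g e q = b q * (G e o \<phi>) q" for e q
    have g: "smooth_fun A (g e)" for e unfolding g_def[abs_def] by (rule ext[OF G(1)])
    have xg: "smooth_fun A (\<lambda>q. x e q * g e q)" for e by (rule smooth_fun_mult[OF A x g])
    have sm: "smooth_fun A (\<lambda>q. \<Sum>e\<in>Basis. x e q * g e q)" by (rule smooth_fun_sum[OF A xg])
    have x0: "x e p = 0" for e by (simp add: x_def)
    have "v f = v (\<lambda>q. f p + (\<Sum>e\<in>Basis. x e q * g e q))"
    proof (rule tangent_local[OF M v f smooth_fun_add[OF A smooth_fun_const sm] b(2,3)])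
     fix q assume q: "q \<in> Y"
     then have "q \<in> ?X" using b(4,7) by blast
     then have q': "q \<in> U" "\<phi> q \<in> ball (\<phi> p) r" by auto
     show "f q = f p + (\<Sum>e\<in>Basis. x e q * g e q)"
      using G(3)[OF q'(2)] i(1)[OF q'(1)] i(1)[OF c(2)] b(5)[OF q] by (simp add: x_def g_def)
    qed
    also have "\<dots> = (\<Sum>e\<in>Basis. v (\<lambda>q. x e q * g e q))"
     using tangentD(2)[OF v smooth_fun_const sm, of "f p"] tangent_const[OF v] tangent_sum[OF v A xg] by simp
    also have "\<dots> = (\<Sum>e\<in>Basis. v (x e) * fderiv ?F (\<phi> p) e)"
     using tangentD(4)[OF v x g] x0 b(3,5) by (simp add: g_def G(2))
    also have "\<dots> = fderiv ?F (\<phi> p) \<xi>"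
     using has_derivative_linear[OF smooth_fun_chart_derivative[OF f c]]
     by (simp add: \<xi>_def linear_sum linear_scale)
    finally show ?thesis using f by (simp add: chart_vec_def)
   qed
  qed (simp add: chart_vec_def tangentD(1)[OF v])
  then show ?thesis using that by blast
 qed
qed

text \<open>A chart has meaningful values on its domain only. Cut off, its components become global
  smooth functions, on which derivations can act.\<close>

lemma chart_coordinates:
 fixes A :: "('p, 'e::euclidean_space) atlas"
 assumes M: "smooth_manifold A" and p: "p \<in> points A"
 obtains U \<phi> Z X where "(U, \<phi>) \<in> A" "openin (mtop A) Z" "p \<in> Z" "Z \<subseteq> U"
  "\<And>q. q \<in> Z ==> X q = \<phi> q" "\<And>w. smooth_fun A (\<lambda>q. X q \<bullet> w)"
proof -
 note A = smooth_manifold_pre[OF M]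
 obtain U \<phi> where U: "(U, \<phi>) \<in> A" "p \<in> U" using p by (rule pointsE)
 have "\<exists>h Y. smooth_fun A h \<and> openin (mtop A) Y \<and> p \<in> Y \<and> Y \<subseteq> U \<and> (\<forall>q\<in>Y. h q = \<phi> q \<bullet> b)" for b
 proof -
  have "smooth_fun_on A (U \<inter> \<phi> -` (\<phi> ` U)) ((\<lambda>x. x \<bullet> b) o \<phi>)"
   by (rule smooth_fun_on_chart[OF A U(1) pre_manifoldD(2)[OF A U(1)] order_refl])
    (rule smooth_on_linear, rule bounded_linear_inner_left)
  moreover have "U \<inter> \<phi> -` (\<phi> ` U) = U" by auto
  ultimately have "smooth_fun_on A U (\<lambda>q. \<phi> q \<bullet> b)" by (simp add: o_def)
  from smooth_fun_local_extension[OF M openin_chart[OF A U(1)] U(2) this] show ?thesis by metis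
 qed
 then obtain h Y where h: "\<And>b. smooth_fun A (h b)" "\<And>b. openin (mtop A) (Y b)" "\<And>b. p \<in> Y b"
  "\<And>b. Y b \<subseteq> U" "\<And>b q. q \<in> Y b ==> h b q = \<phi> q \<bullet> b" by metis
 define Z where "Z = (\<Inter>b\<in>Basis. Y b)"
 define X where "X q = (\<Sum>b\<in>Basis. h b q *\<^sub>R b)" for q
 show ?thesis
 proof (rule that[OF U(1)])
  show "openin (mtop A) Z" unfolding Z_def using h(2) by (intro openin_Inter) auto
  show "p \<in> Z" unfolding Z_def using h(3) by blast
  obtain b :: 'e where "b \<in> Basis" using nonempty_Basis by blast
  then show "Z \<subseteq> U" using h(4)[of b] by (auto simp: Z_def)
  show "X q = \<phi> q" if "q \<in> Z" for q
  proof -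
   have "X q = (\<Sum>b\<in>Basis. (\<phi> q \<bullet> b) *\<^sub>R b)"
    unfolding X_def by (rule sum.cong) (use h(5) that in \<open>auto simp: Z_def\<close>)
   then show ?thesis by (simp add: euclidean_representation)
  qed
  show "smooth_fun A (\<lambda>q. X q \<bullet> w)" for w
   unfolding X_def inner_sum_left inner_scaleR_left
   by (rule smooth_fun_sum[OF A]) (rule smooth_fun_mult[OF A h(1) smooth_fun_const])
 qed
qed

lemma chart_vec_coordinate:
 assumes A: "pre_manifold A" and c: "(U, \<phi>) \<in> A" and Z: "openin (mtop A) Z" "p \<in> Z" "Z \<subseteq> U"
  and X: "\<And>q. q \<in> Z ==> X q = \<phi> q" "smooth_fun A (\<lambda>q. X q \<bullet> w)"
 shows "chart_vec A U \<phi> p \<xi> (\<lambda>q. X q \<bullet> w) = \<xi> \<bullet> w"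
proof -
 let ?S = "\<phi> ` (U \<inter> Z)"
 have S: "open ?S" "\<phi> p \<in> ?S" using openin_mtopD[OF A Z(1) c] Z by auto
 have "fderiv ((\<lambda>q. X q \<bullet> w) o cinv U \<phi>) (\<phi> p) = fderiv (\<lambda>x. x \<bullet> w) (\<phi> p)"
  by (rule frechet_derivative_cong_open(2)[OF S]) (use X(1) chart_inv(1)[OF pre_manifoldD(1)[OF A c]] in auto)
 also have "\<dots> = (\<lambda>x. x \<bullet> w)" by (rule frechet_derivative_eqI) (auto intro!: derivative_eq_intros)
 finally show ?thesis unfolding chart_vec_def using X(2) by simp
qed

subsection \<open>Partial derivatives on a product\<close>

lemma smooth_fun_slice1:
 assumes "pre_manifold A" "pre_manifold B" "smooth_fun (prod_atlas A B) u" "q \<in> points B"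
 shows "smooth_fun A (\<lambda>y. u (y, q))"
 using smooth_map_fun[OF assms(1) pre_manifold_prod[OF assms(1,2)]
   smooth_map_pair[OF assms(1) smooth_map_id[OF assms(1)] smooth_map_const[OF assms(1,4)]] assms(3)]
 by (simp add: o_def)

lemma smooth_fun_slice2:
 assumes "pre_manifold A" "pre_manifold B" "smooth_fun (prod_atlas A B) u" "p \<in> points A"
 shows "smooth_fun B (\<lambda>q. u (p, q))"
 using smooth_map_fun[OF assms(2) pre_manifold_prod[OF assms(1,2)]
   smooth_map_pair[OF assms(2) smooth_map_const[OF assms(2,4)] smooth_map_id[OF assms(2)]] assms(3)]
 by (simp add: o_def)

lemma has_derivative_slices:
 assumes "(w has_derivative w') (at (x, y))"
 shows "((\<lambda>x. w (x, y)) has_derivative (\<lambda>\<xi>. w' (\<xi>, 0))) (at x)"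
  and "((\<lambda>y. w (x, y)) has_derivative (\<lambda>\<eta>. w' (0, \<eta>))) (at y)"
proof -
 have "((\<lambda>x. (x, y)) has_derivative (\<lambda>\<xi>. (\<xi>, 0))) (at x)"
  by (auto intro!: derivative_eq_intros)
 from has_derivative_compose[OF this assms] show "((\<lambda>x. w (x, y)) has_derivative (\<lambda>\<xi>. w' (\<xi>, 0))) (at x)" .
 have "((\<lambda>y. (x, y)) has_derivative (\<lambda>\<eta>. (0, \<eta>))) (at y)"
  by (auto intro!: derivative_eq_intros)
 from has_derivative_compose[OF this assms] show "((\<lambda>y. w (x, y)) has_derivative (\<lambda>\<eta>. w' (0, \<eta>))) (at y)" .
qed

text \<open>In charts, tangent vectors of either factor act as directional derivatives of one and
  the same function \<open>w\<close>. Smooth dependence on the other factor and commutation of the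
  two actions become statements about \<open>w\<close>.\<close>

lemma tangent_partial_charts:
 assumes A: "pre_manifold A" "pre_manifold B" and u: "smooth_fun (prod_atlas A B) u"
  and c: "(U, \<phi>) \<in> A" and d: "(V, \<psi>) \<in> B"
 obtains w where "smooth_on (\<phi> ` U \<times> \<psi> ` V) w"
  "\<And>p y \<xi>. p \<in> U ==> y \<in> \<psi> ` V ==>
   chart_vec A U \<phi> p \<xi> (\<lambda>p'. u (p', cinv V \<psi> y)) = fderiv w (\<phi> p, y) (\<xi>, 0)"
  "\<And>q x \<eta>. q \<in> V ==> x \<in> \<phi> ` U ==>
   chart_vec B V \<psi> q \<eta> (\<lambda>q'. u (cinv U \<phi> x, q')) = fderiv w (x, \<psi> q) (0, \<eta>)"
proof -
 note pA = pre_manifoldD[OF A(1) c] and pB = pre_manifoldD[OF A(2) d]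
 note iA = chart_inv[OF pA(1)] and iB = chart_inv[OF pB(1)]
 define w where "w = u o cinv (U \<times> V) (map_prod \<phi> \<psi>)"
 have w: "smooth_on (\<phi> ` U \<times> \<psi> ` V) w"
  using u prod_atlasI[OF c d] unfolding smooth_fun_def w_def map_prod_image[symmetric] by blast
 have weq: "w (x, y) = u (cinv U \<phi> x, cinv V \<psi> y)" if "x \<in> \<phi> ` U" "y \<in> \<psi> ` V" for x y
  using the_inv_into_map_prod[OF pA(1) pB(1) that] by (simp add: w_def)
 have 1: "chart_vec A U \<phi> p \<xi> (\<lambda>p'. u (p', cinv V \<psi> y)) = fderiv w (\<phi> p, y) (\<xi>, 0)"
  if "p \<in> U" "y \<in> \<psi> ` V" for p y \<xi>
 proof -
  have "(w has_derivative fderiv w (\<phi> p, y)) (at (\<phi> p, y))"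
   using smooth_on_has_derivative[OF w] that by auto
  from frechet_derivative_eqI[OF has_derivative_slices(1)[OF this]]
  have "fderiv (\<lambda>x. w (x, y)) (\<phi> p) = (\<lambda>\<xi>. fderiv w (\<phi> p, y) (\<xi>, 0))" .
  moreover have "fderiv ((\<lambda>p'. u (p', cinv V \<psi> y)) o cinv U \<phi>) (\<phi> p) =
    fderiv (\<lambda>x. w (x, y)) (\<phi> p)"
   by (rule frechet_derivative_cong_open(2)[OF pA(2)]) (use that weq in auto)
  moreover have "smooth_fun A (\<lambda>p'. u (p', cinv V \<psi> y))"
   by (rule smooth_fun_slice1[OF A u pointsI[OF d iB(2)[OF that(2)]]])
  ultimately show ?thesis by (simp add: chart_vec_def)
 qed
 have 2: "chart_vec B V \<psi> q \<eta> (\<lambda>q'. u (cinv U \<phi> x, q')) = fderiv w (x, \<psi> q) (0, \<eta>)"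
  if "q \<in> V" "x \<in> \<phi> ` U" for q x \<eta>
 proof -
  have "(w has_derivative fderiv w (x, \<psi> q)) (at (x, \<psi> q))"
   using smooth_on_has_derivative[OF w] that by auto
  from frechet_derivative_eqI[OF has_derivative_slices(2)[OF this]]
  have "fderiv (\<lambda>y. w (x, y)) (\<psi> q) = (\<lambda>\<eta>. fderiv w (x, \<psi> q) (0, \<eta>))" .
  moreover have "fderiv ((\<lambda>q'. u (cinv U \<phi> x, q')) o cinv V \<psi>) (\<psi> q) =
    fderiv (\<lambda>y. w (x, y)) (\<psi> q)"
   by (rule frechet_derivative_cong_open(2)[OF pB(2)]) (use that weq in auto)
  moreover have "smooth_fun B (\<lambda>q'. u (cinv U \<phi> x, q'))"
   by (rule smooth_fun_slice2[OF A u pointsI[OF c iA(2)[OF that(2)]]])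
  ultimately show ?thesis by (simp add: chart_vec_def)
 qed
 show ?thesis by (rule that[OF w 1 2])
qed

lemma tangent_partial_smooth:
 assumes M: "smooth_manifold A" and B: "pre_manifold B" and u: "smooth_fun (prod_atlas A B) u"
  and p: "p \<in> points A" and v: "v \<in> tangent_space A p"
 shows "smooth_fun B (\<lambda>q. v (\<lambda>y. u (y, q)))"
proof -
 note A = smooth_manifold_pre[OF M]
 obtain U \<phi> where c: "(U, \<phi>) \<in> A" "p \<in> U" using p by (rule pointsE)
 obtain \<xi> where \<xi>: "v = chart_vec A U \<phi> p \<xi>" by (rule tangent_chart_vec[OF M v c])
 have "smooth_on (\<psi> ` V) ((\<lambda>q. v (\<lambda>y. u (y, q))) o cinv V \<psi>)" if d: "(V, \<psi>) \<in> B" for V \<psi>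
 proof (rule tangent_partial_charts[OF A B u c(1) d])
  fix w assume w: "smooth_on (\<phi> ` U \<times> \<psi> ` V) w"
   and 1: "\<And>p y \<xi>. p \<in> U ==> y \<in> \<psi> ` V ==>
    chart_vec A U \<phi> p \<xi> (\<lambda>p'. u (p', cinv V \<psi> y)) = fderiv w (\<phi> p, y) (\<xi>, 0)"
  have o: "open (\<phi> ` U \<times> \<psi> ` V)" "open (\<psi> ` V)"
   using pre_manifoldD(2)[OF A c(1)] pre_manifoldD(2)[OF B d] by (auto intro: open_Times)
  have "smooth_on (\<psi> ` V) (\<lambda>y. fderiv w (\<phi> p, y) (\<xi>, 0))"
   by (rule smooth_on_comp[OF o(2,1) _ smooth_on_Pair[OF o(2) smooth_on_const smooth_on_ident] smooth_on_frechet[OF w]])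
    (use c(2) in auto)
  then show ?thesis
   by (rule smooth_on_eq[OF o(2)]) (use 1[OF c(2)] \<xi> in auto)
 qed
 then show ?thesis by (auto simp: smooth_fun_def)
qed

lemma tangent_partial_smooth2:
 assumes A: "pre_manifold A" and M: "smooth_manifold B" and u: "smooth_fun (prod_atlas A B) u"
  and q: "q \<in> points B" and v: "v \<in> tangent_space B q"
 shows "smooth_fun A (\<lambda>p. v (\<lambda>y. u (p, y)))"
proof -
 note B = smooth_manifold_pre[OF M]
 have "smooth_fun (prod_atlas B A) (u o (\<lambda>z. (snd z, fst z)))"
  by (rule smooth_map_fun[OF pre_manifold_prod[OF B A] pre_manifold_prod[OF A B]
     smooth_map_pair[OF pre_manifold_prod[OF B A] smooth_map_snd[OF B A] smooth_map_fst[OF B A]] u])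
 from tangent_partial_smooth[OF M A this q v] show ?thesis by simp
qed

text \<open>Symmetry of the second derivative of the local representative \<open>w\<close> in the
  directions (\<xi>, 0) and (0, \<eta>).\<close>

lemma tangent_partial_commute:
 assumes M: "smooth_manifold A" "smooth_manifold B" and u: "smooth_fun (prod_atlas A B) u"
  and p: "p \<in> points A" and v: "v \<in> tangent_space A p"
  and q: "q \<in> points B" and v': "v' \<in> tangent_space B q"
 shows "v' (\<lambda>q. v (\<lambda>y. u (y, q))) = v (\<lambda>y. v' (\<lambda>q. u (y, q)))"
proof -
 note A = smooth_manifold_pre[OF M(1)] and B = smooth_manifold_pre[OF M(2)]
 obtain U \<phi> where c: "(U, \<phi>) \<in> A" "p \<in> U" using p by (rule pointsE)
 obtain V \<psi> where d: "(V, \<psi>) \<in> B" "q \<in> V" using q by (rule pointsE)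
 obtain \<xi> where \<xi>: "v = chart_vec A U \<phi> p \<xi>" by (rule tangent_chart_vec[OF M(1) v c])
 obtain \<eta> where \<eta>: "v' = chart_vec B V \<psi> q \<eta>" by (rule tangent_chart_vec[OF M(2) v' d])
 show ?thesis
 proof (rule tangent_partial_charts[OF A B u c(1) d(1)])
  fix w assume w: "smooth_on (\<phi> ` U \<times> \<psi> ` V) w"
   and 1: "\<And>p y \<xi>. p \<in> U ==> y \<in> \<psi> ` V ==>
    chart_vec A U \<phi> p \<xi> (\<lambda>p'. u (p', cinv V \<psi> y)) = fderiv w (\<phi> p, y) (\<xi>, 0)"
   and 2: "\<And>q x \<eta>. q \<in> V ==> x \<in> \<phi> ` U ==>
    chart_vec B V \<psi> q \<eta> (\<lambda>q'. u (cinv U \<phi> x, q')) = fderiv w (x, \<psi> q) (0, \<eta>)"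
  let ?w1 = "\<lambda>z. fderiv w z (\<xi>, 0)" and ?w2 = "\<lambda>z. fderiv w z (0, \<eta>)"
  note o = pre_manifoldD(2)[OF A c(1)] pre_manifoldD(2)[OF B d(1)]
  have oo: "open (\<phi> ` U \<times> \<psi> ` V)" using o by (rule open_Times)
  have pq: "(\<phi> p, \<psi> q) \<in> \<phi> ` U \<times> \<psi> ` V" using c(2) d(2) by auto
  have "v' (\<lambda>q. v (\<lambda>y. u (y, q))) = fderiv ((\<lambda>q. v (\<lambda>y. u (y, q))) o cinv V \<psi>) (\<psi> q) \<eta>"
   using tangent_partial_smooth[OF M(1) B u p v] by (simp add: \<eta> chart_vec_def)
  also have "\<dots> = fderiv (\<lambda>y. ?w1 (\<phi> p, y)) (\<psi> q) \<eta>"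
   by (subst frechet_derivative_cong_open(2)[OF o(2), of _ _ "\<lambda>y. ?w1 (\<phi> p, y)"])
    (use d(2) 1[OF c(2)] \<xi> in auto)
  also have "\<dots> = fderiv ?w1 (\<phi> p, \<psi> q) (0, \<eta>)"
   by (subst frechet_derivative_eqI[OF has_derivative_slices(2)[OF
       smooth_on_has_derivative[OF smooth_on_frechet[OF w] pq]]]) simp
  also have "\<dots> = fderiv ?w2 (\<phi> p, \<psi> q) (\<xi>, 0)"
   by (rule smooth_on_second_derivative_symmetric[OF oo w pq])
  also have "\<dots> = fderiv (\<lambda>x. ?w2 (x, \<psi> q)) (\<phi> p) \<xi>"
   by (subst frechet_derivative_eqI[OF has_derivative_slices(1)[OF
       smooth_on_has_derivative[OF smooth_on_frechet[OF w] pq]]]) simp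
  also have "\<dots> = fderiv ((\<lambda>y. v' (\<lambda>q. u (y, q))) o cinv U \<phi>) (\<phi> p) \<xi>"
   by (subst frechet_derivative_cong_open(2)[OF o(1), of _ _ "\<lambda>x. ?w2 (x, \<psi> q)"])
    (use c(2) 2[OF d(2)] \<eta> in auto)
  also have "\<dots> = v (\<lambda>y. v' (\<lambda>q. u (y, q)))"
   using tangent_partial_smooth2[OF A M(2) u q v'] by (simp add: \<xi> chart_vec_def)
  finally show ?thesis .
 qed
qed

text \<open>The level set through p is closed by continuity and open because \<open>f\<close> is
  constant on balls in charts; connectedness makes it everything.\<close>

lemma smooth_fun_constant:
 assumes M: "smooth_manifold A" and con: "connected_space (mtop A)" and f: "smooth_fun A f"
  and z: "\<And>p v. p \<in> points A ==> v \<in> tangent_space A p ==> v f = 0"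
  and pq: "p \<in> points A" "q \<in> points A"
 shows "f q = f p"
proof -
 note A = smooth_manifold_pre[OF M]
 let ?T = "{x \<in> points A. f x \<in> {f p}}"
 have "closedin (mtop A) ?T"
  using closedin_continuous_map_preimage[OF smooth_fun_continuous_map[OF A f], of "{f p}"]
  by (simp add: topspace_mtop[OF A])
 moreover have "openin (mtop A) ?T"
 proof (subst openin_subopen, intro ballI)
  fix x assume x: "x \<in> ?T"
  then have "x \<in> points A" by simp
  then obtain U \<phi> where c: "(U, \<phi>) \<in> A" "x \<in> U" by (rule pointsE)
  note i = chart_inv[OF pre_manifoldD(1)[OF A c(1)]]
  obtain r where r: "r > 0" "ball (\<phi> x) r \<subseteq> \<phi> ` U"
   using pre_manifoldD(2)[OF A c(1)] c(2) open_contains_ball by (metis image_eqI)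
  let ?F = "f o cinv U \<phi>"
  have d: "(?F has_derivative (\<lambda>_. 0)) (at y within ball (\<phi> x) r)" if y: "y \<in> ball (\<phi> x) r" for y
  proof -
   obtain y' where y': "y' \<in> U" "y = \<phi> y'" using r(2) y by blast
   have "chart_vec A U \<phi> y' \<xi> f = 0" for \<xi>
    by (rule z[OF pointsI[OF c(1) y'(1)] chart_vec_tangent[OF A c(1) y'(1)]])
   then have "fderiv ?F (\<phi> y') = (\<lambda>_. 0)" using f by (simp add: chart_vec_def fun_eq_iff)
   then show ?thesis
    using smooth_fun_chart_derivative[OF f c(1) y'(1)] y'(2) has_derivative_at_withinI by metis
  qed
  have const: "?F y = ?F (\<phi> x)" if "y \<in> ball (\<phi> x) r" for y
   using has_derivative_zero_unique[OF convex_ball d] that r(1) by (metis centre_in_ball)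
  let ?Y = "U \<inter> \<phi> -` ball (\<phi> x) r"
  have "openin (mtop A) ?Y" by (rule openin_chart_vimage[OF A c(1) open_ball])
  moreover have "x \<in> ?Y" using c(2) r(1) by simp
  moreover have "?Y \<subseteq> ?T"
  proof
   fix y assume y: "y \<in> ?Y"
   then have "f y = f x" using const[of "\<phi> y"] i(1)[of y] i(1)[OF c(2)] by simp
   then show "y \<in> ?T" using x y pointsI[OF c(1)] by simp
  qed
  ultimately show "\<exists>Y. openin (mtop A) Y \<and> x \<in> Y \<and> Y \<subseteq> ?T" by blast
 qed
 ultimately have "?T = {} \<or> ?T = points A"
  using con unfolding connected_space_clopen_in topspace_mtop[OF A] by blast
 then show ?thesis using pq by blast
qed

text \<open>Finite-dimensional duality. The vectors that represent y -> T y f for smooth f form a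
  subspace \<open>W\<close>. A vector orthogonal to \<open>W\<close> is annihilated by all smooth
  functions, hence by hypothesis orthogonal to w; so w lies in \<open>W\<close>.\<close>

lemma dual_function_exists:
 fixes T :: "'v::euclidean_space => 'p tvec"
 assumes A: "pre_manifold A" and T: "\<And>y. T y \<in> tangent_space A p" and lin: "\<And>f. linear (\<lambda>y. T y f)"
  and w: "\<And>z. (\<And>f. smooth_fun A f ==> T z f = 0) ==> z \<bullet> w = 0"
 obtains f where "smooth_fun A f" "\<And>y. T y f = y \<bullet> w"
proof -
 define W where "W = {w. \<exists>f. smooth_fun A f \<and> (\<forall>y. T y f = y \<bullet> w)}"
 have W: "subspace W"
  unfolding subspace_def
 proof (intro conjI ballI allI)
  show "0 \<in> W" using smooth_fun_const[of A 0] tangent_const[OF T, of _ 0]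
   by (auto simp: W_def intro!: exI[of _ "\<lambda>_. 0"])
  fix w w' assume "w \<in> W" "w' \<in> W"
  then obtain f f' where f: "smooth_fun A f" "\<forall>y. T y f = y \<bullet> w"
   "smooth_fun A f'" "\<forall>y. T y f' = y \<bullet> w'" by (auto simp: W_def)
  have "\<forall>y. T y (\<lambda>q. f q + f' q) = y \<bullet> (w + w')"
   using tangentD(2)[OF T f(1,3)] f(2,4) by (simp add: inner_add_right)
  then show "w + w' \<in> W" using smooth_fun_add[OF A f(1,3)] unfolding W_def by blast
 next
  fix r w assume "w \<in> W"
  then obtain f where f: "smooth_fun A f" "\<forall>y. T y f = y \<bullet> w" by (auto simp: W_def)
  have "\<forall>y. T y (\<lambda>q. r * f q) = y \<bullet> (r *\<^sub>R w)"
   using tangentD(3)[OF T f(1)] f(2) by simp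
  then show "r *\<^sub>R w \<in> W" using smooth_fun_mult[OF A smooth_fun_const f(1)] unfolding W_def by blast
 qed
 obtain y z where yz: "y \<in> span W" "\<And>x. x \<in> span W ==> orthogonal z x" "w = y + z"
  using orthogonal_subspace_decomp_exists[of W w] by blast
 have "T z f = 0" if f: "smooth_fun A f" for f
 proof -
  define w where "w = (\<Sum>e\<in>Basis. T e f *\<^sub>R e)"
  have w: "T y f = y \<bullet> w" for y
   unfolding linear_Basis_sum[OF lin, of y f] by (simp add: w_def inner_sum_right mult.commute)
  then have "w \<in> span W" using f unfolding W_def by (intro span_base) blast
  then show ?thesis using yz(2) w by (simp add: orthogonal_def)
 qed
 then have "z \<bullet> w = 0" by (rule w)
 then have "z = 0" using yz(2)[OF yz(1)] by (simp add: yz(3) orthogonal_def inner_add_right)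
 then have "w \<in> W" using yz(1,3) W by (simp add: span_eq_iff[THEN iffD2])
 then show ?thesis using that unfolding W_def by blast
qed

section \<open>The Lie algebra\<close>

definition skewp :: "real ^ 'n ^ 'n => real ^ ('n::finite) ^ 'n" where
 "skewp A = (1/2) *\<^sub>R (A - transpose A)"

text \<open>The orthogonal projection of all quadruples onto \<open>galg\<close>. The standard basis
  of the quadruples does not lie in \<open>galg\<close>, so sums over \<open>Basis\<close> pass
  through this map.\<close>

fun galgp :: "('n::finite) quad => 'n quad" where
 "galgp (x, A, u, C) = (x, skewp A, u, skewp C)"

lemma transpose_simps:
 "transpose (A + B) = transpose A + transpose B"
 "transpose (A - B) = transpose A - transpose B"
 "transpose (- A) = - transpose (A :: real ^ 'n ^ 'm)"
 "transpose (r *\<^sub>R A) = r *\<^sub>R transpose A"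
 by (simp_all add: transpose_def vec_eq_iff)

lemma transpose_zero: "transpose 0 = (0 :: real ^ 'n ^ 'm)"
 by (simp add: transpose_def vec_eq_iff)

lemma skew_iff: "A \<in> skew \<longleftrightarrow> (\<forall>i j. A $ i $ j = - A $ j $ i)"
 unfolding skew_def by (auto simp: transpose_def vec_eq_iff)

lemma skewp_skew: "skewp A \<in> skew"
 by (simp add: skewp_def skew_def transpose_simps transpose_transpose algebra_simps)

lemma skewp_ident: "A \<in> skew ==> skewp A = A"
 by (simp add: skewp_def skew_def flip: scaleR_2)

lemma skewp_linear: "skewp (A + B) = skewp A + skewp B" "skewp (r *\<^sub>R A) = r *\<^sub>R skewp A"
 by (simp_all add: skewp_def transpose_simps algebra_simps)

lemma inner_transpose: "A \<bullet> transpose B = transpose A \<bullet> (B :: real ^ 'n ^ 'n)"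
 unfolding inner_vec_def transpose_def by (simp, rule sum.swap)

lemma inner_skewp: "A \<bullet> skewp B = skewp A \<bullet> B"
 by (simp add: skewp_def inner_diff_right inner_diff_left inner_transpose)

lemma subspace_skew: "subspace skew"
 by (auto simp: subspace_def skew_def transpose_simps transpose_zero)

lemma subspace_galg: "subspace galg"
 using subspace_skew by (auto simp: subspace_def galg_def zero_prod_def)

lemma galgp_galg: "galgp a \<in> galg"
 by (cases a) (auto simp: galg_def skewp_skew)

lemma galgp_ident: "a \<in> galg ==> galgp a = a"
 by (cases a) (auto simp: galg_def skewp_ident)

lemma galgp_linear: "linear galgp"
 by (rule linearI) (auto simp: skewp_linear)

lemma inner_galgp: "a \<bullet> galgp b = galgp a \<bullet> b"
 by (cases a; cases b) (simp add: inner_skewp)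

lemma wedge_skew: "wedge x y \<in> skew"
 by (simp add: skew_iff wedge_def)

lemma matrix_linear:
 fixes A B C :: "real ^ 'n ^ 'n"
 shows "(A + B) ** C = A ** C + B ** C" "C ** (A + B) = C ** A + C ** B"
  "(r *\<^sub>R A) ** C = r *\<^sub>R (A ** C)" "C ** (r *\<^sub>R A) = r *\<^sub>R (C ** A)"
  "(- A) ** C = - (A ** C)" "C ** (- A) = - (C ** A)"
  "A ** 0 = 0" "0 ** A = 0"
 by (simp_all add: matrix_matrix_mult_def vec_eq_iff sum.distrib sum_distrib_left sum_negf algebra_simps)

lemma comm_zero: "comm 0 A = 0" "comm A 0 = 0"
 by (simp_all add: comm_def matrix_linear)

lemma comm_skew: "A \<in> skew ==> B \<in> skew ==> comm A B \<in> skew"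
 by (simp add: skew_def comm_def matrix_transpose_mul transpose_simps matrix_linear)

lemma gbracket_galg: "a \<in> galg ==> b \<in> galg ==> gbracket a1 a2 a b \<in> galg"
proof -
 assume "a \<in> galg" "b \<in> galg"
 then obtain x A u C y B v E where
  "a = (x, A, u, C)" "b = (y, B, v, E)" "A \<in> skew" "B \<in> skew" "C \<in> skew" "E \<in> skew"
  by (auto simp: galg_def)
 then show ?thesis
  using wedge_skew comm_skew subspace_skew
  by (auto simp: galg_def comm_zero subspace_0 intro!: subspace_add subspace_diff subspace_scale)
qed

lemma wedge_linear:
 "wedge (x + y) z = wedge x z + wedge y z" "wedge z (x + y) = wedge z x + wedge z y"
 "wedge (r *\<^sub>R x) z = r *\<^sub>R wedge x z" "wedge z (r *\<^sub>R x) = r *\<^sub>R wedge z x"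
 by (simp_all add: wedge_def vec_eq_iff algebra_simps)

lemma wedge_zero: "wedge 0 z = 0" "wedge z 0 = 0"
 by (simp_all add: wedge_def vec_eq_iff)

lemma comm_linear:
 "comm (A + B) C = comm A C + comm B C" "comm C (A + B) = comm C A + comm C B"
 "comm (r *\<^sub>R A) C = r *\<^sub>R comm A C" "comm C (r *\<^sub>R A) = r *\<^sub>R comm C A"
 by (simp_all add: comm_def matrix_linear algebra_simps)

lemma matrix_vector_linear:
 fixes A B :: "real ^ 'n ^ 'n"
 shows "(A + B) *v x = A *v x + B *v x" "A *v (x + y) = A *v x + A *v y"
  "(r *\<^sub>R A) *v x = r *\<^sub>R (A *v x)" "A *v (r *\<^sub>R x) = r *\<^sub>R (A *v x)"
 by (simp_all add: matrix_vector_mult_add_rdistrib matrix_vector_right_distrib scaleR_matrix_vector_assoc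
   matrix_vector_mult_scaleR)

lemma gbracket_linear_left: "linear (\<lambda>a. gbracket a1 a2 a b)"
proof (rule linearI)
 show "gbracket a1 a2 (a + a') b = gbracket a1 a2 a b + gbracket a1 a2 a' b" for a a'
  by (cases a; cases a'; cases b)
   (simp add: wedge_linear comm_linear comm_zero matrix_vector_linear algebra_simps)
 show "gbracket a1 a2 (r *\<^sub>R a) b = r *\<^sub>R gbracket a1 a2 a b" for r a
  by (cases a; cases b)
   (simp add: wedge_linear comm_linear comm_zero matrix_vector_linear algebra_simps)
qed

section \<open>Derivatives of vector-valued functions along tangent vectors\<close>

definition dV :: "'p tvec => ('p => 'v::euclidean_space) => 'v" where
 "dV v \<eta> = (\<Sum>e\<in>Basis. v (\<lambda>h. \<eta> h \<bullet> e) *\<^sub>R e)"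

definition smooth_vec :: "('p, 'e::euclidean_space) atlas => ('p => 'v::euclidean_space) => bool" where
 "smooth_vec A \<eta> \<longleftrightarrow> (\<forall>e. smooth_fun A (\<lambda>h. \<eta> h \<bullet> e))"

lemma smooth_vecD: "smooth_vec A \<eta> ==> smooth_fun A (\<lambda>h. \<eta> h \<bullet> e)"
 by (simp add: smooth_vec_def)

lemma smooth_vec_linear:
 fixes l :: "'v::euclidean_space => 'w::euclidean_space"
 assumes "linear l" "smooth_vec A \<eta>"
 shows "smooth_vec A (\<lambda>h. l (\<eta> h))"
 unfolding smooth_vec_def adjoint_works[OF assms(1), symmetric]
 using smooth_vecD[OF assms(2)] by blast

lemma dV_inner:
 assumes "pre_manifold A" "v \<in> tangent_space A p" "smooth_vec A \<eta>"
 shows "dV v \<eta> \<bullet> w = v (\<lambda>h. \<eta> h \<bullet> w)"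
proof -
 have "(\<lambda>h. \<eta> h \<bullet> w) = (\<lambda>h. \<Sum>e\<in>Basis. (w \<bullet> e) * (\<eta> h \<bullet> e))"
  by (rule ext, subst euclidean_inner) (simp add: mult.commute)
 then have "v (\<lambda>h. \<eta> h \<bullet> w) = (\<Sum>e\<in>Basis. v (\<lambda>h. (w \<bullet> e) * (\<eta> h \<bullet> e)))"
  using tangent_sum[OF assms(2,1), of Basis "\<lambda>e h. (w \<bullet> e) * (\<eta> h \<bullet> e)"]
   smooth_fun_mult[OF assms(1) smooth_fun_const smooth_vecD[OF assms(3)]] by simp
 also have "\<dots> = (\<Sum>e\<in>Basis. (w \<bullet> e) * v (\<lambda>h. \<eta> h \<bullet> e))"
  using tangentD(3)[OF assms(2) smooth_vecD[OF assms(3)]] by simp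
 also have "\<dots> = dV v \<eta> \<bullet> w"
  by (simp add: dV_def inner_sum_left) (simp add: inner_commute mult.commute)
 finally show ?thesis ..
qed

lemma dV_linear:
 fixes l :: "'v::euclidean_space => 'w::euclidean_space"
 assumes "pre_manifold A" "v \<in> tangent_space A p" "smooth_vec A \<eta>" "linear l"
 shows "dV v (\<lambda>h. l (\<eta> h)) = l (dV v \<eta>)"
proof (rule euclidean_eqI)
 fix b :: 'w
 have "dV v (\<lambda>h. l (\<eta> h)) \<bullet> b = v (\<lambda>h. \<eta> h \<bullet> adjoint l b)"
  unfolding dV_inner[OF assms(1,2) smooth_vec_linear[OF assms(4,3)]] adjoint_works[OF assms(4)] ..
 also have "\<dots> = dV v \<eta> \<bullet> adjoint l b" by (rule dV_inner[OF assms(1-3), symmetric])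
 also have "\<dots> = l (dV v \<eta>) \<bullet> b" by (rule adjoint_works[OF assms(4)])
 finally show "dV v (\<lambda>h. l (\<eta> h)) \<bullet> b = l (dV v \<eta>) \<bullet> b" .
qed

lemma smooth_vec_inner:
 assumes "pre_manifold A" "smooth_vec A \<eta>" "smooth_vec A \<zeta>"
 shows "smooth_fun A (\<lambda>h. \<eta> h \<bullet> \<zeta> h)"
proof -
 have "(\<lambda>h. \<eta> h \<bullet> \<zeta> h) = (\<lambda>h. \<Sum>e\<in>Basis. (\<eta> h \<bullet> e) * (\<zeta> h \<bullet> e))"
  by (rule ext, rule euclidean_inner)
 then show ?thesis
  using assms by (auto intro!: smooth_fun_sum smooth_fun_mult smooth_vecD)
qed

lemma tangent_inner:
 assumes "pre_manifold A" "v \<in> tangent_space A p" "smooth_vec A \<eta>" "smooth_vec A \<zeta>"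
 shows "v (\<lambda>h. \<eta> h \<bullet> \<zeta> h) = dV v \<eta> \<bullet> \<zeta> p + \<eta> p \<bullet> dV v \<zeta>"
proof -
 have "(\<lambda>h. \<eta> h \<bullet> \<zeta> h) = (\<lambda>h. \<Sum>e\<in>Basis. (\<eta> h \<bullet> e) * (\<zeta> h \<bullet> e))"
  by (rule ext, rule euclidean_inner)
 then have "v (\<lambda>h. \<eta> h \<bullet> \<zeta> h) = (\<Sum>e\<in>Basis. v (\<lambda>h. (\<eta> h \<bullet> e) * (\<zeta> h \<bullet> e)))"
  using tangent_sum[OF assms(2,1), of Basis "\<lambda>e h. (\<eta> h \<bullet> e) * (\<zeta> h \<bullet> e)"]
   smooth_fun_mult[OF assms(1) smooth_vecD[OF assms(3)] smooth_vecD[OF assms(4)]] by simp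
 also have "\<dots> = (\<Sum>e\<in>Basis. (dV v \<eta> \<bullet> e) * (\<zeta> p \<bullet> e) + (\<eta> p \<bullet> e) * (dV v \<zeta> \<bullet> e))"
  using tangentD(4)[OF assms(2) smooth_vecD[OF assms(3)] smooth_vecD[OF assms(4)]]
   dV_inner[OF assms(1-3)] dV_inner[OF assms(1,2,4)] by simp
 also have "\<dots> = dV v \<eta> \<bullet> \<zeta> p + \<eta> p \<bullet> dV v \<zeta>"
  by (simp add: sum.distrib flip: euclidean_inner)
 finally show ?thesis .
qed

section \<open>Left-invariant fields and the adjoint representation\<close>

locale lie_frame =
 fixes a1 a2 :: real and G :: "'g monoid" and A :: "('g, 'e::euclidean_space) atlas"
  and L :: "('n::finite) quad => 'g vfield"
 assumes lie: "lie_group G A" and con: "connected_space (mtop A)"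
  and iso: "lie_algebra_iso a1 a2 G A L"
begin

abbreviation mul (infixl "\<cdot>" 70) where "x \<cdot> y \<equiv> x \<otimes>\<^bsub>G\<^esub> y"
abbreviation gi :: "'g => 'g" where "gi x \<equiv> inv\<^bsub>G\<^esub> x"
abbreviation e1 :: 'g where "e1 \<equiv> \<one>\<^bsub>G\<^esub>"
abbreviation CG :: "'g set" where "CG \<equiv> carrier G"
abbreviation br :: "'n quad => 'n quad => 'n quad" where "br \<equiv> gbracket a1 a2"

lemma grp: "group G" and Mf: "smooth_manifold A" and pts: "points A = CG"
 using lie by (auto simp: lie_group_def)

lemma pre: "pre_manifold A" by (rule smooth_manifold_pre[OF Mf])

lemma group_simps [simp]:
 "x \<in> CG ==> y \<in> CG ==> x \<cdot> y \<in> CG" "x \<in> CG ==> gi x \<in> CG" "e1 \<in> CG"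
 "x \<in> CG ==> e1 \<cdot> x = x" "x \<in> CG ==> x \<cdot> e1 = x"
 "x \<in> CG ==> gi x \<cdot> x = e1" "x \<in> CG ==> x \<cdot> gi x = e1" "x \<in> CG ==> gi (gi x) = x"
 "gi e1 = e1"
 using grp
 by (auto simp: group.is_monoid monoid.m_closed group.inv_closed monoid.one_closed group.l_inv
   group.r_inv group.inv_inv monoid.inv_one monoid.l_one monoid.r_one group.inv_closed)

lemma assoc: "x \<in> CG ==> y \<in> CG ==> z \<in> CG ==> x \<cdot> y \<cdot> z = x \<cdot> (y \<cdot> z)"
 using grp by (simp add: group.is_monoid monoid.m_assoc)

lemma cancel [simp]:
 assumes "x \<in> CG" "y \<in> CG"
 shows "gi x \<cdot> (x \<cdot> y) = y" "x \<cdot> (gi x \<cdot> y) = y" "y \<cdot> x \<cdot> gi x = y" "y \<cdot> gi x \<cdot> x = y"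
 using assms by (simp_all add: assoc[symmetric]) (simp_all add: assoc)

lemma pre_AA: "pre_manifold (prod_atlas A A)" by (rule pre_manifold_prod[OF pre pre])

lemma mul_smooth:
 assumes "pre_manifold B" "smooth_map B A F" "smooth_map B A H"
 shows "smooth_map B A (\<lambda>p. F p \<cdot> H p)"
proof -
 have "smooth_map (prod_atlas A A) A (\<lambda>(g, h). g \<cdot> h)" using lie by (simp add: lie_group_def)
 from smooth_map_comp[OF assms(1) pre_AA pre smooth_map_pair[OF assms] this]
 show ?thesis by (simp add: o_def)
qed

lemma gi_smooth:
 assumes "pre_manifold B" "smooth_map B A F"
 shows "smooth_map B A (\<lambda>p. gi (F p))"
proof -
 have "smooth_map A A (\<lambda>g. gi g)" using lie by (simp add: lie_group_def)
 from smooth_map_comp[OF assms(1) pre pre assms(2) this] show ?thesis by (simp add: o_def)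
qed

lemma const_smooth: "pre_manifold B ==> g \<in> CG ==> smooth_map B A (\<lambda>_. g)"
 using smooth_map_const pts by metis

lemma ident_smooth: "smooth_map A A (\<lambda>p. p)" by (rule smooth_map_id[OF pre])

lemma fst_smooth: "smooth_map (prod_atlas A A) A fst" by (rule smooth_map_fst[OF pre pre])
lemma snd_smooth: "smooth_map (prod_atlas A A) A snd" by (rule smooth_map_snd[OF pre pre])

lemma smooth_fun_lmul: "smooth_fun A f ==> g \<in> CG ==> smooth_fun A (\<lambda>h. f (g \<cdot> h))"
 using smooth_map_fun[OF pre pre mul_smooth[OF pre const_smooth[OF pre] ident_smooth]] by (simp add: o_def)

lemma smooth_fun_rmul: "smooth_fun A f ==> g \<in> CG ==> smooth_fun A (\<lambda>h. f (h \<cdot> g))"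
 using smooth_map_fun[OF pre pre mul_smooth[OF pre ident_smooth const_smooth[OF pre]]] by (simp add: o_def)

lemma L_field: "a \<in> galg ==> L a \<in> left_invariant_fields G A"
 using iso by (auto simp: lie_algebra_iso_def bij_betw_def)

lemma L_tangent: "a \<in> galg ==> g \<in> CG ==> L a g \<in> tangent_space A g"
 using L_field pts by (auto simp: left_invariant_fields_def vfields_def)

lemma L_smooth: "a \<in> galg ==> smooth_fun A f ==> smooth_fun A (\<lambda>g. L a g f)"
 using L_field by (auto simp: left_invariant_fields_def vfields_def)

lemma L_left:
 assumes "a \<in> galg" "g \<in> CG" "h \<in> CG" "smooth_fun A f"
 shows "L a (g \<cdot> h) f = L a h (\<lambda>k. f (g \<cdot> k))"
proof -
 have "push_forward A (\<lambda>k. g \<cdot> k) (L a h) = L a (g \<cdot> h)"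
  using L_field[OF assms(1)] assms(2,3) by (auto simp: left_invariant_fields_def)
 then show ?thesis using assms(4) by (auto simp: push_forward_def o_def dest: fun_cong[of _ _ f])
qed

lemma L_add: "a \<in> galg ==> b \<in> galg ==> L (a + b) g f = L a g f + L b g f"
 using iso by (simp add: lie_algebra_iso_def)

lemma L_scale: "a \<in> galg ==> L (r *\<^sub>R a) g f = r * L a g f"
proof -
 assume "a \<in> galg"
 then have "\<forall>r. L (r *\<^sub>R a) = (\<lambda>p f. r * L a p f)"
  using iso unfolding lie_algebra_iso_def by blast
 then show ?thesis by simp
qed

lemma L_zero: "L 0 g f = 0"
 using L_scale[of 0 0 g f] subspace_0[OF subspace_galg] by simp

lemma L_neg: "a \<in> galg ==> L (- a) g f = - L a g f"
 using L_scale[of a "-1"] by simp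

lemma L_sum:
 assumes "finite I" "\<And>i. i \<in> I ==> b i \<in> galg"
 shows "L (\<Sum>i\<in>I. c i *\<^sub>R b i) g f = (\<Sum>i\<in>I. c i * L (b i) g f)"
 using assms
proof (induction I rule: finite_induct)
 case (insert i I)
 have "L (c i *\<^sub>R b i + (\<Sum>i\<in>I. c i *\<^sub>R b i)) g f = L (c i *\<^sub>R b i) g f + L (\<Sum>i\<in>I. c i *\<^sub>R b i) g f"
  using insert.prems by (intro L_add subspace_scale subspace_sum subspace_galg) auto
 then show ?case using insert L_scale[of "b i"] by simp
qed (simp add: L_zero)

lemma L_expand:
 assumes "b \<in> galg"
 shows "L b g f = (\<Sum>e\<in>Basis. (b \<bullet> e) * L (galgp e) g f)"
proof -
 have "b = galgp (\<Sum>e\<in>Basis. (b \<bullet> e) *\<^sub>R e)" using galgp_ident[OF assms] by (simp add: euclidean_representation)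
 also have "\<dots> = (\<Sum>e\<in>Basis. (b \<bullet> e) *\<^sub>R galgp e)"
  by (simp add: linear_sum[OF galgp_linear] linear_scale[OF galgp_linear])
 finally have b: "b = (\<Sum>e\<in>Basis. (b \<bullet> e) *\<^sub>R galgp e)" .
 show ?thesis by (subst b) (rule L_sum, simp_all add: galgp_galg)
qed

lemma L_bracket:
 "a \<in> galg ==> b \<in> galg ==> L (br a b) g f = L a g (\<lambda>q. L b q f) - L b g (\<lambda>q. L a q f)"
 using iso by (simp add: lie_algebra_iso_def vf_bracket_def)

text \<open>Vanishing at one point spreads by left translation to the whole group, so the field
  equals \<open>L 0\<close>, and \<open>L\<close> is injective.\<close>

lemma L_eqI:
 assumes "a \<in> galg" "g \<in> CG" "\<And>f. smooth_fun A f ==> L a g f = 0"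
 shows "a = 0"
proof -
 have z: "L a h f = 0" for h f
 proof (cases "h \<in> CG \<and> smooth_fun A f")
  case True
  then have "L a h f = L a (h \<cdot> gi g \<cdot> g) f" using assms(2) by simp
  also have "\<dots> = L a g (\<lambda>k. f (h \<cdot> gi g \<cdot> k))"
   using True assms(1,2) by (intro L_left) auto
  also have "\<dots> = 0" using True assms(2) by (intro assms(3) smooth_fun_lmul) auto
  finally show ?thesis .
 next
  case False
  then show ?thesis
   using L_field[OF assms(1)] tangentD(1)[OF L_tangent[OF assms(1)]] pts
   by (cases "h \<in> CG") (auto simp: left_invariant_fields_def vfields_def)
 qed
 then have "L a = L 0" using L_zero by (intro ext) simp
 moreover have "inj_on L galg" using iso by (auto simp: lie_algebra_iso_def bij_betw_def)
 ultimately show ?thesis using assms(1) subspace_0[OF subspace_galg] by (metis inj_onD)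
qed

lemma L_inj:
 assumes "a \<in> galg" "b \<in> galg" "g \<in> CG" "\<And>f. smooth_fun A f ==> L a g f = L b g f"
 shows "a = b"
proof -
 have "a - b = 0"
 proof (rule L_eqI[OF _ assms(3)])
  show "a - b \<in> galg" using subspace_galg assms(1,2) by (rule subspace_diff)
  show "L (a - b) g f = 0" if "smooth_fun A f" for f
   using L_add[OF assms(1) subspace_neg[OF subspace_galg assms(2)], of g f] L_neg[OF assms(2)] assms(4)[OF that]
   by simp
 qed
 then show ?thesis by simp
qed

text \<open>Translating v around the group gives a left-invariant field. Its smoothness is that of a
  function on the product, differentiated in the first variable by v.\<close>

lemma tangent_L:
 assumes g: "g \<in> CG" and v: "v \<in> tangent_space A g"
 obtains a where "a \<in> galg" "v = L a g"
proof -
 define X where "X h = (if h \<in> CG then push_forward A (\<lambda>k. h \<cdot> gi g \<cdot> k) v else (\<lambda>_. 0))" for h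
 have sm: "smooth_map A A (\<lambda>k. h \<cdot> gi g \<cdot> k)" if "h \<in> CG" for h
  using that g by (intro mul_smooth const_smooth ident_smooth pre) auto
 have "X \<in> vfields A"
  unfolding vfields_def
 proof (intro CollectI conjI ballI allI impI)
  show "X h \<in> tangent_space A h" if "h \<in> points A" for h
   using push_forward_tangent[OF pre pre sm v, of h] that g by (simp add: pts X_def)
  show "X h = (\<lambda>_. 0)" if "h \<notin> points A" for h using that by (simp add: X_def pts)
  fix f assume f: "smooth_fun A f"
  have "smooth_map (prod_atlas A A) A (\<lambda>z. snd z \<cdot> gi g \<cdot> fst z)"
   using g by (intro mul_smooth const_smooth fst_smooth snd_smooth pre_AA) auto
  from smooth_map_fun[OF pre_AA pre this f]
  have "smooth_fun A (\<lambda>h. v (\<lambda>k. f (h \<cdot> gi g \<cdot> k)))"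
   using tangent_partial_smooth[OF Mf pre _ _ v, of "\<lambda>z. f (snd z \<cdot> gi g \<cdot> fst z)"] g
   by (simp add: o_def pts)
  then show "smooth_fun A (\<lambda>h. X h f)"
   by (subst smooth_fun_cong[OF pre, of _ "\<lambda>h. v (\<lambda>k. f (h \<cdot> gi g \<cdot> k))"])
    (auto simp: X_def pts push_forward_def f o_def)
 qed
 moreover have "push_forward A (\<lambda>k. g' \<cdot> k) (X h) = X (g' \<cdot> h)" if gh: "g' \<in> CG" "h \<in> CG" for g' h
 proof
  fix f
  show "push_forward A (\<lambda>k. g' \<cdot> k) (X h) f = X (g' \<cdot> h) f"
  proof (cases "smooth_fun A f")
   case True
   have "v (\<lambda>k. f (g' \<cdot> (h \<cdot> gi g \<cdot> k))) = v (\<lambda>k. f (g' \<cdot> h \<cdot> gi g \<cdot> k))"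
    by (rule tangent_cong[OF Mf v]) (use gh g in \<open>auto simp: pts assoc\<close>)
   then show ?thesis using True gh smooth_fun_lmul[OF True gh(1)] by (simp add: X_def push_forward_def o_def)
  qed (use gh in \<open>simp add: push_forward_def X_def\<close>)
 qed
 ultimately have "X \<in> left_invariant_fields G A" by (simp add: left_invariant_fields_def)
 then obtain a where a: "a \<in> galg" "X = L a"
  using iso unfolding lie_algebra_iso_def bij_betw_def by blast
 have "X g f = v f" for f
 proof (cases "smooth_fun A f")
  case True
  have "v (\<lambda>k. f (g \<cdot> gi g \<cdot> k)) = v f"
   by (rule tangent_cong[OF Mf v]) (use g in \<open>auto simp: pts\<close>)
  then show ?thesis using True g by (simp add: X_def push_forward_def o_def)
 qed (use g tangentD(1)[OF v] in \<open>simp add: push_forward_def X_def\<close>)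
 then show ?thesis using that[OF a(1)] a(2) by (metis ext)
qed

lemma coordinate_function:
 obtains f where "smooth_fun A f" "\<And>a. a \<in> galg ==> L a e1 f = a \<bullet> w"
proof (rule dual_function_exists[OF pre, of "\<lambda>a. L (galgp a) e1" e1 "galgp w"])
 show "L (galgp a) e1 \<in> tangent_space A e1" for a by (rule L_tangent[OF galgp_galg]) simp
 show "linear (\<lambda>a. L (galgp a) e1 f)" for f
  by (rule linearI) (simp_all add: linear_add[OF galgp_linear] linear_scale[OF galgp_linear] L_add L_scale galgp_galg)
 show "z \<bullet> galgp w = 0" if "\<And>f. smooth_fun A f ==> L (galgp z) e1 f = 0" for z
  using L_eqI[OF galgp_galg _ that] by (simp add: inner_galgp)
 fix f assume f: "smooth_fun A f" "\<And>a. L (galgp a) e1 f = a \<bullet> galgp w"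
 show thesis
 proof (rule that[OF f(1)])
  show "L a e1 f = a \<bullet> w" if "a \<in> galg" for a using f(2)[of a] by (simp add: galgp_ident[OF that] inner_galgp)
 qed
qed

text \<open>The value at \<open>g\<close>, in the left-invariant frame, of the right-invariant field
  through \<open>L a e1\<close>. In this form the derivative of \<open>co\<close>
  (\<open>dV_co\<close>) follows from the commutation of left- and right-invariant fields.\<close>

definition co :: "'g => 'n quad => 'n quad" where
 "co g a = (THE b. b \<in> galg \<and> (\<forall>f. smooth_fun A f --> L b g f = L a e1 (\<lambda>y. f (y \<cdot> g))))"

lemma co_spec:
 assumes "g \<in> CG" "a \<in> galg"
 shows "co g a \<in> galg \<and> (\<forall>f. smooth_fun A f --> L (co g a) g f = L a e1 (\<lambda>y. f (y \<cdot> g)))"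
 unfolding co_def
proof (rule theI')
 have "push_forward A (\<lambda>y. y \<cdot> g) (L a e1) \<in> tangent_space A (e1 \<cdot> g)"
  by (rule push_forward_tangent[OF pre pre mul_smooth[OF pre ident_smooth const_smooth[OF pre assms(1)]]
     L_tangent[OF assms(2)]]) simp
 then have "push_forward A (\<lambda>y. y \<cdot> g) (L a e1) \<in> tangent_space A g" using assms(1) by simp
 then obtain b where b: "b \<in> galg" "push_forward A (\<lambda>y. y \<cdot> g) (L a e1) = L b g"
  by (rule tangent_L[OF assms(1)])
 show "\<exists>!b. b \<in> galg \<and> (\<forall>f. smooth_fun A f --> L b g f = L a e1 (\<lambda>y. f (y \<cdot> g)))"
 proof (rule ex1I[of _ b])
  show "b \<in> galg \<and> (\<forall>f. smooth_fun A f --> L b g f = L a e1 (\<lambda>y. f (y \<cdot> g)))"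
   using b(1) by (auto simp: b(2)[symmetric] push_forward_def o_def)
  show "b' = b" if "b' \<in> galg \<and> (\<forall>f. smooth_fun A f --> L b' g f = L a e1 (\<lambda>y. f (y \<cdot> g)))" for b'
   by (rule L_inj[OF _ b(1) assms(1)])
    (use that in \<open>auto simp: b(2)[symmetric] push_forward_def o_def\<close>)
 qed
qed

lemma co_galg [simp]: "g \<in> CG ==> a \<in> galg ==> co g a \<in> galg"
 using co_spec by blast

lemma L_co: "g \<in> CG ==> a \<in> galg ==> smooth_fun A f ==> L (co g a) g f = L a e1 (\<lambda>y. f (y \<cdot> g))"
 using co_spec by blast

lemma co_eqI:
 assumes "g \<in> CG" "a \<in> galg" "b \<in> galg" "\<And>f. smooth_fun A f ==> L b g f = L a e1 (\<lambda>y. f (y \<cdot> g))"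
 shows "co g a = b"
 by (rule L_inj[OF co_galg[OF assms(1,2)] assms(3,1)]) (simp add: L_co[OF assms(1,2)] assms(4))

lemma L_cong:
 assumes "a \<in> galg" "g \<in> CG" "\<And>h. h \<in> CG ==> f h = f' h"
 shows "L a g f = L a g f'"
 by (rule tangent_cong[OF Mf L_tangent[OF assms(1,2)]]) (use assms(2,3) in \<open>auto simp: pts\<close>)

lemma co_one: "a \<in> galg ==> co e1 a = a"
 by (rule co_eqI) (auto intro!: L_cong)

lemma co_mul:
 assumes "g \<in> CG" "h \<in> CG" "a \<in> galg"
 shows "co (g \<cdot> h) a = co h (co g a)"
proof (rule co_eqI)
 fix f assume f: "smooth_fun A f"
 have "L (co h (co g a)) (g \<cdot> h) f = L (co h (co g a)) h (\<lambda>k. f (g \<cdot> k))"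
  using assms f by (intro L_left) auto
 also have "\<dots> = L (co g a) e1 (\<lambda>y. f (g \<cdot> (y \<cdot> h)))"
  using assms smooth_fun_lmul[OF f assms(1)] by (intro L_co) auto
 also have "\<dots> = L (co g a) e1 (\<lambda>y. f (g \<cdot> y \<cdot> h))"
  using assms by (intro L_cong) (auto simp: assoc)
 also have "\<dots> = L (co g a) (g \<cdot> e1) (\<lambda>y. f (y \<cdot> h))"
  using assms smooth_fun_rmul[OF f assms(2)] by (intro L_left[symmetric]) auto
 also have "\<dots> = L a e1 (\<lambda>y. f (y \<cdot> g \<cdot> h))"
  using assms smooth_fun_rmul[OF f assms(2)] L_co[of g a "\<lambda>y. f (y \<cdot> h)"] by simp
 also have "\<dots> = L a e1 (\<lambda>y. f (y \<cdot> (g \<cdot> h)))"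
  using assms by (intro L_cong) (auto simp: assoc)
 finally show "L (co h (co g a)) (g \<cdot> h) f = L a e1 (\<lambda>y. f (y \<cdot> (g \<cdot> h)))" .
qed (use assms in auto)

lemma co_add: "g \<in> CG ==> a \<in> galg ==> b \<in> galg ==> co g (a + b) = co g a + co g b"
 by (rule co_eqI) (auto simp: L_add L_co intro: subspace_add[OF subspace_galg])

lemma co_scale: "g \<in> CG ==> a \<in> galg ==> co g (r *\<^sub>R a) = r *\<^sub>R co g a"
 by (rule co_eqI) (auto simp: L_scale L_co intro: subspace_scale[OF subspace_galg])

lemma co_inv:
 assumes "g \<in> CG" "a \<in> galg"
 shows "co (gi g) (co g a) = a" "co g (co (gi g) a) = a"
 using co_mul[of g "gi g" a] co_mul[of "gi g" g a] assms co_one by simp_all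

lemma co_sum:
 assumes "g \<in> CG" "finite I" "\<And>i. i \<in> I ==> b i \<in> galg"
 shows "co g (\<Sum>i\<in>I. c i *\<^sub>R b i) = (\<Sum>i\<in>I. c i *\<^sub>R co g (b i))"
 using assms(2,3)
proof (induction I rule: finite_induct)
 case empty
 then show ?case using co_scale[OF assms(1), of 0 0] subspace_0[OF subspace_galg] by simp
next
 case (insert i I)
 have "co g (c i *\<^sub>R b i + (\<Sum>i\<in>I. c i *\<^sub>R b i)) = co g (c i *\<^sub>R b i) + co g (\<Sum>i\<in>I. c i *\<^sub>R b i)"
  using insert.prems by (intro co_add assms(1) subspace_scale subspace_sum subspace_galg) auto
 then show ?case using insert co_scale[OF assms(1), of "b i"] by simp
qed

text \<open>Brings \<open>co g a\<close> to the identity, where \<open>coordinate_function\<close>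
  reads off components, and shows it as the derivative of conjugation; smoothness in
  \<open>g\<close> is obtained from this expression.\<close>

lemma co_conj:
 assumes "g \<in> CG" "a \<in> galg" "smooth_fun A f"
 shows "L (co g a) e1 f = L a e1 (\<lambda>y. f (gi g \<cdot> (y \<cdot> g)))"
proof -
 have "L (co g a) (gi g \<cdot> g) f = L (co g a) g (\<lambda>k. f (gi g \<cdot> k))"
  using assms by (intro L_left) auto
 also have "\<dots> = L a e1 (\<lambda>y. f (gi g \<cdot> (y \<cdot> g)))"
  using assms smooth_fun_lmul[OF assms(3)] by (intro L_co) auto
 finally show ?thesis using assms(1) by simp
qed

lemma co_smooth:
 assumes "a \<in> galg"
 shows "smooth_vec A (\<lambda>g. co g a)"
 unfolding smooth_vec_def
proof
 fix w
 obtain f where f: "smooth_fun A f" "\<And>a. a \<in> galg ==> L a e1 f = a \<bullet> w"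
  using coordinate_function[of w] by blast
 have "smooth_map (prod_atlas A A) A (\<lambda>z. gi (snd z) \<cdot> (fst z \<cdot> snd z))"
  by (intro mul_smooth gi_smooth fst_smooth snd_smooth pre_AA)
 from smooth_map_fun[OF pre_AA pre this f(1)]
 have "smooth_fun A (\<lambda>g. L a e1 (\<lambda>y. f (gi g \<cdot> (y \<cdot> g))))"
  using tangent_partial_smooth[OF Mf pre _ _ L_tangent[OF assms], of "\<lambda>z. f (gi (snd z) \<cdot> (fst z \<cdot> snd z))" e1]
  by (simp add: o_def pts)
 then show "smooth_fun A (\<lambda>g. co g a \<bullet> w)"
  by (subst smooth_fun_cong[OF pre, of _ "\<lambda>g. L a e1 (\<lambda>y. f (gi g \<cdot> (y \<cdot> g)))"])
   (auto simp: pts co_conj[OF _ assms f(1), symmetric] f(2) assms)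
qed

text \<open>The function h \<open>\<mapsto>\<close> L a e1 (y \<open>\<mapsto>\<close> f (y h)) is the derivative of f along a right-invariant
 field, and right-invariant fields commute with left-invariant ones.\<close>

lemma dV_co:
 assumes "a \<in> galg" "b \<in> galg" "g \<in> CG"
 shows "dV (L b g) (\<lambda>h. co h a) = br (co g a) b"
proof -
 note Lb = L_tangent[OF assms(2,3)]
 define d where "d = dV (L b g) (\<lambda>h. co h a)"
 have "galgp d = dV (L b g) (\<lambda>h. galgp (co h a))"
  unfolding d_def by (rule dV_linear[OF pre Lb co_smooth[OF assms(1)] galgp_linear, symmetric])
 also have "\<dots> = d"
  unfolding d_def dV_def using assms by (intro sum.cong refl arg_cong2[of _ _ _ _ scaleR] L_cong)
   (auto simp: galgp_ident)
 finally have dg: "d \<in> galg" using galgp_galg[of d] by simp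
 have "d = br (co g a) b"
 proof (rule L_inj[OF dg gbracket_galg[OF co_galg[OF assms(3,1)] assms(2)] assms(3)])
  fix f assume f: "smooth_fun A f"
  have smc: "smooth_fun A (\<lambda>h. co h a \<bullet> e)" for e by (rule smooth_vecD[OF co_smooth[OF assms(1)]])
  have smL: "smooth_fun A (\<lambda>h. L (galgp e) h f)" for e by (rule L_smooth[OF galgp_galg f])
  have "smooth_map (prod_atlas A A) A (\<lambda>z. fst z \<cdot> snd z)"
   by (intro mul_smooth fst_smooth snd_smooth pre_AA)
  from smooth_map_fun[OF pre_AA pre this f] have u: "smooth_fun (prod_atlas A A) (\<lambda>z. f (fst z \<cdot> snd z))"
   by (simp add: o_def)
  have "L b g (\<lambda>h. \<Sum>e\<in>Basis. (co h a \<bullet> e) * L (galgp e) h f) = L b g (\<lambda>h. L a e1 (\<lambda>y. f (y \<cdot> h)))"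
   using assms f by (intro L_cong) (auto simp: L_expand[symmetric] L_co)
  also have "\<dots> = L a e1 (\<lambda>y. L b g (\<lambda>h. f (y \<cdot> h)))"
   using tangent_partial_commute[OF Mf Mf u _ L_tangent[OF assms(1)] _ Lb, of e1] assms(3)
   by (simp add: pts)
  also have "\<dots> = L a e1 (\<lambda>y. L b (y \<cdot> g) f)"
   using assms f by (intro L_cong) (auto simp: L_left)
  also have "\<dots> = L (co g a) g (\<lambda>q. L b q f)"
   using assms by (intro L_co[symmetric] L_smooth f) auto
  finally have 1: "L b g (\<lambda>h. \<Sum>e\<in>Basis. (co h a \<bullet> e) * L (galgp e) h f) = L (co g a) g (\<lambda>q. L b q f)" .
  \<comment> \<open>The same derivative once more, now by the product rule: coefficients and frame
    fields are differentiated separately. Comparison with the first computation leaves the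
    bracket.\<close>
  have "L b g (\<lambda>h. \<Sum>e\<in>Basis. (co h a \<bullet> e) * L (galgp e) h f) =
    (\<Sum>e\<in>Basis. L b g (\<lambda>h. co h a \<bullet> e) * L (galgp e) g f + (co g a \<bullet> e) * L b g (\<lambda>h. L (galgp e) h f))"
   using tangent_sum[OF Lb pre, of Basis "\<lambda>e h. (co h a \<bullet> e) * L (galgp e) h f"]
    smooth_fun_mult[OF pre smc smL] tangentD(4)[OF Lb smc smL] by simp
  also have "\<dots> = (\<Sum>e\<in>Basis. L b g (\<lambda>h. co h a \<bullet> e) * L (galgp e) g f) +
    L b g (\<lambda>h. \<Sum>e\<in>Basis. (co g a \<bullet> e) * L (galgp e) h f)"
   using tangent_sum[OF Lb pre, of Basis "\<lambda>e h. (co g a \<bullet> e) * L (galgp e) h f"]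
    smooth_fun_mult[OF pre smooth_fun_const smL] tangentD(3)[OF Lb smL] by (simp add: sum.distrib)
  also have "L b g (\<lambda>h. \<Sum>e\<in>Basis. (co g a \<bullet> e) * L (galgp e) h f) = L b g (\<lambda>h. L (co g a) h f)"
   using assms by (simp add: L_expand[OF co_galg, symmetric])
  also have "(\<Sum>e\<in>Basis. L b g (\<lambda>h. co h a \<bullet> e) * L (galgp e) g f) = L d g f"
   unfolding L_expand[OF dg, of g f] by (simp add: d_def dV_inner[OF pre Lb co_smooth[OF assms(1)]])
  finally show "L d g f = L (br (co g a) b) g f"
   using 1 assms by (simp add: L_bracket)
 qed
 then show ?thesis by (simp add: d_def)
qed

lemma smooth_fun_constant_on_group:
 assumes f: "smooth_fun A f" and z: "\<And>b g. b \<in> galg ==> g \<in> CG ==> L b g f = 0" and g: "g \<in> CG"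
 shows "f g = f e1"
proof (rule smooth_fun_constant[OF Mf con f])
 fix p v assume "p \<in> points A" "v \<in> tangent_space A p"
 then show "v f = 0" using tangent_L z pts by metis
qed (use g pts in auto)

end

section \<open>Submersions and homogeneous spaces\<close>

text \<open>Restricted to an affine slice through \<open>g0\<close> that is complementary to the
  kernel of its derivative, the map has invertible derivative; the inverse of this restriction is
  the section.\<close>

lemma submersion_section:
 fixes A :: "('p, 'e::euclidean_space) atlas" and B :: "('q, 'm::euclidean_space) atlas"
 assumes M: "smooth_manifold A" and N: "smooth_manifold B" and F: "smooth_map A B F"
  and g: "g0 \<in> points A"
  and sub: "\<And>v. v \<in> tangent_space B (F g0) ==> \<exists>u\<in>tangent_space A g0. push_forward B F u = v"
 obtains X s where "openin (mtop B) X" "F g0 \<in> X" "\<And>p. p \<in> X ==> s p \<in> points A \<and> F (s p) = p"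
  "s (F g0) = g0" "\<And>f. smooth_fun A f ==> smooth_fun_on B X (\<lambda>p. f (s p))"
proof -
 note A = smooth_manifold_pre[OF M] and B = smooth_manifold_pre[OF N]
 obtain U \<phi> where c: "(U, \<phi>) \<in> A" "g0 \<in> U" using g by (rule pointsE)
 obtain V \<psi> Z h where V: "(V, \<psi>) \<in> B" and Z: "openin (mtop B) Z" "F g0 \<in> Z" "Z \<subseteq> V"
  and h: "\<And>q. q \<in> Z ==> h q = \<psi> q" "\<And>w. smooth_fun B (\<lambda>q. h q \<bullet> w)"
  by (rule chart_coordinates[OF N smooth_map_points[OF F g]]) (rule that)
 have d: "(V, \<psi>) \<in> B" "F g0 \<in> V" using V Z by auto
 note iA = chart_inv[OF pre_manifoldD(1)[OF A c(1)]]
 let ?x0 = "\<phi> g0"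
 define S where "S = \<phi> ` (U \<inter> F -` V)"
 define R where "R = \<psi> o F o cinv U \<phi>"
 have S: "open S" "?x0 \<in> S" and R: "smooth_on S R"
  using smooth_mapD[OF F c(1) d(1)] c(2) d(2) by (auto simp: S_def R_def)
 have Rd: "(R has_derivative fderiv R ?x0) (at ?x0)"
  by (rule smooth_on_has_derivative[OF R S(2)])
 have "\<exists>\<xi>. fderiv R ?x0 \<xi> = \<eta>" for \<eta>
 proof -
  obtain u where u: "u \<in> tangent_space A g0" "push_forward B F u = chart_vec B V \<psi> (F g0) \<eta>"
   using sub[OF chart_vec_tangent[OF B d]] by blast
  obtain \<xi> where \<xi>: "u = chart_vec A U \<phi> g0 \<xi>" by (rule tangent_chart_vec[OF M u(1) c])
  have "fderiv R ?x0 \<xi> \<bullet> b = \<eta> \<bullet> b" for b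
  proof -
   let ?h = "\<lambda>q. h q \<bullet> b"
   have "fderiv ((?h o F) o cinv U \<phi>) ?x0 = fderiv (\<lambda>x. R x \<bullet> b) ?x0"
    by (rule frechet_derivative_cong_open(2)[OF openin_mtopD[OF A smooth_map_open_vimage[OF A B F Z(1)] c(1)]])
     (use c g Z h(1) iA(1) in \<open>auto simp: R_def\<close>)
   also have "\<dots> = (\<lambda>\<xi>. fderiv R ?x0 \<xi> \<bullet> b)"
    by (rule frechet_derivative_eqI[OF bounded_linear.has_derivative[OF bounded_linear_inner_left Rd]])
   finally have "u (?h o F) = fderiv R ?x0 \<xi> \<bullet> b"
    using smooth_map_fun[OF A B F h(2)] by (simp add: \<xi> chart_vec_def)
   moreover have "u (?h o F) = \<eta> \<bullet> b"
    using fun_cong[OF u(2), of ?h] chart_vec_coordinate[OF B V Z h(1) h(2)] h(2) by (simp add: push_forward_def)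
   ultimately show ?thesis by simp
  qed
  then show ?thesis using euclidean_eqI by blast
 qed
 then obtain \<Xi> where \<Xi>: "\<And>\<eta>. fderiv R ?x0 (\<Xi> \<eta>) = \<eta>" by metis
 \<comment> \<open>A linear right inverse of the derivative of \<open>R\<close>. Its image is the
   slice, and it normalises the derivative of \<open>r\<close> at 0 to the identity.\<close>
 define j where "j t = (\<Sum>b\<in>Basis. (t \<bullet> b) *\<^sub>R \<Xi> b)" for t :: 'm
 have j: "bounded_linear j"
  unfolding j_def[abs_def] by (intro bounded_linear_sum bounded_linear_scaleR_const bounded_linear_inner_left)
 have Rj: "fderiv R ?x0 (j t) = t" for t
  using has_derivative_linear[OF Rd] \<Xi>
  by (simp add: j_def linear_sum linear_scale euclidean_representation)
 define T where "T = (\<lambda>t. ?x0 + j t) -` S"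
 define r where "r t = R (?x0 + j t)" for t
 have cj: "continuous_on UNIV (\<lambda>t. ?x0 + j t)"
  by (intro continuous_intros linear_continuous_on j)
 have T: "open T" "0 \<in> T"
  unfolding T_def using open_vimage[OF S(1) cj] S(2) linear_0[OF bounded_linear.linear[OF j]] by auto
 have aff: "smooth_on T (\<lambda>t. ?x0 + j t)"
  by (rule smooth_on_add[OF T(1) smooth_on_const smooth_on_linear[OF j]])
 have r: "smooth_on T r"
  unfolding r_def[abs_def] by (rule smooth_on_comp[OF T(1) S(1) _ aff R]) (auto simp: T_def)
 have "(r has_derivative (\<lambda>t. fderiv R ?x0 (j t))) (at 0)"
  unfolding r_def[abs_def]
 proof (rule has_derivative_compose[of "\<lambda>t. ?x0 + j t" j 0 UNIV R])
  show "((\<lambda>t. ?x0 + j t) has_derivative j) (at 0)"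
   using bounded_linear_imp_has_derivative[OF j] by (auto intro!: derivative_eq_intros)
  show "(R has_derivative fderiv R ?x0) (at (?x0 + j 0))"
   using Rd linear_0[OF bounded_linear.linear[OF j]] by simp
 qed
 then have r': "fderiv r 0 = (\<lambda>t. t)"
  unfolding Rj by (rule frechet_derivative_eqI)
 show ?thesis
 proof (rule smooth_inverse_function[OF T(1) r T(2) r'])
  fix U' V' \<gamma>
  assume "open U'" "U' \<subseteq> T" "0 \<in> U'" "open V'" "r 0 \<in> V'" "homeomorphism U' V' r \<gamma>" "smooth_on V' \<gamma>"
  note I = this
  have \<gamma>: "\<gamma> y \<in> U'" "r (\<gamma> y) = y" if "y \<in> V'" for y using I(6) that by (auto simp: homeomorphism_def)
  have \<gamma>0: "\<gamma> (r 0) = 0" using I(3,6) by (auto simp: homeomorphism_def)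
  have r0: "r 0 = \<psi> (F g0)"
   using linear_0[OF bounded_linear.linear[OF j]] iA(1)[OF c(2)] by (simp add: r_def R_def)
  define W where "W = V' \<inter> \<psi> ` V"
  have W: "open W" "W \<subseteq> \<psi> ` V" using I(4) pre_manifoldD(2)[OF B d(1)] by (auto simp: W_def)
  define X where "X = V \<inter> \<psi> -` W"
  define s where "s p = cinv U \<phi> (?x0 + j (\<gamma> (\<psi> p)))" for p
  have inS: "?x0 + j (\<gamma> y) \<in> S" if "y \<in> V'" for y using \<gamma>(1)[OF that] I(2) by (auto simp: T_def)
  have s: "s p \<in> U \<and> F (s p) = p" if "p \<in> X" for p
  proof -
   have p: "p \<in> V" "\<psi> p \<in> V'" using that by (auto simp: X_def W_def)
   obtain z where z: "z \<in> U" "F z \<in> V" "?x0 + j (\<gamma> (\<psi> p)) = \<phi> z" using inS[OF p(2)] by (auto simp: S_def)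
   have sz: "s p = z" using z iA(1) by (simp add: s_def)
   have "\<psi> (F (s p)) = r (\<gamma> (\<psi> p))" by (simp add: r_def R_def s_def)
   also have "\<dots> = \<psi> p" using \<gamma>(2)[OF p(2)] .
   finally show ?thesis
    using inj_onD[OF pre_manifoldD(1)[OF B d(1)] _ _ p(1)] z sz by auto
  qed
  show ?thesis
  proof (rule that)
   show "openin (mtop B) X" unfolding X_def by (rule openin_chart_vimage[OF B d(1) W(1)])
   show "F g0 \<in> X" using d(2) I(5) r0 by (auto simp: X_def W_def)
   show "s p \<in> points A \<and> F (s p) = p" if "p \<in> X" for p using s[OF that] pointsI[OF c(1)] by blast
   show "s (F g0) = g0"
    using \<gamma>0 r0 linear_0[OF bounded_linear.linear[OF j]] iA(1)[OF c(2)] by (simp add: s_def)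
   fix f assume f: "smooth_fun A f"
   have 1: "smooth_on (\<phi> ` U) (f o cinv U \<phi>)" using f c(1) by (auto simp: smooth_fun_def)
   have \<gamma>W: "smooth_on W \<gamma>" using I(7) by (rule smooth_on_subset) (auto simp: W_def)
   have 2: "smooth_on W (\<lambda>y. ?x0 + j (\<gamma> y))"
    by (rule smooth_on_add[OF W(1) smooth_on_const smooth_on_linear_comp[OF j W(1) \<gamma>W]])
   have "smooth_on W (\<lambda>y. (f o cinv U \<phi>) (?x0 + j (\<gamma> y)))"
    by (rule smooth_on_comp[OF W(1) pre_manifoldD(2)[OF A c(1)] _ 2 1])
     (use inS in \<open>auto simp: S_def W_def\<close>)
   from smooth_fun_on_chart[OF B d(1) W this]
   show "smooth_fun_on B X (\<lambda>p. f (s p))" by (simp add: X_def s_def o_def)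
  qed
 qed
qed

lemma skew_inner_zero:
 assumes "C \<in> skew"
 shows "(C *v x) \<bullet> x = 0"
proof -
 have 1: "(C *v x) \<bullet> x = (\<Sum>i\<in>UNIV. \<Sum>j\<in>UNIV. C $ i $ j * (x $ i * x $ j))"
  by (simp add: inner_vec_def matrix_vector_mult_def sum_distrib_left sum_distrib_right ac_simps)
 also have "\<dots> = (\<Sum>j\<in>UNIV. \<Sum>i\<in>UNIV. C $ i $ j * (x $ i * x $ j))" by (rule sum.swap)
 also have "\<dots> = (\<Sum>j\<in>UNIV. \<Sum>i\<in>UNIV. - (C $ j $ i * (x $ j * x $ i)))"
 proof (intro sum.cong refl)
  fix i j
  have "C $ i $ j = - C $ j $ i" using assms unfolding skew_iff by blast
  then show "C $ i $ j * (x $ i * x $ j) = - (C $ j $ i * (x $ j * x $ i))" by simp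
 qed
 also have "\<dots> = - ((C *v x) \<bullet> x)" unfolding 1 by (simp add: sum_negf)
 finally show ?thesis by simp
qed

section \<open>Components of Lie algebra elements\<close>

definition p1 :: "('n::finite) quad => real ^ 'n" where "p1 a = fst a"
definition p2 :: "('n::finite) quad => real ^ 'n ^ 'n" where "p2 a = fst (snd a)"
definition p3 :: "('n::finite) quad => real ^ 'n" where "p3 a = fst (snd (snd a))"
definition p4 :: "('n::finite) quad => real ^ 'n ^ 'n" where "p4 a = snd (snd (snd a))"

lemma p_simps [simp]:
 "p1 (x, A, u, C) = x" "p2 (x, A, u, C) = A" "p3 (x, A, u, C) = u" "p4 (x, A, u, C) = C"
 by (simp_all add: p1_def p2_def p3_def p4_def)

lemma p_linear: "linear p1" "linear p2" "linear p3" "linear p4"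
 by (auto intro!: linearI simp: p1_def p2_def p3_def p4_def)

lemma quad_eq: "a = (p1 a, p2 a, p3 a, p4 a)"
 by (simp add: p1_def p2_def p3_def p4_def)

lemma galg_iff: "a \<in> galg \<longleftrightarrow> p2 a \<in> skew \<and> p4 a \<in> skew"
 by (cases a) (simp add: galg_def)

abbreviation ix :: "real ^ 'n => ('n::finite) quad" where "ix x \<equiv> (x, 0, 0, 0)"
abbreviation ik :: "real ^ 'n ^ 'n => ('n::finite) quad" where "ik C \<equiv> (0, 0, 0, C)"

lemma zero_skew: "0 \<in> skew" by (rule subspace_0[OF subspace_skew])

lemma ix_galg [simp]: "ix x \<in> galg" by (simp add: galg_def zero_skew)

lemma ik_galg: "C \<in> skew ==> ik C \<in> galg" by (simp add: galg_def zero_skew)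

lemma gbracket_ik:
 "gbracket a1 a2 a (ik C) = (- (C *v p1 a), - comm C (p2 a), - (C *v p3 a), - comm C (p4 a))"
proof (cases a)
 case (fields x A u E)
 have "comm E C = - comm C E" by (simp add: comm_def)
 then show ?thesis by (simp add: fields wedge_zero comm_zero)
qed

lemma matrix_inner: "A \<bullet> B = (\<Sum>i\<in>UNIV. \<Sum>j\<in>UNIV. A $ i $ j * B $ i $ j)"
 for A B :: "real ^ 'n ^ 'n"
 by (simp add: inner_vec_def)

text \<open>Left multiplication by \<open>C\<close> acts on the columns of \<open>A\<close> and
  right multiplication acts on its rows by \<open>transpose C\<close>; both are skew, so neither has
  a component along \<open>A\<close>.\<close>

lemma comm_inner_zero: "C \<in> skew ==> comm C A \<bullet> A = 0"
proof -
 assume C: "C \<in> skew"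
 have "(C ** A) \<bullet> A = (\<Sum>j\<in>UNIV. (C *v column j A) \<bullet> column j A)"
  unfolding matrix_inner
  by (subst sum.swap) (simp add: inner_vec_def matrix_matrix_mult_def matrix_vector_mult_def column_def)
 then have 1: "(C ** A) \<bullet> A = 0" by (simp add: skew_inner_zero[OF C])
 have "(A ** C) \<bullet> A = (\<Sum>i\<in>UNIV. (transpose C *v A $ i) \<bullet> A $ i)"
  by (simp add: inner_vec_def matrix_matrix_mult_def matrix_vector_mult_def transpose_def mult.commute)
 then have 2: "(A ** C) \<bullet> A = 0"
  using skew_inner_zero[of "transpose C"] C subspace_neg[OF subspace_skew C] by (simp add: skew_def)
 show ?thesis using 1 2 by (simp add: comm_def inner_diff_left)
qed

locale model = lie_frame a1 a2 G A L
 for a1 a2 :: real and G :: "'g monoid" and A :: "('g, 'e::euclidean_space) atlas"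
  and L :: "('n::finite) quad => 'g vfield" +
 fixes K :: "'g set" and M :: "('g set, 'm::euclidean_space) subriem"
 assumes card: "CARD('n) \<ge> 2"
  and Ksub: "connected_lie_subgroup G A K (L ` {(0, 0, 0, C) | C. C \<in> skew})"
  and hs: "homogeneous_space G A K (atl M)"
  and dst_push: "\<And>g. g \<in> carrier G ==> dst M (coset_proj G K g) = range (horizontal_push G L K (atl M) g)"
  and met_push: "\<And>g x y. g \<in> carrier G ==> met M (coset_proj G K g)
   (horizontal_push G L K (atl M) g x) (horizontal_push G L K (atl M) g y) = x \<bullet> y"
begin

abbreviation B :: "('g set, 'm) atlas" where "B \<equiv> atl M"
abbreviation pr :: "'g => 'g set" where "pr \<equiv> coset_proj G K"
abbreviation lift :: "('g set => real) => 'g => real" where "lift f \<equiv> \<lambda>g. f (pr g)"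

definition Pu :: "'g => 'n quad => 'g set tvec" where
 "Pu g b = push_forward B pr (L b g)"

lemma Mb: "smooth_manifold B" and ptsB: "points B = pr ` CG" and pr_smooth: "smooth_map A B pr"
 using hs by (auto simp: homogeneous_space_def)

lemma preB: "pre_manifold B" by (rule smooth_manifold_pre[OF Mb])

lemma pr_point [simp]: "g \<in> CG ==> pr g \<in> points B" by (simp add: ptsB)

lemma pointE:
 assumes "p \<in> points B" obtains g where "g \<in> CG" "p = pr g"
 using assms ptsB by auto

lemma Kgen: "K = generate G {c 1 | c X. X \<in> L ` {(0, 0, 0, C) | C. C \<in> skew} \<and> exp_curve G A X c}"
 using Ksub unfolding connected_lie_subgroup_def by blast

lemma exp_point: "exp_curve G A X c ==> c t \<in> CG"
 by (simp add: exp_curve_def)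

lemma K_subgroup: "subgroup K G"
proof -
 have "{c 1 | c X. X \<in> L ` {(0, 0, 0, C) | C. C \<in> skew} \<and> exp_curve G A X c} \<subseteq> CG"
  using exp_point by blast
 from group.generate_is_subgroup[OF grp this] show ?thesis unfolding Kgen[symmetric] .
qed

lemma K_simps [simp]: "k \<in> K ==> k \<in> CG" "e1 \<in> K"
 "k \<in> K ==> k' \<in> K ==> k \<cdot> k' \<in> K" "k \<in> K ==> gi k \<in> K"
 using subgroup.mem_carrier[OF K_subgroup] subgroup.one_closed[OF K_subgroup]
  subgroup.m_closed[OF K_subgroup] subgroup.m_inv_closed[OF K_subgroup] by auto

lemma pr_K [simp]:
 assumes "g \<in> CG" "k \<in> K"
 shows "pr (g \<cdot> k) = pr g"
proof -
 have "\<exists>k''\<in>K. g \<cdot> k' = g \<cdot> k \<cdot> k''" if "k' \<in> K" for k'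
  using that assms by (intro bexI[of _ "gi k \<cdot> k'"]) (auto simp: assoc)
 moreover have "\<exists>k''\<in>K. g \<cdot> k \<cdot> k' = g \<cdot> k''" if "k' \<in> K" for k'
  using that assms by (intro bexI[of _ "k \<cdot> k'"]) (auto simp: assoc)
 ultimately show ?thesis unfolding coset_proj_def l_coset_def by blast
qed

lemma pr_eq_iff:
 assumes "g \<in> CG" "h \<in> CG"
 shows "pr g = pr h \<longleftrightarrow> gi g \<cdot> h \<in> K"
proof
 assume "pr g = pr h"
 moreover have "h \<cdot> e1 \<in> pr h" unfolding coset_proj_def l_coset_def by (auto intro!: bexI[of _ e1])
 ultimately have "h \<in> pr g" using assms by simp
 then obtain k where "k \<in> K" "h = g \<cdot> k" unfolding coset_proj_def l_coset_def by blast
 then show "gi g \<cdot> h \<in> K" using assms by simp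
next
 assume "gi g \<cdot> h \<in> K"
 from pr_K[OF assms(1) this] show "pr g = pr h" using assms by simp
qed

lemma lift_smooth: "smooth_fun B f ==> smooth_fun A (lift f)"
 using smooth_map_fun[OF pre preB pr_smooth] by (simp add: o_def)

lemma Pu_apply: "Pu g b f = (if smooth_fun B f then L b g (lift f) else 0)"
 by (simp add: Pu_def push_forward_def o_def)

lemma Pu_ext: "(\<And>f. smooth_fun B f ==> L b g (lift f) = L b' g' (lift f)) ==> Pu g b = Pu g' b'"
 by (rule ext) (simp add: Pu_apply)

lemma hp_Pu: "horizontal_push G L K B g x = Pu g (ix x)"
 by (simp add: horizontal_push_def Pu_def)

lemma dst_eq: "g \<in> CG ==> dst M (pr g) = range (\<lambda>x. Pu g (ix x))"
 using dst_push by (simp add: hp_Pu[abs_def])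

lemma met_eq: "g \<in> CG ==> met M (pr g) (Pu g (ix x)) (Pu g (ix y)) = x \<bullet> y"
 using met_push by (simp add: hp_Pu)

lemma Pu_dst [simp]: "g \<in> CG ==> Pu g (ix x) \<in> dst M (pr g)"
 by (simp add: dst_eq)

lemma Pu_tangent: "g \<in> CG ==> b \<in> galg ==> Pu g b \<in> tangent_space B (pr g)"
 unfolding Pu_def by (rule push_forward_tangent[OF pre preB pr_smooth L_tangent])

lemma Pu_surj:
 assumes "g \<in> CG" "v \<in> tangent_space B (pr g)"
 obtains b where "b \<in> galg" "v = Pu g b"
proof -
 have "v \<in> push_forward B pr ` tangent_space A g"
  using hs assms unfolding homogeneous_space_def by blast
 then obtain u where u: "u \<in> tangent_space A g" "v = push_forward B pr u" by blast
 from tangent_L[OF assms(1) u(1)] obtain b where "b \<in> galg" "u = L b g" .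
 then show ?thesis using that u(2) by (simp add: Pu_def)
qed

lemma Pu_add: "a \<in> galg ==> b \<in> galg ==> Pu g (a + b) = (\<lambda>f. Pu g a f + Pu g b f)"
 by (rule ext) (simp add: Pu_apply L_add)

lemma Pu_scale: "a \<in> galg ==> Pu g (r *\<^sub>R a) = (\<lambda>f. r * Pu g a f)"
 by (rule ext) (simp add: Pu_apply L_scale)

lemma Pu_ix_inj:
 assumes "g \<in> CG" "Pu g (ix x) = Pu g (ix y)"
 shows "x = y"
proof -
 have "x \<bullet> z = y \<bullet> z" for z using met_eq[OF assms(1), of _ z] assms(2) by metis
 then show ?thesis by (metis vector_eq_ldot inner_commute)
qed

section \<open>The isotropy group acts by isometries of each component\<close>

lemma exp_curve_deriv:
 "exp_curve G A X c ==> smooth_fun A f ==> ((f o c) has_real_derivative X (c t) f) (at t)"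
 unfolding exp_curve_def by blast

text \<open>Along the flow of \<open>ik C\<close> the vector \<open>l (co g a)\<close> has
  derivative \<open>l (br (co g a) (ik C))\<close>, which hypothesis \<open>z\<close> makes
  orthogonal to the vector itself; so its length is constant.\<close>

lemma exp_curve_smooth_vec_const:
 assumes c: "exp_curve G A (L (ik C)) c" "C \<in> skew" and l: "linear l" and a: "a \<in> galg"
  and z: "\<And>b. b \<in> galg ==> l (br b (ik C)) \<bullet> l b = (0::real)"
 shows "norm (l (co (c t) a) :: 'v::euclidean_space) = norm (l a)"
proof -
 let ?f = "\<lambda>g. l (co g a) \<bullet> l (co g a)"
 have sv: "smooth_vec A (\<lambda>g. l (co g a))" by (rule smooth_vec_linear[OF l co_smooth[OF a]])
 have f: "smooth_fun A ?f" by (rule smooth_vec_inner[OF pre sv sv])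
 have L0: "L (ik C) g ?f = 0" if g: "g \<in> CG" for g
 proof -
  note t = L_tangent[OF ik_galg[OF c(2)] g]
  have d: "dV (L (ik C) g) (\<lambda>g. l (co g a)) = l (br (co g a) (ik C))"
   unfolding dV_linear[OF pre t co_smooth[OF a] l] dV_co[OF a ik_galg[OF c(2)] g] ..
  have "L (ik C) g ?f = l (br (co g a) (ik C)) \<bullet> l (co g a) + l (co g a) \<bullet> l (br (co g a) (ik C))"
   unfolding tangent_inner[OF pre t sv sv] d ..
  also have "\<dots> = 0"
   unfolding inner_commute[of "l (co g a)"] z[OF co_galg[OF g a]] by simp
  finally show ?thesis .
 qed
 have "((?f o c) has_real_derivative 0) (at s)" for s
  using exp_curve_deriv[OF c(1) f, of s] unfolding L0[OF exp_point[OF c(1)]] .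
 then have "(?f o c) t = (?f o c) 0" using DERIV_isconst_all by blast
 then show ?thesis using c(1) co_one[OF a] by (simp add: exp_curve_def norm_eq_sqrt_inner)
qed

text \<open>Equality of the four norms says at once that \<open>co k\<close> maps each of the four
  summands into itself and is isometric there: a component that is zero stays zero.\<close>

definition Kpres :: "'g => bool" where
 "Kpres k \<longleftrightarrow> (\<forall>a\<in>galg. norm (p1 (co k a)) = norm (p1 a) \<and> norm (p2 (co k a)) = norm (p2 a) \<and>
  norm (p3 (co k a)) = norm (p3 a) \<and> norm (p4 (co k a)) = norm (p4 a))"

lemma Kpres_exp:
 assumes c: "exp_curve G A (L (ik C)) c" "C \<in> skew"
 shows "Kpres (c t)"
 unfolding Kpres_def
proof (intro ballI conjI)
 fix a :: "'n quad" assume a: "a \<in> galg"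
 note e = exp_curve_smooth_vec_const[OF c _ a]
 show "norm (p1 (co (c t) a)) = norm (p1 a)"
  by (rule e[OF p_linear(1)]) (simp add: gbracket_ik skew_inner_zero[OF c(2)])
 show "norm (p2 (co (c t) a)) = norm (p2 a)"
  by (rule e[OF p_linear(2)]) (simp add: gbracket_ik comm_inner_zero[OF c(2)])
 show "norm (p3 (co (c t) a)) = norm (p3 a)"
  by (rule e[OF p_linear(3)]) (simp add: gbracket_ik skew_inner_zero[OF c(2)])
 show "norm (p4 (co (c t) a)) = norm (p4 a)"
  by (rule e[OF p_linear(4)]) (simp add: gbracket_ik comm_inner_zero[OF c(2)])
qed

lemma Kpres_inv:
 assumes "k \<in> CG" "Kpres k" shows "Kpres (gi k)"
 unfolding Kpres_def
proof
 fix a :: "'n quad" assume a: "a \<in> galg"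
 have "co (gi k) a \<in> galg" using assms(1) a by simp
 then show "norm (p1 (co (gi k) a)) = norm (p1 a) \<and> norm (p2 (co (gi k) a)) = norm (p2 a) \<and>
  norm (p3 (co (gi k) a)) = norm (p3 a) \<and> norm (p4 (co (gi k) a)) = norm (p4 a)"
  using assms(2) co_inv(2)[OF assms(1) a] unfolding Kpres_def by metis
qed

lemma K_pres: "k \<in> K ==> Kpres k"
proof -
 assume "k \<in> K"
 then have "k \<in> generate G {c 1 | c X. X \<in> L ` {(0, 0, 0, C) | C. C \<in> skew} \<and> exp_curve G A X c}"
  using Kgen by simp
 then have "k \<in> CG \<and> Kpres k"
 proof (induction rule: generate.induct)
  case one
  then show ?case using co_one by (simp add: Kpres_def)
 next
  case (incl h)
  then obtain c C where "h = c 1" "C \<in> skew" "exp_curve G A (L (ik C)) c" by blast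
  then show ?case using Kpres_exp exp_point by blast
 next
  case (inv h)
  then obtain c C where "h = c 1" "C \<in> skew" "exp_curve G A (L (ik C)) c" by blast
  then show ?case using Kpres_exp[of C c 1] exp_point[of "L (ik C)" c 1] Kpres_inv[of h] by simp
 next
  case (eng h h')
  then show ?case using co_mul[of h h'] by (simp add: Kpres_def)
 qed
 then show ?thesis by blast
qed

lemma co_K_ix:
 assumes "k \<in> K"
 shows "co k (ix x) = ix (p1 (co k (ix x)))"
proof -
 have "p2 (co k (ix x)) = 0" "p3 (co k (ix x)) = 0" "p4 (co k (ix x)) = 0"
  using bspec[OF K_pres[OF assms, unfolded Kpres_def] ix_galg[of x]] by simp_all
 then show ?thesis using quad_eq[of "co k (ix x)"] by simp
qed

lemma p1_co_K:
 assumes "k \<in> K" "a \<in> galg"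
 shows "p1 (co k a) = p1 (co k (ix (p1 a)))"
proof -
 have b: "a - ix (p1 a) \<in> galg" by (rule subspace_diff[OF subspace_galg assms(2) ix_galg])
 have "co k a = co k (ix (p1 a)) + co k (a - ix (p1 a))"
  using co_add[of k "ix (p1 a)" "a - ix (p1 a)"] assms b by simp
 moreover have "norm (p1 (co k (a - ix (p1 a)))) = norm (p1 (a - ix (p1 a)))"
  using K_pres[OF assms(1)] b unfolding Kpres_def by blast
 moreover have "p1 (a - ix (p1 a)) = 0" by (simp add: p1_def)
 ultimately show ?thesis by (simp add: linear_add[OF p_linear(1)])
qed

text \<open>The rule for changing the representative of a coset. It is what makes constructions on
  the group descend to the quotient.\<close>

lemma Pu_K:
 assumes "k \<in> K" "g \<in> CG" "b \<in> galg"
 shows "Pu (g \<cdot> k) (co k b) = Pu g b"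
proof (rule Pu_ext)
 fix f assume f: "smooth_fun B f"
 note l = lift_smooth[OF f]
 have "L (co k b) (g \<cdot> k) (lift f) = L (co k b) k (\<lambda>h. lift f (g \<cdot> h))"
  using assms by (intro L_left l) auto
 also have "\<dots> = L b e1 (\<lambda>y. lift f (g \<cdot> (y \<cdot> k)))"
  using assms smooth_fun_lmul[OF l assms(2)] by (intro L_co) auto
 also have "\<dots> = L b e1 (\<lambda>y. lift f (g \<cdot> y))"
  using assms by (intro L_cong) (auto simp: assoc[symmetric])
 also have "\<dots> = L b (g \<cdot> e1) (lift f)"
  using assms by (intro L_left[symmetric] l) auto
 finally show "L (co k b) (g \<cdot> k) (lift f) = L b g (lift f)" using assms by simp
qed

lemma local_section:
 assumes g: "g \<in> CG"
 obtains X s where "openin (mtop B) X" "pr g \<in> X" "\<And>p. p \<in> X ==> s p \<in> CG \<and> pr (s p) = p"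
  "s (pr g) = g" "\<And>f. smooth_fun A f ==> smooth_fun_on B X (\<lambda>p. f (s p))"
proof (rule submersion_section[OF Mf Mb pr_smooth])
 show "g \<in> points A" using g pts by simp
 have 1: "push_forward B pr ` tangent_space A g = tangent_space B (pr g)"
  using hs g unfolding homogeneous_space_def by blast
 show "\<exists>u\<in>tangent_space A g. push_forward B pr u = v" if "v \<in> tangent_space B (pr g)" for v
  using that unfolding 1[symmetric] by blast
 fix X s
 assume "openin (mtop B) X" "pr g \<in> X" "\<And>p. p \<in> X ==> s p \<in> points A \<and> pr (s p) = p"
  "s (pr g) = g" "\<And>f. smooth_fun A f ==> smooth_fun_on B X (\<lambda>p. f (s p))"
 then show thesis unfolding pts by (rule that)
qed

text \<open>Locally, a function on the quotient is its lift composed with a smooth section.\<close>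

lemma descent:
 assumes "smooth_fun A (lift h)"
 shows "smooth_fun B h"
 unfolding smooth_fun_iff_on
proof (rule smooth_fun_on_local[OF preB])
 fix p assume "p \<in> points B"
 then obtain g where g: "g \<in> CG" "p = pr g" by (rule pointE)
 show "\<exists>Y. openin (mtop B) Y \<and> p \<in> Y \<and> smooth_fun_on B Y h"
 proof (rule local_section[OF g(1)])
  fix X s assume X: "openin (mtop B) X" "pr g \<in> X" "\<And>p. p \<in> X ==> s p \<in> CG \<and> pr (s p) = p"
   "\<And>f. smooth_fun A f ==> smooth_fun_on B X (\<lambda>p. f (s p))"
  have "smooth_fun_on B X (\<lambda>p. lift h (s p))" by (rule X(4)[OF assms])
  moreover have "smooth_fun_on B X (\<lambda>p. lift h (s p)) \<longleftrightarrow> smooth_fun_on B X h"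
   by (rule smooth_fun_on_cong[OF preB X(1)]) (use X(3) in auto)
  ultimately show ?thesis using X(1,2) g(2) by blast
 qed
qed

end

context model
begin

section \<open>Translations and the sections defined by the adjoint representation\<close>

definition rep :: "'g set => 'g" where "rep p = (SOME g. g \<in> CG \<and> pr g = p)"

lemma rep_pr:
 assumes "g \<in> CG"
 obtains k where "k \<in> K" "rep (pr g) = g \<cdot> k"
proof -
 have "rep (pr g) \<in> CG \<and> pr (rep (pr g)) = pr g"
  unfolding rep_def by (rule someI[of _ g]) (simp add: assms)
 then show ?thesis using that[of "gi g \<cdot> rep (pr g)"] pr_eq_iff[OF assms, of "rep (pr g)"] assms by auto
qed

lemma smooth_fun_L:
 assumes \<eta>: "smooth_vec A \<eta>" "\<And>g. g \<in> CG ==> \<eta> g \<in> galg" and f: "smooth_fun A f"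
 shows "smooth_fun A (\<lambda>g. L (\<eta> g) g f)"
proof -
 have "smooth_fun A (\<lambda>g. \<Sum>e\<in>Basis. (\<eta> g \<bullet> e) * L (galgp e) g f)"
  by (intro smooth_fun_sum smooth_fun_mult pre smooth_vecD[OF \<eta>(1)] L_smooth galgp_galg f)
 then show ?thesis
  by (subst smooth_fun_cong[OF pre, of _ "\<lambda>g. \<Sum>e\<in>Basis. (\<eta> g \<bullet> e) * L (galgp e) g f"])
   (auto simp: pts L_expand[OF \<eta>(2)])
qed

definition Y :: "'n quad => 'g set vfield" where
 "Y a = (\<lambda>p. if p \<in> points B then Pu (rep p) (ix (p1 (co (rep p) a))) else (\<lambda>_. 0))"

text \<open>The chosen representative differs from \<open>g\<close> by an element of
  \<open>K\<close>, under which the \<open>p1\<close> component transforms by itself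
  (\<open>p1_co_K\<close>); \<open>Pu_K\<close> absorbs the change.\<close>

lemma Y_pr:
 assumes "g \<in> CG" "a \<in> galg"
 shows "Y a (pr g) = Pu g (ix (p1 (co g a)))"
proof -
 obtain k where k: "k \<in> K" "rep (pr g) = g \<cdot> k" by (rule rep_pr[OF assms(1)])
 have "ix (p1 (co (g \<cdot> k) a)) = co k (ix (p1 (co g a)))"
  using p1_co_K[OF k(1) co_galg[OF assms]] co_K_ix[OF k(1)] co_mul[OF assms(1) _ assms(2), of k] k(1) by simp
 then show ?thesis
  using Pu_K[OF k(1) assms(1) ix_galg, of "p1 (co g a)"] assms(1) by (simp add: Y_def k(2))
qed

lemma smooth_vec_ix:
 assumes "smooth_vec A \<zeta>" shows "smooth_vec A (\<lambda>g. ix (\<zeta> g))"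
 by (rule smooth_vec_linear[OF _ assms]) (auto intro: linearI)

lemma sectionI:
 assumes X: "\<And>g. g \<in> CG ==> X (pr g) = Pu g (ix (\<zeta> g))" and \<zeta>: "smooth_vec A \<zeta>"
  and z: "\<And>p. p \<notin> points B ==> X p = (\<lambda>_. 0)"
 shows "X \<in> sections M"
proof -
 have "smooth_fun B (\<lambda>p. X p f)" if f: "smooth_fun B f" for f
 proof (rule descent)
  have "smooth_fun A (\<lambda>g. L (ix (\<zeta> g)) g (lift f))"
   by (rule smooth_fun_L[OF smooth_vec_ix[OF \<zeta>] ix_galg lift_smooth[OF f]])
  then show "smooth_fun A (\<lambda>g. X (pr g) f)"
   by (subst smooth_fun_cong[OF pre, of _ "\<lambda>g. L (ix (\<zeta> g)) g (lift f)"])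
    (auto simp: pts X Pu_apply f)
 qed
 moreover have "X p \<in> tangent_space B p \<and> X p \<in> dst M p" if p: "p \<in> points B" for p
 proof -
  obtain g where "g \<in> CG" "p = pr g" using p by (rule pointE)
  then show ?thesis using X Pu_tangent[OF _ ix_galg] Pu_dst by simp
 qed
 ultimately show ?thesis using z by (auto simp: sections_def vfields_def)
qed

lemma smooth_p1_co: "a \<in> galg ==> smooth_vec A (\<lambda>h. p1 (co h a))"
 by (rule smooth_vec_linear[OF p_linear(1) co_smooth])

lemma Y_section:
 assumes a: "a \<in> galg" shows "Y a \<in> sections M"
 by (rule sectionI[OF Y_pr[OF _ a] smooth_p1_co[OF a]]) (simp_all add: Y_def)

lemma Y_add:
 assumes "a \<in> galg" "b \<in> galg"
 shows "Y (a + b) = (\<lambda>p f. Y a p f + Y b p f)"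
proof
 fix p show "Y (a + b) p = (\<lambda>f. Y a p f + Y b p f)"
 proof (cases "p \<in> points B")
  case True
  then obtain g where g: "g \<in> CG" "p = pr g" by (rule pointE)
  have "ix (p1 (co g (a + b))) = ix (p1 (co g a)) + ix (p1 (co g b))"
   using co_add[OF g(1) assms] by (simp add: linear_add[OF p_linear(1)])
  then show ?thesis
   using Pu_add[OF ix_galg ix_galg, of g "p1 (co g a)" "p1 (co g b)"] g assms
   by (simp add: Y_pr subspace_add[OF subspace_galg] del: add_Pair)
 qed (simp add: Y_def)
qed

lemma Y_scale:
 assumes "a \<in> galg"
 shows "Y (r *\<^sub>R a) = (\<lambda>p f. r * Y a p f)"
proof
 fix p show "Y (r *\<^sub>R a) p = (\<lambda>f. r * Y a p f)"
 proof (cases "p \<in> points B")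
  case True
  then obtain g where g: "g \<in> CG" "p = pr g" by (rule pointE)
  have "ix (p1 (co g (r *\<^sub>R a))) = r *\<^sub>R ix (p1 (co g a))"
   using co_scale[OF g(1) assms] by (simp add: linear_scale[OF p_linear(1)])
  then show ?thesis
   using Pu_scale[OF ix_galg, of g r "p1 (co g a)"] g assms
   by (simp add: Y_pr subspace_scale[OF subspace_galg] del: scaleR_Pair)
 qed (simp add: Y_def)
qed

section \<open>Left translations of the quotient are isometries\<close>

definition tau :: "'g => 'g set => 'g set" where
 "tau g p = (if p \<in> points B then pr (g \<cdot> rep p) else p)"

lemma tau_pr:
 assumes "g \<in> CG" "h \<in> CG"
 shows "tau g (pr h) = pr (g \<cdot> h)"
proof -
 obtain k where k: "k \<in> K" "rep (pr h) = h \<cdot> k" by (rule rep_pr[OF assms(2)])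
 have "g \<cdot> (h \<cdot> k) = g \<cdot> h \<cdot> k" using assms k(1) by (simp add: assoc)
 then show ?thesis using pr_K[of "g \<cdot> h" k] assms k by (simp add: tau_def)
qed

lemma tau_point: "g \<in> CG ==> p \<in> points B ==> tau g p \<in> points B"
 using tau_pr by (metis pointE pr_point group_simps(1))

lemma tau_inverse:
 assumes "g \<in> CG" "p \<in> points B"
 shows "tau (gi g) (tau g p) = p" "tau g (tau (gi g) p) = p"
proof -
 obtain h where h: "h \<in> CG" "p = pr h" using assms(2) by (rule pointE)
 show "tau (gi g) (tau g p) = p" "tau g (tau (gi g) p) = p"
  using assms(1) h by (simp_all add: tau_pr)
qed

lemma tau_smooth:
 assumes "g \<in> CG" "smooth_fun B f"
 shows "smooth_fun B (f o tau g)"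
proof (rule descent)
 show "smooth_fun A (\<lambda>h. (f o tau g) (pr h))"
  using smooth_fun_lmul[OF lift_smooth[OF assms(2)] assms(1)]
  by (subst smooth_fun_cong[OF pre, of _ "\<lambda>h. lift f (g \<cdot> h)"]) (auto simp: pts tau_pr assms(1))
qed

lemma tau_push:
 assumes "g \<in> CG" "h \<in> CG" "b \<in> galg"
 shows "push_forward B (tau g) (Pu h b) = Pu (g \<cdot> h) b"
proof
 fix f
 show "push_forward B (tau g) (Pu h b) f = Pu (g \<cdot> h) b f"
 proof (cases "smooth_fun B f")
  case True
  have "L b h (lift (f o tau g)) = L b h (\<lambda>k. lift f (g \<cdot> k))"
   using assms by (intro L_cong) (auto simp: tau_pr)
  also have "\<dots> = L b (g \<cdot> h) (lift f)"
   using assms by (intro L_left[symmetric] lift_smooth True) auto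
  finally show ?thesis using True tau_smooth[OF assms(1) True] by (simp add: push_forward_def Pu_apply)
 qed (simp add: push_forward_def Pu_apply)
qed

lemma tau_dst:
 assumes "g \<in> CG" "p \<in> points B" "u \<in> dst M p"
 shows "push_forward B (tau g) u \<in> dst M (tau g p)"
  and "met M (tau g p) (push_forward B (tau g) u) (push_forward B (tau g) u) = met M p u u"
proof -
 obtain h where h: "h \<in> CG" "p = pr h" using assms(2) by (rule pointE)
 then obtain x where x: "u = Pu h (ix x)" using assms(3) by (auto simp: dst_eq)
 show "push_forward B (tau g) u \<in> dst M (tau g p)"
  using h assms(1) by (simp add: x tau_push tau_pr)
 show "met M (tau g p) (push_forward B (tau g) u) (push_forward B (tau g) u) = met M p u u"
  using h assms(1) by (simp add: x tau_push tau_pr met_eq)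
qed

lemma tau_continuous: "g \<in> CG ==> continuous_map (mtop B) (mtop B) (tau g)"
proof (rule continuous_map_by_smooth_functions[OF Mb])
 assume g: "g \<in> CG"
 show "tau g x \<in> points B" if "x \<in> topspace (mtop B)" for x
  using that tau_point[OF g] by (simp add: topspace_mtop[OF preB])
 show "continuous_map (mtop B) euclideanreal (\<lambda>x. f (tau g x))" if "smooth_fun B f" for f
  using smooth_fun_continuous_map[OF preB tau_smooth[OF g that]] by (simp add: o_def)
qed

lemma velocity_compose:
 assumes "\<And>f. smooth_fun B f ==> smooth_fun B (f o F)"
 shows "velocity B (F o c) t = push_forward B F (velocity B c t)"
 using assms by (auto simp: velocity_def push_forward_def o_assoc)

lemma pathin_point: "pathin (mtop B) c ==> t \<in> {0..1} ==> c t \<in> points B"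
 unfolding pathin_def using topspace_mtop[OF preB] by (auto simp: continuous_map_def)

lemma horizontal_tau:
 assumes g: "g \<in> CG" and c: "horizontal_curve M c"
 shows "horizontal_curve M (tau g o c)" "curve_length M (tau g o c) = curve_length M c"
proof -
 have p: "pathin (mtop B) c" using c by (simp add: horizontal_curve_def)
 have ae: "AE t in lebesgue. t \<in> {0..1} -->
    (\<forall>f. smooth_fun B f --> (f o c) differentiable (at t)) \<and> velocity B c t \<in> dst M (c t)"
  using c by (simp add: horizontal_curve_def)
 note vel = velocity_compose[of "tau g" c, OF tau_smooth[OF g]]
 show "horizontal_curve M (tau g o c)"
  unfolding horizontal_curve_def
 proof (intro conjI allI impI)
  show "pathin (mtop B) (tau g o c)"
   using p tau_continuous[OF g] unfolding pathin_def by (rule continuous_map_compose)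
  show "abs_continuous_on {0..1} (f o (tau g o c))" if "smooth_fun B f" for f
   using c tau_smooth[OF g that] by (simp add: horizontal_curve_def o_assoc)
  show "AE t in lebesgue. t \<in> {0..1} -->
    (\<forall>f. smooth_fun B f --> (f o (tau g o c)) differentiable (at t)) \<and>
    velocity B (tau g o c) t \<in> dst M ((tau g o c) t)"
   using ae
  proof (rule eventually_mono, intro impI conjI allI)
   fix t assume t: "t \<in> {0..1} -->
    (\<forall>f. smooth_fun B f --> (f o c) differentiable (at t)) \<and> velocity B c t \<in> dst M (c t)"
    and t01: "t \<in> {0..1::real}"
   show "(f o (tau g o c)) differentiable (at t)" if "smooth_fun B f" for f
    using t t01 tau_smooth[OF g that] by (simp add: o_assoc)
   show "velocity B (tau g o c) t \<in> dst M ((tau g o c) t)"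
    using tau_dst(1)[OF g pathin_point[OF p t01], of "velocity B c t"] t t01 by (simp add: vel)
  qed
 qed
 show "curve_length M (tau g o c) = curve_length M c"
  unfolding curve_length_def
 proof (rule nn_integral_cong_AE)
  show "AE t in lebesgue.
    ennreal (sqrt (met M ((tau g o c) t) (velocity B (tau g o c) t) (velocity B (tau g o c) t))) * indicator {0..1} t =
    ennreal (sqrt (met M (c t) (velocity B c t) (velocity B c t))) * indicator {0..1} t"
   using ae
  proof (rule eventually_mono)
   fix t assume t: "t \<in> {0..1} -->
    (\<forall>f. smooth_fun B f --> (f o c) differentiable (at t)) \<and> velocity B c t \<in> dst M (c t)"
   show "ennreal (sqrt (met M ((tau g o c) t) (velocity B (tau g o c) t) (velocity B (tau g o c) t))) * indicator {0..1} t =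
    ennreal (sqrt (met M (c t) (velocity B c t) (velocity B c t))) * indicator {0..1} t"
   proof (cases "t \<in> {0..1}")
    case True
    then show ?thesis
     using tau_dst(2)[OF g pathin_point[OF p True], of "velocity B c t"] t by (simp add: vel)
   qed simp
  qed
 qed
qed

lemma cc_dist_tau_le:
 assumes "g \<in> CG"
 shows "cc_dist M (tau g p) (tau g q) \<le> cc_dist M p q"
 unfolding cc_dist_def[of M p q]
proof (rule INF_greatest)
 fix c assume "c \<in> {c. horizontal_curve M c \<and> c 0 = p \<and> c 1 = q}"
 then have c: "horizontal_curve M c" "c 0 = p" "c 1 = q" by auto
 have "cc_dist M (tau g p) (tau g q) \<le> curve_length M (tau g o c)"
  unfolding cc_dist_def by (rule INF_lower) (use horizontal_tau(1)[OF assms c(1)] c in auto)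
 then show "cc_dist M (tau g p) (tau g q) \<le> curve_length M c"
  using horizontal_tau(2)[OF assms c(1)] by simp
qed

lemma tau_isom:
 assumes g: "g \<in> CG" shows "tau g \<in> isom M"
proof -
 have "homeomorphic_maps (mtop B) (mtop B) (tau g) (tau (gi g))"
  unfolding homeomorphic_maps_def topspace_mtop[OF preB]
  using tau_continuous[OF g] tau_continuous[of "gi g"] tau_inverse[OF g] g by simp
 then have "homeomorphic_map (mtop B) (mtop B) (tau g)" by (rule homeomorphic_maps_imp_map)
 moreover have "cc_dist M (tau g p) (tau g q) = cc_dist M p q" if "p \<in> points B" "q \<in> points B" for p q
 proof (rule antisym[OF cc_dist_tau_le[OF g]])
  show "cc_dist M p q \<le> cc_dist M (tau g p) (tau g q)"
   using cc_dist_tau_le[of "gi g" "tau g p" "tau g q"] tau_inverse(1)[OF g] that g by simp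
 qed
 ultimately show ?thesis by (simp add: isom_def)
qed

lemma inv_into_tau:
 assumes "g \<in> CG" "h \<in> CG"
 shows "inv_into (points B) (tau g) (pr h) = pr (gi g \<cdot> h)"
proof (rule inv_into_f_eq)
 show "inj_on (tau g) (points B)" using tau_inverse(1)[OF assms(1)] by (rule inj_on_inverseI)
qed (use assms in \<open>auto simp: tau_pr\<close>)

text \<open>Left translations permute the right-invariant fields through the adjoint action, and
  taking horizontal parts commutes with left translation.\<close>

lemma Ad_tau_Y:
 assumes "g \<in> CG" "a \<in> galg"
 shows "vf_Ad B (tau g) (Y a) = Y (co (gi g) a)"
proof
 fix p show "vf_Ad B (tau g) (Y a) p = Y (co (gi g) a) p"
 proof (cases "p \<in> points B")
  case True
  then obtain h where h: "h \<in> CG" "p = pr h" by (rule pointE)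
  have "vf_Ad B (tau g) (Y a) p = Pu (g \<cdot> (gi g \<cdot> h)) (ix (p1 (co (gi g \<cdot> h) a)))"
   using assms h by (simp add: vf_Ad_def inv_into_tau Y_pr tau_push del: cancel)
  then show ?thesis using assms h by (simp add: Y_pr co_mul)
 qed (simp add: vf_Ad_def Y_def)
qed

lemma K_exp_curve:
 assumes "C \<in> skew"
 obtains c where "exp_curve G A (L (ik C)) c" "\<forall>t. c t \<in> K"
proof -
 have "L ` {(0, 0, 0, C) | C. C \<in> skew} = {X \<in> left_invariant_fields G A. \<exists>c. exp_curve G A X c \<and> range c \<subseteq> K}"
  using Ksub unfolding connected_lie_subgroup_def by blast
 moreover have "L (ik C) \<in> L ` {(0, 0, 0, C) | C. C \<in> skew}" using assms by blast
 ultimately have "\<exists>c. exp_curve G A (L (ik C)) c \<and> range c \<subseteq> K" by blast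
 then obtain c where "exp_curve G A (L (ik C)) c" "range c \<subseteq> K" by blast
 then show ?thesis using that by blast
qed

lemma exp_curve_vec_derivative:
 assumes c: "exp_curve G A (L b) c" "b \<in> galg" and \<eta>: "smooth_vec A \<eta>"
 shows "((\<lambda>t. \<eta> (c t)) has_vector_derivative dV (L b (c t)) \<eta>) (at t)"
proof -
 have "((\<lambda>t. \<eta> (c t) \<bullet> e) has_real_derivative L b (c t) (\<lambda>h. \<eta> h \<bullet> e)) (at t)" for e
  using exp_curve_deriv[OF c(1) smooth_vecD[OF \<eta>, of e], of t] by (simp add: o_def)
 then have "((\<lambda>t. \<Sum>e\<in>Basis. (\<eta> (c t) \<bullet> e) *\<^sub>R e) has_vector_derivative
   (\<Sum>e\<in>Basis. L b (c t) (\<lambda>h. \<eta> h \<bullet> e) *\<^sub>R e)) (at t)"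
  by (intro has_vector_derivative_sum)
   (auto intro!: derivative_eq_intros simp: has_real_derivative_iff_has_vector_derivative)
 then show ?thesis by (simp add: euclidean_representation dV_def)
qed

end

section \<open>The canonical partial connection\<close>

locale model_connection = model a1 a2 G A L K M
 for a1 a2 :: real and G :: "'g monoid" and A :: "('g, 'e::euclidean_space) atlas"
  and L :: "('n::finite) quad => 'g vfield" and K :: "'g set"
  and M :: "('g set, 'm::euclidean_space) subriem" +
 fixes nab :: "'g set pconn"
 assumes can: "canonical_partial_connection M nab"
begin

lemma sr: "sr_model_space M" and pc: "partial_connection M nab" and mc: "metric_compatible M nab"
 and ii: "isom_invariant M nab"
 using can by (auto simp: canonical_partial_connection_def)

lemma nab_rules:
 assumes "Z \<in> sections M" "p \<in> points B" "u \<in> dst M p"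
 shows "v \<in> dst M p ==> nab Z p (\<lambda>f. u f + v f) = (\<lambda>f. nab Z p u f + nab Z p v f)"
  "nab Z p (\<lambda>f. r * u f) = (\<lambda>f. r * nab Z p u f)"
  "Z' \<in> sections M ==> nab (\<lambda>q f. Z q f + Z' q f) p u = (\<lambda>f. nab Z p u f + nab Z' p u f)"
  "nab (\<lambda>q f. r * Z q f) p u = (\<lambda>f. r * nab Z p u f)"
  "smooth_fun B h ==> nab (\<lambda>q f. h q * Z q f) p u = (\<lambda>f. u h * Z p f + h p * nab Z p u f)"
 using pc assms unfolding partial_connection_def by blast+

lemma Y_at:
 assumes "g \<in> CG" shows "Y (co (gi g) (ix x)) (pr g) = Pu g (ix x)"
 using assms by (simp add: Y_pr co_inv)

lemma nab_dst:
 assumes "Z \<in> sections M" "g \<in> CG"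
 shows "nab Z (pr g) (Pu g (ix x)) \<in> dst M (pr g)"
proof -
 have "(\<lambda>p. nab Z p (Y (co (gi g) (ix x)) p)) \<in> sections M"
  using pc assms Y_section[OF co_galg[OF _ ix_galg]] unfolding partial_connection_def by simp
 then have "nab Z (pr g) (Y (co (gi g) (ix x)) (pr g)) \<in> dst M (pr g)"
  using assms(2) by (simp add: sections_def)
 then show ?thesis using Y_at[OF assms(2)] by simp
qed

definition Bn :: "real ^ 'n => 'n quad => real ^ 'n" where
 "Bn x a = (THE y. nab (Y a) (pr e1) (Pu e1 (ix x)) = Pu e1 (ix y))"

lemma Bn:
 assumes "a \<in> galg"
 shows "nab (Y a) (pr e1) (Pu e1 (ix x)) = Pu e1 (ix (Bn x a))"
 unfolding Bn_def
proof (rule theI')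
 obtain y where y: "nab (Y a) (pr e1) (Pu e1 (ix x)) = Pu e1 (ix y)"
  using nab_dst[OF Y_section[OF assms], of e1 x] by (auto simp: dst_eq)
 show "\<exists>!y. nab (Y a) (pr e1) (Pu e1 (ix x)) = Pu e1 (ix y)"
 proof (rule ex1I[where a = y])
  show "nab (Y a) (pr e1) (Pu e1 (ix x)) = Pu e1 (ix y)" by (rule y)
  show "y' = y" if "nab (Y a) (pr e1) (Pu e1 (ix x)) = Pu e1 (ix y')" for y'
   by (rule Pu_ix_inj[of e1]) (use that y in auto)
 qed
qed

text \<open>Translation by \<open>g\<close> carries \<open>Y (co g a)\<close> to \<open>Y a\<close>,
  so invariance moves the derivative at \<open>pr g\<close> to the base point, where it is
  \<open>Bn\<close>.\<close>

lemma nab_Y: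
 assumes g: "g \<in> CG" and a: "a \<in> galg"
 shows "nab (Y a) (pr g) (Pu g (ix x)) = Pu g (ix (Bn x (co g a)))"
proof -
 have "nab (vf_Ad B (tau g) (Y (co g a))) (pr g) (vf_Ad B (tau g) (Y (ix x)) (pr g)) =
   vf_Ad B (tau g) (\<lambda>q. nab (Y (co g a)) q (Y (ix x) q)) (pr g)"
  using ii tau_isom[OF g] Y_section[OF co_galg[OF g a]] Y_section[OF ix_galg] g
  unfolding isom_invariant_def by simp
 moreover have "vf_Ad B (tau g) (Y (co g a)) = Y a" using Ad_tau_Y[OF g co_galg[OF g a]] co_inv(1)[OF g a] by simp
 moreover have "vf_Ad B (tau g) (Y (ix x)) (pr g) = Pu g (ix x)" using Ad_tau_Y[OF g ix_galg] Y_at[OF g] by simp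
 moreover have "vf_Ad B (tau g) (\<lambda>q. nab (Y (co g a)) q (Y (ix x) q)) (pr g) = Pu g (ix (Bn x (co g a)))"
  using g inv_into_tau[OF g g] Bn[OF co_galg[OF g a]] Y_pr[of e1 "ix x"] co_one[OF ix_galg]
   tau_push[OF g _ ix_galg, of e1]
  by (simp add: vf_Ad_def)
 ultimately show ?thesis by simp
qed

lemma Bn_add_right:
 assumes "a \<in> galg" "b \<in> galg" shows "Bn x (a + b) = Bn x a + Bn x b"
proof -
 have "Pu e1 (ix (Bn x (a + b))) = Pu e1 (ix (Bn x a) + ix (Bn x b))"
  unfolding Pu_add[OF ix_galg ix_galg] Bn[OF assms(1), symmetric] Bn[OF assms(2), symmetric]
   Bn[OF subspace_add[OF subspace_galg assms], symmetric] Y_add[OF assms]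
  by (rule nab_rules(3)[OF Y_section[OF assms(1)] _ _ Y_section[OF assms(2)]]) simp_all
 from Pu_ix_inj[of e1 _ "Bn x a + Bn x b"] this show ?thesis by simp
qed

lemma Bn_scale_right:
 assumes "a \<in> galg" shows "Bn x (r *\<^sub>R a) = r *\<^sub>R Bn x a"
proof -
 have "Pu e1 (ix (Bn x (r *\<^sub>R a))) = Pu e1 (r *\<^sub>R ix (Bn x a))"
  unfolding Pu_scale[OF ix_galg] Bn[OF assms(1), symmetric]
   Bn[OF subspace_scale[OF subspace_galg assms], symmetric] Y_scale[OF assms]
  by (rule nab_rules(4)[OF Y_section[OF assms(1)]]) simp_all
 from Pu_ix_inj[of e1 _ "r *\<^sub>R Bn x a"] this show ?thesis by simp
qed

lemma Bn_add_left:
 assumes "a \<in> galg" shows "Bn (x + y) a = Bn x a + Bn y a"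
proof -
 have "Pu e1 (ix (Bn (x + y) a)) = Pu e1 (ix (Bn x a) + ix (Bn y a))"
  unfolding Pu_add[OF ix_galg ix_galg] Bn[OF assms(1), symmetric]
  using nab_rules(1)[OF Y_section[OF assms], of "pr e1" "Pu e1 (ix x)" "Pu e1 (ix y)"]
   Pu_add[OF ix_galg ix_galg, of e1 x y] by simp
 from Pu_ix_inj[of e1 _ "Bn x a + Bn y a"] this show ?thesis by simp
qed

lemma Bn_scale_left:
 assumes "a \<in> galg" shows "Bn (r *\<^sub>R x) a = r *\<^sub>R Bn x a"
proof -
 have "Pu e1 (ix (Bn (r *\<^sub>R x) a)) = Pu e1 (r *\<^sub>R ix (Bn x a))"
  unfolding Pu_scale[OF ix_galg] Bn[OF assms(1), symmetric]
  using nab_rules(2)[OF Y_section[OF assms], of "pr e1" "Pu e1 (ix x)" r]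
   Pu_scale[OF ix_galg, of e1 r x] by simp
 from Pu_ix_inj[of e1 _ "r *\<^sub>R Bn x a"] this show ?thesis by simp
qed

lemma dV_p1_co:
 assumes "a \<in> galg" "b \<in> galg" "g \<in> CG"
 shows "dV (L b g) (\<lambda>h. p1 (co h a)) = p1 (br (co g a) b)"
 unfolding dV_linear[OF pre L_tangent[OF assms(2,3)] co_smooth[OF assms(1)] p_linear(1)] dV_co[OF assms] ..

text \<open>The derivative of the inner product of \<open>Y a\<close> and \<open>Y c\<close> at the
  base point, computed once on the group by \<open>dV_p1_co\<close> and once by metric
  compatibility.\<close>

lemma metric_Bn:
 assumes a: "a \<in> galg" and c: "c \<in> galg"
 shows "p1 (br a (ix x)) \<bullet> p1 c + p1 a \<bullet> p1 (br c (ix x)) = Bn x a \<bullet> p1 c + p1 a \<bullet> Bn x c"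
proof -
 define m where "m q = met M q (Y a q) (Y c q)" for q
 have lm: "lift m g = p1 (co g a) \<bullet> p1 (co g c)" if "g \<in> CG" for g
  using that a c by (simp add: m_def Y_pr met_eq)
 have "smooth_fun A (lift m)"
  by (subst smooth_fun_cong[OF pre, of _ "\<lambda>g. p1 (co g a) \<bullet> p1 (co g c)"])
   (auto simp: pts lm intro!: smooth_vec_inner[OF pre] smooth_p1_co a c)
 then have m: "smooth_fun B m" by (rule descent)
 have "Y (ix x) (pr e1) m = L (ix x) e1 (lift m)"
  using Y_pr[of e1 "ix x"] co_one[OF ix_galg] by (simp add: Pu_apply m)
 also have "\<dots> = L (ix x) e1 (\<lambda>g. p1 (co g a) \<bullet> p1 (co g c))"
  by (rule L_cong) (auto simp: lm)
 also have "\<dots> = p1 (br a (ix x)) \<bullet> p1 c + p1 a \<bullet> p1 (br c (ix x))"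
  using tangent_inner[OF pre L_tangent[OF ix_galg] smooth_p1_co[OF a] smooth_p1_co[OF c], of e1 x]
   dV_p1_co[OF a ix_galg, of e1 x] dV_p1_co[OF c ix_galg, of e1 x] co_one[OF a] co_one[OF c] by simp
 finally have 1: "Y (ix x) (pr e1) m = p1 (br a (ix x)) \<bullet> p1 c + p1 a \<bullet> p1 (br c (ix x))" .
 have "Y (ix x) (pr e1) m =
   met M (pr e1) (nab (Y a) (pr e1) (Y (ix x) (pr e1))) (Y c (pr e1)) +
   met M (pr e1) (Y a (pr e1)) (nab (Y c) (pr e1) (Y (ix x) (pr e1)))"
  using mc Y_section[OF ix_galg] Y_section[OF a] Y_section[OF c]
  unfolding metric_compatible_def m_def[abs_def] by simp
 also have "\<dots> = Bn x a \<bullet> p1 c + p1 a \<bullet> Bn x c"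
  using a c by (simp add: Y_pr co_one Bn met_eq)
 finally show ?thesis using 1 by simp
qed

lemma p1_br_ix: "p1 (br (ix x) (ix y)) = 0"
 by simp

definition S :: "real ^ 'n => real ^ 'n => real ^ 'n" where "S x y = Bn x (ix y)"

lemma S_skew: "S x y \<bullet> z = - (y \<bullet> S x z)"
 using metric_Bn[of "ix y" "ix z" x] by (simp add: S_def)

lemma S_linear: "linear (S x)" "linear (\<lambda>x. S x y)"
proof -
 show "linear (S x)"
  using Bn_add_right[OF ix_galg ix_galg, of x] Bn_scale_right[OF ix_galg, of x]
  by (intro linearI) (auto simp: S_def)
 show "linear (\<lambda>x. S x y)"
  using Bn_add_left[OF ix_galg] Bn_scale_left[OF ix_galg] by (intro linearI) (auto simp: S_def)
qed

text \<open>A field \<open>Y a\<close> with \<open>p1 a = 0\<close> vanishes at the base point, so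
  compatibility tested against the fields \<open>Y (ix z)\<close> determines its derivative
  completely. Only the summand \<open>ix (p1 a)\<close> leaves an undetermined term, and that is
  \<open>S\<close>.\<close>

lemma Bn_S:
 assumes a: "a \<in> galg" shows "Bn x a = p1 (br a (ix x)) + S x (p1 a)"
proof -
 let ?a = "a - ix (p1 a)"
 have g: "?a \<in> galg" by (rule subspace_diff[OF subspace_galg a ix_galg])
 have p: "p1 ?a = 0" by (simp add: p1_def)
 have "Bn x ?a \<bullet> z = p1 (br ?a (ix x)) \<bullet> z" for z
  using metric_Bn[OF g ix_galg, of x z] p by simp
 then have 1: "Bn x ?a = p1 (br ?a (ix x))" by (metis vector_eq_rdot)
 have "Bn x a = Bn x ?a + S x (p1 a)"
  using Bn_add_right[OF g ix_galg, of x "p1 a"] by (simp add: S_def)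
 moreover have "p1 (br ?a (ix x)) = p1 (br a (ix x)) - p1 (br (ix (p1 a)) (ix x))"
  by (simp only: linear_diff[OF gbracket_linear_left] linear_diff[OF p_linear(1)])
 ultimately show ?thesis using 1 by simp
qed

lemma nab_Y_S:
 assumes "g \<in> CG" "a \<in> galg"
 shows "nab (Y a) (pr g) (Pu g (ix x)) = Pu g (ix (p1 (br (co g a) (ix x)) + S x (p1 (co g a))))"
 using nab_Y[OF assms] Bn_S[OF co_galg[OF assms]] by simp

text \<open>The representatives k and \<open>e1\<close> describe the same point of the quotient; the
  two expressions of one covariant derivative there give the equivariance.\<close>

lemma S_K:
 assumes k: "k \<in> K"
 shows "S (p1 (co k (ix x))) (p1 (co k (ix z))) = p1 (co k (ix (S x z)))"
proof -
 have e: "Pu k (ix (p1 (co k (ix y)))) = Pu e1 (ix y)" for y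
  using Pu_K[OF k _ ix_galg, of e1 y] co_K_ix[OF k, of y] k by simp
 have pk: "pr k = pr e1" using pr_K[of e1 k] k by simp
 have "Pu k (ix (Bn (p1 (co k (ix x))) (co k (ix z)))) = nab (Y (ix z)) (pr k) (Pu k (ix (p1 (co k (ix x)))))"
  using k by (simp add: nab_Y)
 also have "\<dots> = nab (Y (ix z)) (pr e1) (Pu e1 (ix x))" unfolding e pk ..
 also have "\<dots> = Pu e1 (ix (S x z))" by (simp add: Bn S_def)
 also have "\<dots> = Pu k (ix (p1 (co k (ix (S x z)))))" unfolding e ..
 finally have "Bn (p1 (co k (ix x))) (co k (ix z)) = p1 (co k (ix (S x z)))"
  using Pu_ix_inj[of k] k by simp
 then show ?thesis using co_K_ix[OF k, of z] by (simp add: S_def)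
qed

lemma S_bilinear: "bounded_bilinear S"
 using S_linear bilinear_conv_bounded_bilinear unfolding bilinear_def by blast

text \<open>The derivative of \<open>S_K\<close> at the identity along a one-parameter subgroup of
  \<open>K\<close>.\<close>

lemma S_skew_equivariant:
 assumes C: "C \<in> skew"
 shows "S (C *v x) z + S x (C *v z) = C *v S x z"
proof -
 obtain c where c: "exp_curve G A (L (ik C)) c" "\<forall>t. c t \<in> K" by (rule K_exp_curve[OF C])
 have c0: "c 0 = e1" using c(1) by (simp add: exp_curve_def)
 have d: "((\<lambda>t. p1 (co (c t) (ix y))) has_vector_derivative - (C *v y)) (at 0)" for y
  using exp_curve_vec_derivative[OF c(1) ik_galg[OF C] smooth_p1_co[OF ix_galg], of y 0]
   dV_p1_co[OF ix_galg ik_galg[OF C], of e1 y]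
  by (simp add: c0 co_one gbracket_ik)
 have "((\<lambda>t. S (p1 (co (c t) (ix x))) (p1 (co (c t) (ix z)))) has_vector_derivative
   S (p1 (co (c 0) (ix x))) (- (C *v z)) + S (- (C *v x)) (p1 (co (c 0) (ix z)))) (at 0)"
  by (rule bounded_bilinear.has_vector_derivative[OF S_bilinear d d])
 moreover have "(\<lambda>t. S (p1 (co (c t) (ix x))) (p1 (co (c t) (ix z)))) = (\<lambda>t. p1 (co (c t) (ix (S x z))))"
  using S_K[OF c(2)[rule_format]] by blast
 ultimately have "S x (- (C *v z)) + S (- (C *v x)) z = - (C *v S x z)"
  using vector_derivative_unique_at d[of "S x z"] by (simp add: c0 co_one) blast
 then show ?thesis
  using linear_neg[OF S_linear(1)] linear_neg[OF S_linear(2)] by (simp add: algebra_simps)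
qed

end

section \<open>Absolutely continuous functions\<close>

definition ac_modulus :: "real set => (real => real) => real => real => bool" where
 "ac_modulus S f e \<delta> \<longleftrightarrow> \<delta> > 0 \<and> (\<forall>(N::nat) a b. (\<forall>i<N. a i \<le> b i \<and> {a i..b i} \<subseteq> S) -->
   disjoint_family_on (\<lambda>i. {a i<..<b i}) {..<N} -->
   (\<Sum>i<N. b i - a i) < \<delta> --> (\<Sum>i<N. \<bar>f (b i) - f (a i)\<bar>) < e)"

lemma abs_continuous_modulus: "abs_continuous_on S f \<longleftrightarrow> (\<forall>e>0. \<exists>\<delta>. ac_modulus S f e \<delta>)"
 by (simp add: abs_continuous_on_def ac_modulus_def)

lemma ac_modulusD:
 assumes "ac_modulus S f e \<delta>"
 shows "\<delta> > 0" "\<forall>i<N::nat. a i \<le> b i \<and> {a i..b i} \<subseteq> S ==> disjoint_family_on (\<lambda>i. {a i<..<b i}) {..<N} ==>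
  (\<Sum>i<N. b i - a i) < \<delta> ==> (\<Sum>i<N. \<bar>f (b i) - f (a i)\<bar>) < e"
 using assms unfolding ac_modulus_def by simp_all

text \<open>A fundamental theorem of calculus as an inequality, by tagged divisions. Intervals
  tagged outside \<open>N\<close> are controlled by the derivative at the tag and form a Riemann sum
  of \<phi>. Those tagged in \<open>N\<close> lie in an open set \<open>T\<close> of small measure,
  where absolute continuity bounds their total increment.\<close>

lemma abs_continuous_increment_le_integral:
 fixes h \<phi> :: "real => real"
 assumes ac: "abs_continuous_on {0..1} h" and ab: "0 \<le> a" "a \<le> b" "b \<le> 1"
  and N: "N \<in> null_sets lebesgue" and \<phi>0: "\<And>x. 0 \<le> \<phi> x"
  and d: "\<And>x. x \<in> {0..1} - N ==> \<exists>d. (h has_real_derivative d) (at x) \<and> \<bar>d\<bar> \<le> \<phi> x"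
  and I: "(\<phi> has_integral I) {a..b}"
 shows "\<bar>h b - h a\<bar> \<le> I"
proof (rule field_le_epsilon)
 fix e3 :: real assume "e3 > 0"
 \<comment> \<open>One share each for the linear approximation at the tags, for the intervals tagged
   in \<open>N\<close>, and for the Riemann sum.\<close>
 define e where "e = e3 / 3"
 have e: "e > 0" using \<open>e3 > 0\<close> by (simp add: e_def)
 obtain \<gamma>1 where \<gamma>1: "gauge \<gamma>1" "\<And>p. p tagged_division_of {a..b} ==> \<gamma>1 fine p ==>
   norm (sum (\<lambda>(x,k). measure lborel k *\<^sub>R \<phi> x) p - I) < e"
 proof -
  from I[unfolded has_integral_real, rule_format, OF e]
  obtain \<gamma> where g: "gauge \<gamma> \<and> (\<forall>\<D>. \<D> tagged_division_of {a..b} \<and> \<gamma> fine \<D> -->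
    norm (sum (\<lambda>(x,k). measure lborel k *\<^sub>R \<phi> x) \<D> - I) < e)" by (rule exE)
  show ?thesis by (rule that[OF conjunct1[OF g] conjunct2[OF g, rule_format, OF conjI]])
 qed
 obtain \<delta> where "ac_modulus {0..1} h e \<delta>" using ac e abs_continuous_modulus by blast
 note \<delta> = ac_modulusD[OF this]
 obtain T where T: "open T" "N \<subseteq> T" "T - N \<in> lmeasurable" "emeasure lebesgue (T - N) < ennreal \<delta>"
  using sets_lebesgue_outer_open[OF null_setsD2[OF N] \<delta>(1)] by blast
 have "T - N \<union> N = T" using T(2) by blast
 then have "emeasure lebesgue T \<le> emeasure lebesgue (T - N) + emeasure lebesgue N"
  using emeasure_subadditive[OF fmeasurableD[OF T(3)] null_setsD2[OF N]] by metis
 then have Td: "emeasure lebesgue T < ennreal \<delta>" using T(4) N by (simp add: null_setsD1)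
 have "\<exists>r>0. (x \<in> N --> ball x r \<subseteq> T) \<and> (x \<in> {0..1} - N -->
   (\<exists>d. \<bar>d\<bar> \<le> \<phi> x \<and> (\<forall>y. \<bar>y - x\<bar> < r --> \<bar>h y - h x - d * (y - x)\<bar> \<le> e * \<bar>y - x\<bar>)))" for x
 proof (cases "x \<in> N")
  case True
  then obtain r where "r > 0" "ball x r \<subseteq> T" using T(1,2) by (metis open_contains_ball subsetD)
  then show ?thesis using True by blast
 next
  case False
  show ?thesis
  proof (cases "x \<in> {0..1}")
   case True
   then obtain d where d: "(h has_real_derivative d) (at x)" "\<bar>d\<bar> \<le> \<phi> x" using d[of x] False by blast
   have "\<exists>r>0. \<forall>y. norm (y - x) < r --> norm (h y - h x - d * (y - x)) \<le> e * norm (y - x)"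
    using d(1) e unfolding has_field_derivative_def has_derivative_at_alt by blast
   then show ?thesis using False d(2) by auto
  next
   case F: False
   then show ?thesis using False by (intro exI[of _ 1]) auto
  qed
 qed
 then obtain R where R: "\<And>x. R x > 0" "\<And>x. x \<in> N ==> ball x (R x) \<subseteq> T" "\<And>x. x \<in> {0..1} - N ==>
   \<exists>d. \<bar>d\<bar> \<le> \<phi> x \<and> (\<forall>y. \<bar>y - x\<bar> < R x --> \<bar>h y - h x - d * (y - x)\<bar> \<le> e * \<bar>y - x\<bar>)"
  by metis
 define \<gamma> where "\<gamma> x = \<gamma>1 x \<inter> ball x (R x)" for x
 have "gauge \<gamma>" unfolding \<gamma>_def[abs_def]
  by (rule gauge_Int[OF \<gamma>1(1) gauge_ball_dependent]) (use R(1) in blast)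
 then obtain p where p: "p tagged_division_of {a..b}" "\<gamma> fine p" by (rule fine_division_exists_real)
 have p1: "\<gamma>1 fine p" and pR: "\<And>x k. (x, k) \<in> p ==> k \<subseteq> ball x (R x)"
  using p(2) unfolding fine_def \<gamma>_def by blast+
 have fin: "finite p" by (rule tagged_division_ofD(1)[OF p(1)])
 have int: "\<exists>u v. k = {u..v} \<and> u \<le> x \<and> x \<le> v \<and> a \<le> u \<and> v \<le> b" if xk: "(x, k) \<in> p" for x k
 proof -
  obtain u v where uv: "k = {u..v}" using tagged_division_ofD(4)[OF p(1) xk] by auto
  then show ?thesis
   using tagged_division_ofD(2,3)[OF p(1) xk] by auto
 qed
 let ?D = "\<lambda>(x, k). h (Sup k) - h (Inf k)"
 let ?P1 = "{z\<in>p. fst z \<notin> N}" and ?P2 = "{z\<in>p. fst z \<in> N}"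
 have b1: "\<bar>?D z\<bar> \<le> (\<phi> (fst z) + e) * measure lborel (snd z)" if z: "z \<in> ?P1" for z
 proof -
  obtain x k where zxk: "z = (x, k)" by (cases z)
  with z have xk: "z = (x, k)" "(x, k) \<in> p" "x \<notin> N" by auto
  obtain u v where uv: "k = {u..v}" "u \<le> x" "x \<le> v" "a \<le> u" "v \<le> b" using int[OF xk(2)] by blast
  have "x \<in> {0..1} - N" using uv ab xk(3) by auto
  then obtain d where d: "\<bar>d\<bar> \<le> \<phi> x" "\<And>y. \<bar>y - x\<bar> < R x ==> \<bar>h y - h x - d * (y - x)\<bar> \<le> e * \<bar>y - x\<bar>"
   using R(3) by blast
  have "u \<in> k" "v \<in> k" using uv by auto
  then have "u \<in> ball x (R x)" "v \<in> ball x (R x)" using pR[OF xk(2)] by blast+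
  then have "\<bar>h v - h x - d * (v - x)\<bar> \<le> e * (v - x)" "\<bar>h u - h x - d * (u - x)\<bar> \<le> e * (x - u)"
   using d(2)[of u] d(2)[of v] uv(2,3) by (auto simp: dist_real_def)
  moreover have "h v - h u = (h v - h x - d * (v - x)) - (h u - h x - d * (u - x)) + d * (v - u)"
   by (simp add: algebra_simps)
  moreover have "\<bar>d * (v - u)\<bar> \<le> \<phi> x * (v - u)"
   using d(1) uv by (simp add: abs_mult mult_right_mono)
  ultimately have "\<bar>h v - h u\<bar> \<le> e * (v - x) + e * (x - u) + \<phi> x * (v - u)" by linarith
  also have "\<dots> = (\<phi> x + e) * (v - u)" by (simp add: algebra_simps)
  finally show ?thesis using uv xk(1) by simp
 qed
 have b2: "(\<Sum>z\<in>?P2. \<bar>?D z\<bar>) < e"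
 proof -
  obtain q where q: "bij_betw q {0..<card ?P2} ?P2" using ex_bij_betw_nat_finite[of ?P2] fin by auto
  define n where "n = card ?P2"
  have qb: "bij_betw q {..<n} ?P2" using q by (simp add: n_def lessThan_atLeast0)
  have "q i \<in> ?P2" if "i < n" for i using bij_betw_apply[OF qb, of i] that by blast
  then have qp: "q i \<in> p" "fst (q i) \<in> N" if "i < n" for i using that by blast+
  define l where "l i = Inf (snd (q i))" for i
  define r where "r i = Sup (snd (q i))" for i
  have lr: "snd (q i) = {l i..r i} \<and> l i \<le> r i \<and> a \<le> l i \<and> r i \<le> b" if i: "i < n" for i
  proof -
   obtain u v where uv: "snd (q i) = {u..v}" "u \<le> v" "a \<le> u" "v \<le> b"
    using int[of "fst (q i)" "snd (q i)"] qp(1)[OF i] by force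
   then have "l i = u" "r i = v" unfolding l_def r_def uv(1) by simp_all
   with uv show ?thesis by simp
  qed
  have disj: "disjoint_family_on (\<lambda>i. {l i<..<r i}) {..<n}"
   unfolding disjoint_family_on_def
  proof (intro ballI impI)
   fix i j assume ij: "i \<in> {..<n}" "j \<in> {..<n}" "i \<noteq> j"
   then have i: "i < n" "j < n" by auto
   have "q i \<noteq> q j" using bij_betw_imp_inj_on[OF qb] ij by (metis inj_onD)
   then have "(fst (q i), snd (q i)) \<noteq> (fst (q j), snd (q j))" by simp
   then have "interior (snd (q i)) \<inter> interior (snd (q j)) = {}"
    using tagged_division_ofD(5)[OF p(1), of "fst (q i)" "snd (q i)" "fst (q j)" "snd (q j)"]
     qp(1)[OF i(1)] qp(1)[OF i(2)] by simp
   then show "{l i<..<r i} \<inter> {l j<..<r j} = {}"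
    unfolding conjunct1[OF lr[OF i(1)]] conjunct1[OF lr[OF i(2)]] interior_atLeastAtMost_real .
  qed
  have sub: "(\<Union>i<n. {l i<..<r i}) \<subseteq> T"
  proof
   fix y assume "y \<in> (\<Union>i<n. {l i<..<r i})"
   then obtain i where i: "i < n" "y \<in> {l i<..<r i}" by blast
   have "y \<in> snd (q i)" unfolding conjunct1[OF lr[OF i(1)]] using i(2) by simp
   then have "y \<in> ball (fst (q i)) (R (fst (q i)))"
    using pR[of "fst (q i)" "snd (q i)"] qp(1)[OF i(1)] by (auto simp del: mem_ball)
   then show "y \<in> T" using R(2)[OF qp(2)[OF i(1)]] by blast
  qed
  have nn: "0 \<le> r i - l i" if "i < n" for i using lr[OF that] by simp
  have "ennreal (\<Sum>i<n. r i - l i) = (\<Sum>i<n. ennreal (r i - l i))"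
   by (rule sum_ennreal[symmetric]) (use nn in simp)
  also have "\<dots> = (\<Sum>i<n. emeasure lebesgue {l i<..<r i})"
   by (rule sum.cong) (use lr in simp_all)
  also have "\<dots> = emeasure lebesgue (\<Union>i<n. {l i<..<r i})"
   by (rule sum_emeasure[OF _ disj]) auto
  also have "\<dots> \<le> emeasure lebesgue T"
   by (rule emeasure_mono[OF sub]) (use T(1) in simp)
  also note Td
  finally have small: "(\<Sum>i<n. r i - l i) < \<delta>"
   by (subst (asm) ennreal_less_iff) (use nn in \<open>auto intro!: sum_nonneg\<close>)
  have "(\<Sum>i<n. \<bar>h (r i) - h (l i)\<bar>) < e"
   by (rule \<delta>(2)[OF _ disj small]) (use lr ab in force)
  moreover have "(\<Sum>z\<in>?P2. \<bar>?D z\<bar>) = (\<Sum>i<n. \<bar>?D (q i)\<bar>)"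
   by (rule sum.reindex_bij_betw[OF qb, symmetric])
  moreover have "?D (q i) = h (r i) - h (l i)" for i by (simp add: l_def r_def case_prod_unfold)
  ultimately show ?thesis by simp
 qed
 have sump: "sum f p = sum f ?P1 + sum f ?P2" for f :: "real \<times> real set => real"
  by (subst sum.union_disjoint[symmetric]) (use fin in \<open>auto intro!: sum.cong\<close>)
 have "\<bar>h b - h a\<bar> = \<bar>\<Sum>z\<in>p. ?D z\<bar>"
  using additive_tagged_division_1[OF ab(2) p(1), of h] by simp
 also have "\<dots> \<le> (\<Sum>z\<in>p. \<bar>?D z\<bar>)" by (rule sum_abs)
 also have "\<dots> \<le> (\<Sum>z\<in>?P1. (\<phi> (fst z) + e) * measure lborel (snd z)) + e"
  unfolding sump using sum_mono[of ?P1 "\<lambda>z. \<bar>?D z\<bar>", OF b1] b2 by linarith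
 also have "\<dots> \<le> (\<Sum>z\<in>p. (\<phi> (fst z) + e) * measure lborel (snd z)) + e"
  using fin \<phi>0 e by (intro add_right_mono sum_mono2) (auto intro!: mult_nonneg_nonneg add_nonneg_nonneg)
 also have "(\<Sum>z\<in>p. (\<phi> (fst z) + e) * measure lborel (snd z)) =
   (\<Sum>(x,k)\<in>p. measure lborel k *\<^sub>R \<phi> x) + e * (\<Sum>(x,k)\<in>p. measure lborel k)"
  by (simp add: case_prod_unfold algebra_simps sum.distrib sum_distrib_left)
 also have "(\<Sum>(x,k)\<in>p. measure lborel k) = b - a"
  using additive_content_tagged_division[of p a b] p(1) ab(2) by simp
 also have "(\<Sum>(x,k)\<in>p. measure lborel k *\<^sub>R \<phi> x) \<le> I + e"
  using \<gamma>1(2)[OF p(1) p1] by simp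
 also have "e * (b - a) \<le> e" using e ab by (simp add: mult_left_le)
 finally show "\<bar>h b - h a\<bar> \<le> I + e3" by (simp add: e_def)
qed

lemma abs_continuous_imp_continuous:
 assumes "abs_continuous_on {0..1} h"
 shows "continuous_on {0..1} h"
 unfolding continuous_on_iff
proof (intro ballI allI impI)
 fix x e :: real assume x: "x \<in> {0..1}" and e: "e > 0"
 obtain \<delta> where "ac_modulus {0..1} h e \<delta>" using assms e abs_continuous_modulus by blast
 note \<delta> = ac_modulusD[OF this]
 have *: "\<bar>h v - h u\<bar> < e" if "u \<le> v" "v - u < \<delta>" "u \<in> {0..1}" "v \<in> {0..1}" for u v
  using \<delta>(2)[of 1 "\<lambda>_. u" "\<lambda>_. v"] that by (auto simp: disjoint_family_on_def)
 show "\<exists>d>0. \<forall>y\<in>{0..1}. dist y x < d --> dist (h y) (h x) < e"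
 proof (intro exI conjI ballI impI)
  show "dist (h y) (h x) < e" if "y \<in> {0..1}" "dist y x < \<delta>" for y
   using *[of x y] *[of y x] that x by (cases "x \<le> y") (auto simp: dist_real_def abs_minus_commute)
 qed (rule \<delta>(1))
qed

lemma abs_continuous_constant:
 assumes ac: "abs_continuous_on {0..1} h"
  and ae: "AE t in lebesgue. t \<in> {0..1} --> (h has_real_derivative 0) (at t)"
 shows "h 1 = h 0"
proof -
 obtain N where N: "N \<in> null_sets lebesgue" "{t \<in> space lebesgue. \<not> (t \<in> {0..1} --> (h has_real_derivative 0) (at t))} \<subseteq> N"
  using ae unfolding eventually_ae_filter by blast
 have "\<bar>h 1 - h 0\<bar> \<le> 0"
  by (rule abs_continuous_increment_le_integral[OF ac _ _ _ N(1), of 0 1 "\<lambda>_. 0"])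
   (use N(2) in auto)
 then show ?thesis by simp
qed

text \<open>Measurability of \<open>s\<close> is not assumed. A measurable version \<phi> of the
  absolute derivative is therefore built from difference quotients and compared with
  \<open>s\<close> by monotonicity of the integral.\<close>

lemma abs_continuous_increment_le_nn_integral:
 assumes ac: "abs_continuous_on {0..1} h" and ab: "0 \<le> a" "a \<le> b" "b \<le> 1"
  and ae: "AE t in lebesgue. t \<in> {0..1} --> h differentiable (at t) \<and> \<bar>deriv h t\<bar> \<le> C * s t"
  and C: "C \<ge> 0"
 shows "ennreal \<bar>h b - h a\<bar> \<le> ennreal C * (\<integral>\<^sup>+t\<in>{0..1}. ennreal (s t) \<partial>lebesgue)"
proof -
 let ?P = "\<lambda>t. t \<in> {0..1} --> h differentiable (at t) \<and> \<bar>deriv h t\<bar> \<le> C * s t"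
 have "{t \<in> space lebesgue. \<not> ?P t} \<in> null_sets lebesgue"
  using ae unfolding eventually_ae_filter by (blast intro: null_sets_completion_subset)
 moreover have "{0, 1 :: real} \<in> null_sets lebesgue"
  by (rule null_sets_completionI[OF countable_imp_null_set_lborel]) simp
 ultimately have "{t \<in> space lebesgue. \<not> ?P t} \<union> {0, 1} \<in> null_sets lebesgue" by (rule null_sets.Un)
 then have "{t. \<not> ?P t} \<union> {0, 1} \<in> null_sets lebesgue" by simp
 moreover define N where "N = {t. \<not> ?P t} \<union> {0, 1}"
 ultimately have N: "N \<in> null_sets lebesgue" by simp
 define E where "E = {0..1} - N"
 have E: "E \<in> sets lebesgue" unfolding E_def using N by auto
 \<comment> \<open>Difference quotients with arguments clamped to [0, 1], so that they are
   continuous on the whole line and hence measurable.\<close>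
 define g where "g n t = real (Suc n) * (h (max 0 (min 1 (t + 1 / real (Suc n)))) - h (max 0 (min 1 t)))" for n t
 define \<phi> where "\<phi> t = (if t \<in> E then \<bar>lim (\<lambda>n. g n t)\<bar> else 0)" for t
 have cont: "continuous_on UNIV (\<lambda>t. h (max 0 (min 1 (t + c))))" for c
  by (rule continuous_on_compose2[OF abs_continuous_imp_continuous[OF ac]])
   (auto intro!: continuous_intros)
 have "g n \<in> borel_measurable borel" for n
  unfolding g_def[abs_def] using cont[of "1 / real (Suc n)"] cont[of 0]
  by (intro borel_measurable_times borel_measurable_diff borel_measurable_continuous_onI) auto
 then have gm: "g n \<in> borel_measurable lebesgue" for n
  by (intro measurable_completion) simp
 have "(\<lambda>t. lim (\<lambda>n. g n t)) \<in> borel_measurable lebesgue"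
  by (rule borel_measurable_lim_metric[OF gm])
 then have \<phi>m: "\<phi> \<in> borel_measurable lebesgue"
  unfolding \<phi>_def[abs_def] using E by (intro measurable_If_set borel_measurable_abs) auto
 have lim0: "(\<lambda>n. 1 / real (Suc n)) \<longlonglongrightarrow> 0"
  by (rule LIMSEQ_Suc[OF lim_1_over_n])
 have \<phi>E: "(h has_real_derivative deriv h t) (at t) \<and> \<phi> t = \<bar>deriv h t\<bar>" if t: "t \<in> E" for t
 proof
  have t': "0 < t" "t < 1" "h differentiable (at t)" using t by (auto simp: E_def N_def)
  show D: "(h has_real_derivative deriv h t) (at t)"
   using t'(3) DERIV_deriv_iff_real_differentiable by blast
  have "(\<lambda>n. g n t) \<longlonglongrightarrow> deriv h t"
  proof (rule Lim_transform_eventually)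
   have "filterlim (\<lambda>n. 1 / real (Suc n)) (at 0) sequentially"
    unfolding filterlim_at using lim0 by auto
   from filterlim_compose[OF D[unfolded DERIV_def] this]
   show "(\<lambda>n. (h (t + 1 / real (Suc n)) - h t) / (1 / real (Suc n))) \<longlonglongrightarrow> deriv h t" .
   have "\<forall>\<^sub>F n in sequentially. 1 / real (Suc n) < 1 - t"
    using t'(2) by (intro order_tendstoD(2)[OF lim0]) simp
   then show "\<forall>\<^sub>F n in sequentially. (h (t + 1 / real (Suc n)) - h t) / (1 / real (Suc n)) = g n t"
   proof (rule eventually_mono)
    fix n assume "1 / real (Suc n) < 1 - t"
    moreover have "0 < 1 / real (Suc n)" by simp
    ultimately have "max 0 (min 1 (t + 1 / real (Suc n))) = t + 1 / real (Suc n)" "max 0 (min 1 t) = t"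
     using t'(1,2) by linarith+
    then show "(h (t + 1 / real (Suc n)) - h t) / (1 / real (Suc n)) = g n t" by (simp add: g_def)
   qed
  qed
  then show "\<phi> t = \<bar>deriv h t\<bar>" using t by (simp add: \<phi>_def limI)
 qed
 have \<phi>0: "0 \<le> \<phi> t" for t by (simp add: \<phi>_def)
 have le: "(\<integral>\<^sup>+t. ennreal (\<phi> t) \<partial>lebesgue) \<le> ennreal C * (\<integral>\<^sup>+t\<in>{0..1}. ennreal (s t) \<partial>lebesgue)"
 proof -
  have pt: "ennreal (\<phi> t) \<le> ennreal C * (ennreal (s t) * indicator {0..1} t)" for t
  proof (cases "t \<in> E")
   case True
   then have "\<phi> t \<le> C * s t" "t \<in> {0..1}" using \<phi>E[OF True] by (auto simp: E_def N_def)
   then show ?thesis using C by (simp add: ennreal_mult'[symmetric] ennreal_leI)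
  qed (simp add: \<phi>_def)
  show ?thesis
  proof (cases "C = 0")
   case True
   then have "\<phi> t = 0" for t using pt[of t] \<phi>0[of t] by (simp add: ennreal_eq_0_iff)
   then show ?thesis by simp
  next
   case False
   then have C0: "C > 0" using C by simp
   \<comment> \<open>The constant is divided out on the side of \<phi>, because extracting it from
     an integral requires a measurable integrand.\<close>
   have "ennreal (\<phi> t / C) \<le> ennreal (s t) * indicator {0..1} t" for t
   proof -
    have "ennreal C * ennreal (\<phi> t / C) \<le> ennreal C * (ennreal (s t) * indicator {0..1} t)"
     using pt[of t] C0 \<phi>0[of t] by (simp add: ennreal_mult[symmetric])
    then show ?thesis using C0 by (subst (asm) ennreal_mult_le_mult_iff) auto
   qed
   then have "(\<integral>\<^sup>+t. ennreal (\<phi> t / C) \<partial>lebesgue) \<le> (\<integral>\<^sup>+t\<in>{0..1}. ennreal (s t) \<partial>lebesgue)"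
    by (intro nn_integral_mono) auto
   then have "ennreal C * (\<integral>\<^sup>+t. ennreal (\<phi> t / C) \<partial>lebesgue) \<le> ennreal C * (\<integral>\<^sup>+t\<in>{0..1}. ennreal (s t) \<partial>lebesgue)"
    by (rule mult_left_mono) simp
   moreover have "ennreal C * (\<integral>\<^sup>+t. ennreal (\<phi> t / C) \<partial>lebesgue) = (\<integral>\<^sup>+t. ennreal C * ennreal (\<phi> t / C) \<partial>lebesgue)"
    using \<phi>m by (intro nn_integral_cmult[symmetric]) simp
   moreover have "ennreal C * ennreal (\<phi> t / C) = ennreal (\<phi> t)" for t
    using C0 \<phi>0[of t] by (simp add: ennreal_mult[symmetric])
   ultimately show ?thesis by simp
  qed
 qed
 show ?thesis
 proof (cases "(\<integral>\<^sup>+t. ennreal (\<phi> t) \<partial>lebesgue) = \<infinity>")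
  case True
  then show ?thesis using le by (simp add: top_unique)
 next
  case False
  then have int: "integrable lebesgue \<phi>"
   by (intro integrableI_nonneg \<phi>m) (auto simp: \<phi>0 less_top)
  note hi = has_integral_integral_lebesgue[OF int]
  have i1: "\<phi> integrable_on {a..b}"
   using integrable_on_subcbox[OF has_integral_integrable[OF hi], of a b] by simp
  have "\<bar>h b - h a\<bar> \<le> integral {a..b} \<phi>"
  proof (rule abs_continuous_increment_le_integral[OF ac ab N \<phi>0 _ integrable_integral[OF i1]])
   show "\<exists>d. (h has_real_derivative d) (at x) \<and> \<bar>d\<bar> \<le> \<phi> x" if "x \<in> {0..1} - N" for x
    using \<phi>E[of x] that by (auto simp: E_def)
  qed
  also have "\<dots> \<le> integral UNIV \<phi>"
   by (rule integral_subset_le[OF _ i1 has_integral_integrable[OF hi]]) (use \<phi>0 in auto)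
  also have "\<dots> = integral\<^sup>L lebesgue \<phi>" using hi by (rule integral_unique)
  finally have "ennreal \<bar>h b - h a\<bar> \<le> ennreal (integral\<^sup>L lebesgue \<phi>)" by (rule ennreal_leI)
  also have "\<dots> = (\<integral>\<^sup>+t. ennreal (\<phi> t) \<partial>lebesgue)"
   using nn_integral_eq_integral[OF int] \<phi>0 by simp
  finally show ?thesis using le by (rule order_trans)
 qed
qed

text \<open>One comparison from which Lipschitz functions, sums and products are all
  obtained.\<close>

lemma abs_continuous_dominated:
 assumes f: "abs_continuous_on S f" and g: "abs_continuous_on S g" and C: "C > 0"
  and h: "\<And>u v. u \<in> S ==> v \<in> S ==> \<bar>h v - h u\<bar> \<le> C * (\<bar>f v - f u\<bar> + \<bar>g v - g u\<bar>)"
 shows "abs_continuous_on S h"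
 unfolding abs_continuous_modulus
proof (intro allI impI)
 fix e :: real assume "e > 0"
 then have e: "e / (2 * C) > 0" using C by simp
 obtain d1 d2 where d: "ac_modulus S f (e / (2 * C)) d1" "ac_modulus S g (e / (2 * C)) d2"
  using f g e unfolding abs_continuous_modulus by blast
 have "ac_modulus S h e (min d1 d2)"
  unfolding ac_modulus_def
 proof (intro conjI allI impI)
  fix N :: nat and a b :: "nat => real"
  assume ab: "\<forall>i<N. a i \<le> b i \<and> {a i..b i} \<subseteq> S" and dj: "disjoint_family_on (\<lambda>i. {a i<..<b i}) {..<N}"
   and s: "(\<Sum>i<N. b i - a i) < min d1 d2"
  have "(\<Sum>i<N. \<bar>h (b i) - h (a i)\<bar>) \<le> (\<Sum>i<N. C * (\<bar>f (b i) - f (a i)\<bar> + \<bar>g (b i) - g (a i)\<bar>))"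
  proof (rule sum_mono)
   fix i assume "i \<in> {..<N}"
   then have "a i \<le> b i" "{a i..b i} \<subseteq> S" using ab by auto
   then show "\<bar>h (b i) - h (a i)\<bar> \<le> C * (\<bar>f (b i) - f (a i)\<bar> + \<bar>g (b i) - g (a i)\<bar>)" by (intro h) auto
  qed
  also have "\<dots> = C * ((\<Sum>i<N. \<bar>f (b i) - f (a i)\<bar>) + (\<Sum>i<N. \<bar>g (b i) - g (a i)\<bar>))"
   by (simp only: sum.distrib[symmetric] sum_distrib_left)
  also have "\<dots> < C * (e / (2 * C) + e / (2 * C))"
   using s by (intro mult_strict_left_mono[OF _ C] add_strict_mono ac_modulusD(2)[OF d(1) ab dj] ac_modulusD(2)[OF d(2) ab dj]) auto
  finally show "(\<Sum>i<N. \<bar>h (b i) - h (a i)\<bar>) < e" using C by simp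
 qed (use ac_modulusD(1)[OF d(1)] ac_modulusD(1)[OF d(2)] in simp)
 then show "\<exists>\<delta>. ac_modulus S h e \<delta>" ..
qed

lemma Lipschitz_imp_abs_continuous:
 assumes "\<And>s t. s \<in> S ==> t \<in> S ==> \<bar>h t - h s\<bar> \<le> C * \<bar>t - s\<bar>"
 shows "abs_continuous_on S h"
proof (rule abs_continuous_dominated)
 have id: "ac_modulus S (\<lambda>t. t) e e" if "e > 0" for e
  unfolding ac_modulus_def
 proof (intro conjI allI impI that)
  fix N :: nat and a b :: "nat => real"
  assume ab: "\<forall>i<N. a i \<le> b i \<and> {a i..b i} \<subseteq> S" and s: "(\<Sum>i<N. b i - a i) < e"
  have "(\<Sum>i<N. \<bar>b i - a i\<bar>) = (\<Sum>i<N. b i - a i)" using ab by (intro sum.cong) auto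
  then show "(\<Sum>i<N. \<bar>b i - a i\<bar>) < e" using s by simp
 qed
 then show "abs_continuous_on S (\<lambda>t. t)" "abs_continuous_on S (\<lambda>t. t)"
  unfolding abs_continuous_modulus by blast+
 show "\<bar>h v - h u\<bar> \<le> max C 1 * (\<bar>v - u\<bar> + \<bar>v - u\<bar>)" if "u \<in> S" "v \<in> S" for u v
 proof -
  have "C * \<bar>v - u\<bar> \<le> max C 1 * \<bar>v - u\<bar>" by (rule mult_right_mono) auto
  moreover have "0 \<le> max C 1 * \<bar>v - u\<bar>" by simp
  ultimately show ?thesis using assms[OF that] by (simp add: distrib_left)
 qed
qed simp

lemma abs_continuous_sum:
 assumes "finite I" "\<And>i. i \<in> I ==> abs_continuous_on S (f i)"
 shows "abs_continuous_on S (\<lambda>t. \<Sum>i\<in>I. f i t)"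
 using assms
proof (induction I rule: finite_induct)
 case empty
 show ?case by (rule Lipschitz_imp_abs_continuous[of _ _ 0]) simp
next
 case (insert j I)
 show ?case
  by (rule abs_continuous_dominated[of _ "f j" "\<lambda>t. \<Sum>i\<in>I. f i t" 1]) (use insert in auto)
qed

lemma abs_continuous_mult:
 assumes f: "abs_continuous_on {0..1} f" and g: "abs_continuous_on {0..1} g"
 shows "abs_continuous_on {0..1} (\<lambda>t. f t * g t)"
proof -
 have bd: "\<exists>C>0. \<forall>t\<in>{0..1::real}. \<bar>h t\<bar> \<le> C" if "abs_continuous_on {0..1} h" for h
 proof -
  have "bounded (h ` {0..1})"
   by (rule compact_imp_bounded[OF compact_continuous_image[OF abs_continuous_imp_continuous[OF that]]]) simp
  then show ?thesis by (auto simp: bounded_pos)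
 qed
 obtain C D where C: "C > 0" "\<forall>t\<in>{0..1}. \<bar>f t\<bar> \<le> C" and D: "D > 0" "\<forall>t\<in>{0..1}. \<bar>g t\<bar> \<le> D"
  using bd[OF f] bd[OF g] by blast
 show ?thesis
 proof (rule abs_continuous_dominated[OF f g])
  fix u v :: real assume uv: "u \<in> {0..1}" "v \<in> {0..1}"
  have "f v * g v - f u * g u = g v * (f v - f u) + f u * (g v - g u)" by (simp add: algebra_simps)
  also have "\<bar>\<dots>\<bar> \<le> \<bar>g v\<bar> * \<bar>f v - f u\<bar> + \<bar>f u\<bar> * \<bar>g v - g u\<bar>"
   by (rule order_trans[OF abs_triangle_ineq]) (simp add: abs_mult)
  also have "\<dots> \<le> max C D * \<bar>f v - f u\<bar> + max C D * \<bar>g v - g u\<bar>"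
   by (intro add_mono mult_right_mono) (use C(2) D(2) uv in \<open>auto simp: le_max_iff_disj\<close>)
  finally show "\<bar>f v * g v - f u * g u\<bar> \<le> max C D * (\<bar>f v - f u\<bar> + \<bar>g v - g u\<bar>)" by (simp add: distrib_left)
 qed (use C in auto)
qed

section \<open>Integral curves\<close>

lemma smooth_on_Lipschitz_cball:
 fixes X :: "'a::euclidean_space => 'a"
 assumes "smooth_on S X" "cball x0 r \<subseteq> S"
 obtains C where "C \<ge> 0" "\<And>x y. x \<in> cball x0 r ==> y \<in> cball x0 r ==> norm (X x - X y) \<le> C * norm (x - y)"
proof -
 let ?D = "\<lambda>x. fderiv X x"
 have "\<exists>C. \<forall>x\<in>cball x0 r. norm (?D x b) \<le> C" for b
 proof -
  have "continuous_on (cball x0 r) (\<lambda>x. ?D x b)"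
   by (rule continuous_on_subset[OF smooth_on_continuous[OF smooth_on_frechet[OF assms(1)]] assms(2)])
  then have "bounded ((\<lambda>x. ?D x b) ` cball x0 r)"
   by (intro compact_imp_bounded compact_continuous_image) auto
  then show ?thesis by (auto simp: bounded_iff)
 qed
 then obtain c where c: "\<And>b x. x \<in> cball x0 r ==> norm (?D x b) \<le> c b" by metis
 define C where "C = (\<Sum>b\<in>(Basis::'a set). \<bar>c b\<bar>)"
 have d: "(X has_derivative ?D x) (at x)" if "x \<in> cball x0 r" for x
  using smooth_on_has_derivative[OF assms(1)] that assms(2) by blast
 have on: "onorm (?D x) \<le> C" if x: "x \<in> cball x0 r" for x
 proof (rule onorm_le)
  fix v
  have "?D x v = (\<Sum>b\<in>Basis. (v \<bullet> b) *\<^sub>R ?D x b)"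
   by (rule linear_Basis_sum[OF has_derivative_linear[OF d[OF x]]])
  also have "norm \<dots> \<le> (\<Sum>b\<in>Basis. norm v * \<bar>c b\<bar>)"
  proof (rule sum_norm_le)
   fix b :: 'a assume b: "b \<in> Basis"
   have "norm (?D x b) \<le> \<bar>c b\<bar>" using c[OF x, of b] by linarith
   then show "norm ((v \<bullet> b) *\<^sub>R ?D x b) \<le> norm v * \<bar>c b\<bar>"
    using Basis_le_norm[OF b, of v] by (simp add: mult_mono)
  qed
  finally show "norm (?D x v) \<le> C * norm v" by (simp add: C_def sum_distrib_left mult.commute)
 qed
 have "C \<ge> 0" unfolding C_def by (simp add: sum_nonneg)
 moreover have "norm (X x - X y) \<le> C * norm (x - y)" if "x \<in> cball x0 r" "y \<in> cball x0 r" for x y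
  by (rule differentiable_bound[OF convex_cball has_derivative_at_withinI[OF d] on that]) auto
 ultimately show ?thesis by (rule that)
qed

text \<open>Banach's fixed point theorem on the bounded continuous functions of the line. Clamping
  time to [-e, e] by \<open>cl\<close> keeps the integral operator \<open>T\<close> inside that
  space and is invisible for |t| < e. Taking a difference of two integrals from -e treats both signs
  of t at once.\<close>

lemma Picard_Lindelof_global:
 fixes X :: "'a::euclidean_space => 'a"
 assumes C: "C \<ge> 0" "\<And>x y. norm (X x - X y) \<le> C * norm (x - y)"
 obtains \<epsilon> \<gamma> where "\<epsilon> > 0" "\<gamma> 0 = x0"
  "\<And>t. \<bar>t\<bar> < \<epsilon> ==> (\<gamma> has_vector_derivative X (\<gamma> t)) (at t)"
proof -
 \<comment> \<open>Chosen to make 4 e C < 1: the two integrals in \<open>T\<close> each contribute 2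
   e C to the contraction constant.\<close>
 define e where "e = 1 / (5 * (C + 1))"
 have e: "e > 0" "4 * e * C < 1" using C(1) by (auto simp: e_def field_simps)
 have Xc: "continuous_on UNIV X"
 proof (rule continuous_onI)
  fix x and r :: real assume r: "r > 0"
  show "\<exists>d>0. \<forall>x'\<in>UNIV. dist x' x < d --> dist (X x') (X x) \<le> r"
  proof (intro exI[of _ "r / (C + 1)"] conjI ballI impI)
   fix x' assume "dist x' x < r / (C + 1)"
   then have "(C + 1) * norm (x' - x) < r" using C(1) by (simp add: dist_norm field_simps)
   moreover have "C * norm (x' - x) \<le> (C + 1) * norm (x' - x)" by (simp add: mult_right_mono)
   ultimately show "dist (X x') (X x) \<le> r" using C(2)[of x' x] by (simp add: dist_norm)
  qed (use r C in simp)
 qed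
 define I where "I c s = integral {-e..s} (\<lambda>u. X (c u))" for c :: "real => 'a" and s
 define cl where "cl t = max (- e) (min e t)" for t :: real
 define T where "T c t = x0 + (I c (cl t) - I c 0)" for c t
 have clm: "cl t \<in> {-e..e}" for t using e by (auto simp: cl_def)
 have clc: "continuous_on UNIV cl" unfolding cl_def[abs_def] by (intro continuous_intros)
 have Xcc: "continuous_on S (\<lambda>u. X (c u))" if "continuous_on UNIV c" for c and S :: "real set"
  by (rule continuous_on_subset[OF continuous_on_compose2[OF Xc that]]) auto
 have Ic: "continuous_on {-e..e} (I c)" if "continuous_on UNIV c" for c
  unfolding I_def[abs_def]
  by (rule indefinite_integral_continuous_1[OF integrable_continuous_real[OF Xcc[OF that]]])
 have Tc: "T c \<in> bcontfun" if c: "continuous_on UNIV c" for c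
  unfolding bcontfun_def
 proof (intro CollectI conjI)
  have ct: "continuous_on UNIV (\<lambda>t. I c (cl t))"
   by (rule continuous_on_compose2[OF Ic[OF c] clc]) (use clm in auto)
  then show "continuous_on UNIV (T c)" unfolding T_def[abs_def] by (intro continuous_intros)
  have "range (T c) \<subseteq> (\<lambda>s. x0 + (I c s - I c 0)) ` {-e..e}" using clm by (auto simp: T_def)
  moreover have "compact ((\<lambda>s. x0 + (I c s - I c 0)) ` {-e..e})"
   by (intro compact_continuous_image continuous_intros Ic c) auto
  ultimately show "bounded (range (T c))" using bounded_subset compact_imp_bounded by blast
 qed
 define P where "P c = Bcontfun (T (apply_bcontfun c))" for c :: "real \<Rightarrow>\<^sub>C 'a"
 have P: "apply_bcontfun (P c) = T (apply_bcontfun c)" for c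
  unfolding P_def by (rule Bcontfun_inverse) (rule Tc, simp)
 have Id: "norm (I c s - I d s) \<le> 2 * e * (C * dist c d)" if s: "s \<in> {-e..e}" for c d :: "real \<Rightarrow>\<^sub>C 'a" and s
 proof -
  have i: "(\<lambda>u. X (apply_bcontfun c u)) integrable_on {-e..s}" for c :: "real \<Rightarrow>\<^sub>C 'a"
   by (rule integrable_continuous_real[OF Xcc]) simp
  have "I c s - I d s = integral {-e..s} (\<lambda>u. X (apply_bcontfun c u) - X (apply_bcontfun d u))"
   unfolding I_def by (rule integral_diff[OF i i, symmetric])
  also have "norm \<dots> \<le> (C * dist c d) * (s - - e)"
  proof (rule integral_bound)
   show "continuous_on {-e..s} (\<lambda>u. X (apply_bcontfun c u) - X (apply_bcontfun d u))"
    by (intro continuous_intros Xcc) simp_all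
   fix u
   have "norm (X (apply_bcontfun c u) - X (apply_bcontfun d u)) \<le> C * norm (apply_bcontfun c u - apply_bcontfun d u)"
    by (rule C(2))
   also have "\<dots> \<le> C * dist c d" using dist_bounded[of c u d] C(1) by (simp add: dist_norm mult_left_mono)
   finally show "norm (X (apply_bcontfun c u) - X (apply_bcontfun d u)) \<le> C * dist c d" .
  qed (use s in auto)
  also have "\<dots> \<le> (C * dist c d) * (2 * e)" using s C(1) by (intro mult_left_mono) auto
  finally show ?thesis by (simp add: mult_ac)
 qed
 have e0: "0 \<in> {-e..e}" using e by simp
 have "dist (P c) (P d) \<le> (4 * e * C) * dist c d" for c d
 proof (rule dist_bound)
  fix t
  have "dist (apply_bcontfun (P c) t) (apply_bcontfun (P d) t) =
    norm ((I c (cl t) - I d (cl t)) - (I c 0 - I d 0))"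
   unfolding P T_def dist_norm by (simp add: algebra_simps)
  also have "\<dots> \<le> norm (I c (cl t) - I d (cl t)) + norm (I c 0 - I d 0)" by (rule norm_triangle_ineq4)
  also have "\<dots> \<le> 2 * e * (C * dist c d) + 2 * e * (C * dist c d)" by (rule add_mono[OF Id[OF clm] Id[OF e0]])
  finally show "dist (apply_bcontfun (P c) t) (apply_bcontfun (P d) t) \<le> (4 * e * C) * dist c d"
   by (simp add: algebra_simps)
 qed
 then have "\<exists>!c. P c = c" using e C(1) by (intro banach_fix_type[of "4 * e * C"]) auto
 then obtain c where "P c = c" by blast
 then have c: "apply_bcontfun c = T c" using P[of c] by simp
 have cc: "continuous_on UNIV (apply_bcontfun c)" by simp
 show ?thesis
 proof (rule that[OF e(1)])
  show "apply_bcontfun c 0 = x0" by (subst c) (use e in \<open>simp add: T_def cl_def\<close>)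
  fix t :: real assume t: "\<bar>t\<bar> < e"
  have "(I c has_vector_derivative X (apply_bcontfun c t)) (at t within {-e..e})"
   unfolding I_def[abs_def] by (rule integral_has_vector_derivative[OF Xcc[OF cc]]) (use t in auto)
  then have "(I c has_vector_derivative X (apply_bcontfun c t)) (at t)"
   using at_within_Icc_at[of "- e" t e] t by (simp add: abs_less_iff)
  then have "((\<lambda>s. x0 + (I c s - I c 0)) has_vector_derivative X (apply_bcontfun c t)) (at t)"
   by (auto intro!: derivative_eq_intros)
  then show "(apply_bcontfun c has_vector_derivative X (apply_bcontfun c t)) (at t)"
  proof (rule has_vector_derivative_transform_within_open[of _ _ _ "{-e<..<e}"])
   show "x0 + (I c s - I c 0) = apply_bcontfun c s" if "s \<in> {-e<..<e}" for s
    using that by (subst c) (simp add: T_def cl_def)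
  qed (use t in auto)
 qed
qed

text \<open>Precomposing with the nearest-point projection onto a closed ball, which is 1-Lipschitz,
  makes the field globally Lipschitz. The global solution stays in the ball for a short time and
  there solves the original equation.\<close>

lemma Picard_Lindelof:
 fixes X :: "'a::euclidean_space => 'a"
 assumes S: "open S" "x0 \<in> S" "smooth_on S X"
 obtains \<epsilon> \<gamma> where "\<epsilon> > 0" "\<gamma> 0 = x0"
  "\<And>t. \<bar>t\<bar> < \<epsilon> ==> \<gamma> t \<in> S" "\<And>t. \<bar>t\<bar> < \<epsilon> ==> (\<gamma> has_vector_derivative X (\<gamma> t)) (at t)"
proof -
 obtain r where r: "r > 0" "cball x0 r \<subseteq> S" using S open_contains_cball by blast
 obtain C where C: "C \<ge> 0" "\<And>x y. x \<in> cball x0 r ==> y \<in> cball x0 r ==> norm (X x - X y) \<le> C * norm (x - y)"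
  using smooth_on_Lipschitz_cball[OF S(3) r(2)] by blast
 define q where "q = closest_point (cball x0 r)"
 have q: "q x \<in> cball x0 r" for x unfolding q_def by (rule closest_point_in_set) (use r in auto)
 have "norm (X (q x) - X (q y)) \<le> C * norm (x - y)" for x y
 proof -
  have "norm (X (q x) - X (q y)) \<le> C * norm (q x - q y)" by (rule C(2)[OF q q])
  also have "\<dots> \<le> C * norm (x - y)"
   using closest_point_lipschitz[of "cball x0 r" x y] r(1) C(1)
   by (intro mult_left_mono) (auto simp: q_def dist_norm)
  finally show ?thesis .
 qed
 then obtain e \<gamma> where e: "e > 0" "\<gamma> 0 = x0"
  "\<And>t. \<bar>t\<bar> < e ==> (\<gamma> has_vector_derivative X (q (\<gamma> t))) (at t)"
  using Picard_Lindelof_global[OF C(1), of "\<lambda>x. X (q x)" x0] by blast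
 have "isCont \<gamma> 0" using e(3)[of 0] e(1) by (intro has_vector_derivative_continuous) auto
 then obtain d where d: "d > 0" "\<And>t. \<bar>t\<bar> < d ==> dist (\<gamma> t) x0 < r"
  using r(1) e(2) unfolding continuous_at_eps_delta by (metis dist_0_norm dist_commute real_norm_def)
 have m: "\<gamma> t \<in> cball x0 r" if "\<bar>t\<bar> < d" for t using d(2)[OF that] by (simp add: dist_commute)
 have mq: "q (\<gamma> t) = \<gamma> t" if "\<bar>t\<bar> < d" for t unfolding q_def by (rule closest_point_self[OF m[OF that]])
 show ?thesis
 proof (rule that[of "min e d" \<gamma>])
  show "(\<gamma> has_vector_derivative X (\<gamma> t)) (at t)" if "\<bar>t\<bar> < min e d" for t
   using e(3)[of t] mq[of t] that by simp
  show "\<gamma> t \<in> S" if "\<bar>t\<bar> < min e d" for t using m[of t] r(2) that by auto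
 qed (use e d in auto)
qed

text \<open>In a chart the components of the field are its values on the cut-off coordinate
  functions \<open>h\<close>; this turns a field of derivations into an ordinary differential
  equation.\<close>

lemma integral_curve:
 fixes A :: "('p, 'e::euclidean_space) atlas"
 assumes M: "smooth_manifold A" and p: "p \<in> points A"
  and X: "\<And>q. q \<in> points A ==> X q \<in> tangent_space A q"
   "\<And>f. smooth_fun A f ==> smooth_fun A (\<lambda>q. X q f)"
 obtains \<epsilon> c where "\<epsilon> > 0" "c 0 = p" "\<And>t. \<bar>t\<bar> < \<epsilon> ==> c t \<in> points A"
  "\<And>t f. \<bar>t\<bar> < \<epsilon> ==> smooth_fun A f ==> ((\<lambda>s. f (c s)) has_real_derivative X (c t) f) (at t)"
proof -
 note A = smooth_manifold_pre[OF M]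
 obtain U \<phi> Z h where U: "(U, \<phi>) \<in> A" and Z: "openin (mtop A) Z" "p \<in> Z" "Z \<subseteq> U"
  and h: "\<And>q. q \<in> Z ==> h q = \<phi> q" "\<And>w. smooth_fun A (\<lambda>q. h q \<bullet> w)"
  by (rule chart_coordinates[OF M p]) (rule that)
 let ?i = "cinv U \<phi>"
 note i = chart_inv[OF pre_manifoldD(1)[OF A U]]
 define S where "S = \<phi> ` (U \<inter> Z)"
 have S: "open S" "\<phi> p \<in> S" "S \<subseteq> \<phi> ` U" unfolding S_def using openin_mtopD[OF A Z(1) U] Z by auto
 have SZ: "?i x \<in> Z" "\<phi> (?i x) = x" "?i x \<in> U" if "x \<in> S" for x using that i by (auto simp: S_def)
 define \<xi> where "\<xi> x = (\<Sum>b\<in>Basis. X (?i x) (\<lambda>q. h q \<bullet> b) *\<^sub>R b)" for x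
 have "smooth_on S (\<lambda>x. X (?i x) (\<lambda>q. h q \<bullet> b))" for b
 proof (rule smooth_on_subset[OF _ S(3)])
  show "smooth_on (\<phi> ` U) (\<lambda>x. X (?i x) (\<lambda>q. h q \<bullet> b))"
   using X(2)[OF h(2)[of b]] U unfolding smooth_fun_def by (auto simp: o_def)
 qed
 then have "smooth_on S \<xi>"
  unfolding \<xi>_def[abs_def] by (intro smooth_on_sum smooth_on_scaleR S(1) smooth_on_const)
 from Picard_Lindelof[OF S(1,2) this] obtain e \<gamma> where e: "e > 0" "\<gamma> 0 = \<phi> p"
  "\<And>t. \<bar>t\<bar> < e ==> \<gamma> t \<in> S" "\<And>t. \<bar>t\<bar> < e ==> (\<gamma> has_vector_derivative \<xi> (\<gamma> t)) (at t)" by blast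
 show ?thesis
 proof (rule that[OF e(1), of "\<lambda>t. ?i (\<gamma> t)"])
  show "?i (\<gamma> 0) = p" using e(2) i(1) Z by auto
  fix t :: real assume t: "\<bar>t\<bar> < e"
  note q = SZ[OF e(3)[OF t]]
  show pt: "?i (\<gamma> t) \<in> points A" using q(3) U by (rule pointsI[rotated])
  fix f assume f: "smooth_fun A f"
  obtain \<zeta> where \<zeta>: "X (?i (\<gamma> t)) = chart_vec A U \<phi> (?i (\<gamma> t)) \<zeta>"
   using tangent_chart_vec[OF M X(1)[OF pt] U q(3)] by blast
  have "X (?i (\<gamma> t)) (\<lambda>q. h q \<bullet> b) = \<zeta> \<bullet> b" for b
   unfolding \<zeta> by (rule chart_vec_coordinate[OF A U Z(1) q(1) Z(3) h])
  then have \<xi>: "\<xi> (\<gamma> t) = \<zeta>" unfolding \<xi>_def by (simp add: euclidean_representation)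
  have "((f o ?i) o \<gamma> has_vector_derivative fderiv (f o ?i) (\<gamma> t) (\<xi> (\<gamma> t))) (at t)"
  proof (rule vector_derivative_diff_chain_within)
   show "(\<gamma> has_vector_derivative \<xi> (\<gamma> t)) (at t)" by (rule e(4)[OF t])
   show "((f o ?i) has_derivative fderiv (f o ?i) (\<gamma> t)) (at (\<gamma> t) within range \<gamma>)"
    using smooth_fun_chart_derivative[OF f U q(3)] q(2) by (simp add: has_derivative_at_withinI)
  qed
  then show "((\<lambda>s. f (?i (\<gamma> s))) has_real_derivative X (?i (\<gamma> t)) f) (at t)"
   unfolding \<zeta> chart_vec_def using f q(2) \<xi> by (simp add: has_real_derivative_iff_has_vector_derivative o_def)
 qed
qed

section \<open>The torsion in dimension two\<close>

context model_connection begin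

text \<open>Skew maps of the plane are multiples of the quarter turn \<open>J\<close>, so
  \<open>S u\<close> commutes with \<open>J\<close>. Equivariance under \<open>J\<close> then
  reduces to S (J u) = 0, and \<open>J\<close> is onto.\<close>

lemma S_zero_2:
 assumes "CARD('n) = 2"
 shows "S x y = 0"
proof -
 obtain i j :: 'n where ij: "i \<noteq> j" "UNIV = {i, j}" using assms by (auto simp: card_2_iff)
 define J :: "real ^ 'n ^ 'n" where "J = (\<chi> k l. if k = i \<and> l = j then 1 else if k = j \<and> l = i then - 1 else 0)"
 have J: "J \<in> skew" using ij by (auto simp: J_def skew_iff)
 have u: "(\<Sum>k\<in>UNIV. f k) = f i + f j" for f :: "'n => real" using ij(1) unfolding ij(2) by simp
 have Jv: "(J *v v) $ i = v $ j" "(J *v v) $ j = - v $ i" for v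
  using ij(1) by (simp_all add: J_def matrix_vector_mult_def u)
 have eqI: "v = w" if "v $ i = w $ i" "v $ j = w $ j" for v w :: "real ^ 'n"
  unfolding vec_eq_iff
 proof
  fix k have "k \<in> {i, j}" using ij(2) by (metis UNIV_I)
  then show "v $ k = w $ k" using that by auto
 qed
 have d: "v \<bullet> w = v $ i * w $ i + v $ j * w $ j" for v w :: "real ^ 'n"
  by (simp add: inner_vec_def u)
 have rot: "\<exists>r. \<forall>z. S u z = r *\<^sub>R (J *v z)" for u
 proof (intro exI allI)
  fix z
  let ?i = "axis i 1 :: real ^ 'n" and ?j = "axis j 1 :: real ^ 'n"
  have c: "S u z $ k = - (z \<bullet> S u (axis k 1))" for k z
   using S_skew[of u z "axis k 1"] by (simp add: inner_axis)
  have "S u ?i $ i = 0" "S u ?j $ j = 0" "S u ?j $ i = - S u ?i $ j"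
   using c[of ?i i] c[of ?j j] c[of ?j i] ij(1) by (simp_all add: inner_axis' d axis_def)
  then show "S u z = (- S u ?i $ j) *\<^sub>R (J *v z)"
   using ij(1) by (intro eqI) (simp_all add: c[of z] d[of z] Jv)
 qed
 have "S (J *v u) z = 0" for u z
 proof -
  obtain r where r: "\<And>z. S u z = r *\<^sub>R (J *v z)" using rot[of u] by blast
  show ?thesis using S_skew_equivariant[OF J, of u z] by (simp add: r matrix_vector_linear)
 qed
 moreover have "J *v (- (J *v x)) = x" by (rule eqI) (simp_all add: Jv)
 ultimately show ?thesis by metis
qed

end

section \<open>Horizontal curves and isometries\<close>

context model begin

text \<open>Horizontal curves on the group with control \<open>u\<close>. The finite exceptional set
  \<open>N\<close> makes the class closed under concatenation, and the Lipschitz clause gives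
  absolute continuity after composition with any smooth function.\<close>

definition hcurve :: "(real => 'g) => real set => (real => real ^ 'n) => bool" where
 "hcurve g N u \<longleftrightarrow> (\<forall>t\<in>{0..1}. g t \<in> CG) \<and> finite N \<and>
  (\<forall>f. smooth_fun A f --> (\<exists>C. \<forall>s\<in>{0..1}. \<forall>t\<in>{0..1}. \<bar>f (g t) - f (g s)\<bar> \<le> C * \<bar>t - s\<bar>)) \<and>
  (\<forall>t\<in>{0..1} - N. \<forall>f. smooth_fun A f -->
   ((\<lambda>s. f (g s)) has_real_derivative L (ix (u t)) (g t) f) (at t))"

lemma hcurveD:
 assumes "hcurve g N u"
 shows "t \<in> {0..1} ==> g t \<in> CG" "finite N"
  "t \<in> {0..1} ==> t \<notin> N ==> smooth_fun A f ==>
   ((\<lambda>s. f (g s)) has_real_derivative L (ix (u t)) (g t) f) (at t)"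
 using assms unfolding hcurve_def by blast+

lemma hcurve_Lipschitz:
 assumes "hcurve g N u" "smooth_fun A f"
 obtains C where "\<And>s t. s \<in> {0..1} ==> t \<in> {0..1} ==> \<bar>f (g t) - f (g s)\<bar> \<le> C * \<bar>t - s\<bar>"
 using assms unfolding hcurve_def by meson

lemma Lipschitz_imp_continuous_real:
 fixes h :: "real => real"
 assumes "\<And>s t. s \<in> S ==> t \<in> S ==> \<bar>h t - h s\<bar> \<le> C * \<bar>t - s\<bar>"
 shows "continuous_on S h"
proof (rule continuous_onI)
 fix x e :: real assume x: "x \<in> S" and e: "e > 0"
 show "\<exists>d>0. \<forall>x'\<in>S. dist x' x < d --> dist (h x') (h x) \<le> e"
 proof (intro exI[of _ "e / (\<bar>C\<bar> + 1)"] conjI ballI impI)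
  fix y assume y: "y \<in> S" "dist y x < e / (\<bar>C\<bar> + 1)"
  have "\<bar>h y - h x\<bar> \<le> C * \<bar>y - x\<bar>" by (rule assms[OF x y(1)])
  also have "\<dots> \<le> (\<bar>C\<bar> + 1) * \<bar>y - x\<bar>" by (rule mult_right_mono) auto
  also have "\<dots> \<le> e" using y(2) by (simp add: dist_real_def field_simps)
  finally show "dist (h y) (h x) \<le> e" by (simp add: dist_real_def)
 qed (use e in simp)
qed

lemma finite_AE_lebesgue: "finite (N :: real set) ==> AE t in lebesgue. t \<notin> N"
 by (rule AE_not_in, rule null_sets_completionI, rule countable_imp_null_set_lborel) (rule countable_finite)

lemma hcurve_velocity:
 assumes g: "hcurve g N u" and t: "t \<in> {0..1}" "t \<notin> N"
 shows "velocity B (pr o g) t = Pu (g t) (ix (u t))"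
proof
 fix f
 show "velocity B (pr o g) t f = Pu (g t) (ix (u t)) f"
  using DERIV_imp_deriv[OF hcurveD(3)[OF g t lift_smooth]] by (simp add: velocity_def Pu_apply o_def)
qed

lemma hcurve_horizontal:
 assumes g: "hcurve g N u"
 shows "horizontal_curve M (pr o g)"
 unfolding horizontal_curve_def
proof (intro conjI allI impI)
 show "pathin (mtop B) (pr o g)"
  unfolding pathin_def
 proof (rule continuous_map_by_smooth_functions[OF Mb])
  show "(pr o g) t \<in> points B" if "t \<in> topspace (top_of_set {0..1})" for t
   using hcurveD(1)[OF g, of t] that by simp
  fix f assume "smooth_fun B f"
  from hcurve_Lipschitz[OF g lift_smooth[OF this]] obtain C where
   "\<And>s t. s \<in> {0..1} ==> t \<in> {0..1} ==> \<bar>f (pr (g t)) - f (pr (g s))\<bar> \<le> C * \<bar>t - s\<bar>" by blast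
  from Lipschitz_imp_continuous_real[of "{0..1}" "\<lambda>t. f (pr (g t))", OF this]
  show "continuous_map (top_of_set {0..1}) euclideanreal (\<lambda>t. f ((pr o g) t))" by simp
 qed
 show "abs_continuous_on {0..1} (f o (pr o g))" if f: "smooth_fun B f" for f
 proof -
  from hcurve_Lipschitz[OF g lift_smooth[OF f]] obtain C where
   "\<And>s t. s \<in> {0..1} ==> t \<in> {0..1} ==> \<bar>f (pr (g t)) - f (pr (g s))\<bar> \<le> C * \<bar>t - s\<bar>" by blast
  then show ?thesis by (intro Lipschitz_imp_abs_continuous[of _ _ C]) simp
 qed
 show "AE t in lebesgue. t \<in> {0..1} -->
   (\<forall>f. smooth_fun B f --> (f o (pr o g)) differentiable (at t)) \<and>
   velocity B (pr o g) t \<in> dst M ((pr o g) t)"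
  using finite_AE_lebesgue[OF hcurveD(2)[OF g]]
 proof (rule eventually_mono, intro impI conjI allI)
  fix t assume t: "t \<notin> N" "t \<in> {0..1}"
  show "(f o (pr o g)) differentiable (at t)" if "smooth_fun B f" for f
   using hcurveD(3)[OF g t(2,1) lift_smooth[OF that]]
   unfolding real_differentiable_def by (auto simp: o_def)
  show "velocity B (pr o g) t \<in> dst M ((pr o g) t)"
   using hcurve_velocity[OF g t(2,1)] hcurveD(1)[OF g t(2)] by simp
 qed
qed

lemma hcurve_length_le:
 assumes g: "hcurve g N u" and r: "\<And>t. t \<in> {0..1} ==> t \<notin> N ==> norm (u t) \<le> r"
 shows "curve_length M (pr o g) \<le> ennreal r"
proof -
 have "curve_length M (pr o g) \<le> (\<integral>\<^sup>+t\<in>{0..1::real}. ennreal r \<partial>lebesgue)"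
  unfolding curve_length_def
 proof (rule nn_integral_mono_AE)
  show "AE t in lebesgue. ennreal (sqrt (met M ((pr o g) t) (velocity B (pr o g) t) (velocity B (pr o g) t))) *
    indicator {0..1} t \<le> ennreal r * indicator {0..1} t"
   using finite_AE_lebesgue[OF hcurveD(2)[OF g]]
  proof (rule eventually_mono)
   fix t assume t: "t \<notin> N"
   show "ennreal (sqrt (met M ((pr o g) t) (velocity B (pr o g) t) (velocity B (pr o g) t))) *
    indicator {0..1} t \<le> ennreal r * indicator {0..1} t"
   proof (cases "t \<in> {0..1}")
    case True
    have "sqrt (met M ((pr o g) t) (velocity B (pr o g) t) (velocity B (pr o g) t)) = norm (u t)"
     using hcurve_velocity[OF g True t] met_eq[OF hcurveD(1)[OF g True]] by (simp add: norm_eq_sqrt_inner)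
    then show ?thesis using r[OF True t] True by (simp add: ennreal_leI)
   qed simp
  qed
 qed
 also have "\<dots> = ennreal r" by (simp add: nn_integral_cmult_indicator)
 finally show ?thesis .
qed

text \<open>The last clause fits the curve to the unit interval: running time r becomes control r
  x.\<close>

lemma integral_hcurve:
 assumes g: "g \<in> CG"
 obtains \<epsilon> c where "\<epsilon> > 0" "c 0 = g" "\<And>t. \<bar>t\<bar> < \<epsilon> ==> c t \<in> CG"
  "\<And>t f. \<bar>t\<bar> < \<epsilon> ==> smooth_fun A f ==> ((\<lambda>s. f (c s)) has_real_derivative L (ix x) (c t) f) (at t)"
  "\<And>r. \<bar>r\<bar> < \<epsilon> ==> hcurve (\<lambda>t. c (r * t)) {} (\<lambda>_. r *\<^sub>R x)"
proof -
 have "g \<in> points A" using g pts by simp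
 note p = this
 obtain e c where c: "e > 0" "c 0 = g" "\<And>t. \<bar>t\<bar> < e ==> c t \<in> points A"
  "\<And>t f. \<bar>t\<bar> < e ==> smooth_fun A f ==> ((\<lambda>s. f (c s)) has_real_derivative L (ix x) (c t) f) (at t)"
  by (rule integral_curve[OF Mf p, of "L (ix x)"]) (use L_tangent[OF ix_galg] L_smooth[OF ix_galg] pts in simp_all)
 have "hcurve (\<lambda>t. c (r * t)) {} (\<lambda>_. r *\<^sub>R x)" if r: "\<bar>r\<bar> < e" for r
 proof -
  have m: "\<bar>r * t\<bar> < e" if "t \<in> {0..1}" for t
  proof -
   have "\<bar>r * t\<bar> \<le> \<bar>r\<bar> * 1" unfolding abs_mult by (rule mult_left_mono) (use that in auto)
   then show ?thesis using r by simp
  qed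
  have d: "((\<lambda>s. f (c (r * s))) has_real_derivative L (ix (r *\<^sub>R x)) (c (r * t)) f) (at t)"
   if t: "t \<in> {0..1}" and f: "smooth_fun A f" for t f
  proof -
   have s: "(r *\<^sub>R x, 0, 0, 0) = r *\<^sub>R ix x" by simp
   have "((\<lambda>s. f (c (r * s))) has_real_derivative L (ix x) (c (r * t)) f * r) (at t)"
    by (rule DERIV_chain2[where g = "\<lambda>s. r * s" and x = t, OF c(4)[OF m[OF t] f]]) (auto intro!: derivative_eq_intros)
   then show ?thesis unfolding s L_scale[OF ix_galg] by (simp add: mult.commute)
  qed
  have "\<exists>C. \<forall>s\<in>{0..1}. \<forall>t\<in>{0..1}. \<bar>f (c (r * t)) - f (c (r * s))\<bar> \<le> C * \<bar>t - s\<bar>"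
   if f: "smooth_fun A f" for f
  proof -
   let ?d = "\<lambda>t. L (ix (r *\<^sub>R x)) (c (r * t)) f"
   have "continuous_on {0..1} ?d"
    by (rule DERIV_continuous_on[OF has_field_derivative_at_within[OF d[OF _ L_smooth[OF ix_galg f]]]])
   then have "bounded (?d ` {0..1})" by (intro compact_imp_bounded compact_continuous_image) auto
   then obtain C where C: "\<forall>x\<in>?d ` {0..1}. norm x \<le> C" unfolding bounded_iff by (rule exE)
   have "norm (f (c (r * t)) - f (c (r * s))) \<le> C * norm (t - s)" if "s \<in> {0..1}" "t \<in> {0..1}" for s t
    by (rule field_differentiable_bound[of "{0..1}" _ ?d, OF _ has_field_derivative_at_within[OF d[OF _ f]]])
     (use C that in auto)
   then show ?thesis unfolding real_norm_def by blast
  qed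
  then show ?thesis unfolding hcurve_def using d c(3)[OF m] pts by simp
 qed
 then show ?thesis using c pts by (intro that[of e c]) auto
qed

lemma linear_horizontal: "linear (\<lambda>x. L (ix x) g f)"
proof
 fix x y :: "real ^ 'n" and r :: real
 have "(x + y, 0, 0, 0) = ix x + ix y" "(r *\<^sub>R x, 0, 0, 0) = r *\<^sub>R ix x" by simp_all
 then show "L (ix (x + y)) g f = L (ix x) g f + L (ix y) g f"
  "L (ix (r *\<^sub>R x)) g f = r *\<^sub>R L (ix x) g f"
  using L_add[OF ix_galg ix_galg, of x y] L_scale[OF ix_galg, of r x] by simp_all
qed

lemma horizontal_bound:
 fixes r :: real
 assumes "\<And>i. \<bar>L (ix (axis i 1)) g f\<bar> \<le> r"
 shows "\<bar>L (ix x) g f\<bar> \<le> (CARD('n) * r) * norm x"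
proof -
 have "L (ix x) g f = (\<Sum>i\<in>UNIV. x $ i * L (ix (axis i 1)) g f)"
 proof -
  have "L (ix x) g f = L (ix (\<Sum>i\<in>UNIV. x $ i *\<^sub>R axis i 1)) g f"
   by (simp add: basis_expansion[of x, unfolded scalar_mult_eq_scaleR])
  then show ?thesis by (simp add: linear_sum[OF linear_horizontal] linear_scale[OF linear_horizontal])
 qed
 also have "\<bar>\<dots>\<bar> \<le> (\<Sum>i\<in>(UNIV::'n set). norm x * r)"
 proof (rule order_trans[OF sum_abs], rule sum_mono)
  fix i :: 'n
  show "\<bar>x $ i * L (ix (axis i 1)) g f\<bar> \<le> norm x * r"
   unfolding abs_mult using assms[of i] component_le_norm_cart[of x i] by (intro mult_mono) auto
 qed
 finally show ?thesis by (simp add: mult_ac)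
qed

text \<open>Functions on the quotient with prescribed horizontal differential at one point; they
  serve as coordinates on the horizontal space there.\<close>

lemma dual_function:
 assumes h: "h \<in> CG"
 obtains q where "smooth_fun B q" "\<And>y. L (ix y) h (lift q) = y \<bullet> w"
proof (rule dual_function_exists[OF preB, of "\<lambda>y. Pu h (ix y)" "pr h" w])
 show "Pu h (ix y) \<in> tangent_space B (pr h)" for y by (rule Pu_tangent[OF h ix_galg])
 show "linear (\<lambda>y. Pu h (ix y) f)" for f
  using linear_horizontal[of h "lift f"] by (cases "smooth_fun B f") (simp_all add: Pu_apply linear_zero)
 show "z \<bullet> w = 0" if z: "\<And>f. smooth_fun B f ==> Pu h (ix z) f = 0" for z
 proof -
  have "Pu h (ix z) = Pu h (ix 0)"
  proof (rule Pu_ext)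
   show "L (ix z) h (lift f) = L (ix 0) h (lift f)" if f: "smooth_fun B f" for f
    using z[OF f] f linear_0[OF linear_horizontal, of h "lift f"] by (simp add: Pu_apply)
  qed
  from Pu_ix_inj[OF h this] show ?thesis by simp
 qed
qed (use that in \<open>simp add: Pu_apply\<close>)

end

section \<open>Isometries preserve the horizontal bundle\<close>

context model begin

abbreviation spd :: "(real => 'g set) => real => real" where
 "spd c t \<equiv> sqrt (met M (c t) (velocity B c t) (velocity B c t))"

lemma horizontal_increment_le:
 assumes c: "horizontal_curve M c" and h: "smooth_fun B h" and N: "N \<ge> 0" and ab: "0 \<le> a" "a \<le> b" "b \<le> 1"
  and bd: "\<And>t v. t \<in> {0..1} ==> v \<in> dst M (c t) ==> \<bar>v h\<bar> \<le> N * sqrt (met M (c t) v v)"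
 shows "ennreal \<bar>h (c b) - h (c a)\<bar> \<le> ennreal N * curve_length M c"
proof -
 have "ennreal \<bar>(h o c) b - (h o c) a\<bar> \<le> ennreal N * (\<integral>\<^sup>+t\<in>{0..1}. ennreal (spd c t) \<partial>lebesgue)"
 proof (rule abs_continuous_increment_le_nn_integral[OF _ ab _ N])
  show "abs_continuous_on {0..1} (h o c)" using c h by (simp add: horizontal_curve_def)
  have "AE t in lebesgue. t \<in> {0..1} -->
    (\<forall>f. smooth_fun B f --> (f o c) differentiable (at t)) \<and> velocity B c t \<in> dst M (c t)"
   using c by (simp add: horizontal_curve_def)
  then show "AE t in lebesgue. t \<in> {0..1} -->
    (h o c) differentiable (at t) \<and> \<bar>deriv (h o c) t\<bar> \<le> N * spd c t"
  proof (rule eventually_mono, intro impI conjI)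
   fix t assume t: "t \<in> {0..1} -->
    (\<forall>f. smooth_fun B f --> (f o c) differentiable (at t)) \<and> velocity B c t \<in> dst M (c t)"
    and t01: "t \<in> {0..1::real}"
   show "(h o c) differentiable (at t)" using t t01 h by blast
   show "\<bar>deriv (h o c) t\<bar> \<le> N * spd c t"
    using bd[OF t01, of "velocity B c t"] t t01 h by (simp add: velocity_def)
  qed
 qed
 then show ?thesis by (simp add: curve_length_def)
qed

text \<open>Near \<open>pr g0\<close> the horizontal derivative of \<open>f\<close> is at most e in
  norm, by continuity along a local section. It remains to keep short curves from
  \<open>pr g0\<close> in that neighbourhood, which a bump function with bounded horizontal
  derivative does.\<close>

lemma cc_estimate:
 assumes g0: "g0 \<in> CG" and f: "smooth_fun B f" and z: "\<And>x. L (ix x) g0 (lift f) = 0" and e: "e > 0"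
 obtains \<delta> where "\<delta> > 0"
  "\<And>c. horizontal_curve M c ==> c 0 = pr g0 ==> curve_length M c < ennreal \<delta> ==>
   ennreal \<bar>f (c 1) - f (pr g0)\<bar> \<le> ennreal e * curve_length M c"
proof -
 obtain X s where X: "openin (mtop B) X" "pr g0 \<in> X" "\<And>p. p \<in> X ==> s p \<in> CG \<and> pr (s p) = p"
  "s (pr g0) = g0" "\<And>f. smooth_fun A f ==> smooth_fun_on B X (\<lambda>p. f (s p))"
  by (rule local_section[OF g0]) (rule that)
 define n where "n = real CARD('n)"
 have n: "n > 0" by (simp add: n_def)
 define D where "D h i p = L (ix (axis i 1)) (s p) (lift h)" for h i p
 have Ds: "smooth_fun_on B X (D h i)" if "smooth_fun B h" for h i
  unfolding D_def[abs_def] by (rule X(5)[OF L_smooth[OF ix_galg lift_smooth[OF that]]])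
 \<comment> \<open>A bound e / n for each of the n frame components gives the bound e on all
   horizontal vectors, by \<open>horizontal_bound\<close>.\<close>
 define W where "W = (\<Inter>i\<in>UNIV. X \<inter> D f i -` {- (e / n)<..<e / n})"
 have W: "openin (mtop B) W" "pr g0 \<in> W" "W \<subseteq> X"
 proof -
  show "openin (mtop B) W"
   unfolding W_def by (intro openin_Inter) (auto intro!: openin_smooth_fun_on_vimage[OF preB X(1) Ds[OF f]])
  show "pr g0 \<in> W" "W \<subseteq> X" using X(2,4) z e n by (auto simp: W_def D_def)
 qed
 have df: "\<bar>v f\<bar> \<le> e * sqrt (met M p v v)" if p: "p \<in> W" and v: "v \<in> dst M p" for p v
 proof -
  have sp: "s p \<in> CG" "pr (s p) = p" using X(3) p W(3) by blast+
  from v sp dst_eq[of "s p"] obtain x where x: "v = Pu (s p) (ix x)" by auto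
  have "\<bar>L (ix (axis i 1)) (s p) (lift f)\<bar> \<le> e / n" for i
  proof -
   have "p \<in> X \<inter> D f i -` {- (e / n)<..<e / n}" using p unfolding W_def by blast
   then show ?thesis unfolding D_def by auto
  qed
  from horizontal_bound[OF this, of x]
  have "\<bar>L (ix x) (s p) (lift f)\<bar> \<le> e * norm x" using n by (simp add: n_def)
  then show ?thesis using met_eq[OF sp(1), of x x] sp(2) f x by (simp add: Pu_apply norm_eq_sqrt_inner)
 qed
 obtain b C V where b: "smooth_fun B b" "\<And>q. 0 \<le> b q" "\<And>q. b q \<le> 1" "openin (mtop B) V" "pr g0 \<in> V"
  "V \<subseteq> C" "\<And>q. q \<in> V ==> b q = 1" "compactin (mtop B) C" "closedin (mtop B) C" "C \<subseteq> W"
  "\<And>q. q \<notin> C ==> b q = 0"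
  by (rule manifold_bump[OF Mb W(1,2)]) (rule that)
 have "\<exists>N. \<forall>p\<in>C. \<bar>b p * D b i p\<bar> \<le> N" for i
 proof -
  have "smooth_fun B (\<lambda>q. b q * D b i q)"
   by (rule smooth_fun_cutoff[OF preB X(1) Ds[OF b(1)] b(1,9) _ b(11)]) (use b(10) W(3) in blast)
  from image_compactin[OF b(8) smooth_fun_continuous_map[OF preB this]]
  have "bounded ((\<lambda>q. b q * D b i q) ` C)" by (simp add: compact_imp_bounded)
  then show ?thesis by (auto simp: bounded_iff)
 qed
 then obtain N' where N': "\<And>i p. p \<in> C ==> \<bar>b p * D b i p\<bar> \<le> N' i" by metis
 define N where "N = n * (\<Sum>i\<in>UNIV. \<bar>N' i\<bar>)"
 have N0: "N \<ge> 0" unfolding N_def using n by (simp add: sum_nonneg)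
 \<comment> \<open>The square, because its derivative is 2 b times that of b: this vanishes off
   \<open>C\<close> together with b, and on \<open>C\<close> it is governed by b times
   \<open>D b i\<close>, which is smooth on all of the quotient and so bounded on a compact
   set.\<close>
 define b2 where "b2 q = b q * b q" for q
 have b2: "smooth_fun B b2" unfolding b2_def[abs_def] by (rule smooth_fun_mult[OF preB b(1) b(1)])
 have db: "\<bar>v b2\<bar> \<le> (2 * N) * sqrt (met M p v v)" if p: "p \<in> points B" and v: "v \<in> dst M p" for p v
 proof -
  obtain g where g: "g \<in> CG" "p = pr g" using p by (rule pointE)
  have met0: "sqrt (met M p v v) \<ge> 0" using v g dst_eq met_eq by fastforce
  have vt: "v \<in> tangent_space B p" using v g dst_eq Pu_tangent[OF g(1) ix_galg] by auto
  have vb: "v b2 = 2 * (b p * v b)"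
   unfolding b2_def[abs_def] using tangentD(4)[OF vt b(1) b(1)] by simp
  show ?thesis
  proof (cases "p \<in> C")
   case False
   then show ?thesis using vb b(11)[OF False] met0 N0 by simp
  next
   case True
   have sp: "s p \<in> CG" "pr (s p) = p" using X(3) True b(10) W(3) by blast+
   from v sp dst_eq[of "s p"] obtain x where x: "v = Pu (s p) (ix x)" by auto
   have "\<bar>L (ix (axis i 1)) (s p) (\<lambda>g. b p * lift b g)\<bar> \<le> (\<Sum>i\<in>UNIV. \<bar>N' i\<bar>)" for i
   proof -
    have "\<bar>b p * D b i p\<bar> \<le> \<bar>N' i\<bar>" using N'[OF True, of i] by linarith
    also have "\<dots> \<le> (\<Sum>i\<in>UNIV. \<bar>N' i\<bar>)" by (rule member_le_sum) auto
    finally show ?thesis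
     using tangentD(3)[OF L_tangent[OF ix_galg sp(1)] lift_smooth[OF b(1)]] by (simp add: D_def)
   qed
   from horizontal_bound[OF this, of x]
   have "\<bar>b p * L (ix x) (s p) (lift b)\<bar> \<le> N * norm x"
    using tangentD(3)[OF L_tangent[OF ix_galg sp(1)] lift_smooth[OF b(1)]] by (simp add: N_def n_def)
   then show ?thesis
    using vb met_eq[OF sp(1), of x x] sp(2) b(1) x by (simp add: Pu_apply norm_eq_sqrt_inner abs_mult)
  qed
 qed
 \<comment> \<open>With a length below 1 / (2 N + 1) the function \<open>b2\<close> drops from its
   initial value 1 by at most 2 N / (2 N + 1) < 1, so the curve never leaves
   \<open>C\<close>.\<close>
 show ?thesis
 proof (rule that[of "1 / (2 * N + 1)"])
  show "1 / (2 * N + 1) > 0" using N0 by simp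
  fix c assume c: "horizontal_curve M c" "c 0 = pr g0" and l: "curve_length M c < ennreal (1 / (2 * N + 1))"
  have pt: "c t \<in> points B" if "t \<in> {0..1}" for t
   using pathin_point[OF _ that] c(1) by (simp add: horizontal_curve_def)
  have inW: "c t \<in> W" if t: "t \<in> {0..1}" for t
  proof -
   have "ennreal \<bar>b2 (c t) - b2 (c 0)\<bar> \<le> ennreal (2 * N) * curve_length M c"
    by (rule horizontal_increment_le[OF c(1) b2]) (use N0 t db pt in auto)
   also have "\<dots> \<le> ennreal (2 * N) * ennreal (1 / (2 * N + 1))"
    using l by (intro mult_left_mono) auto
   also have "\<dots> = ennreal (2 * N / (2 * N + 1))" using N0 by (simp add: ennreal_mult[symmetric])
   finally have "\<bar>b2 (c t) - b2 (c 0)\<bar> \<le> 2 * N / (2 * N + 1)" using N0 by (simp add: ennreal_le_iff)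
   also have "\<dots> < 1" using N0 by simp
   finally have "b2 (c t) \<noteq> 0" using b(5,7) c(2) by (auto simp: b2_def)
   then have "c t \<in> C" using b(11)[of "c t"] by (auto simp: b2_def)
   then show ?thesis using b(10) by blast
  qed
  have "ennreal \<bar>f (c 1) - f (c 0)\<bar> \<le> ennreal e * curve_length M c"
   by (rule horizontal_increment_le[OF c(1) f]) (use e df inW in auto)
  then show "ennreal \<bar>f (c 1) - f (pr g0)\<bar> \<le> ennreal e * curve_length M c" using c(2) by simp
 qed
qed

text \<open>Following x for time t costs length at most t |x|. The isometry keeps distances, so the
  image point is reached by a horizontal curve of length below t r, along which \<open>f\<close>
  changes by at most e t for small t, by \<open>cc_estimate\<close>. Hence the derivative in
  question is at most e for every e > 0.\<close>

lemma isometry_horizontal_zero: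
 assumes F: "F \<in> isom M" "smooth_map B B F" and g: "g \<in> CG" and h: "h \<in> CG" "pr h = F (pr g)"
  and f: "smooth_fun B f" and z: "\<And>y. L (ix y) h (lift f) = 0"
 shows "L (ix x) g (\<lambda>k. f (F (pr k))) = 0"
proof -
 have fF: "smooth_fun B (f o F)" by (rule smooth_map_fun[OF preB preB F(2) f])
 obtain d c where c: "d > 0" "c 0 = g" "\<And>t. \<bar>t\<bar> < d ==> c t \<in> CG"
  "\<And>t f. \<bar>t\<bar> < d ==> smooth_fun A f ==> ((\<lambda>s. f (c s)) has_real_derivative L (ix x) (c t) f) (at t)"
  "\<And>r. \<bar>r\<bar> < d ==> hcurve (\<lambda>t. c (r * t)) {} (\<lambda>_. r *\<^sub>R x)"
  by (rule integral_hcurve[OF g, of x]) (rule that)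
 define \<phi> where "\<phi> t = f (F (pr (c t)))" for t
 define D where "D = L (ix x) g (\<lambda>k. f (F (pr k)))"
 have D: "(\<phi> has_real_derivative D) (at 0)"
  using c(4)[of 0, OF _ lift_smooth[OF fF]] c(1,2) by (simp add: D_def \<phi>_def[abs_def])
 \<comment> \<open>The extra 1 makes t |x| < t r strict, so that the infimum in
   \<open>cc_dist\<close> is undercut by an actual curve.\<close>
 define r where "r = norm x + 1"
 have r: "r > 0" using norm_ge_zero[of x] unfolding r_def by linarith
 have "\<bar>D\<bar> \<le> e" if e: "e > 0" for e
 proof -
  obtain \<delta> where \<delta>: "\<delta> > 0"
   "\<And>c. horizontal_curve M c ==> c 0 = pr h ==> curve_length M c < ennreal \<delta> ==>
    ennreal \<bar>f (c 1) - f (pr h)\<bar> \<le> ennreal (e / r) * curve_length M c"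
   by (rule cc_estimate[OF h(1) f z, of "e / r"]) (use e r in simp, rule that)
  have est: "\<bar>\<phi> t - \<phi> 0\<bar> \<le> e * t" if t: "0 < t" "t < d" "t < \<delta> / r" for t
  proof -
   have "cc_dist M (pr g) (pr (c t)) \<le> curve_length M (pr o (\<lambda>s. c (t * s)))"
    unfolding cc_dist_def
    by (rule INF_lower) (use hcurve_horizontal[OF c(5), of t] t c(2) in auto)
   also have "\<dots> \<le> ennreal (t * norm x)"
    by (rule hcurve_length_le[OF c(5)]) (use t in auto)
   also have "\<dots> < ennreal (t * r)"
    by (rule ennreal_lessI) (use t r in \<open>auto simp: r_def\<close>)
   finally have "cc_dist M (F (pr g)) (F (pr (c t))) < ennreal (t * r)"
    using F(1) c(3)[of t] g t unfolding isom_def by auto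
   then obtain \<gamma> where \<gamma>: "horizontal_curve M \<gamma>" "\<gamma> 0 = pr h" "\<gamma> 1 = F (pr (c t))"
    "curve_length M \<gamma> < ennreal (t * r)"
    unfolding cc_dist_def INF_less_iff h(2)[symmetric] by blast
   have "t * r < \<delta>" using t(3) r by (simp add: field_simps)
   then have "ennreal (t * r) \<le> ennreal \<delta>" by (intro ennreal_leI) simp
   then have "curve_length M \<gamma> < ennreal \<delta>" using \<gamma>(4) by (rule less_le_trans[rotated])
   from \<delta>(2)[OF \<gamma>(1,2) this]
   have "ennreal \<bar>\<phi> t - \<phi> 0\<bar> \<le> ennreal (e / r) * curve_length M \<gamma>" using \<gamma>(3) h(2) c(2) by (simp add: \<phi>_def)
   also have "\<dots> \<le> ennreal (e / r) * ennreal (t * r)" using \<gamma>(4) by (intro mult_left_mono) auto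
   also have "\<dots> = ennreal (e * t)" using e r t by (simp add: ennreal_mult[symmetric])
   finally show ?thesis using e t by (simp add: ennreal_le_iff)
  qed
  have "((\<lambda>t. \<bar>(\<phi> (0 + t) - \<phi> 0) / t\<bar>) \<longlongrightarrow> \<bar>D\<bar>) (at_right 0)"
   using D unfolding DERIV_def by (intro tendsto_rabs) (rule filterlim_mono, auto simp: at_le)
  moreover have "\<forall>\<^sub>F t in at_right 0. \<bar>(\<phi> (0 + t) - \<phi> 0) / t\<bar> \<le> e"
  proof -
   have "\<forall>\<^sub>F t in at_right (0::real). t \<in> {0<..<min d (\<delta> / r)}"
    by (rule eventually_at_right_real) (use c(1) \<delta>(1) r in simp)
   then show ?thesis
   proof (rule eventually_mono)
    fix t assume t: "t \<in> {0<..<min d (\<delta> / r)}"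
    then have "\<bar>\<phi> t - \<phi> 0\<bar> \<le> e * t" using est[of t] by auto
    then show "\<bar>(\<phi> (0 + t) - \<phi> 0) / t\<bar> \<le> e" using t by (simp add: abs_divide field_simps)
   qed
  qed
  ultimately show ?thesis by (rule tendsto_upperbound) simp
 qed
 then have "\<bar>D\<bar> \<le> 0 + e" if "e > 0" for e using that by simp
 then have "\<bar>D\<bar> \<le> 0" by (rule field_le_epsilon)
 then show ?thesis by (simp add: D_def)
qed

text \<open>The image vector \<open>Pu h b\<close> annihilates every function whose horizontal
  derivative at h is zero. Subtracting from f the combination of dual functions \<open>q i\<close>
  with the same horizontal derivative leaves such a function, so \<open>b\<close> acts like the
  horizontal vector with coordinates \<open>L b h (lift (q i))\<close>.\<close>

lemma isometry_horizontal:
 assumes F: "F \<in> isom M" "smooth_map B B F" and g: "g \<in> CG" and h: "h \<in> CG" "pr h = F (pr g)"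
 obtains y where "push_forward B F (Pu g (ix x)) = Pu h (ix y)"
proof -
 have pf: "push_forward B F (Pu g (ix x)) f = (if smooth_fun B f then L (ix x) g (\<lambda>k. f (F (pr k))) else 0)" for f
  using smooth_map_fun[OF preB preB F(2)] by (simp add: push_forward_def Pu_apply o_def)
 have "push_forward B F (Pu g (ix x)) \<in> tangent_space B (pr h)"
  unfolding h(2) by (rule push_forward_tangent[OF preB preB F(2) Pu_tangent[OF g ix_galg]])
 then obtain b where b: "b \<in> galg" "push_forward B F (Pu g (ix x)) = Pu h b" by (rule Pu_surj[OF h(1)])
 note Tb = L_tangent[OF b(1) h(1)]
 have van: "L b h (lift f) = 0" if "smooth_fun B f" "\<And>y. L (ix y) h (lift f) = 0" for f
  using isometry_horizontal_zero[OF F g h that, of x] pf[of f] that(1) b(2) by (simp add: Pu_apply)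
 obtain q where q: "\<And>i. smooth_fun B (q i)" "\<And>i y. L (ix y) h (lift (q i)) = y $ i"
 proof -
  have "\<exists>q. smooth_fun B q \<and> (\<forall>y. L (ix y) h (lift q) = y $ i)" for i
   by (rule dual_function[OF h(1), of "axis i 1"]) (auto simp: inner_axis)
  then show thesis using that by metis
 qed
 define y :: "real ^ 'n" where "y = (\<chi> i. L b h (lift (q i)))"
 have "Pu h b = Pu h (ix y)"
 proof (rule Pu_ext)
  fix f assume f: "smooth_fun B f"
  define w where "w i = L (ix (axis i 1)) h (lift f)" for i
  have fe: "L (ix z) h (lift f) = (\<Sum>i\<in>UNIV. z $ i * w i)" for z
  proof -
   have "L (ix z) h (lift f) = L (ix (\<Sum>i\<in>UNIV. z $ i *\<^sub>R axis i 1)) h (lift f)"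
    by (simp add: basis_expansion[of z, unfolded scalar_mult_eq_scaleR])
   then show ?thesis by (simp add: linear_sum[OF linear_horizontal] linear_scale[OF linear_horizontal] w_def)
  qed
  define k where "k p = f p - (\<Sum>i\<in>UNIV. w i * q i p)" for p
  have ws: "smooth_fun B (\<lambda>p. w i * q i p)" for i by (rule smooth_fun_mult[OF preB smooth_fun_const q(1)])
  have ss: "smooth_fun B (\<lambda>p. \<Sum>i\<in>UNIV. w i * q i p)" by (rule smooth_fun_sum[OF preB ws])
  have k: "smooth_fun B k" unfolding k_def[abs_def] by (rule smooth_fun_diff[OF preB f ss])
  have kL: "v (lift k) = v (lift f) - (\<Sum>i\<in>UNIV. w i * v (lift (q i)))" if "v \<in> tangent_space A h" for v
  proof -
   have "v (lift k) = v (lift f) - v (\<lambda>g. \<Sum>i\<in>UNIV. w i * lift (q i) g)"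
    unfolding k_def using tangent_diff[OF that pre lift_smooth[OF f] lift_smooth[OF ss]] by simp
   also have "v (\<lambda>g. \<Sum>i\<in>UNIV. w i * lift (q i) g) = (\<Sum>i\<in>UNIV. w i * v (lift (q i)))"
    using tangent_sum[OF that pre, of "UNIV :: 'n set" "\<lambda>i. lift (\<lambda>p. w i * q i p)"] lift_smooth[OF ws]
     tangentD(3)[OF that lift_smooth[OF q(1)]] by simp
   finally show ?thesis .
  qed
  have "L b h (lift k) = 0"
   by (rule van[OF k]) (simp add: kL[OF L_tangent[OF ix_galg h(1)]] fe q(2) mult.commute)
  then show "L b h (lift f) = L (ix y) h (lift f)"
   using kL[OF Tb] fe[of y] by (simp add: y_def mult.commute)
 qed
 with b(2) that show ?thesis by simp
qed

end

section \<open>Vanishing of the torsion\<close>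

lemma smooth_vec_bilinear:
 fixes h :: "'u::euclidean_space => 'v::euclidean_space => 'w::euclidean_space"
 assumes A: "pre_manifold A" and h: "bounded_bilinear h" and s: "smooth_vec A \<eta>" "smooth_vec A \<omega>"
 shows "smooth_vec A (\<lambda>g. h (\<eta> g) (\<omega> g))"
 unfolding smooth_vec_def
proof
 fix w
 interpret h: bounded_bilinear h by (rule h)
 have "h (\<eta> g) (\<omega> g) \<bullet> w = (\<Sum>d\<in>Basis. \<Sum>e\<in>Basis. (\<eta> g \<bullet> d) * ((\<omega> g \<bullet> e) * (h d e \<bullet> w)))" for g
 proof -
  have "h (\<eta> g) (\<omega> g) = h (\<Sum>d\<in>Basis. (\<eta> g \<bullet> d) *\<^sub>R d) (\<Sum>e\<in>Basis. (\<omega> g \<bullet> e) *\<^sub>R e)"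
   by (simp add: euclidean_representation)
  then show ?thesis
   by (simp only: h.sum_left h.sum_right h.scaleR_left h.scaleR_right inner_sum_left inner_scaleR_left
     sum_distrib_left) (subst sum.swap, simp add: mult.left_commute)
 qed
 moreover have "smooth_fun A (\<lambda>g. \<Sum>d\<in>Basis. \<Sum>e\<in>Basis. (\<eta> g \<bullet> d) * ((\<omega> g \<bullet> e) * (h d e \<bullet> w)))"
  by (intro smooth_fun_sum[OF A] smooth_fun_mult[OF A] smooth_vecD[OF s(1)] smooth_vecD[OF s(2)] smooth_fun_const)
 ultimately show "smooth_fun A (\<lambda>g. h (\<eta> g) (\<omega> g) \<bullet> w)" by simp
qed

lemma smooth_vec_add:
 assumes "pre_manifold A" "smooth_vec A \<eta>" "smooth_vec A \<omega>"
 shows "smooth_vec A (\<lambda>g. \<eta> g + \<omega> g)"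
 using assms unfolding smooth_vec_def by (auto simp: inner_add_left intro: smooth_fun_add)

lemma smooth_vec_scale:
 assumes "pre_manifold A" "smooth_fun A h" "smooth_vec A \<omega>"
 shows "smooth_vec A (\<lambda>g. h g *\<^sub>R \<omega> g)"
 using assms unfolding smooth_vec_def by (auto intro: smooth_fun_mult)

lemma dV_add:
 assumes A: "pre_manifold A" and v: "v \<in> tangent_space A p" and s: "smooth_vec A \<eta>" "smooth_vec A \<omega>"
 shows "dV v (\<lambda>g. \<eta> g + \<omega> g) = dV v \<eta> + dV v \<omega>"
proof (rule euclidean_eqI)
 fix e :: 'c
 show "dV v (\<lambda>g. \<eta> g + \<omega> g) \<bullet> e = (dV v \<eta> + dV v \<omega>) \<bullet> e"
  using tangentD(2)[OF v smooth_vecD[OF s(1)] smooth_vecD[OF s(2)], of e e]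
  by (simp add: dV_inner[OF A v] smooth_vec_add[OF A s] s inner_add_left)
qed

lemma dV_scale:
 assumes A: "pre_manifold A" and v: "v \<in> tangent_space A p" and s: "smooth_fun A h" "smooth_vec A \<omega>"
 shows "dV v (\<lambda>g. h g *\<^sub>R \<omega> g) = v h *\<^sub>R \<omega> p + h p *\<^sub>R dV v \<omega>"
proof (rule euclidean_eqI)
 fix e :: 'c
 show "dV v (\<lambda>g. h g *\<^sub>R \<omega> g) \<bullet> e = (v h *\<^sub>R \<omega> p + h p *\<^sub>R dV v \<omega>) \<bullet> e"
  using tangentD(4)[OF v s(1) smooth_vecD[OF s(2)], of e]
  by (simp add: dV_inner[OF A v] smooth_vec_scale[OF A s] s inner_add_left)
qed

lemma bounded_bilinear_wedge: "bounded_bilinear (wedge :: real ^ ('n::finite) => _)"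
 unfolding bilinear_conv_bounded_bilinear[symmetric] bilinear_def
 by (auto intro!: linearI simp: wedge_linear)

section \<open>Lifts of vector fields to functions with values in the Lie algebra\<close>

context model begin

text \<open>The lift \<eta> is not unique: values that project to zero may be added. The bracket
  formula \<open>bracket_flift\<close> holds for every choice.\<close>

definition flift :: "'g set vfield => ('g => 'n quad) => bool" where
 "flift X \<eta> \<longleftrightarrow> smooth_vec A \<eta> \<and> (\<forall>g\<in>CG. \<eta> g \<in> galg) \<and>
  (\<forall>g\<in>CG. \<forall>f. smooth_fun B f --> X (pr g) f = L (\<eta> g) g (lift f))"

lemma fliftD:
 assumes "flift X \<eta>"
 shows "smooth_vec A \<eta>" "g \<in> CG ==> \<eta> g \<in> galg"
  "g \<in> CG ==> smooth_fun B f ==> X (pr g) f = L (\<eta> g) g (lift f)"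
 using assms unfolding flift_def by blast+

lemma flift_smooth:
 assumes "flift X \<eta>" "smooth_fun B f"
 shows "smooth_fun B (\<lambda>p. X p f)"
proof (rule descent)
 have "smooth_fun A (\<lambda>g. L (\<eta> g) g (lift f))"
  by (rule smooth_fun_L[OF fliftD(1,2)[OF assms(1)] lift_smooth[OF assms(2)]])
 then show "smooth_fun A (\<lambda>g. X (pr g) f)"
  by (subst smooth_fun_cong[OF pre, of _ "\<lambda>g. L (\<eta> g) g (lift f)"])
   (auto simp: pts fliftD(3)[OF assms(1) _ assms(2)])
qed

lemma dV_galg:
 assumes "v \<in> tangent_space A p" "p \<in> CG" "smooth_vec A \<eta>" "\<And>g. g \<in> CG ==> \<eta> g \<in> galg"
 shows "dV v \<eta> \<in> galg"
proof -
 have "galgp (dV v \<eta>) = dV v (\<lambda>h. galgp (\<eta> h))"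
  by (rule dV_linear[OF pre assms(1,3) galgp_linear, symmetric])
 also have "\<dots> = dV v \<eta>"
  unfolding dV_def
  by (intro sum.cong refl arg_cong2[of _ _ _ _ scaleR] tangent_cong[OF Mf assms(1)])
   (simp_all add: assms(2,4) pts galgp_ident)
 finally show ?thesis using galgp_galg[of "dV v \<eta>"] by simp
qed

text \<open>The product rule in the left-invariant frame: one term differentiates the coefficient,
  the other freezes it at g.\<close>

lemma L_L:
 assumes g: "g \<in> CG" and v: "v \<in> tangent_space A g" and \<omega>: "smooth_vec A \<omega>" "\<And>h. h \<in> CG ==> \<omega> h \<in> galg"
  and f: "smooth_fun A f"
 shows "v (\<lambda>h. L (\<omega> h) h f) = L (dV v \<omega>) g f + v (\<lambda>h. L (\<omega> g) h f)"
proof -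
 note Lf = L_smooth[OF galgp_galg f]
 have s: "smooth_fun A (\<lambda>h. (\<omega> h \<bullet> e) * L (galgp e) h f)" for e
  by (rule smooth_fun_mult[OF pre smooth_vecD[OF \<omega>(1)] Lf])
 have "v (\<lambda>h. L (\<omega> h) h f) = v (\<lambda>h. \<Sum>e\<in>Basis. (\<omega> h \<bullet> e) * L (galgp e) h f)"
  by (rule tangent_cong[OF Mf v]) (use g pts L_expand[OF \<omega>(2)] in auto)
 also have "\<dots> = (\<Sum>e\<in>Basis. v (\<lambda>h. \<omega> h \<bullet> e) * L (galgp e) g f + (\<omega> g \<bullet> e) * v (\<lambda>h. L (galgp e) h f))"
  using tangent_sum[OF v pre, of Basis "\<lambda>e h. (\<omega> h \<bullet> e) * L (galgp e) h f"] s tangentD(4)[OF v smooth_vecD[OF \<omega>(1)] Lf] by simp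
 also have "\<dots> = (\<Sum>e\<in>Basis. (dV v \<omega> \<bullet> e) * L (galgp e) g f) + (\<Sum>e\<in>Basis. (\<omega> g \<bullet> e) * v (\<lambda>h. L (galgp e) h f))"
  by (simp add: sum.distrib dV_inner[OF pre v \<omega>(1)])
 also have "(\<Sum>e\<in>Basis. (dV v \<omega> \<bullet> e) * L (galgp e) g f) = L (dV v \<omega>) g f"
  by (rule L_expand[OF dV_galg[OF v g \<omega>], symmetric])
 also have "(\<Sum>e\<in>Basis. (\<omega> g \<bullet> e) * v (\<lambda>h. L (galgp e) h f)) = v (\<lambda>h. L (\<omega> g) h f)"
 proof -
  have "v (\<lambda>h. L (\<omega> g) h f) = v (\<lambda>h. \<Sum>e\<in>Basis. (\<omega> g \<bullet> e) * L (galgp e) h f)"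
   by (rule arg_cong[where f = v], rule ext, rule L_expand[OF \<omega>(2)[OF g]])
  also have "\<dots> = (\<Sum>e\<in>Basis. v (\<lambda>h. (\<omega> g \<bullet> e) * L (galgp e) h f))"
   by (rule tangent_sum[OF v pre]) (rule smooth_fun_mult[OF pre smooth_fun_const Lf])
  finally show ?thesis using tangentD(3)[OF v Lf] by simp
 qed
 finally show ?thesis .
qed

lemma bracket_flift:
 assumes X: "flift X \<eta>" and X': "flift X' \<omega>" and g: "g \<in> CG" and f: "smooth_fun B f"
 shows "vf_bracket X X' (pr g) f =
  L (dV (L (\<eta> g) g) \<omega> - dV (L (\<omega> g) g) \<eta> + br (\<eta> g) (\<omega> g)) g (lift f)"
proof -
 note eta = fliftD(1,2)[OF X] and om = fliftD(1,2)[OF X'] and F = lift_smooth[OF f]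
 note T = L_tangent[OF eta(2)[OF g] g] and T' = L_tangent[OF om(2)[OF g] g]
 note dg = dV_galg[OF T g om] dV_galg[OF T' g eta] gbracket_galg[OF eta(2)[OF g] om(2)[OF g], of a1 a2]
 have 1: "X (pr g) (\<lambda>p. X' p f) = L (dV (L (\<eta> g) g) \<omega>) g (lift f) + L (\<eta> g) g (\<lambda>h. L (\<omega> g) h (lift f))"
 proof -
  have "X (pr g) (\<lambda>p. X' p f) = L (\<eta> g) g (\<lambda>h. X' (pr h) f)"
   by (rule fliftD(3)[OF X g flift_smooth[OF X' f]])
  also have "\<dots> = L (\<eta> g) g (\<lambda>h. L (\<omega> h) h (lift f))"
   by (rule L_cong[OF eta(2)[OF g] g]) (rule fliftD(3)[OF X' _ f])
  also have "\<dots> = L (dV (L (\<eta> g) g) \<omega>) g (lift f) + L (\<eta> g) g (\<lambda>h. L (\<omega> g) h (lift f))"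
   by (rule L_L[OF g T om F])
  finally show ?thesis .
 qed
 have 2: "X' (pr g) (\<lambda>p. X p f) = L (dV (L (\<omega> g) g) \<eta>) g (lift f) + L (\<omega> g) g (\<lambda>h. L (\<eta> g) h (lift f))"
 proof -
  have "X' (pr g) (\<lambda>p. X p f) = L (\<omega> g) g (\<lambda>h. X (pr h) f)"
   by (rule fliftD(3)[OF X' g flift_smooth[OF X f]])
  also have "\<dots> = L (\<omega> g) g (\<lambda>h. L (\<eta> h) h (lift f))"
   by (rule L_cong[OF om(2)[OF g] g]) (rule fliftD(3)[OF X _ f])
  also have "\<dots> = L (dV (L (\<omega> g) g) \<eta>) g (lift f) + L (\<omega> g) g (\<lambda>h. L (\<eta> g) h (lift f))"
   by (rule L_L[OF g T' eta F])
  finally show ?thesis .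
 qed
 have "L (dV (L (\<eta> g) g) \<omega> - dV (L (\<omega> g) g) \<eta> + br (\<eta> g) (\<omega> g)) g (lift f) =
   L (dV (L (\<eta> g) g) \<omega>) g (lift f) - L (dV (L (\<omega> g) g) \<eta>) g (lift f) + L (br (\<eta> g) (\<omega> g)) g (lift f)"
  using L_add[OF subspace_diff[OF subspace_galg dg(1,2)] dg(3), of g "lift f"]
   L_add[OF dg(1) subspace_neg[OF subspace_galg dg(2)], of g "lift f"] L_neg[OF dg(2), of g "lift f"]
  by simp
 then show ?thesis
  unfolding vf_bracket_def 1 2 L_bracket[OF eta(2)[OF g] om(2)[OF g]] by simp
qed

end

section \<open>Sections with known covariant derivative, and the torsion\<close>

context model_connection begin

text \<open>The connection is understood on the fields \<open>Y a\<close> (\<open>nab_Y_S\<close>).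
  The last clause is their formula in a shape that survives sums and smooth factors, so that it
  reaches the frames that an isometry produces.\<close>

definition slift :: "'g set vfield => ('g => real ^ 'n) => bool" where
 "slift X \<zeta> \<longleftrightarrow> smooth_vec A \<zeta> \<and> X \<in> sections M \<and> (\<forall>g\<in>CG. X (pr g) = Pu g (ix (\<zeta> g))) \<and>
  (\<forall>g\<in>CG. \<forall>z. nab X (pr g) (Pu g (ix z)) = Pu g (ix (dV (L (ix z) g) \<zeta> + S z (\<zeta> g))))"

lemma sliftD:
 assumes "slift X \<zeta>"
 shows "smooth_vec A \<zeta>" "X \<in> sections M" "g \<in> CG ==> X (pr g) = Pu g (ix (\<zeta> g))"
  "g \<in> CG ==> nab X (pr g) (Pu g (ix z)) = Pu g (ix (dV (L (ix z) g) \<zeta> + S z (\<zeta> g)))"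
 using assms unfolding slift_def by blast+

lemma slift_Y:
 assumes a: "a \<in> galg"
 shows "slift (Y a) (\<lambda>g. p1 (co g a))"
 unfolding slift_def
 using smooth_p1_co[OF a] Y_section[OF a] Y_pr[OF _ a] nab_Y_S[OF _ a] dV_p1_co[OF a ix_galg] by simp

lemma section_outside: "X \<in> sections M ==> p \<notin> points B ==> X p = (\<lambda>_. 0)"
 by (simp add: sections_def vfields_def)

lemma Pu_ix_add: "Pu g (ix (x + y)) = (\<lambda>f. Pu g (ix x) f + Pu g (ix y) f)"
 using Pu_add[OF ix_galg ix_galg, of g x y] by simp

lemma Pu_ix_scale: "Pu g (ix (r *\<^sub>R x)) = (\<lambda>f. r * Pu g (ix x) f)"
 using Pu_scale[OF ix_galg, of g r x] by simp

lemma slift_add: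
 assumes X: "slift X \<zeta>" and X': "slift X' \<zeta>'"
 shows "slift (\<lambda>p f. X p f + X' p f) (\<lambda>g. \<zeta> g + \<zeta>' g)"
proof -
 have s: "smooth_vec A (\<lambda>g. \<zeta> g + \<zeta>' g)" by (rule smooth_vec_add[OF pre sliftD(1)[OF X] sliftD(1)[OF X']])
 have P: "(\<lambda>f. X (pr g) f + X' (pr g) f) = Pu g (ix (\<zeta> g + \<zeta>' g))" if "g \<in> CG" for g
  by (simp only: sliftD(3)[OF X that] sliftD(3)[OF X' that] Pu_ix_add)
 have "(\<lambda>p f. X p f + X' p f) \<in> sections M"
  by (rule sectionI[OF _ s]) (use P section_outside[OF sliftD(2)[OF X]] section_outside[OF sliftD(2)[OF X']] in auto)
 moreover have "nab (\<lambda>p f. X p f + X' p f) (pr g) (Pu g (ix z)) =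
   Pu g (ix (dV (L (ix z) g) (\<lambda>g. \<zeta> g + \<zeta>' g) + S z (\<zeta> g + \<zeta>' g)))" if g: "g \<in> CG" for g z
 proof -
  have e: "dV (L (ix z) g) (\<lambda>g. \<zeta> g + \<zeta>' g) + S z (\<zeta> g + \<zeta>' g) =
    (dV (L (ix z) g) \<zeta> + S z (\<zeta> g)) + (dV (L (ix z) g) \<zeta>' + S z (\<zeta>' g))"
   by (simp add: dV_add[OF pre L_tangent[OF ix_galg g] sliftD(1)[OF X] sliftD(1)[OF X']]
     linear_add[OF S_linear(1)])
  show ?thesis
   unfolding e Pu_ix_add[of g "dV (L (ix z) g) \<zeta> + S z (\<zeta> g)"]
   by (simp only: nab_rules(3)[OF sliftD(2)[OF X] pr_point[OF g] Pu_dst[OF g] sliftD(2)[OF X']]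
     sliftD(4)[OF X g] sliftD(4)[OF X' g])
 qed
 ultimately show ?thesis unfolding slift_def using s P by blast
qed

lemma slift_mult:
 assumes h: "smooth_fun B h" and X: "slift X \<zeta>"
 shows "slift (\<lambda>p f. h p * X p f) (\<lambda>g. h (pr g) *\<^sub>R \<zeta> g)"
proof -
 have s: "smooth_vec A (\<lambda>g. h (pr g) *\<^sub>R \<zeta> g)" by (rule smooth_vec_scale[OF pre lift_smooth[OF h] sliftD(1)[OF X]])
 have P: "(\<lambda>f. h (pr g) * X (pr g) f) = Pu g (ix (h (pr g) *\<^sub>R \<zeta> g))" if "g \<in> CG" for g
  by (simp only: sliftD(3)[OF X that] Pu_ix_scale)
 have "(\<lambda>p f. h p * X p f) \<in> sections M"
  by (rule sectionI[OF _ s]) (use P section_outside[OF sliftD(2)[OF X]] in auto)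
 moreover have "nab (\<lambda>p f. h p * X p f) (pr g) (Pu g (ix z)) =
   Pu g (ix (dV (L (ix z) g) (\<lambda>g. h (pr g) *\<^sub>R \<zeta> g) + S z (h (pr g) *\<^sub>R \<zeta> g)))" if g: "g \<in> CG" for g z
 proof -
  have e: "dV (L (ix z) g) (\<lambda>g. h (pr g) *\<^sub>R \<zeta> g) + S z (h (pr g) *\<^sub>R \<zeta> g) =
    L (ix z) g (lift h) *\<^sub>R \<zeta> g + h (pr g) *\<^sub>R (dV (L (ix z) g) \<zeta> + S z (\<zeta> g))"
   by (simp add: dV_scale[OF pre L_tangent[OF ix_galg g] lift_smooth[OF h] sliftD(1)[OF X]]
     linear_scale[OF S_linear(1)] scaleR_add_right)
  show ?thesis
   unfolding e Pu_ix_add Pu_ix_scale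
   unfolding nab_rules(5)[OF sliftD(2)[OF X] pr_point[OF g] Pu_dst[OF g] h]
    sliftD(4)[OF X g] sliftD(3)[OF X g] by (simp add: Pu_apply h Pu_ix_add)
 qed
 ultimately show ?thesis unfolding slift_def using s P by blast
qed

lemma slift_sum:
 assumes "finite I" "\<And>i. i \<in> I ==> smooth_fun B (h i)" "\<And>i. i \<in> I ==> slift (X i) (\<zeta> i)"
 shows "slift (\<lambda>p f. \<Sum>i\<in>I. h i p * X i p f) (\<lambda>g. \<Sum>i\<in>I. h i (pr g) *\<^sub>R \<zeta> i g)"
 using assms
proof (induction I rule: finite_induct)
 case empty
 show ?case using slift_mult[OF smooth_fun_const slift_Y[OF ix_galg], of 0] by simp
next
 case (insert i I)
 have "slift (\<lambda>p f. h i p * X i p f + (\<Sum>i\<in>I. h i p * X i p f))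
   (\<lambda>g. h i (pr g) *\<^sub>R \<zeta> i g + (\<Sum>i\<in>I. h i (pr g) *\<^sub>R \<zeta> i g))"
  by (rule slift_add[OF slift_mult insert.IH]) (use insert.prems in auto)
 then show ?case using insert.hyps by simp
qed

lemma slift_flift:
 assumes "slift X \<zeta>" shows "flift X (\<lambda>g. ix (\<zeta> g))"
 unfolding flift_def using smooth_vec_ix[OF sliftD(1)[OF assms]] sliftD(3)[OF assms] by (simp add: Pu_apply)

text \<open>Minus the usual torsion. Since the bracket of horizontal fields leaves the bundle, its
  value is a general tangent vector; that it is tensorial is visible in \<open>tors_flift\<close>,
  where no derivative of the lifts is left.\<close>

definition tors :: "'g set vfield => 'g set vfield => 'g set vfield" where
 "tors X X' = (\<lambda>p f. vf_bracket X X' p f - nab X' p (X p) f + nab X p (X' p) f)"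

lemma tors_flift:
 assumes X: "slift X \<zeta>" and X': "slift X' \<zeta>'"
 shows "flift (tors X X') (\<lambda>g. (S (\<zeta>' g) (\<zeta> g) - S (\<zeta> g) (\<zeta>' g), wedge (\<zeta> g) (\<zeta>' g), 0, 0))"
proof -
 define \<tau> where "\<tau> g = (S (\<zeta>' g) (\<zeta> g) - S (\<zeta> g) (\<zeta>' g), wedge (\<zeta> g) (\<zeta>' g), 0 :: real ^ 'n, 0 :: real ^ 'n ^ 'n)" for g
 note s = sliftD(1)[OF X] sliftD(1)[OF X']
 have sm: "smooth_vec A \<tau>"
 proof -
  have 1: "smooth_vec A (\<lambda>g. S (\<zeta>' g) (\<zeta> g) + (-1) *\<^sub>R S (\<zeta> g) (\<zeta>' g))"
   by (intro smooth_vec_add[OF pre] smooth_vec_scale[OF pre] smooth_fun_const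
     smooth_vec_bilinear[OF pre S_bilinear] s)
  have "linear (\<lambda>x::real ^ 'n. (x, 0 :: real ^ 'n ^ 'n, 0 :: real ^ 'n, 0 :: real ^ 'n ^ 'n))" by (auto intro: linearI)
  from smooth_vec_linear[OF this 1]
  have 2: "smooth_vec A (\<lambda>g. (S (\<zeta>' g) (\<zeta> g) - S (\<zeta> g) (\<zeta>' g), 0 :: real ^ 'n ^ 'n, 0 :: real ^ 'n, 0 :: real ^ 'n ^ 'n))"
   by simp
  have "linear (\<lambda>x::real ^ 'n ^ 'n. (0 :: real ^ 'n, x, 0 :: real ^ 'n, 0 :: real ^ 'n ^ 'n))" by (auto intro: linearI)
  from smooth_vec_linear[OF this smooth_vec_bilinear[OF pre bounded_bilinear_wedge s]]
  have "smooth_vec A (\<lambda>g. (0 :: real ^ 'n, wedge (\<zeta> g) (\<zeta>' g), 0 :: real ^ 'n, 0 :: real ^ 'n ^ 'n))" .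
  from smooth_vec_add[OF pre 2 this] show ?thesis unfolding \<tau>_def[abs_def] by simp
 qed
 moreover have "\<tau> g \<in> galg" for g unfolding \<tau>_def galg_iff by (simp add: wedge_skew zero_skew)
 moreover have "tors X X' (pr g) f = L (\<tau> g) g (lift f)" if g: "g \<in> CG" and f: "smooth_fun B f" for g f
 proof -
  have dix: "dV (L (ix z) g) (\<lambda>g. ix (\<xi> g)) = ix (dV (L (ix z) g) \<xi>)" if "smooth_vec A \<xi>" for z \<xi>
   by (rule dV_linear[OF pre L_tangent[OF ix_galg g] that]) (auto intro: linearI)
  have "vf_bracket X X' (pr g) f =
    L (ix (dV (L (ix (\<zeta> g)) g) \<zeta>') - ix (dV (L (ix (\<zeta>' g)) g) \<zeta>) + br (ix (\<zeta> g)) (ix (\<zeta>' g))) g (lift f)"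
   using bracket_flift[OF slift_flift[OF X] slift_flift[OF X'] g f] by (simp only: dix s)
  \<comment> \<open>The derivatives of the two lifts are exactly those in the covariant derivatives;
    what is left over is \<open>S\<close> and the bracket of horizontal elements, a
    \<open>wedge\<close>.\<close>
  also have "ix (dV (L (ix (\<zeta> g)) g) \<zeta>') - ix (dV (L (ix (\<zeta>' g)) g) \<zeta>) + br (ix (\<zeta> g)) (ix (\<zeta>' g)) =
    \<tau> g + ix (dV (L (ix (\<zeta> g)) g) \<zeta>' + S (\<zeta> g) (\<zeta>' g)) - ix (dV (L (ix (\<zeta>' g)) g) \<zeta> + S (\<zeta>' g) (\<zeta> g))"
   by (simp add: \<tau>_def comm_zero wedge_zero)
  also have "L \<dots> g (lift f) = L (\<tau> g) g (lift f) + nab X' (pr g) (X (pr g)) f - nab X (pr g) (X' (pr g)) f"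
  proof -
   let ?a = "ix (dV (L (ix (\<zeta> g)) g) \<zeta>' + S (\<zeta> g) (\<zeta>' g))"
    and ?b = "ix (dV (L (ix (\<zeta>' g)) g) \<zeta> + S (\<zeta>' g) (\<zeta> g))"
   have t: "\<tau> g \<in> galg" by fact
   have "L (\<tau> g + ?a - ?b) g (lift f) = L (\<tau> g) g (lift f) + L ?a g (lift f) - L ?b g (lift f)"
    by (simp only: diff_conv_add_uminus[of "\<tau> g + ?a"] diff_conv_add_uminus[of "_ + _ :: real"]
      L_add[OF subspace_add[OF subspace_galg t ix_galg] subspace_neg[OF subspace_galg ix_galg]]
      L_add[OF t ix_galg] L_neg[OF ix_galg])
   also have "L ?a g (lift f) = nab X' (pr g) (X (pr g)) f"
    by (simp only: sliftD(3)[OF X g] sliftD(4)[OF X' g] Pu_apply f if_True)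
   also have "L ?b g (lift f) = nab X (pr g) (X' (pr g)) f"
    by (simp only: sliftD(3)[OF X' g] sliftD(4)[OF X g] Pu_apply f if_True)
   finally show ?thesis .
  qed
  finally show ?thesis by (simp add: tors_def)
 qed
 ultimately show ?thesis unfolding flift_def \<tau>_def[abs_def] by blast
qed

end

lemma smooth_fun_on_det:
 fixes R :: "'p => real ^ ('n::finite) ^ 'n"
 assumes A: "pre_manifold A" and X: "openin (mtop A) X" and R: "\<And>i j. smooth_fun_on A X (\<lambda>p. R p $ i $ j)"
 shows "smooth_fun_on A X (\<lambda>p. det (R p))"
 unfolding det_def
 by (intro smooth_fun_on_sum[OF A X] smooth_fun_on_mult[OF A X] smooth_fun_on_const smooth_fun_on_prod[OF A X] R)

context model begin

lemma e1_point: "e1 \<in> points A"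
 using pts by simp

lemma points_separated:
 assumes p: "p \<in> points B" and q: "q \<in> points B" and eq: "\<And>f. smooth_fun B f ==> f p = f q"
 shows "p = q"
proof (rule ccontr)
 assume ne: "p \<noteq> q"
 have "closedin (mtop B) {q}"
  using closedin_Hausdorff_singleton[OF smooth_manifold_Hausdorff[OF Mb]] q topspace_mtop[OF preB] by simp
 then have "openin (mtop B) (points B - {q})" by (rule openin_points_Diff[OF preB])
 moreover have "p \<in> points B - {q}" using p ne by simp
 ultimately show False
 proof (rule manifold_bump[OF Mb])
  fix b C V
  assume "smooth_fun B b" "p \<in> V" "\<And>q. q \<in> V ==> b q = 1" "C \<subseteq> points B - {q}" "\<And>q. q \<notin> C ==> b q = 0"
  then have "smooth_fun B b" "b p = 1" "b q = 0" by auto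
  then show False using eq[of b] by simp
 qed
qed

lemma wedge_mult: "wedge x y *v u = (x \<bullet> u) *\<^sub>R y - (y \<bullet> u) *\<^sub>R x"
proof (subst vec_eq_iff, rule allI)
 fix i
 have "(wedge x y *v u) $ i = (\<Sum>j\<in>UNIV. y $ i * (x $ j * u $ j) - x $ i * (y $ j * u $ j))"
  by (simp add: wedge_def matrix_vector_mult_def algebra_simps)
 then show "(wedge x y *v u) $ i = ((x \<bullet> u) *\<^sub>R y - (y \<bullet> u) *\<^sub>R x) $ i"
  by (simp add: inner_vec_def sum_subtractf sum_distrib_left mult.commute)
qed

lemma other_index: "\<exists>j. j \<noteq> (i :: 'n)"
proof (rule ccontr)
 assume "\<not> (\<exists>j. j \<noteq> i)"
 then have "(UNIV :: 'n set) = {i}" by auto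
 then have "CARD('n) = card {i}" by (rule arg_cong)
 then show False using card by simp
qed

lemma skew_annihilated:
 fixes u :: "real ^ 'n"
 assumes z: "\<And>E. E \<in> skew ==> E *v u = 0"
 shows "u = 0"
proof -
 have "u $ i = 0" for i
 proof -
  obtain j where j: "j \<noteq> i" using other_index by blast
  have "wedge (axis i 1) (axis j 1) *v u = 0" by (rule z[OF wedge_skew])
  then have "(u $ i *\<^sub>R axis j 1 - u $ j *\<^sub>R axis i 1 :: real ^ 'n) $ j = 0"
   by (simp add: wedge_mult inner_axis')
  then show ?thesis using j by (simp add: axis_def)
 qed
 then show ?thesis by (simp add: vec_eq_iff)
qed

text \<open>An element annihilated by the projection generates a curve inside \<open>K\<close>,
  since by left invariance every lifted function is constant along it. Elements of \<open>K\<close>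
  keep the \<open>p3\<close> component of \<open>ik E\<close> zero; differentiating at the identity
  gives E p3 b = 0 for every skew E.\<close>

lemma kernel_p3:
 assumes b: "b \<in> galg" and z: "\<And>f. smooth_fun B f ==> L b e1 (lift f) = 0"
 shows "p3 b = 0"
proof (rule skew_annihilated)
 fix E :: "real ^ 'n ^ 'n" assume E: "E \<in> skew"
 obtain d c where c: "d > 0" "c 0 = e1" "\<And>t. \<bar>t\<bar> < d ==> c t \<in> points A"
  "\<And>t f. \<bar>t\<bar> < d ==> smooth_fun A f ==> ((\<lambda>s. f (c s)) has_real_derivative L b (c t) f) (at t)"
  by (rule integral_curve[OF Mf e1_point, of "L b"]) (use L_tangent[OF b] L_smooth[OF b] pts in simp_all)
 have cK: "c t \<in> K" if t: "\<bar>t\<bar> < d" for t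
 proof -
  have ct: "c s \<in> CG" if "\<bar>s\<bar> < d" for s using c(3)[OF that] pts by simp
  have "pr (c t) = pr e1"
  proof (rule points_separated)
   fix f assume f: "smooth_fun B f"
   have "((\<lambda>s. f (pr (c s))) has_real_derivative 0) (at s within {-d<..<d})" if s: "s \<in> {-d<..<d}" for s
   proof -
    have s': "\<bar>s\<bar> < d" using s by auto
    have "L b (c s) (lift f) = L b (c s \<cdot> e1) (lift f)" using ct[OF s'] by simp
    also have "\<dots> = L b e1 (\<lambda>k. f (pr (c s \<cdot> k)))" by (rule L_left[OF b ct[OF s'] _ lift_smooth[OF f]]) simp
    also have "\<dots> = L b e1 (lift (f o tau (c s)))"
     by (rule L_cong[OF b]) (simp_all add: tau_pr ct[OF s'])
    also have "\<dots> = 0" by (rule z[OF tau_smooth[OF ct[OF s'] f]])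
    finally show ?thesis using c(4)[OF s' lift_smooth[OF f]] by (simp add: has_field_derivative_at_within)
   qed
   from has_field_derivative_zero_constant[OF _ this]
   obtain a where a: "\<And>s. s \<in> {-d<..<d} ==> f (pr (c s)) = a" by auto
   show "f (pr (c t)) = f (pr e1)" using a[of t] a[of 0] t c(1,2) by (simp add: abs_less_iff)
  qed (use ct[OF t] in auto)
  then show ?thesis using pr_eq_iff[of e1 "c t"] ct[OF t] by simp
 qed
 have z0: "p3 (co (c t) (ik E)) = 0" if t: "\<bar>t\<bar> < d" for t
  using K_pres[OF cK[OF t]] ik_galg[OF E] unfolding Kpres_def by fastforce
 have sm: "smooth_vec A (\<lambda>g. p3 (co g (ik E)))"
  by (rule smooth_vec_linear[OF p_linear(3) co_smooth[OF ik_galg[OF E]]])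
 note T = L_tangent[OF b, of e1]
 have "p3 (br (ik E) b) \<bullet> w = 0" for w
 proof -
  have "dV (L b e1) (\<lambda>g. p3 (co g (ik E))) = p3 (br (ik E) b)"
   using dV_linear[OF pre T co_smooth[OF ik_galg[OF E]] p_linear(3)] dV_co[OF ik_galg[OF E] b, of e1]
    co_one[OF ik_galg[OF E]] by simp
  then have e: "L b e1 (\<lambda>g. p3 (co g (ik E)) \<bullet> w) = p3 (br (ik E) b) \<bullet> w"
   using dV_inner[OF pre T sm] by simp
  have "((\<lambda>s. p3 (co (c s) (ik E)) \<bullet> w) has_real_derivative p3 (br (ik E) b) \<bullet> w) (at 0)"
   using c(4)[of 0, OF _ smooth_vecD[OF sm, of w]] c(1,2) e by simp
  moreover have "((\<lambda>s. p3 (co (c s) (ik E)) \<bullet> w) has_real_derivative 0) (at 0)"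
   by (rule has_field_derivative_transform_within_open[of "\<lambda>_. 0" _ _ "{-d<..<d}"])
    (use z0 c(1) in auto)
  ultimately show ?thesis by (rule DERIV_unique)
 qed
 then have "p3 (br (ik E) b) = 0" by (metis inner_eq_zero_iff)
 moreover have "p3 (br (ik E) b) = E *v p3 b"
  by (subst (1 2) quad_eq[of b]) (simp add: matrix_vector_mult_0 comm_zero wedge_zero)
 ultimately show "E *v p3 b = 0" by simp
qed

end

section \<open>A horizontal frame and its image under an isometry\<close>

context model_connection begin

abbreviation Yb :: "'n => 'g set vfield" where "Yb i \<equiv> Y (ix (axis i 1))"

text \<open>The definition of an isometry does not provide smoothness of the inverse of
  \<open>F\<close>, so fields are not pushed forward by it. Instead \<open>Z j\<close> is prescribed
  at the target, and the coefficients of \<open>X j\<close> at the source are solved for by Cramer's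
  rule, which keeps them smooth.\<close>

lemma isometry_frame:
 assumes F: "F \<in> isom M" "smooth_map B B F" "F (pr e1) = pr e1"
  and neg: "\<And>v. v \<in> dst M (pr e1) ==> push_forward B F v = (\<lambda>f. - v f)"
 obtains X Z \<zeta> \<xi> where "\<And>j. slift (X j) (\<zeta> j)" "\<And>j. slift (Z j) (\<xi> j)"
  "\<And>j. \<zeta> j e1 = - axis j 1" "\<And>j. \<xi> j e1 = axis j 1"
  "\<And>j p f. p \<in> points B ==> smooth_fun B f ==> X j p (f o F) = Z j (F p) f"
proof -
 have fF: "smooth_fun B (f o F)" if "smooth_fun B f" for f by (rule smooth_map_fun[OF preB preB F(2) that])
 have Fp: "F p \<in> points B" if "p \<in> points B" for p by (rule smooth_map_points[OF F(2) that])
 have hom: "homeomorphic_map (mtop B) (mtop B) F" using F(1) by (simp add: isom_def)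
 have op: "pr e1 \<in> points B" by simp
 have Ys: "Y a \<in> vfields B" if "a \<in> galg" for a using Y_section[OF that] by (simp add: sections_def)
 have Ysm: "smooth_fun B (\<lambda>p. Yb i p f)" if "smooth_fun B f" for i f
  using Ys[OF ix_galg] that by (simp add: vfields_def)
 obtain q where q: "\<And>i. smooth_fun B (q i)" "\<And>i y. L (ix y) e1 (lift (q i)) = y $ i"
 proof -
  have "\<exists>q. smooth_fun B q \<and> (\<forall>y. L (ix y) e1 (lift q) = y $ i)" for i
   by (rule dual_function[of e1 "axis i 1"]) (auto simp: inner_axis)
  then show thesis using that by metis
 qed
 \<comment> \<open>The \<open>q k\<close> are coordinates on the horizontal space at the base point.
   \<open>P\<close> and \<open>R\<close> are the matrices of the frame \<open>Yb\<close> and of its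
   image under \<open>F\<close> in these coordinates; at the base point they are 1 and -1.\<close>
 define P where "P p = (\<chi> j k. Yb j p (q k))" for p
 define R where "R p = (\<chi> i k. Yb i p (q k o F))" for p
 have Ps: "smooth_fun B (\<lambda>p. P p $ j $ k)" for j k using Ysm[OF q(1)] by (simp add: P_def)
 have Rs: "smooth_fun B (\<lambda>p. R p $ j $ k)" for j k using Ysm[OF fF[OF q(1)]] by (simp add: R_def)
 have Y0: "Yb i (pr e1) = Pu e1 (ix (axis i 1))" for i
  using Y_pr[of e1 "ix (axis i 1)"] by (simp add: co_one)
 have Yq: "Yb i (pr e1) (q k) = (axis i 1 :: real ^ 'n) $ k" for i k
  using q by (simp add: Y0 Pu_apply)
 have ax: "(axis i 1 :: real ^ 'n) $ k = (if i = k then 1 else 0)" for i k by (simp add: axis_def)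
 have P0: "P (pr e1) = mat 1" by (simp add: P_def Yq mat_def vec_eq_iff ax)
 have pfY: "Yb i (pr e1) (f o F) = - Yb i (pr e1) f" if "smooth_fun B f" for i f
 proof -
  have "push_forward B F (Yb i (pr e1)) f = - Yb i (pr e1) f"
   using neg[of "Yb i (pr e1)"] Pu_dst[of e1] Y0 by simp
  then show ?thesis using that by (simp add: push_forward_def)
 qed
 have R0: "R (pr e1) = - mat 1"
  using pfY[OF q(1)] by (simp add: R_def Yq mat_def vec_eq_iff ax)
 have dR: "smooth_fun_on B (points B) (\<lambda>p. det (R p))"
  by (rule smooth_fun_on_det[OF preB openin_points[OF preB] smooth_fun_imp_on[OF Rs]])
 have dP: "smooth_fun_on B (points B) (\<lambda>p. det (P p))"
  by (rule smooth_fun_on_det[OF preB openin_points[OF preB] smooth_fun_imp_on[OF Ps]])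
 define O1 where "O1 = points B \<inter> (\<lambda>p. det (R p)) -` (- {0})"
 define O2 where "O2 = points B \<inter> (\<lambda>p. det (P p)) -` (- {0})"
 have O1: "openin (mtop B) O1" unfolding O1_def
  by (rule openin_smooth_fun_on_vimage[OF preB openin_points[OF preB] dR]) (rule open_Compl, simp)
 have O2: "openin (mtop B) O2" unfolding O2_def
  by (rule openin_smooth_fun_on_vimage[OF preB openin_points[OF preB] dP]) (rule open_Compl, simp)
 have "det (- mat 1 :: real ^ 'n ^ 'n) * det (- mat 1 :: real ^ 'n ^ 'n) = 1"
  by (simp add: det_mul[symmetric] matrix_linear)
 then have "det (- mat 1 :: real ^ 'n ^ 'n) \<noteq> 0" by auto
 then have o12: "pr e1 \<in> O1" "pr e1 \<in> O2" by (simp_all add: O1_def O2_def R0 P0)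
 \<comment> \<open>Images of points where \<open>R\<close> is invertible, among the points where
   \<open>P\<close> is; open because a homeomorphism is an open map.\<close>
 define W where "W = F ` O1 \<inter> O2"
 have W: "openin (mtop B) W" "pr e1 \<in> W"
 proof -
  have "openin (mtop B) (F ` O1)"
   using homeomorphic_imp_open_map[OF hom] O1 by (simp add: open_map_def)
  then show "openin (mtop B) W" unfolding W_def using O2 by (rule openin_Int)
  show "pr e1 \<in> W" unfolding W_def using o12 F(3) by force
 qed
 obtain b C V where b: "smooth_fun B b" "pr e1 \<in> V" "\<And>q. q \<in> V ==> b q = 1"
  "closedin (mtop B) C" "C \<subseteq> W" "\<And>q. q \<notin> C ==> b q = 0"
  by (rule manifold_bump[OF Mb W]) (rule that)
 have inj: "inj_on F (points B)"
  using homeomorphic_imp_injective_map[OF hom] topspace_mtop[OF preB] by simp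
 have FC: "p \<in> O1" if p: "p \<in> points B" "F p \<in> C" for p
 proof -
  obtain p' where p': "p' \<in> O1" "F p = F p'" using p(2) b(5) by (auto simp: W_def)
  then have "p = p'" using inj p(1) by (auto simp: O1_def dest: inj_onD)
  then show ?thesis using p' by simp
 qed
 \<comment> \<open>Cramer's rule for the combination of the rows of \<open>R p\<close> that equals
   row j of \<open>P (F p)\<close>.\<close>
 define N where "N j i p = det (\<chi> a c. if c = i then P (F p) $ j $ a else R p $ c $ a) / det (R p)" for j i p
 have N: "smooth_fun_on B O1 (N j i)" for j i
  unfolding N_def[abs_def]
 proof (rule smooth_fun_on_divide[OF preB O1])
  show "smooth_fun_on B O1 (\<lambda>p. det (R p))" by (rule smooth_fun_on_subset[OF dR]) (simp add: O1_def)
  show "smooth_fun_on B O1 (\<lambda>p. det (\<chi> a c. if c = i then P (F p) $ j $ a else R p $ c $ a))"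
  proof (rule smooth_fun_on_det[OF preB O1])
   fix a c
   have "smooth_fun_on B O1 (\<lambda>p. P (F p) $ j $ a)"
    using smooth_fun_imp_on[OF fF[OF Ps[of j a]]] by (simp add: o_def)
   then show "smooth_fun_on B O1 (\<lambda>p. (\<chi> a c. if c = i then P (F p) $ j $ a else R p $ c $ a) $ a $ c)"
    using smooth_fun_imp_on[OF Rs[of c a]] by (cases "c = i") simp_all
  qed
 qed (simp add: O1_def)
 define h where "h j i p = b (F p) * N j i p" for j i p
 have hs: "smooth_fun B (h j i)" for j i
 proof -
  let ?C = "points B \<inter> F -` C"
  have cl: "closedin (mtop B) ?C"
  proof -
   have "closedin (mtop B) {p \<in> topspace (mtop B). F p \<in> C}"
    by (rule closedin_continuous_map_preimage[OF homeomorphic_imp_continuous_map[OF hom] b(4)])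
   moreover have "{p \<in> topspace (mtop B). F p \<in> C} = ?C" using topspace_mtop[OF preB] by auto
   ultimately show ?thesis by simp
  qed
  \<comment> \<open>Away from the manifold \<open>F\<close> may take values in \<open>C\<close>;
    setting the cut-off to 0 there gives it the form that \<open>smooth_fun_cutoff\<close>
    requires.\<close>
  define b' where "b' p = (if p \<in> points B then b (F p) else 0)" for p
  have b': "smooth_fun B b'"
   using fF[OF b(1)] smooth_fun_cong[OF preB, of b' "b o F"] by (simp add: b'_def)
  have "smooth_fun B (\<lambda>p. b' p * N j i p)"
   by (rule smooth_fun_cutoff[OF preB O1 N b' cl]) (use FC b(6) in \<open>auto simp: b'_def\<close>)
  then show ?thesis using smooth_fun_cong[OF preB, of "h j i" "\<lambda>p. b' p * N j i p"] by (simp add: b'_def h_def[abs_def])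
 qed
 have solve: "(\<Sum>i\<in>UNIV. N j i p * R p $ i $ k) = P (F p) $ j $ k" if p: "p \<in> O1" for j k p
 proof -
  have "det (transpose (R p)) \<noteq> 0" using p by (simp add: O1_def det_transpose)
  note cr = cramer[OF this, of "\<chi> i. N j i p" "P (F p) $ j"]
  have "transpose (R p) *v (\<chi> i. N j i p) = P (F p) $ j"
   unfolding cr unfolding N_def det_transpose by (simp add: transpose_def cong: if_cong)
  then have "(transpose (R p) *v (\<chi> i. N j i p)) $ k = P (F p) $ j $ k" by simp
  then show ?thesis by (simp add: matrix_vector_mult_def transpose_def mult.commute)
 qed
 define X where "X j = (\<lambda>p f. \<Sum>i\<in>UNIV. h j i p * Yb i p f)" for j
 define Z where "Z j = (\<lambda>p f. b p * Yb j p f)" for j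
 define \<zeta> where "\<zeta> j = (\<lambda>g. \<Sum>i\<in>UNIV. h j i (pr g) *\<^sub>R p1 (co g (ix (axis i 1))))" for j
 define \<xi> where "\<xi> j = (\<lambda>g. b (pr g) *\<^sub>R p1 (co g (ix (axis j 1))))" for j
 have sX: "slift (X j) (\<zeta> j)" for j
  unfolding X_def \<zeta>_def by (rule slift_sum) (auto intro: hs slift_Y)
 have sZ: "slift (Z j) (\<xi> j)" for j
  unfolding Z_def \<xi>_def by (rule slift_mult[OF b(1) slift_Y]) simp
 have rel: "X j p (f o F) = Z j (F p) f" if p: "p \<in> points B" and f: "smooth_fun B f" for j p f
 proof (cases "F p \<in> C")
  case False
  then show ?thesis using b(6) by (simp add: X_def Z_def h_def)
 next
  case True
  have pO: "p \<in> O1" and FO: "F p \<in> O2" using FC[OF p True] True b(5) by (auto simp: W_def)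
  obtain g where g: "g \<in> CG" "p = pr g" using p by (rule pointE)
  obtain k where k: "k \<in> CG" "F p = pr k" using Fp[OF p] by (rule pointE)
  \<comment> \<open>Coordinates of horizontal vectors at \<open>F p\<close>. The images of the frame
    are horizontal by \<open>isometry_horizontal\<close>, so equal coordinates mean equal vectors
    once \<open>l\<close> is injective, which invertibility of \<open>P (F p)\<close>
    provides.\<close>
  define l where "l y = (\<chi> m. L (ix y) k (lift (q m)))" for y
  have l: "linear l"
   using linear_add[OF linear_horizontal] linear_scale[OF linear_horizontal]
   by (intro linearI) (simp_all add: l_def vec_eq_iff)
  have "\<exists>y. push_forward B F (Yb i p) = Pu k (ix y)" for i
  proof -
   have "Yb i p = Pu g (ix (p1 (co g (ix (axis i 1)))))" using Y_pr[OF g(1) ix_galg] g(2) by simp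
   then show ?thesis
    using isometry_horizontal[OF F(1,2) g(1) k(1), of "p1 (co g (ix (axis i 1)))"] k(2) g(2) by metis
  qed
  then obtain y where y: "\<And>i. push_forward B F (Yb i p) = Pu k (ix (y i))" by metis
  have yf: "Yb i p (f o F) = L (ix (y i)) k (lift f)" if "smooth_fun B f" for i f
   using fun_cong[OF y[of i], of f] that by (simp add: push_forward_def Pu_apply)
  define w where "w j = p1 (co k (ix (axis j 1)))" for j
  have Yk: "Yb j (F p) f = L (ix (w j)) k (lift f)" if "smooth_fun B f" for j f
   using Y_pr[OF k(1) ix_galg] k(2) that by (simp add: w_def Pu_apply)
  have lw: "l (w j) = P (F p) $ j" for j by (simp add: l_def P_def vec_eq_iff Yk[OF q(1)])
  have "surj l"
  proof -
   have "invertible (P (F p))" using FO by (simp add: O2_def invertible_det_nz)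
   then obtain Q where Q: "Q ** P (F p) = mat 1" unfolding invertible_def by blast
   have "x = l (\<Sum>j\<in>UNIV. (\<Sum>m\<in>UNIV. x $ m * Q $ m $ j) *\<^sub>R w j)" for x
   proof -
    have "(\<Sum>j\<in>UNIV. (\<Sum>m\<in>UNIV. x $ m * Q $ m $ j) * P (F p) $ j $ c) = x $ c" for c
    proof -
     have "(\<Sum>j\<in>UNIV. (\<Sum>m\<in>UNIV. x $ m * Q $ m $ j) * P (F p) $ j $ c) =
       (\<Sum>m\<in>UNIV. x $ m * (Q ** P (F p)) $ m $ c)"
      unfolding matrix_matrix_mult_def
      by (simp add: sum_distrib_left sum_distrib_right mult.assoc) (rule sum.swap)
     also have "\<dots> = x $ c" by (simp add: Q mat_def if_distrib cong: if_cong)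
     finally show ?thesis .
    qed
    then show ?thesis
     by (simp add: linear_sum[OF l] linear_scale[OF l] lw vec_eq_iff)
   qed
   note onto = this
   show ?thesis unfolding surj_def by (intro allI exI) (rule onto)
  qed
  then have "inj l" by (rule linear_surjective_imp_injective[OF l]) simp
  moreover have "l (\<Sum>i\<in>UNIV. N j i p *\<^sub>R y i) = l (w j)"
  proof -
   have "l (y i) = R p $ i" for i by (simp add: l_def R_def vec_eq_iff yf[OF q(1)])
   then show ?thesis
    using solve[OF pO] by (simp add: linear_sum[OF l] linear_scale[OF l] lw vec_eq_iff)
  qed
  ultimately have wj: "w j = (\<Sum>i\<in>UNIV. N j i p *\<^sub>R y i)" by (metis injD)
  have "X j p (f o F) = b (F p) * (\<Sum>i\<in>UNIV. N j i p * L (ix (y i)) k (lift f))"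
   by (simp add: X_def h_def yf[OF f] sum_distrib_left mult.assoc)
  also have "(\<Sum>i\<in>UNIV. N j i p * L (ix (y i)) k (lift f)) = L (ix (w j)) k (lift f)"
   unfolding wj by (simp add: linear_sum[OF linear_horizontal] linear_scale[OF linear_horizontal])
  finally show ?thesis by (simp only: Z_def Yk[OF f])
 qed
 have \<xi>0: "\<xi> j e1 = axis j 1" for j using b(2,3) by (simp add: \<xi>_def co_one)
 have \<zeta>0: "\<zeta> j e1 = - axis j 1" for j
 proof -
  have "Pu e1 (ix (\<zeta> j e1)) f = Pu e1 (ix (- axis j 1)) f" for f
  proof (cases "smooth_fun B f")
   case True
   have "X j (pr e1) (f o F) = Pu e1 (ix (axis j 1)) f"
    using rel[OF op True] sliftD(3)[OF sZ, of e1] F(3) \<xi>0 by simp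
   moreover have "X j (pr e1) (f o F) = - X j (pr e1) f"
    by (simp add: X_def pfY[OF True] sum_negf)
   moreover have "X j (pr e1) = Pu e1 (ix (\<zeta> j e1))" using sliftD(3)[OF sX, of e1] by simp
   ultimately show ?thesis using Pu_ix_scale[of e1 "-1" "axis j 1"] by simp
  qed (simp add: Pu_apply)
  then show ?thesis using Pu_ix_inj[of e1 "\<zeta> j e1" "- axis j 1"] by auto
 qed
 show ?thesis by (rule that[OF sX sZ \<zeta>0 \<xi>0 rel])
qed

end

section \<open>Vector fields related by a map\<close>

context model begin

text \<open>The classical relation of F-related fields, stated on test functions. It passes to
  brackets (\<open>frel_bracket\<close>) without mention of an inverse of \<open>F\<close>.\<close>

definition frel :: "('g set => 'g set) => 'g set vfield => 'g set vfield => bool" where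
 "frel F X Z \<longleftrightarrow> (\<forall>p\<in>points B. \<forall>f. smooth_fun B f --> X p (f o F) = Z (F p) f)"

lemma flift_cong:
 assumes X: "flift X \<eta>" and p: "p \<in> points B" and f: "smooth_fun B f"
  and eq: "\<And>q. q \<in> points B ==> f q = h q"
 shows "X p f = X p h"
proof -
 obtain g where g: "g \<in> CG" "p = pr g" using p by (rule pointE)
 have h: "smooth_fun B h" using f smooth_fun_cong[OF preB eq] by simp
 have "L (\<eta> g) g (lift f) = L (\<eta> g) g (lift h)"
  by (rule L_cong[OF fliftD(2)[OF X g(1)] g(1)]) (simp add: eq)
 then show ?thesis using fliftD(3)[OF X g(1)] f h g(2) by simp
qed

lemma frel_bracket:
 assumes F: "smooth_map B B F"
  and X: "flift X \<eta>" and X': "flift X' \<eta>'" and Z: "flift Z \<omega>" and Z': "flift Z' \<omega>'"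
  and r: "frel F X Z" "frel F X' Z'"
 shows "frel F (vf_bracket X X') (vf_bracket Z Z')"
proof -
 have *: "X p (\<lambda>q. X' q (f o F)) = Z (F p) (\<lambda>q. Z' q f)"
  if X: "flift X \<eta>" and X': "flift X' \<eta>'" and Z': "flift Z' \<omega>'" and r: "frel F X Z" "frel F X' Z'"
   and p: "p \<in> points B" and f: "smooth_fun B f" for X X' Z Z' \<eta> \<eta>' \<omega>' p f
 proof -
  have fF: "smooth_fun B (f o F)" by (rule smooth_map_fun[OF preB preB F f])
  have "X p (\<lambda>q. X' q (f o F)) = X p ((\<lambda>q. Z' q f) o F)"
   by (rule flift_cong[OF X p flift_smooth[OF X' fF]]) (use r(2) f in \<open>simp add: frel_def\<close>)
  also have "\<dots> = Z (F p) (\<lambda>q. Z' q f)" using r(1) p flift_smooth[OF Z' f] by (simp add: frel_def)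
  finally show ?thesis .
 qed
 show ?thesis
  unfolding frel_def vf_bracket_def
  using *[OF X X' Z' r] *[OF X' X Z r(2,1)] by simp
qed

lemma p3_dV:
 assumes v: "v \<in> tangent_space A p" and \<eta>: "smooth_vec A \<eta>" and z: "\<And>g. p3 (\<eta> g) = 0"
 shows "p3 (dV v \<eta>) = 0"
proof -
 have "p3 (dV v \<eta>) = dV v (\<lambda>g. p3 (\<eta> g))" by (rule dV_linear[OF pre v \<eta> p_linear(3), symmetric])
 also have "\<dots> = 0" unfolding z dV_def using tangent_const[OF v] by simp
 finally show ?thesis .
qed

end

text \<open>Each pair of indices occurs twice in the double sum, hence the factor 1/2; the order of
  indices in \<open>C $ j $ i\<close> matches the sign convention of \<open>wedge\<close>.\<close>

lemma skew_sum_wedge: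
 fixes C :: "real ^ 'n ^ ('n::finite)"
 assumes "C \<in> skew"
 shows "C = (\<Sum>i\<in>UNIV. \<Sum>j\<in>UNIV. (C $ j $ i / 2) *\<^sub>R wedge (axis i 1) (axis j 1))"
proof -
 define D where "D = (\<Sum>i\<in>UNIV. \<Sum>j\<in>UNIV. (C $ j $ i / 2) *\<^sub>R wedge (axis i 1 :: real ^ 'n) (axis j 1))"
 have "D $ a $ c = C $ a $ c" for a c
 proof -
  have "D $ a $ c =
    (\<Sum>i\<in>UNIV. \<Sum>j\<in>UNIV. (if j = a \<and> i = c then C $ j $ i / 2 else 0) - (if i = a \<and> j = c then C $ j $ i / 2 else 0))"
  proof -
   have if_mult: "x * ((if P then 1 else 0) - (if Q then 1 else 0)) = (if P then x else 0) - (if Q then x else 0)"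
    for x :: real and P Q by simp
   have w: "(wedge (axis i 1 :: real ^ 'n) (axis j 1)) $ a $ c =
     (if j = a \<and> i = c then 1 else 0) - (if i = a \<and> j = c then 1 else 0)" for i j
    by (cases "j = a"; cases "i = c"; cases "i = a"; cases "j = c") (simp_all add: wedge_def axis_def)
   have "(C $ j $ i / 2) * (wedge (axis i 1 :: real ^ 'n) (axis j 1)) $ a $ c =
     (if j = a \<and> i = c then C $ j $ i / 2 else 0) - (if i = a \<and> j = c then C $ j $ i / 2 else 0)" for i j
    unfolding w by (rule if_mult)
   then show ?thesis unfolding D_def sum_component vector_scaleR_component real_scaleR_def by (simp only:)
  qed
  also have "\<dots> = C $ a $ c / 2 - C $ c $ a / 2"
  proof -
   have "(\<Sum>i\<in>UNIV. \<Sum>j\<in>UNIV. if j = a \<and> i = c then C $ j $ i / 2 else 0) =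
     (\<Sum>i\<in>UNIV. if i = c then C $ a $ i / 2 else 0)"
    by (rule sum.cong[OF refl], case_tac "x = c") simp_all
   moreover have "(\<Sum>i\<in>UNIV. \<Sum>j\<in>UNIV. if i = a \<and> j = c then C $ j $ i / 2 else 0) =
     (\<Sum>i\<in>UNIV. if i = a then C $ c $ i / 2 else 0)"
    by (rule sum.cong[OF refl], case_tac "x = a") simp_all
   ultimately show ?thesis by (simp add: sum_subtractf)
  qed
  also have "\<dots> = C $ a $ c"
  proof -
   have "C $ c $ a = - C $ a $ c" using assms unfolding skew_iff by blast
   then show ?thesis by simp
  qed
  finally show ?thesis .
 qed
 then have "D = C" by (simp add: vec_eq_iff)
 then show ?thesis unfolding D_def ..
qed

lemma skew_span:
 fixes C :: "real ^ 'n ^ ('n::finite)" and l :: "real ^ 'n ^ 'n => 'v::real_vector"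
 assumes P: "subspace P" and l: "linear l" and w: "\<And>i j. l (wedge (axis i 1) (axis j 1)) \<in> P" and C: "C \<in> skew"
 shows "l C \<in> P"
proof -
 have "(\<Sum>i\<in>UNIV. \<Sum>j\<in>UNIV. (C $ j $ i / 2) *\<^sub>R l (wedge (axis i 1) (axis j 1))) \<in> P"
  by (intro subspace_sum subspace_scale P w)
 then show ?thesis by (subst skew_sum_wedge[OF C]) (simp only: linear_sum[OF l] linear_scale[OF l])
qed

lemma galg_spanned:
 fixes P :: "('n::finite) quad set"
 assumes P: "subspace P" and x: "\<And>x. ix x \<in> P" and w: "\<And>i j. (0, wedge (axis i 1) (axis j 1), 0, 0) \<in> P"
  and u: "\<And>j. (0, 0, axis j 1, 0) \<in> P" and k: "\<And>i j. ik (wedge (axis i 1) (axis j 1)) \<in> P"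
  and b: "b \<in> galg"
 shows "b \<in> P"
proof -
 have sk: "p2 b \<in> skew" "p4 b \<in> skew" using b by (simp_all add: galg_iff)
 have 2: "(0, p2 b, 0, 0) \<in> P" by (rule skew_span[where l = "\<lambda>C. (0, C, 0, 0)", OF P _ w sk(1)]) (auto intro: linearI)
 have 4: "ik (p4 b) \<in> P" by (rule skew_span[where l = ik, OF P _ k sk(2)]) (auto intro: linearI)
 have l: "linear (\<lambda>u :: real ^ 'n. (0 :: real ^ 'n, 0 :: real ^ 'n ^ 'n, u, 0 :: real ^ 'n ^ 'n))" by (auto intro: linearI)
 have "(\<Sum>j\<in>UNIV. p3 b $ j *\<^sub>R (0 :: real ^ 'n, 0 :: real ^ 'n ^ 'n, axis j 1 :: real ^ 'n, 0 :: real ^ 'n ^ 'n)) \<in> P"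
  by (intro subspace_sum subspace_scale P u)
 also have "(\<Sum>j\<in>UNIV. p3 b $ j *\<^sub>R (0 :: real ^ 'n, 0 :: real ^ 'n ^ 'n, axis j 1 :: real ^ 'n, 0 :: real ^ 'n ^ 'n)) =
   (0, 0, \<Sum>j\<in>UNIV. p3 b $ j *\<^sub>R axis j 1, 0)"
  by (simp only: linear_sum[OF l] linear_scale[OF l])
 also have "\<dots> = (0, 0, p3 b, 0)" by (simp add: basis_expansion[of "p3 b", unfolded scalar_mult_eq_scaleR])
 finally have 3: "(0, 0, p3 b, 0) \<in> P" .
 have "ix (p1 b) + (0, p2 b, 0, 0) + (0, 0, p3 b, 0) + ik (p4 b) \<in> P"
  by (intro subspace_add P x 2 3 4)
 then show ?thesis by (subst quad_eq[of b]) simp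
qed

context model_connection begin

text \<open>Turns the relation into a push-forward by \<open>vf_Ad\<close>, the form in which
  invariance of the connection is stated.\<close>

lemma frel_Ad:
 assumes F: "F \<in> isom M" "smooth_map B B F" and r: "frel F X Z"
  and X: "\<And>p f. p \<in> points B ==> \<not> smooth_fun B f ==> Z p f = 0" and Z: "\<And>p. p \<notin> points B ==> Z p = (\<lambda>_. 0)"
 shows "vf_Ad B F X = Z"
proof
 fix p
 have hom: "homeomorphic_map (mtop B) (mtop B) F" using F(1) by (simp add: isom_def)
 show "vf_Ad B F X p = Z p"
 proof (cases "p \<in> points B")
  case False
  then show ?thesis using Z by (simp add: vf_Ad_def)
 next
  case True
  have im: "F ` points B = points B"
   using homeomorphic_imp_surjective_map[OF hom] topspace_mtop[OF preB] by simp
  let ?q = "inv_into (points B) F p"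
  have q: "?q \<in> points B" "F ?q = p" using inv_into_into[of p F "points B"] f_inv_into_f[of p F "points B"] True im by auto
  show ?thesis
  proof
   fix f show "vf_Ad B F X p f = Z p f"
    using r q True X[OF True, of f] by (simp add: vf_Ad_def push_forward_def frel_def)
  qed
 qed
qed

lemma frel_tors:
 assumes F: "F \<in> isom M" "smooth_map B B F"
  and X: "slift X \<zeta>" and X': "slift X' \<zeta>'" and Z: "slift Z \<xi>" and Z': "slift Z' \<xi>'"
  and r: "frel F X Z" "frel F X' Z'"
 shows "frel F (tors X X') (tors Z Z')"
proof -
 have hom: "homeomorphic_map (mtop B) (mtop B) F" using F(1) by (simp add: isom_def)
 have inj: "inj_on F (points B)"
  using homeomorphic_imp_injective_map[OF hom] topspace_mtop[OF preB] by simp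
 have *: "nab X' p (X p) (f o F) = nab Z' (F p) (Z (F p)) f"
  if X: "slift X \<zeta>" and X': "slift X' \<zeta>'" and Z: "slift Z \<xi>" and Z': "slift Z' \<xi>'"
   and r: "frel F X Z" "frel F X' Z'" and p: "p \<in> points B" and f: "smooth_fun B f" for X X' Z Z' \<zeta> \<zeta>' \<xi> \<xi>' p f
 proof -
  have Ad: "vf_Ad B F X = Z" if "slift Z \<xi>" "frel F X Z" for X Z \<xi>
  proof (rule frel_Ad[OF F that(2)])
   show "Z p f = 0" if "p \<in> points B" "\<not> smooth_fun B f" for p f
    using sliftD(2)[OF \<open>slift Z \<xi>\<close>] that by (auto simp: sections_def vfields_def dest: tangentD(1))
  qed (rule section_outside[OF sliftD(2)[OF that(1)]])
  have Fp: "F p \<in> points B" by (rule smooth_map_points[OF F(2) p])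
  have "nab Z' (F p) (Z (F p)) = nab (vf_Ad B F X') (F p) (vf_Ad B F X (F p))"
   using Ad[OF Z r(1)] Ad[OF Z' r(2)] by simp
  also have "\<dots> = vf_Ad B F (\<lambda>q. nab X' q (X q)) (F p)"
   using ii F(1) sliftD(2)[OF X] sliftD(2)[OF X'] Fp unfolding isom_invariant_def by blast
  finally have "nab Z' (F p) (Z (F p)) f = vf_Ad B F (\<lambda>q. nab X' q (X q)) (F p) f" by (rule fun_cong)
  then show ?thesis
   using Fp f inv_into_f_f[OF inj p] by (simp add: vf_Ad_def push_forward_def)
 qed
 note bra = frel_bracket[OF F(2) slift_flift[OF X] slift_flift[OF X'] slift_flift[OF Z] slift_flift[OF Z'] r]
 show ?thesis
  unfolding frel_def tors_def
  using bra[unfolded frel_def] *[OF X X' Z Z' r] *[OF X' X Z' Z r(2,1)] by simp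
qed

text \<open>The model space property applied to minus the identity, a linear isometry of the
  horizontal space at the base point.\<close>

lemma negating_isometry:
 obtains F where "F \<in> isom M" "smooth_map B B F" "F (pr e1) = pr e1"
  "\<And>v. v \<in> dst M (pr e1) ==> push_forward B F v = (\<lambda>f. - v f)"
proof -
 let ?Q = "\<lambda>(v :: 'g set tvec) f. - v f"
 have D: "dst M (pr e1) = range (\<lambda>x. Pu e1 (ix x))" by (rule dst_eq) simp
 have Q: "?Q (Pu e1 (ix x)) = Pu e1 (ix (- x))" for x using Pu_ix_scale[of e1 "-1" x] by simp
 have m: "met M (pr e1) (?Q u) (?Q v) = met M (pr e1) u v" if uv: "u \<in> dst M (pr e1)" "v \<in> dst M (pr e1)" for u v
 proof -
  obtain x y where "u = Pu e1 (ix x)" "v = Pu e1 (ix y)" using uv unfolding D by blast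
  then show ?thesis using met_eq[of e1] by (simp add: Q)
 qed
 have inQ: "?Q v \<in> dst M (pr e1)" if v: "v \<in> dst M (pr e1)" for v
 proof -
  obtain x where "v = Pu e1 (ix x)" using v unfolding D by blast
  then show ?thesis unfolding D using Q by blast
 qed
 have "linear_isometry M (pr e1) (pr e1) ?Q"
  unfolding linear_isometry_def
 proof (intro conjI ballI allI)
  show "bij_betw ?Q (dst M (pr e1)) (dst M (pr e1))"
   by (rule bij_betw_byWitness[of _ ?Q]) (use inQ in auto)
 qed (use m in \<open>auto simp: fun_eq_iff\<close>)
 moreover have "pr e1 \<in> points B" by simp
 ultimately have "\<exists>F\<in>isom M. smooth_map B B F \<and> F (pr e1) = pr e1 \<and>
   (\<forall>v\<in>dst M (pr e1). push_forward B F v = ?Q v)"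
  using sr unfolding sr_model_space_def by blast
 then show ?thesis using that by blast
qed

text \<open>The isometry \<open>F\<close> acts by \<open>-1\<close> on \<open>a\<^sup>1\<close>, hence by \<open>+1\<close> on torsion values and by \<open>-1\<close> on brackets of
 sections with torsions, so it acts by \<open>-1\<close> on the \<open>a\<^sup>3\<close> component. Brackets of two torsion fields are
 invariant, so their \<open>a\<^sup>3\<close> component vanishes.\<close>

lemma torsion_identity:
 fixes s :: "'n => 'n => real ^ 'n"
 defines "s i j \<equiv> S (axis j 1) (axis i 1) - S (axis i 1) (axis j 1)"
 shows "wedge (axis i 1) (axis j 1) *v s k l = wedge (axis k 1) (axis l 1) *v s i j"
proof -
 obtain F where F: "F \<in> isom M" "smooth_map B B F" "F (pr e1) = pr e1"
  "\<And>v. v \<in> dst M (pr e1) ==> push_forward B F v = (\<lambda>f. - v f)"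
  by (rule negating_isometry) (rule that)
 obtain X Z \<zeta> \<xi> where X: "\<And>j. slift (X j) (\<zeta> j)" and Z: "\<And>j. slift (Z j) (\<xi> j)"
  and \<zeta>: "\<And>j. \<zeta> j e1 = - axis j 1" and \<xi>: "\<And>j. \<xi> j e1 = axis j 1"
  and rel': "\<And>j p f. p \<in> points B ==> smooth_fun B f ==> X j p (f o F) = Z j (F p) f"
  by (rule isometry_frame[OF F(1-3)], erule F(4), rule that)
 have rel: "frel F (X j) (Z j)" for j unfolding frel_def using rel' by blast
 \<comment> \<open>The differential of \<open>F\<close> at the base point sends the tangent vector
   of b to that of b'. A relation, because Lie algebra elements determine tangent vectors but not
   conversely.\<close>
 define Fr where "Fr b b' \<longleftrightarrow> b \<in> galg \<and> b' \<in> galg \<and>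
  (\<forall>f. smooth_fun B f --> L b e1 (lift (f o F)) = L b' e1 (lift f))" for b b'
 have fF: "smooth_fun B (f o F)" if "smooth_fun B f" for f by (rule smooth_map_fun[OF preB preB F(2) that])
 have Fr_flift: "Fr (\<eta> e1) (\<omega> e1)" if "flift V \<eta>" "flift W \<omega>" "frel F V W" for V W \<eta> \<omega>
  unfolding Fr_def
 proof (intro conjI allI impI)
  show "\<eta> e1 \<in> galg" "\<omega> e1 \<in> galg" using fliftD(2)[OF that(1)] fliftD(2)[OF that(2)] by simp_all
  fix f assume f: "smooth_fun B f"
  have "V (pr e1) (f o F) = W (F (pr e1)) f" using that(3) f by (simp add: frel_def)
  then show "L (\<eta> e1) e1 (lift (f o F)) = L (\<omega> e1) e1 (lift f)"
   using fliftD(3)[OF that(1), of e1, OF _ fF[OF f]] fliftD(3)[OF that(2), of e1, OF _ f] F(3) by simp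
 qed
 have Fr_bracket: "Fr (dV (L (\<eta> e1) e1) \<eta>' - dV (L (\<eta>' e1) e1) \<eta> + br (\<eta> e1) (\<eta>' e1))
   (dV (L (\<omega> e1) e1) \<omega>' - dV (L (\<omega>' e1) e1) \<omega> + br (\<omega> e1) (\<omega>' e1))"
  if V: "flift V \<eta>" and V': "flift V' \<eta>'" and W: "flift W \<omega>" and W': "flift W' \<omega>'"
   and r: "frel F V W" "frel F V' W'" for V V' W W' \<eta> \<eta>' \<omega> \<omega>'
  unfolding Fr_def
 proof (intro conjI allI impI)
  have "dV (L (\<eta> e1) e1) \<eta>' - dV (L (\<eta>' e1) e1) \<eta> + br (\<eta> e1) (\<eta>' e1) \<in> galg"
   if V: "flift V \<eta>" and V': "flift V' \<eta>'" for V V' \<eta> \<eta>'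
   by (intro subspace_add subspace_diff subspace_galg gbracket_galg dV_galg[of _ e1] L_tangent fliftD(1,2)[OF V]
     fliftD(1,2)[OF V']) simp_all
  then show "dV (L (\<eta> e1) e1) \<eta>' - dV (L (\<eta>' e1) e1) \<eta> + br (\<eta> e1) (\<eta>' e1) \<in> galg"
   "dV (L (\<omega> e1) e1) \<omega>' - dV (L (\<omega>' e1) e1) \<omega> + br (\<omega> e1) (\<omega>' e1) \<in> galg" using V V' W W' by blast+
  fix f assume f: "smooth_fun B f"
  have "vf_bracket V V' (pr e1) (f o F) = vf_bracket W W' (F (pr e1)) f"
   using frel_bracket[OF F(2) V V' W W' r] f by (simp add: frel_def)
  then show "L (dV (L (\<eta> e1) e1) \<eta>' - dV (L (\<eta>' e1) e1) \<eta> + br (\<eta> e1) (\<eta>' e1)) e1 (lift (f o F)) =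
    L (dV (L (\<omega> e1) e1) \<omega>' - dV (L (\<omega>' e1) e1) \<omega> + br (\<omega> e1) (\<omega>' e1)) e1 (lift f)"
   using bracket_flift[OF V V', of e1, OF _ fF[OF f]] bracket_flift[OF W W', of e1, OF _ f] F(3) by simp
 qed
 \<comment> \<open>Elements on which the differential of \<open>F\<close> can be represented with
   the sign -1 on \<open>p3\<close>. This subspace is shown to contain all four summands of
   \<open>galg\<close>.\<close>
 define P where "P = {b. \<exists>b'. Fr b b' \<and> p3 b' = - p3 b}"
 have P: "subspace P"
  unfolding subspace_def
 proof (intro conjI ballI allI)
  show "0 \<in> P" unfolding P_def Fr_def
   by (intro CollectI exI[of _ 0]) (simp add: subspace_0[OF subspace_galg] linear_0[OF p_linear(3)] L_zero)
  fix b c assume "b \<in> P" "c \<in> P"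
  then obtain b' c' where "Fr b b'" "p3 b' = - p3 b" "Fr c c'" "p3 c' = - p3 c" unfolding P_def by blast
  then show "b + c \<in> P" unfolding P_def Fr_def
   by (intro CollectI exI[of _ "b' + c'"]) (simp add: L_add subspace_add[OF subspace_galg] linear_add[OF p_linear(3)])
 next
  fix r b assume "b \<in> P"
  then obtain b' where "Fr b b'" "p3 b' = - p3 b" unfolding P_def by blast
  then show "r *\<^sub>R b \<in> P" unfolding P_def Fr_def
   by (intro CollectI exI[of _ "r *\<^sub>R b'"]) (simp add: L_scale subspace_scale[OF subspace_galg] linear_scale[OF p_linear(3)])
 qed
 define \<tau> where "\<tau> \<zeta> i j g = (S (\<zeta> j g) (\<zeta> i g) - S (\<zeta> i g) (\<zeta> j g), wedge (\<zeta> i g) (\<zeta> j g), 0 :: real ^ 'n, 0 :: real ^ 'n ^ 'n)"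
  for \<zeta> :: "'n => 'g => real ^ 'n" and i j g
 have TX: "flift (tors (X i) (X j)) (\<tau> \<zeta> i j)" and TZ: "flift (tors (Z i) (Z j)) (\<tau> \<xi> i j)" for i j
  using tors_flift[OF X X] tors_flift[OF Z Z] unfolding \<tau>_def[abs_def] by blast+
 have relT: "frel F (tors (X i) (X j)) (tors (Z i) (Z j))" for i j
  by (rule frel_tors[OF F(1,2) X X Z Z rel rel])
 have Sneg: "S (- x) (- y) = S x y" for x y
  using linear_neg[OF S_linear(1)] linear_neg[OF S_linear(2)] by simp
 have wneg: "wedge (- x) (- y) = wedge x y" for x y :: "real ^ 'n" by (simp add: wedge_def)
 have \<tau>0: "\<tau> \<zeta> i j e1 = (s i j, wedge (axis i 1) (axis j 1), 0, 0)" "\<tau> \<xi> i j e1 = (s i j, wedge (axis i 1) (axis j 1), 0, 0)" for i j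
  by (simp_all add: \<tau>_def \<zeta> \<xi> s_def Sneg wneg)
 have Px: "ix x \<in> P" for x
 proof -
  have "ix (- axis i 1) \<in> P" for i
   unfolding P_def using Fr_flift[OF slift_flift[OF X] slift_flift[OF Z] rel, of i] \<zeta> \<xi> by auto
  then have "(\<Sum>i\<in>UNIV. (- x $ i) *\<^sub>R ix (- axis i 1)) \<in> P" by (intro subspace_sum subspace_scale P) auto
  also have "(\<Sum>i\<in>UNIV. (- x $ i) *\<^sub>R ix (- axis i 1)) = ix (\<Sum>i\<in>UNIV. x $ i *\<^sub>R axis i 1)"
  proof -
   have "linear (\<lambda>x :: real ^ 'n. ix x)" by (auto intro: linearI)
   from linear_sum[OF this, of "\<lambda>i. x $ i *\<^sub>R axis i 1" UNIV] show ?thesis by simp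
  qed
  finally show ?thesis by (simp add: basis_expansion[of x, unfolded scalar_mult_eq_scaleR])
 qed
 have Pk: "ik C \<in> P" if C: "C \<in> skew" for C
 proof -
  have "Fr (ik C) 0"
   unfolding Fr_def
  proof (intro conjI allI impI ik_galg C subspace_0[OF subspace_galg])
   fix f assume f: "smooth_fun B f"
   obtain c where c: "exp_curve G A (L (ik C)) c" "\<forall>t. c t \<in> K" by (rule K_exp_curve[OF C])
   have c0: "c 0 = e1" using c(1) by (simp add: exp_curve_def)
   have "((\<lambda>t. (f o F) (pr (c t))) has_real_derivative L (ik C) e1 (lift (f o F))) (at 0)"
    using exp_curve_deriv[OF c(1) lift_smooth[OF fF[OF f]], of 0] c0 by (simp add: o_def)
   moreover have "(\<lambda>t. (f o F) (pr (c t))) = (\<lambda>t. (f o F) (pr e1))"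
    using pr_K[of e1] c(2) by (metis K_simps(1) group_simps(3,4))
   ultimately have "L (ik C) e1 (lift (f o F)) = 0" using DERIV_unique[OF _ DERIV_const] by metis
   then show "L (ik C) e1 (lift (f o F)) = L 0 e1 (lift f)" by (simp add: L_zero)
  qed
  then show ?thesis unfolding P_def by (intro CollectI exI[of _ 0]) (simp add: linear_0[OF p_linear(3)])
 qed
 have Pw: "(0, C, 0, 0) \<in> P" if "C \<in> skew" for C
 proof -
  have w: "(0, wedge (axis i 1) (axis j 1), 0, 0) \<in> P" for i j
  proof -
   \<comment> \<open>Torsion values have \<open>p3 = 0\<close>, so the sign condition is void for
     them; removing their horizontal part leaves the \<open>wedge\<close>.\<close>
   have "\<tau> \<zeta> i j e1 \<in> P"
    unfolding P_def using Fr_flift[OF TX TZ relT, of i j] by (intro CollectI exI[of _ "\<tau> \<xi> i j e1"]) (simp add: \<tau>0)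
   moreover have "\<tau> \<zeta> i j e1 - ix (s i j) = (0, wedge (axis i 1) (axis j 1), 0, 0)"
    by (simp add: \<tau>0 prod_eq_iff)
   ultimately show ?thesis using subspace_diff[OF P _ Px[of "s i j"]] by metis
  qed
  show ?thesis by (rule skew_span[where l = "\<lambda>C. (0, C, 0, 0)", OF P _ w that]) (auto intro: linearI)
 qed
 have p3T: "p3 (\<tau> \<zeta> i j g) = 0" for \<zeta> i j g by (simp add: \<tau>_def)
 have dV0: "p3 (dV (L (\<eta> e1) e1) \<eta>' - dV (L (\<eta>' e1) e1) \<eta> + d) = p3 d"
  if V: "flift V \<eta>" and V': "flift V' \<eta>'" and z: "\<And>g. p3 (\<eta> g) = 0" "\<And>g. p3 (\<eta>' g) = 0" for V V' \<eta> \<eta>' d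
 proof -
  have "L (\<eta> e1) e1 \<in> tangent_space A e1" "L (\<eta>' e1) e1 \<in> tangent_space A e1"
   using L_tangent fliftD(2)[OF V] fliftD(2)[OF V'] by simp_all
  then show ?thesis
   using p3_dV[OF _ fliftD(1)[OF V] z(1)] p3_dV[OF _ fliftD(1)[OF V'] z(2)]
   by (simp add: linear_add[OF p_linear(3)] linear_diff[OF p_linear(3)])
 qed
 have Pu3: "(0, 0, axis j 1, 0) \<in> P" for j
 proof -
  obtain i where i: "i \<noteq> j" using other_index by blast
  let ?A = "wedge (axis i 1) (axis j 1) :: real ^ 'n ^ 'n"
  \<comment> \<open>The bracket of \<open>X i\<close> with a torsion field. Its \<open>p3\<close>
    component is the \<open>wedge\<close> applied to the value of the first lift up to sign, so it
    inherits the sign change between \<open>\<zeta> i e1\<close> and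
    \<open>\<xi> i e1\<close>.\<close>
  define b where "b = dV (L (ix (\<zeta> i e1)) e1) (\<tau> \<zeta> i j) - dV (L (\<tau> \<zeta> i j e1) e1) (\<lambda>g. ix (\<zeta> i g)) + br (ix (\<zeta> i e1)) (\<tau> \<zeta> i j e1)"
  define b' where "b' = dV (L (ix (\<xi> i e1)) e1) (\<tau> \<xi> i j) - dV (L (\<tau> \<xi> i j e1) e1) (\<lambda>g. ix (\<xi> i g)) + br (ix (\<xi> i e1)) (\<tau> \<xi> i j e1)"
  have Fb: "Fr b b'"
   unfolding b_def b'_def by (rule Fr_bracket[OF slift_flift[OF X] TX slift_flift[OF Z] TZ rel relT])
  have Ai: "?A *v axis i 1 = axis j 1"
   using i by (simp add: wedge_mult inner_axis_axis)
  have "?A *v (- axis i 1) = - axis j 1"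
   using Ai matrix_vector_linear(4)[of ?A "-1" "axis i 1"] by simp
  then have pb: "p3 b = axis j 1" "p3 b' = - axis j 1"
   unfolding b_def b'_def dV0[OF slift_flift[OF X] TX p_simps(3) p3T] dV0[OF slift_flift[OF Z] TZ p_simps(3) p3T]
   using Ai by (simp_all add: \<tau>0 \<zeta> \<xi> matrix_vector_mult_0 wedge_zero comm_zero)
  then have bP: "b \<in> P" unfolding P_def using Fb by (intro CollectI exI[of _ b']) simp
  have "b \<in> galg" using Fb by (simp add: Fr_def)
  then have sk: "p2 b \<in> skew" "p4 b \<in> skew" by (simp_all add: galg_iff)
  have "b - ix (p1 b) - (0, p2 b, 0, 0) - ik (p4 b) \<in> P"
   by (intro subspace_diff P bP Px Pw Pk sk)
  moreover have "b - ix (p1 b) - (0, p2 b, 0, 0) - ik (p4 b) = (0, 0, axis j 1, 0)"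
   by (subst (1) quad_eq[of b]) (simp add: pb(1) prod_eq_iff)
  ultimately show ?thesis by simp
 qed
 have Pa: "b \<in> P" if b: "b \<in> galg" for b
  by (rule galg_spanned[OF P Px Pw[OF wedge_skew] Pu3 Pk[OF wedge_skew] b])
 \<comment> \<open>The bracket of two torsion fields has equal \<open>p3\<close> at source and
   target, because their lifts agree at the base point. Membership in \<open>P\<close> represents
   the same tangent vector with the opposite sign, and \<open>kernel_p3\<close> makes the two
   representatives comparable.\<close>
 define b where "b = dV (L (\<tau> \<zeta> i j e1) e1) (\<tau> \<zeta> k l) - dV (L (\<tau> \<zeta> k l e1) e1) (\<tau> \<zeta> i j) + br (\<tau> \<zeta> i j e1) (\<tau> \<zeta> k l e1)"
 define c where "c = dV (L (\<tau> \<xi> i j e1) e1) (\<tau> \<xi> k l) - dV (L (\<tau> \<xi> k l e1) e1) (\<tau> \<xi> i j) + br (\<tau> \<xi> i j e1) (\<tau> \<xi> k l e1)"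
 have Fc: "Fr b c" unfolding b_def c_def by (rule Fr_bracket[OF TX TX TZ TZ relT relT])
 have pc: "p3 b = wedge (axis i 1) (axis j 1) *v s k l - wedge (axis k 1) (axis l 1) *v s i j" "p3 c = p3 b"
  unfolding b_def c_def dV0[OF TX TX p3T p3T] dV0[OF TZ TZ p3T p3T] by (simp_all add: \<tau>0 matrix_vector_mult_0_right)
 obtain b' where b': "Fr b b'" "p3 b' = - p3 b" using Pa[of b] Fc unfolding P_def Fr_def by blast
 have "p3 (b' - c) = 0"
 proof (rule kernel_p3)
  show "b' - c \<in> galg" by (rule subspace_diff[OF subspace_galg]) (use b' Fc in \<open>simp_all add: Fr_def\<close>)
  fix f assume "smooth_fun B f"
  then show "L (b' - c) e1 (lift f) = 0"
   using b'(1) Fc L_add[of b' "- c" e1 "lift f"] L_neg[of c e1 "lift f"] subspace_neg[OF subspace_galg, of c]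
   by (simp add: Fr_def)
 qed
 then have "- p3 b = p3 b" using b'(2) pc(2) by (simp add: linear_diff[OF p_linear(3)])
 then have "p3 b $ m = 0" for m using arg_cong[of "- p3 b" "p3 b" "\<lambda>v. v $ m"] by simp
 then have "p3 b = 0" by (simp add: vec_eq_iff)
 then show ?thesis using pc(1) by simp
qed

text \<open>In components \<open>torsion_identity\<close> forces s i k $ l to be symmetric in k and
  l for distinct indices; as it is antisymmetric in i and k, it vanishes. Then \<open>S\<close> is
  symmetric in its two arguments while each \<open>S x\<close> is skew, and the same play of
  symmetries shows that it is zero.\<close>

lemma S_zero_3:
 assumes c3: "CARD('n) \<ge> 3"
 shows "S x y = 0"
proof -
 define s where "s i j = S (axis j 1) (axis i 1) - S (axis i 1) (axis j 1)" for i j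
 have I: "(s k l $ i) *\<^sub>R (axis j 1 :: real ^ 'n) - (s k l $ j) *\<^sub>R axis i 1 =
   (s i j $ k) *\<^sub>R axis l 1 - (s i j $ l) *\<^sub>R axis k 1" for i j k l
  using torsion_identity[where i = i and j = j and k = k and l = l] by (simp add: wedge_mult inner_axis' s_def)
 have C: "(s k l $ i) * (if m = j then 1 else 0) - (s k l $ j) * (if m = i then 1 else 0) =
   (s i j $ k) * (if m = l then 1 else 0) - (s i j $ l) * (if m = k then 1 else 0)" for i j k l m
  using arg_cong[OF I, of "\<lambda>v. v $ m"]
  unfolding vector_minus_component vector_scaleR_component real_scaleR_def axis_def vec_lambda_beta .
 have anti: "s j i = - s i j" for i j by (simp add: s_def)
 \<comment> \<open>Here dimension at least 3 enters; with it a repeated index is disposed of in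
   \<open>d1\<close>.\<close>
 have third: "\<exists>l. l \<noteq> i \<and> l \<noteq> j" for i j :: 'n
 proof (rule ccontr)
  assume "\<not> (\<exists>l. l \<noteq> i \<and> l \<noteq> j)"
  then have "(UNIV :: 'n set) \<subseteq> {i, j}" by blast
  then have "CARD('n) \<le> card {i, j}" by (intro card_mono) auto
  also have "\<dots> \<le> 2" by (simp add: card_insert_if)
  finally show False using c3 by simp
 qed
 have d1: "s i k $ i = 0" for i k
 proof (cases "i = k")
  case True then show ?thesis by (simp add: s_def)
 next
  case False
  obtain l where "l \<noteq> i" "l \<noteq> k" using third by blast
  then show ?thesis using C[where k = i and l = l and i = i and j = k and m = l] False by simp
 qed
 have d2: "s i k $ k = 0" for i k using d1[of k i] anti[of i k] by simp
 have sym: "s i l $ k = s i k $ l" if "i \<noteq> k" "i \<noteq> l" "k \<noteq> l" for i k l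
  using C[where k = i and l = l and i = i and j = k and m = i] that by simp
 have "s i k $ l = 0" for i k l
 proof (cases "i = k \<or> i = l \<or> k = l")
  case True
  then show ?thesis using d1 d2 by (auto simp: s_def)
 next
  case False
  then have "s i k $ l = s i l $ k" "s l k $ i = s l i $ k" "s k l $ i = s k i $ l" using sym by auto
  then show ?thesis using anti[of i k] anti[of i l] anti[of k l] by simp
 qed
 then have "s i j = 0" for i j by (simp add: vec_eq_iff)
 then have symS: "S (axis i 1) (axis j 1) = S (axis j 1) (axis i 1)" for i j
  using eq_iff_diff_eq_0 by (simp add: s_def)
 have asym: "S u (axis j 1) $ k = - (S u (axis k 1) $ j)" for u j k
  using S_skew[of u "axis j 1" "axis k 1"] by (simp add: inner_axis inner_axis')
 have "S (axis i 1) (axis j 1) $ k = 0" for i j k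
  using symS[of i j] symS[of j k] symS[of i k] asym[of "axis i 1" j k] asym[of "axis j 1" i k] asym[of "axis k 1" i j] by simp
 then have z: "S (axis i 1) (axis j 1) = 0" for i j by (simp add: vec_eq_iff)
 have "S (\<Sum>i\<in>UNIV. x $ i *\<^sub>R axis i 1) (\<Sum>j\<in>UNIV. y $ j *\<^sub>R axis j 1) = 0"
  by (simp add: linear_sum[OF S_linear(1)] linear_sum[OF S_linear(2)] linear_scale[OF S_linear(1)]
    linear_scale[OF S_linear(2)] z)
 then show ?thesis
  using basis_expansion[of x, unfolded scalar_mult_eq_scaleR] basis_expansion[of y, unfolded scalar_mult_eq_scaleR]
  by simp
qed

lemma S_zero: "S x y = 0"
 using S_zero_2 S_zero_3 card by (cases "CARD('n) = 2") auto

lemma nab_Y_formula: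
 assumes "g \<in> CG" "a \<in> galg"
 shows "nab (Y a) (pr g) (Pu g (ix x)) = Pu g (ix (p1 (br (co g a) (ix x))))"
 using nab_Y_S[OF assms] S_zero by simp

end

section \<open>Parallel transport\<close>

context model_connection begin

lemma Pu_ix_sum: "Pu g (ix (\<Sum>i\<in>I. r i *\<^sub>R x i)) = (\<lambda>f. \<Sum>i\<in>I. r i * Pu g (ix (x i)) f)"
proof
 fix f
 show "Pu g (ix (\<Sum>i\<in>I. r i *\<^sub>R x i)) f = (\<Sum>i\<in>I. r i * Pu g (ix (x i)) f)"
  by (simp add: Pu_apply linear_sum[OF linear_horizontal] linear_scale[OF linear_horizontal])
qed

lemma Pu_ix_zero: "Pu g (ix 0) = (\<lambda>_. 0)"
 using Pu_ix_scale[of g 0 0] by simp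

lemma horizontal_constant:
 assumes x: "x \<in> points B"
 shows "horizontal_curve M (\<lambda>_. x)" "velocity B (\<lambda>_. x) t = (\<lambda>_. 0)"
proof -
 have v: "velocity B (\<lambda>_. x) t = (\<lambda>_. 0)" for t by (auto simp: velocity_def o_def)
 then show "velocity B (\<lambda>_. x) t = (\<lambda>_. 0)" .
 have zero_dst: "(\<lambda>_. 0) \<in> dst M x"
 proof -
  obtain g where g: "g \<in> CG" "x = pr g" using x by (rule pointE)
  show ?thesis unfolding g(2) Pu_ix_zero[of g, symmetric] by (rule Pu_dst[OF g(1)])
 qed
 show "horizontal_curve M (\<lambda>_. x)"
  unfolding horizontal_curve_def
 proof (intro conjI allI impI)
  show "pathin (mtop B) (\<lambda>_. x)"
   using x topspace_mtop[OF preB] unfolding pathin_def by simp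
  show "abs_continuous_on {0..1} (f o (\<lambda>_. x))" for f
   by (rule Lipschitz_imp_abs_continuous[of _ _ 0]) simp
  show "AE t in lebesgue. t \<in> {0..1} --> (\<forall>f. smooth_fun B f --> (f o (\<lambda>_. x)) differentiable (at t)) \<and>
    velocity B (\<lambda>_. x) t \<in> dst M x"
   using zero_dst v by (simp add: o_def)
 qed
qed

lemma id_holonomy:
 assumes x: "x \<in> points B"
 shows "restrict id (dst M x) \<in> horizontal_holonomy M nab x"
proof -
 have "parallel_transport M nab (\<lambda>_. x) v v" if v: "v \<in> dst M x" for v
 proof -
  obtain g where g: "g \<in> CG" "x = pr g" using x by (rule pointE)
  obtain z where z: "v = Pu g (ix z)" using v dst_eq[OF g(1)] g(2) by auto
  define a where "a = co (gi g) (ix z)"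
  have a: "Y a \<in> sections M" "Y a x = v" using Y_at[OF g(1)] Y_section g by (simp_all add: a_def z)
  have n: "nab (Y a) x (\<lambda>_. 0) = (\<lambda>_. 0)" using nab_rules(2)[OF a(1) x v, of 0] by simp
  have "parallel_along M nab (\<lambda>_. x) (\<lambda>_. v)"
   unfolding parallel_along_def
  proof (intro exI[of _ "1::nat"] exI[of _ "\<lambda>_. Y a"] exI[of _ "\<lambda>_ _. 1 :: real"] conjI)
   show "\<forall>i<1::nat. Y a \<in> sections M \<and> abs_continuous_on {0..1} (\<lambda>_. 1)"
    using a(1) Lipschitz_imp_abs_continuous[of _ "\<lambda>_. 1" 0] by simp
   show "AE t in lebesgue. t \<in> {0..1} --> (\<exists>a'. \<forall>i<1::nat. ((\<lambda>_. 1) has_real_derivative a' i) (at t)) \<and>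
     (\<forall>f. (\<Sum>i<1::nat. deriv (\<lambda>_. 1) t * Y a x f + 1 * nab (Y a) x (velocity B (\<lambda>_. x) t) f) = 0)"
    using n horizontal_constant(2)[OF x] by (auto intro!: exI[of _ "\<lambda>_. 0"])
  qed (use a in simp)
  then show ?thesis unfolding parallel_transport_def by auto
 qed
 then show ?thesis
  unfolding horizontal_holonomy_def
  using horizontal_constant(1)[OF x] by (auto intro!: exI[of _ "\<lambda>_. x"])
qed

lemma smooth_met:
 assumes "X \<in> sections M" "Z \<in> sections M"
 shows "smooth_fun B (\<lambda>p. met M p (X p) (Z p))"
proof -
 have "\<forall>X\<in>sections M. \<forall>Y\<in>sections M. smooth_fun B (\<lambda>p. met M p (X p) (Y p))"
  using sr unfolding sr_model_space_def sub_riemannian_def by (elim conjE) assumption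
 from this[rule_format, OF assms] show ?thesis .
qed

lemma holonomy_trivial:
 assumes a2: "a2 = 0" and x: "x \<in> points B"
 shows "horizontal_holonomy M nab x = {restrict id (dst M x)}"
proof -
 \<comment> \<open>For \<open>a2 = 0\<close> the derivative of \<open>p4 (co g a)\<close> is a
   commutator with \<open>p4\<close> of the direction, hence orthogonal to it. Its length is
   therefore constant, and it is 0 at the identity.\<close>
 have p4z: "p4 (co g (ix y)) = 0" if g: "g \<in> CG" for g y
 proof -
  have s: "smooth_vec A (\<lambda>g. p4 (co g (ix y)))" by (rule smooth_vec_linear[OF p_linear(4) co_smooth[OF ix_galg]])
  have "(\<lambda>g. p4 (co g (ix y)) \<bullet> p4 (co g (ix y))) g = (\<lambda>g. p4 (co g (ix y)) \<bullet> p4 (co g (ix y))) e1"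
  proof (rule smooth_fun_constant_on_group[OF smooth_vec_inner[OF pre s s] _ g])
   fix b :: "'n quad" and g assume b: "b \<in> galg" and g: "g \<in> CG"
   let ?c = "co g (ix y)"
   have d: "dV (L b g) (\<lambda>h. p4 (co h (ix y))) = p4 (br ?c b)"
    using dV_linear[OF pre L_tangent[OF b g] co_smooth[OF ix_galg] p_linear(4)] dV_co[OF ix_galg b g] by simp
   have "p4 (br ?c b) = comm (p4 ?c) (p4 b)"
    by (subst (1) quad_eq[of ?c], subst (1) quad_eq[of b]) (simp add: a2 comm_zero)
   also have "\<dots> = - comm (p4 b) (p4 ?c)" by (simp add: comm_def)
   finally have "p4 (br ?c b) \<bullet> p4 ?c = 0" using comm_inner_zero[of "p4 b" "p4 ?c"] b by (simp add: galg_iff)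
   then show "L b g (\<lambda>g. p4 (co g (ix y)) \<bullet> p4 (co g (ix y))) = 0"
    unfolding tangent_inner[OF pre L_tangent[OF b g] s s] d by (simp add: inner_commute)
  qed
  then show ?thesis by (simp add: co_one)
 qed
 have brp1: "p1 (br (co g (ix y)) b) = - (p4 b *v p1 (co g (ix y)))" if "g \<in> CG" for g y b
  using p4z[OF that, of y]
  by (subst quad_eq[of "co g (ix y)"], subst (1) quad_eq[of b]) (simp add: a2 matrix_vector_mult_0)
 \<comment> \<open>With \<open>p4\<close> gone, p1 (co g (ix y)) is moved by skew maps only. So the
   fields \<open>Y (ix y)\<close> have constant length, and by dimension they span every horizontal
   space.\<close>
 have isom: "norm (p1 (co g (ix y))) = norm y" if g: "g \<in> CG" for g y
 proof -
  note s = smooth_p1_co[OF ix_galg, of y]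
  have "(\<lambda>g. p1 (co g (ix y)) \<bullet> p1 (co g (ix y))) g = (\<lambda>g. p1 (co g (ix y)) \<bullet> p1 (co g (ix y))) e1"
  proof (rule smooth_fun_constant_on_group[OF smooth_vec_inner[OF pre s s] _ g])
   fix b :: "'n quad" and g assume b: "b \<in> galg" and g: "g \<in> CG"
   have "(p4 b *v p1 (co g (ix y))) \<bullet> p1 (co g (ix y)) = 0"
    by (rule skew_inner_zero) (use b in \<open>simp add: galg_iff\<close>)
   then show "L b g (\<lambda>g. p1 (co g (ix y)) \<bullet> p1 (co g (ix y))) = 0"
    unfolding tangent_inner[OF pre L_tangent[OF b g] s s] dV_p1_co[OF ix_galg b g] brp1[OF g]
    by (simp add: inner_commute)
  qed
  then show ?thesis by (simp add: co_one norm_eq_sqrt_inner)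
 qed
 have span: "\<exists>y. p1 (co g (ix y)) = z" if g: "g \<in> CG" for g z
 proof -
  have l: "linear (\<lambda>y. p1 (co g (ix y)))"
  proof
   fix y z :: "real ^ 'n" and r :: real
   have "(y + z, 0, 0, 0) = ix y + ix z" "(r *\<^sub>R y, 0, 0, 0) = r *\<^sub>R ix y" by simp_all
   then show "p1 (co g (ix (y + z))) = p1 (co g (ix y)) + p1 (co g (ix z))"
    "p1 (co g (ix (r *\<^sub>R y))) = r *\<^sub>R p1 (co g (ix y))"
    using co_add[OF g ix_galg ix_galg, of y z] co_scale[OF g ix_galg, of r y]
    by (simp_all only: linear_add[OF p_linear(1)] linear_scale[OF p_linear(1)])
  qed
  have "inj (\<lambda>y. p1 (co g (ix y)))"
   unfolding linear_injective_0[OF l] using isom[OF g] by (metis norm_eq_zero)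
  then have "surj (\<lambda>y. p1 (co g (ix y)))" by (intro linear_injective_imp_surjective[OF l]) simp_all
  then have "z \<in> range (\<lambda>y. p1 (co g (ix y)))" by simp
  then show ?thesis by blast
 qed
 have nabz: "nab (Y (ix y)) (pr g) (Pu g (ix z)) = Pu g (ix 0)" if g: "g \<in> CG" for g y z
  using nab_Y_formula[OF g ix_galg] brp1[OF g, of y "ix z"] by simp
 have "P = restrict id (dst M x)" if P: "P \<in> horizontal_holonomy M nab x" for P
 proof -
  obtain c where c: "P \<in> dst M x \<rightarrow>\<^sub>E dst M x" "horizontal_curve M c" "c 0 = x" "c 1 = x"
   "\<And>v. v \<in> dst M x ==> parallel_transport M nab c v (P v)"
   using P unfolding horizontal_holonomy_def by blast
  have cp: "c t \<in> points B" if "t \<in> {0..1}" for t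
   using pathin_point[OF _ that] c(2) by (simp add: horizontal_curve_def)
  have "P v = v" if v: "v \<in> dst M x" for v
  proof -
   obtain V where V: "parallel_along M nab c V" "V 0 = v" "V 1 = P v"
    using c(5)[OF v] unfolding parallel_transport_def by blast
   then obtain m E a where E: "\<And>i. i < m ==> E i \<in> sections M" "\<And>i. i < m ==> abs_continuous_on {0..1} (a i)"
    "\<And>t. t \<in> {0..1} ==> V t = (\<lambda>f. \<Sum>i<m. a i t * E i (c t) f)"
    "AE t in lebesgue. t \<in> {0..1} --> (\<exists>a'. \<forall>i<(m::nat). (a i has_real_derivative a' i) (at t)) \<and>
     (\<forall>f. (\<Sum>i<m. deriv (a i) t * E i (c t) f + a i t * nab (E i) (c t) (velocity B c t) f) = 0)"
    unfolding parallel_along_def by blast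
   obtain g where g: "g \<in> CG" "x = pr g" using x by (rule pointE)
   have rep: "\<exists>\<epsilon>. \<forall>i<m. E i (pr h) = Pu h (ix (\<epsilon> i))" if h: "h \<in> CG" for h
   proof -
    have "\<exists>e. i < m --> E i (pr h) = Pu h (ix e)" for i
    proof (cases "i < m")
     case True
     then have "E i (pr h) \<in> range (\<lambda>e. Pu h (ix e))"
      using E(1) pr_point[OF h] unfolding dst_eq[OF h, symmetric] sections_def by blast
     then show ?thesis by blast
    qed blast
    then obtain e where "\<And>i. i < m --> E i (pr h) = Pu h (ix (e i))" by metis
    then show ?thesis by blast
   qed
   \<comment> \<open>\<open>V\<close> is only a combination of sections with absolutely continuous
     coefficients. Its inner product with \<open>Y (ix y)\<close> is absolutely continuous with
     derivative 0 almost everywhere: one factor is parallel along c by assumption, the other by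
     \<open>nabz\<close>.\<close>
   have key: "met M x (P v) (Y (ix y) x) = met M x v (Y (ix y) x)" for y
   proof -
    define \<psi> where "\<psi> i p = met M p (E i p) (Y (ix y) p)" for i p
    have \<psi>: "smooth_fun B (\<psi> i)" if "i < m" for i
     unfolding \<psi>_def[abs_def] by (rule smooth_met[OF E(1)[OF that] Y_section[OF ix_galg]])
    define \<phi> where "\<phi> t = (\<Sum>i<m. a i t * (\<psi> i o c) t)" for t
    have "abs_continuous_on {0..1} \<phi>"
     unfolding \<phi>_def[abs_def]
    proof (rule abs_continuous_sum)
     fix i assume "i \<in> {..<m}"
     then have i: "i < m" by simp
     show "abs_continuous_on {0..1} (\<lambda>t. a i t * (\<psi> i o c) t)"
      by (rule abs_continuous_mult[OF E(2)[OF i]])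
       (use c(2) \<psi>[OF i] in \<open>simp only: horizontal_curve_def\<close>)
    qed simp
    moreover have "AE t in lebesgue. t \<in> {0..1} --> (\<phi> has_real_derivative 0) (at t)"
    proof -
     have "AE t in lebesgue. t \<in> {0..1} -->
       (\<forall>f. smooth_fun B f --> (f o c) differentiable (at t)) \<and> velocity B c t \<in> dst M (c t)"
      using c(2) by (simp add: horizontal_curve_def)
     with E(4) show ?thesis
     proof (eventually_elim, intro impI)
      fix t :: real assume t: "t \<in> {0..1}"
      assume "t \<in> {0..1} --> (\<exists>a'. \<forall>i<m. (a i has_real_derivative a' i) (at t)) \<and>
        (\<forall>f. (\<Sum>i<m. deriv (a i) t * E i (c t) f + a i t * nab (E i) (c t) (velocity B c t) f) = 0)"
       "t \<in> {0..1} --> (\<forall>f. smooth_fun B f --> (f o c) differentiable (at t)) \<and> velocity B c t \<in> dst M (c t)"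
      then have d: "\<exists>a'. \<forall>i<m. (a i has_real_derivative a' i) (at t)"
       and z: "\<And>f. (\<Sum>i<m. deriv (a i) t * E i (c t) f + a i t * nab (E i) (c t) (velocity B c t) f) = 0"
       and df: "\<And>f. smooth_fun B f ==> (f o c) differentiable (at t)"
       and ve: "velocity B c t \<in> dst M (c t)" using t by auto
      have da: "(a i has_real_derivative deriv (a i) t) (at t)" if "i < m" for i
       using d that DERIV_imp_deriv by metis
      obtain h where h: "h \<in> CG" "c t = pr h" using cp[OF t] by (rule pointE)
      obtain w where w: "velocity B c t = Pu h (ix w)" using ve dst_eq[OF h(1)] h(2) by auto
      obtain b where b: "p1 (co h (ix b)) = w" using span[OF h(1)] by blast
      have Yb: "Y (ix b) (pr h) = Pu h (ix w)" using Y_pr[OF h(1) ix_galg] b by simp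
      define u where "u = p1 (co h (ix y))"
      have Yy: "Y (ix y) (pr h) = Pu h (ix u)" using Y_pr[OF h(1) ix_galg] by (simp add: u_def)
      obtain \<epsilon> where \<epsilon>: "\<And>i. i < m ==> E i (pr h) = Pu h (ix (\<epsilon> i))" using rep[OF h(1)] by blast
      have "\<exists>n. i < m --> nab (E i) (pr h) (Pu h (ix w)) = Pu h (ix n)" for i
       using nab_dst[OF E(1) h(1), of i w] dst_eq[OF h(1)] by auto
      then obtain \<nu> where \<nu>: "\<And>i. i < m ==> nab (E i) (pr h) (Pu h (ix w)) = Pu h (ix (\<nu> i))" by metis
      have d\<psi>: "((\<psi> i o c) has_real_derivative \<nu> i \<bullet> u) (at t)" if i: "i < m" for i
      proof -
       have "((\<psi> i o c) has_real_derivative deriv (\<psi> i o c) t) (at t)"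
        using df[OF \<psi>[OF i]] DERIV_deriv_iff_real_differentiable by blast
       also have "deriv (\<psi> i o c) t = velocity B c t (\<psi> i)" using \<psi>[OF i] by (simp add: velocity_def)
       also have "\<dots> = Y (ix b) (pr h) (\<lambda>q. met M q (E i q) (Y (ix y) q))"
        unfolding w Yb \<psi>_def[abs_def] ..
       also have "\<dots> = met M (pr h) (nab (E i) (pr h) (Y (ix b) (pr h))) (Y (ix y) (pr h)) +
         met M (pr h) (E i (pr h)) (nab (Y (ix y)) (pr h) (Y (ix b) (pr h)))"
        using mc Y_section[OF ix_galg] E(1)[OF i] pr_point[OF h(1)] unfolding metric_compatible_def by blast
       also have "\<dots> = \<nu> i \<bullet> u"
        unfolding Yb Yy \<nu>[OF i] \<epsilon>[OF i] nabz[OF h(1)] met_eq[OF h(1)] by simp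
       finally show ?thesis .
      qed
      have \<psi>c: "(\<psi> i o c) t = \<epsilon> i \<bullet> u" if "i < m" for i
       using \<epsilon>[OF that] Yy met_eq[OF h(1)] h(2) by (simp add: \<psi>_def)
      have "(\<phi> has_real_derivative (\<Sum>i<m. deriv (a i) t * (\<psi> i o c) t + (\<nu> i \<bullet> u) * a i t)) (at t)"
       unfolding \<phi>_def[abs_def]
       by (intro DERIV_sum DERIV_mult da d\<psi>) auto
      also have "(\<Sum>i<m. deriv (a i) t * (\<psi> i o c) t + (\<nu> i \<bullet> u) * a i t) =
        (\<Sum>i<m. deriv (a i) t *\<^sub>R \<epsilon> i + a i t *\<^sub>R \<nu> i) \<bullet> u"
       unfolding inner_sum_left by (rule sum.cong) (simp_all add: \<psi>c[unfolded o_def] inner_add_left)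
      also have "(\<Sum>i<m. deriv (a i) t *\<^sub>R \<epsilon> i + a i t *\<^sub>R \<nu> i) = 0"
      proof -
       have "Pu h (ix (\<Sum>i<m. deriv (a i) t *\<^sub>R \<epsilon> i + a i t *\<^sub>R \<nu> i)) f = 0" for f
       proof -
        have "Pu h (ix (\<Sum>i<m. deriv (a i) t *\<^sub>R \<epsilon> i + a i t *\<^sub>R \<nu> i)) f =
          (\<Sum>i<m. deriv (a i) t * Pu h (ix (\<epsilon> i)) f + a i t * Pu h (ix (\<nu> i)) f)"
         by (simp add: sum.distrib Pu_ix_add Pu_ix_sum)
        also have "\<dots> = (\<Sum>i<m. deriv (a i) t * E i (c t) f + a i t * nab (E i) (c t) (velocity B c t) f)"
         by (rule sum.cong) (simp_all add: h(2) w \<epsilon> \<nu>)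
        finally show ?thesis using z by simp
       qed
       then have "Pu h (ix (\<Sum>i<m. deriv (a i) t *\<^sub>R \<epsilon> i + a i t *\<^sub>R \<nu> i)) = Pu h (ix 0)"
        unfolding Pu_ix_zero by blast
       then show ?thesis by (rule Pu_ix_inj[OF h(1)])
      qed
      finally show "(\<phi> has_real_derivative 0) (at t)" by simp
     qed
    qed
    ultimately have \<phi>1: "\<phi> 1 = \<phi> 0" by (rule abs_continuous_constant)
    obtain \<epsilon> where \<epsilon>: "\<And>i. i < m ==> E i (pr g) = Pu g (ix (\<epsilon> i))" using rep[OF g(1)] by blast
    have "met M x (V t) (Y (ix y) x) = \<phi> t" if t: "t \<in> {0..1}" "c t = x" for t
    proof -
     have "V t = Pu g (ix (\<Sum>i<m. a i t *\<^sub>R \<epsilon> i))"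
      unfolding E(3)[OF t(1)] Pu_ix_sum t(2) g(2) using \<epsilon> by simp
     then show ?thesis
      using Y_pr[OF g(1) ix_galg, of y] met_eq[OF g(1)] t(2) g(2) \<epsilon>
      by (simp add: \<phi>_def \<psi>_def inner_sum_left)
    qed
    from this[of 0] this[of 1] \<phi>1 V(2,3) c(3,4) show ?thesis by simp
   qed
   have "P v \<in> dst M x" using c(1) v by auto
   then obtain v0 v1 where v01: "v = Pu g (ix v0)" "P v = Pu g (ix v1)" using v dst_eq[OF g(1)] g(2) by auto
   have "v1 \<bullet> z = v0 \<bullet> z" for z
   proof -
    obtain y where y: "p1 (co g (ix y)) = z" using span[OF g(1)] by blast
    have Yz: "Y (ix y) x = Pu g (ix z)" using Y_pr[OF g(1) ix_galg, of y] by (simp add: g(2) y)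
    have "met M x (Pu g (ix v1)) (Pu g (ix z)) = met M x (Pu g (ix v0)) (Pu g (ix z))"
     using key[of y] unfolding Yz v01(2) unfolding v01(1) .
    then show ?thesis by (simp add: g(2) met_eq[OF g(1)])
   qed
   then have "v1 = v0" using vector_eq_rdot[of v1 v0] by simp
   then show ?thesis using v01 by simp
  qed
  then show ?thesis using c(1) by (intro extensionalityI[of _ "dst M x"]) (auto simp: PiE_def)
 qed
 then show ?thesis using id_holonomy[OF x] by blast
qed

end

section \<open>Horizontally reachable elements\<close>

context model begin

lemma hcurve_left:
 assumes c: "hcurve c N u" and g: "g \<in> CG"
 shows "hcurve (\<lambda>t. g \<cdot> c t) N u"
 unfolding hcurve_def
proof (intro conjI ballI allI impI)
 show "finite N" by (rule hcurveD(2)[OF c])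
 show "g \<cdot> c t \<in> CG" if "t \<in> {0..1}" for t using hcurveD(1)[OF c that] g by simp
 fix f assume f: "smooth_fun A f"
 note gf = smooth_fun_lmul[OF f g]
 show "\<exists>C. \<forall>s\<in>{0..1}. \<forall>t\<in>{0..1}. \<bar>f (g \<cdot> c t) - f (g \<cdot> c s)\<bar> \<le> C * \<bar>t - s\<bar>"
  using c gf unfolding hcurve_def by blast
 show "((\<lambda>s. f (g \<cdot> c s)) has_real_derivative L (ix (u t)) (g \<cdot> c t) f) (at t)" if t: "t \<in> {0..1} - N" for t
  using hcurveD(3)[OF c _ _ gf, of t] L_left[OF ix_galg g hcurveD(1)[OF c] f, of t "u t"] t by simp
qed

lemma hcurve_reverse:
 assumes c: "hcurve c N u"
 shows "hcurve (\<lambda>t. c (1 - t)) ((\<lambda>t. 1 - t) ` N) (\<lambda>t. - u (1 - t))"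
 unfolding hcurve_def
proof (intro conjI ballI allI impI)
 show "finite ((\<lambda>t. 1 - t) ` N)" using hcurveD(2)[OF c] by simp
 show "c (1 - t) \<in> CG" if "t \<in> {0..1}" for t by (rule hcurveD(1)[OF c]) (use that in auto)
 fix f assume f: "smooth_fun A f"
 obtain C where C: "\<And>s t. s \<in> {0..1} ==> t \<in> {0..1} ==> \<bar>f (c t) - f (c s)\<bar> \<le> C * \<bar>t - s\<bar>"
  by (rule hcurve_Lipschitz[OF c f]) (rule that)
 have "\<bar>f (c (1 - t)) - f (c (1 - s))\<bar> \<le> C * \<bar>t - s\<bar>" if "s \<in> {0..1}" "t \<in> {0..1}" for s t
  using C[of "1 - s" "1 - t"] that by (simp add: abs_minus_commute)
 then show "\<exists>C. \<forall>s\<in>{0..1}. \<forall>t\<in>{0..1}. \<bar>f (c (1 - t)) - f (c (1 - s))\<bar> \<le> C * \<bar>t - s\<bar>" by blast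
 fix t assume t: "t \<in> {0..1} - (\<lambda>t. 1 - t) ` N"
 have "1 - t \<notin> N" using t by force
 then have d: "((\<lambda>s. f (c s)) has_real_derivative L (ix (u (1 - t))) (c (1 - t)) f) (at (1 - t))"
  by (intro hcurveD(3)[OF c _ _ f]) (use t in auto)
 have "((\<lambda>s. f (c (1 - s))) has_real_derivative L (ix (u (1 - t))) (c (1 - t)) f * (- 1)) (at t)"
  by (rule DERIV_chain2[where g = "\<lambda>s. 1 - s" and x = t, OF d]) (auto intro!: derivative_eq_intros)
 moreover have "L (ix (- u (1 - t))) (c (1 - t)) f = L (ix (u (1 - t))) (c (1 - t)) f * (- 1)"
  using linear_neg[OF linear_horizontal] by simp
 ultimately show "((\<lambda>s. f (c (1 - s))) has_real_derivative L (ix (- u (1 - t))) (c (1 - t)) f) (at t)" by simp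
qed

lemma hcurve_concat:
 assumes c: "hcurve c N u" and d: "hcurve d N' u'" and cd: "c 1 = d 0"
 shows "\<exists>N'' u''. hcurve (\<lambda>t. if t \<le> 1 / 2 then c (2 * t) else d (2 * t - 1)) N'' u''"
proof -
 define p where "p t = (if t \<le> 1 / 2 then c (2 * t) else d (2 * t - 1))" for t :: real
 \<comment> \<open>The junction joins the exceptional set, since the control may jump there.\<close>
 define N'' where "N'' = insert (1 / 2) ((\<lambda>t. t / 2) ` N \<union> (\<lambda>t. (t + 1) / 2) ` N')"
 define w where "w t = (if t \<le> 1 / 2 then 2 *\<^sub>R u (2 * t) else 2 *\<^sub>R u' (2 * t - 1))" for t :: real
 have "hcurve p N'' w"
  unfolding hcurve_def
 proof (intro conjI ballI allI impI)
  show "finite N''" unfolding N''_def using hcurveD(2)[OF c] hcurveD(2)[OF d] by simp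
  show "p t \<in> CG" if "t \<in> {0..1}" for t
   using hcurveD(1)[OF c, of "2 * t"] hcurveD(1)[OF d, of "2 * t - 1"] that by (simp add: p_def)
  fix f assume f: "smooth_fun A f"
  obtain C where C: "\<And>s t. s \<in> {0..1} ==> t \<in> {0..1} ==> \<bar>f (c t) - f (c s)\<bar> \<le> C * \<bar>t - s\<bar>"
   by (rule hcurve_Lipschitz[OF c f]) (rule that)
  obtain D where D: "\<And>s t. s \<in> {0..1} ==> t \<in> {0..1} ==> \<bar>f (d t) - f (d s)\<bar> \<le> D * \<bar>t - s\<bar>"
   by (rule hcurve_Lipschitz[OF d f]) (rule that)
  define m where "m = 2 * max C D"
  have Cm: "C * \<bar>2 * t - 2 * s\<bar> \<le> m * \<bar>t - s\<bar>" and Dm: "D * \<bar>2 * t - 2 * s\<bar> \<le> m * \<bar>t - s\<bar>" for s t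
  proof -
   have "\<bar>2 * t - 2 * s\<bar> = 2 * \<bar>t - s\<bar>" by (simp add: abs_if)
   moreover have "C * 2 * \<bar>t - s\<bar> \<le> m * \<bar>t - s\<bar>" "D * 2 * \<bar>t - s\<bar> \<le> m * \<bar>t - s\<bar>"
    by (rule mult_right_mono, simp add: m_def, simp)+
   ultimately show "C * \<bar>2 * t - 2 * s\<bar> \<le> m * \<bar>t - s\<bar>" "D * \<bar>2 * t - 2 * s\<bar> \<le> m * \<bar>t - s\<bar>"
    by (simp_all add: mult.assoc)
  qed
  have le: "\<bar>f (p t) - f (p s)\<bar> \<le> m * (t - s)" if st: "0 \<le> s" "s \<le> t" "t \<le> 1" for s t
  proof (cases "t \<le> 1 / 2")
   case True
   have "\<bar>f (c (2 * t)) - f (c (2 * s))\<bar> \<le> C * \<bar>2 * t - 2 * s\<bar>" by (rule C) (use True st in auto)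
   then show ?thesis using Cm[of t s] True st by (simp add: p_def)
  next
   case t: False
   show ?thesis
   proof (cases "s \<le> 1 / 2")
    case False
    have "\<bar>f (d (2 * t - 1)) - f (d (2 * s - 1))\<bar> \<le> D * \<bar>(2 * t - 1) - (2 * s - 1)\<bar>"
     by (rule D) (use t False st in auto)
    then show ?thesis using Dm[of t s] t False st by (simp add: p_def)
   next
    case True
    have "\<bar>f (c 1) - f (c (2 * s))\<bar> \<le> C * \<bar>1 - 2 * s\<bar>" by (rule C) (use True st in auto)
    then have 1: "\<bar>f (c 1) - f (c (2 * s))\<bar> \<le> m * (1 / 2 - s)" using Cm[of "1 / 2" s] True by simp
    have "\<bar>f (d (2 * t - 1)) - f (d 0)\<bar> \<le> D * \<bar>(2 * t - 1) - 0\<bar>" by (rule D) (use t st in auto)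
    then have "\<bar>f (d (2 * t - 1)) - f (d 0)\<bar> \<le> m * (t - 1 / 2)" using Dm[of t "1 / 2"] t by simp
    with 1 have "\<bar>f (d (2 * t - 1)) - f (c (2 * s))\<bar> \<le> m * (1 / 2 - s) + m * (t - 1 / 2)" using cd by simp
    also have "\<dots> = m * (t - s)" by (simp add: algebra_simps)
    finally show ?thesis using t True by (simp add: p_def)
   qed
  qed
  have "\<bar>f (p t) - f (p s)\<bar> \<le> m * \<bar>t - s\<bar>" if "s \<in> {0..1}" "t \<in> {0..1}" for s t
   using le[of s t] le[of t s] that by (cases "s \<le> t") (auto simp: abs_minus_commute)
  then show "\<exists>C. \<forall>s\<in>{0..1}. \<forall>t\<in>{0..1}. \<bar>f (p t) - f (p s)\<bar> \<le> C * \<bar>t - s\<bar>" by blast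
  fix t assume t: "t \<in> {0..1} - N''"
  then have ne: "t \<noteq> 1 / 2" by (auto simp: N''_def)
  have s2: "L (ix (2 *\<^sub>R y)) g f = L (ix y) g f * 2" for y g
   using linear_scale[OF linear_horizontal] by simp
  show "((\<lambda>s. f (p s)) has_real_derivative L (ix (w t)) (p t) f) (at t)"
  proof (cases "t < 1 / 2")
   case True
   have "2 * t \<notin> N"
   proof
    assume "2 * t \<in> N"
    then have "t \<in> (\<lambda>t. t / 2) ` N" by (intro image_eqI[of _ _ "2 * t"]) auto
    then show False using t by (auto simp: N''_def)
   qed
   then have e: "((\<lambda>s. f (c s)) has_real_derivative L (ix (u (2 * t))) (c (2 * t)) f) (at (2 * t))"
    by (intro hcurveD(3)[OF c _ _ f]) (use t True in auto)
   have "((\<lambda>s. f (c (2 * s))) has_real_derivative L (ix (u (2 * t))) (c (2 * t)) f * 2) (at t)"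
    by (rule DERIV_chain2[where g = "\<lambda>s. 2 * s" and x = t, OF e]) (auto intro!: derivative_eq_intros)
   then have "((\<lambda>s. f (p s)) has_real_derivative L (ix (u (2 * t))) (c (2 * t)) f * 2) (at t)"
    by (rule has_field_derivative_transform_within_open[of _ _ _ "{..<1/2}"]) (use True in \<open>auto simp: p_def\<close>)
   then show ?thesis using True by (simp add: p_def w_def s2)
  next
   case False
   then have t2: "t > 1 / 2" using ne by simp
   have "2 * t - 1 \<notin> N'"
   proof
    assume "2 * t - 1 \<in> N'"
    then have "t \<in> (\<lambda>t. (t + 1) / 2) ` N'" by (intro image_eqI[of _ _ "2 * t - 1"]) auto
    then show False using t by (auto simp: N''_def)
   qed
   then have e: "((\<lambda>s. f (d s)) has_real_derivative L (ix (u' (2 * t - 1))) (d (2 * t - 1)) f) (at (2 * t - 1))"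
    by (intro hcurveD(3)[OF d _ _ f]) (use t t2 in auto)
   have "((\<lambda>s. f (d (2 * s - 1))) has_real_derivative L (ix (u' (2 * t - 1))) (d (2 * t - 1)) f * 2) (at t)"
    by (rule DERIV_chain2[where g = "\<lambda>s. 2 * s - 1" and x = t, OF e]) (auto intro!: derivative_eq_intros)
   then have "((\<lambda>s. f (p s)) has_real_derivative L (ix (u' (2 * t - 1))) (d (2 * t - 1)) f * 2) (at t)"
    by (rule has_field_derivative_transform_within_open[of _ _ _ "{1/2<..}"]) (use t2 in \<open>auto simp: p_def\<close>)
   then show ?thesis using t2 by (simp add: p_def w_def s2)
  qed
 qed
 then show ?thesis unfolding p_def[abs_def] by blast
qed

definition reachable :: "'g set" where
 "reachable = {h. \<exists>c N u. hcurve c N u \<and> c 0 = e1 \<and> c 1 = h}"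

lemma reachable_CG: "h \<in> reachable ==> h \<in> CG"
 unfolding reachable_def using hcurveD(1)[of _ _ _ 1] by force

lemma reachable_mul:
 assumes "g \<in> reachable" "h \<in> reachable"
 shows "g \<cdot> h \<in> reachable"
proof -
 obtain c N u d N' u' where c: "hcurve c N u" "c 0 = e1" "c 1 = g" and d: "hcurve d N' u'" "d 0 = e1" "d 1 = h"
  using assms unfolding reachable_def by blast
 have g: "g \<in> CG" by (rule reachable_CG[OF assms(1)])
 have "c 1 = g \<cdot> d 0" using c(3) d(2) g by simp
 from hcurve_concat[OF c(1) hcurve_left[OF d(1) g] this]
 obtain N'' u'' where e: "hcurve (\<lambda>t. if t \<le> 1 / 2 then c (2 * t) else g \<cdot> d (2 * t - 1)) N'' u''" by blast
 show ?thesis unfolding reachable_def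
  by (rule CollectI, rule exI, rule exI, rule exI, rule conjI, rule e) (use c d in simp)
qed

lemma reachable_inv:
 assumes "g \<in> reachable"
 shows "gi g \<in> reachable"
proof -
 obtain c N u where c: "hcurve c N u" "c 0 = e1" "c 1 = g" using assms unfolding reachable_def by blast
 have g: "g \<in> CG" by (rule reachable_CG[OF assms])
 have e: "hcurve (\<lambda>t. gi g \<cdot> c (1 - t)) ((\<lambda>t. 1 - t) ` N) (\<lambda>t. - u (1 - t))"
  by (rule hcurve_left[OF hcurve_reverse[OF c(1)]]) (use g in simp)
 show ?thesis unfolding reachable_def
  by (rule CollectI, rule exI, rule exI, rule exI, rule conjI, rule e) (use c g in simp)
qed

text \<open>Continuous everywhere, differentiable at 0 with differential \<open>l\<close> read in
  the Lie algebra: these conditions pass to products (\<open>gdiff_mul\<close>), and they are what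
  \<open>sussmann_open_mapping\<close> asks for.\<close>

definition gdiff :: "('v::real_normed_vector => 'g) => ('v => 'n quad) => bool" where
 "gdiff \<Phi> l \<longleftrightarrow> \<Phi> 0 = e1 \<and> (\<forall>v. \<Phi> v \<in> CG) \<and> (\<forall>v. l v \<in> galg) \<and>
  (\<forall>f. smooth_fun A f --> continuous_on UNIV (\<lambda>v. f (\<Phi> v)) \<and>
   ((\<lambda>v. f (\<Phi> v)) has_derivative (\<lambda>h. L (l h) e1 f)) (at 0))"

lemma gdiffD:
 assumes "gdiff \<Phi> l"
 shows "\<Phi> 0 = e1" "\<Phi> v \<in> CG" "l v \<in> galg" "smooth_fun A f ==> continuous_on UNIV (\<lambda>v. f (\<Phi> v))"
  "smooth_fun A f ==> ((\<lambda>v. f (\<Phi> v)) has_derivative (\<lambda>h. L (l h) e1 f)) (at 0)"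
 using assms unfolding gdiff_def by blast+

lemma continuous_map_group:
 fixes \<Phi> :: "'v::topological_space => 'g"
 assumes "\<And>v. \<Phi> v \<in> CG" "\<And>f. smooth_fun A f ==> continuous_on UNIV (\<lambda>v. f (\<Phi> v))"
 shows "continuous_map euclidean (mtop A) \<Phi>"
 by (rule continuous_map_by_smooth_functions[OF Mf]) (use assms pts in auto)

lemma continuous_on_smooth_pair:
 fixes \<Phi> \<Psi> :: "'v::topological_space => 'g"
 assumes \<Phi>: "continuous_map euclidean (mtop A) \<Phi>" and \<Psi>: "continuous_map euclidean (mtop A) \<Psi>"
  and F: "smooth_fun (prod_atlas A A) F"
 shows "continuous_on UNIV (\<lambda>v. F (\<Phi> v, \<Psi> v))"
proof -
 have op: "open {v. \<Phi> v \<in> Q}" if "openin (mtop A) Q" "continuous_map euclidean (mtop A) \<Phi>" for Q and \<Phi> :: "'v => 'g"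
  using openin_continuous_map_preimage[OF that(2,1)] by simp
 have pt: "\<Phi> v \<in> points A" if "continuous_map euclidean (mtop A) \<Phi>" for \<Phi> :: "'v => 'g" and v
  using that topspace_mtop[OF pre] by (auto simp: continuous_map_def)
 have "continuous_map euclidean (mtop (prod_atlas A A)) (\<lambda>v. (\<Phi> v, \<Psi> v))"
  unfolding mtop_def
 proof (rule continuous_on_generated_topo)
  fix Q assume "Q \<in> {U \<inter> \<phi> -` W |U \<phi> W. (U, \<phi>) \<in> prod_atlas A A \<and> open W}"
  then obtain P \<pi> W where Q: "Q = P \<inter> \<pi> -` W" "(P, \<pi>) \<in> prod_atlas A A" "open W" by blast
  obtain U \<phi> V \<psi> where c: "P = U \<times> V" "\<pi> = map_prod \<phi> \<psi>" "(U, \<phi>) \<in> A" "(V, \<psi>) \<in> A"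
   using prod_atlasE[OF Q(2)] by (metis prod.inject)
  have "open {v. (\<Phi> v, \<Psi> v) \<in> Q}"
  proof (subst open_subopen, intro ballI)
   fix v assume "v \<in> {v. (\<Phi> v, \<Psi> v) \<in> Q}"
   then have v: "\<Phi> v \<in> U" "\<Psi> v \<in> V" "(\<phi> (\<Phi> v), \<psi> (\<Psi> v)) \<in> W" by (auto simp: Q(1) c(1,2))
   obtain W1 W2 where W: "open W1" "open W2" "(\<phi> (\<Phi> v), \<psi> (\<Psi> v)) \<in> W1 \<times> W2" "W1 \<times> W2 \<subseteq> W"
    using Q(3) v(3) by (rule open_prod_elim)
   let ?T = "{v. \<Phi> v \<in> U \<inter> \<phi> -` W1} \<inter> {v. \<Psi> v \<in> V \<inter> \<psi> -` W2}"
   have "open ?T"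
    by (intro open_Int op openin_chart_vimage[OF pre] c W(1,2) \<Phi> \<Psi>)
   moreover have "v \<in> ?T" using v W(3) by auto
   moreover have "?T \<subseteq> {v. (\<Phi> v, \<Psi> v) \<in> Q}" using W(4) by (auto simp: Q(1) c(1,2))
   ultimately show "\<exists>T. open T \<and> v \<in> T \<and> T \<subseteq> {v. (\<Phi> v, \<Psi> v) \<in> Q}" by blast
  qed
  then show "openin euclidean ((\<lambda>v. (\<Phi> v, \<Psi> v)) -` Q \<inter> topspace euclidean)" by (simp add: vimage_def)
 next
  show "(\<lambda>v. (\<Phi> v, \<Psi> v)) ` topspace euclidean \<subseteq> \<Union> {U \<inter> \<phi> -` W |U \<phi> W. (U, \<phi>) \<in> prod_atlas A A \<and> open W}"
  proof clarsimp
   fix v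
   obtain U \<phi> where U: "(U, \<phi>) \<in> A" "\<Phi> v \<in> U" using pt[OF \<Phi>] by (rule pointsE)
   obtain V \<psi> where V: "(V, \<psi>) \<in> A" "\<Psi> v \<in> V" using pt[OF \<Psi>] by (rule pointsE)
   show "\<exists>Q. (\<exists>U \<phi> W. Q = U \<inter> \<phi> -` W \<and> (U, \<phi>) \<in> prod_atlas A A \<and> open W) \<and> (\<Phi> v, \<Psi> v) \<in> Q"
    using prod_atlasI[OF U(1) V(1)] U(2) V(2)
    by (intro exI[of _ "U \<times> V"] conjI exI[of _ "map_prod \<phi> \<psi>"] exI[of _ UNIV]) auto
  qed
 qed
 from continuous_map_compose[OF this smooth_fun_continuous_map[OF pre_AA F]]
 show ?thesis by (simp add: o_def)
qed

lemma gdiff_chart: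
 fixes \<Phi> :: "'v::real_normed_vector => 'g"
 assumes \<Phi>: "gdiff \<Phi> l" and X: "\<And>w. smooth_fun A (\<lambda>g. X g \<bullet> w)"
 shows "((\<lambda>v. X (\<Phi> v)) has_derivative (\<lambda>h. \<Sum>b\<in>(Basis::'a::euclidean_space set). L (l h) e1 (\<lambda>g. X g \<bullet> b) *\<^sub>R b)) (at 0)"
  and "continuous_on UNIV (\<lambda>v. X (\<Phi> v))"
proof -
 have "((\<lambda>v. \<Sum>b\<in>Basis. (X (\<Phi> v) \<bullet> b) *\<^sub>R b) has_derivative (\<lambda>h. \<Sum>b\<in>Basis. L (l h) e1 (\<lambda>g. X g \<bullet> b) *\<^sub>R b)) (at 0)"
  by (rule has_derivative_sum) (rule has_derivative_scaleR_left[OF gdiffD(5)[OF \<Phi> X]])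
 then show "((\<lambda>v. X (\<Phi> v)) has_derivative (\<lambda>h. \<Sum>b\<in>Basis. L (l h) e1 (\<lambda>g. X g \<bullet> b) *\<^sub>R b)) (at 0)"
  by (simp add: euclidean_representation)
 have "continuous_on UNIV (\<lambda>v. \<Sum>b\<in>Basis. (X (\<Phi> v) \<bullet> b) *\<^sub>R b)"
  by (intro continuous_intros gdiffD(4)[OF \<Phi> X])
 then show "continuous_on UNIV (\<lambda>v. X (\<Phi> v))" by (simp add: euclidean_representation)
qed

lemma gdiff_near:
 assumes \<Phi>: "gdiff \<Phi> l" and Z: "openin (mtop A) Z" "e1 \<in> Z"
 shows "open {v. \<Phi> v \<in> Z}" "0 \<in> {v. \<Phi> v \<in> Z}"
proof -
 have "openin euclidean {v \<in> topspace euclidean. \<Phi> v \<in> Z}"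
  by (rule openin_continuous_map_preimage[OF continuous_map_group Z(1)]) (use gdiffD[OF \<Phi>] in auto)
 then show "open {v. \<Phi> v \<in> Z}" by simp
 show "0 \<in> {v. \<Phi> v \<in> Z}" using Z(2) gdiffD(1)[OF \<Phi>] by simp
qed

text \<open>The differential of multiplication at the identity is addition. In a chart, f (g h)
  becomes a function \<open>W\<close> of two variables, and fixing one factor at the identity
  identifies each of its partial differentials with that of \<open>f\<close>.\<close>

lemma gdiff_mul:
 fixes \<Phi> \<Psi> :: "'v::real_normed_vector => 'g"
 assumes \<Phi>: "gdiff \<Phi> l" and \<Psi>: "gdiff \<Psi> m"
 shows "gdiff (\<lambda>v. \<Phi> v \<cdot> \<Psi> v) (\<lambda>v. l v + m v)"
 unfolding gdiff_def
proof (intro conjI allI impI)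
 show "\<Phi> 0 \<cdot> \<Psi> 0 = e1" using gdiffD(1)[OF \<Phi>] gdiffD(1)[OF \<Psi>] by simp
 show "\<Phi> v \<cdot> \<Psi> v \<in> CG" for v using gdiffD(2)[OF \<Phi>] gdiffD(2)[OF \<Psi>] by simp
 show "l v + m v \<in> galg" for v by (rule subspace_add[OF subspace_galg gdiffD(3)[OF \<Phi>] gdiffD(3)[OF \<Psi>]])
 fix f assume f: "smooth_fun A f"
 define F where "F p = f (fst p \<cdot> snd p)" for p
 have F: "smooth_fun (prod_atlas A A) F"
  using smooth_map_fun[OF pre_AA pre mul_smooth[OF pre_AA fst_smooth snd_smooth] f] by (simp add: F_def[abs_def] o_def)
 have cont: "continuous_map euclidean (mtop A) \<Phi>" if "gdiff \<Phi> l" for \<Phi> :: "'v => 'g" and l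
  by (rule continuous_map_group) (use gdiffD[OF that] in auto)
 obtain U \<phi> Z X where U: "(U, \<phi>) \<in> A" and Z: "openin (mtop A) Z" "e1 \<in> Z" "Z \<subseteq> U"
  and X: "\<And>g. g \<in> Z ==> X g = \<phi> g" "\<And>w. smooth_fun A (\<lambda>g. X g \<bullet> w)"
  by (rule chart_coordinates[OF Mf e1_point]) (rule that)
 note i = chart_inv[OF pre_manifoldD(1)[OF pre U]]
 let ?i = "cinv U \<phi>"
 define W where "W = (\<lambda>z. f (?i (fst z) \<cdot> ?i (snd z)))"
 have opU: "open (\<phi> ` U)" by (rule pre_manifoldD(2)[OF pre U])
 have Ws: "smooth_on (\<phi> ` U \<times> \<phi> ` U) W"
 proof -
  have "smooth_on (map_prod \<phi> \<phi> ` (U \<times> U)) (F o cinv (U \<times> U) (map_prod \<phi> \<phi>))"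
   using F prod_atlasI[OF U U] unfolding smooth_fun_def by blast
  then have "smooth_on (\<phi> ` U \<times> \<phi> ` U) (F o cinv (U \<times> U) (map_prod \<phi> \<phi>))" by (simp only: map_prod_image)
  then show ?thesis
  proof (rule smooth_on_eq[rotated])
   show "open (\<phi> ` U \<times> \<phi> ` U)" by (rule open_Times[OF opU opU])
   fix z assume "z \<in> \<phi> ` U \<times> \<phi> ` U"
   then show "(F o cinv (U \<times> U) (map_prod \<phi> \<phi>)) z = W z"
    using the_inv_into_map_prod[OF pre_manifoldD(1)[OF pre U] pre_manifoldD(1)[OF pre U], of "fst z" "snd z"]
    by (auto simp: F_def W_def)
  qed
 qed
 define x0 where "x0 = \<phi> e1"
 have x0: "x0 \<in> \<phi> ` U" "?i x0 = e1" using Z i(1) by (auto simp: x0_def)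
 define W' where "W' = fderiv W (x0, x0)"
 have dW: "(W has_derivative W') (at (x0, x0))"
  unfolding W'_def by (rule smooth_on_has_derivative[OF Ws]) (use x0 in simp)
 note sl = has_derivative_slices[OF dW]
 note W'l = has_derivative_linear[OF dW]
 define d\<Phi> where "d\<Phi> l h = (\<Sum>b\<in>Basis. L (l h) e1 (\<lambda>g. X g \<bullet> b) *\<^sub>R b)" for l :: "'v => 'n quad" and h
 have X0: "X (\<Phi> 0) = x0" if "gdiff \<Phi> l" for \<Phi> :: "'v => 'g" and l
  using X(1) Z(2) gdiffD(1)[OF that] by (simp add: x0_def)
 \<comment> \<open>Both sides are the derivative at 0 of \<open>f\<close> along the map, once
   through the chart and once by \<open>gdiff\<close>; derivatives are unique.\<close>
 have single: "k (d\<Phi> l h) = L (l h) e1 f"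
  if g: "gdiff \<Phi> l" and k: "(w has_derivative k) (at x0)" and w: "\<And>g. g \<in> Z ==> w (\<phi> g) = f g" for \<Phi> :: "'v => 'g" and l w k h
 proof -
  have "((\<lambda>v. w (X (\<Phi> v))) has_derivative (\<lambda>h. k (d\<Phi> l h))) (at 0)"
   by (rule has_derivative_compose[OF gdiff_chart(1)[OF g X(2)], folded d\<Phi>_def]) (use k X0[OF g] in simp)
  then have "((\<lambda>v. f (\<Phi> v)) has_derivative (\<lambda>h. k (d\<Phi> l h))) (at 0)"
   by (rule has_derivative_transform_within_open[OF _ gdiff_near[OF g Z(1,2)]]) (use X(1) w in auto)
  then have "(\<lambda>h. k (d\<Phi> l h)) = (\<lambda>h. L (l h) e1 f)"
   using gdiffD(5)[OF g f] by (rule has_derivative_unique)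
  then show ?thesis by (rule fun_cong)
 qed
 have 1: "W' (d\<Phi> l h, 0) = L (l h) e1 f" for h
 proof (rule single[OF \<Phi> sl(1)])
  fix g assume g: "g \<in> Z"
  then have "g \<in> CG" using Z(3) chart_subset_points[OF U] pts by blast
  then show "W (\<phi> g, x0) = f g" using i(1) g Z(3) x0(2) by (auto simp: W_def)
 qed
 have 2: "W' (0, d\<Phi> m h) = L (m h) e1 f" for h
 proof (rule single[OF \<Psi> sl(2)])
  fix g assume g: "g \<in> Z"
  then have "g \<in> CG" using Z(3) chart_subset_points[OF U] pts by blast
  then show "W (x0, \<phi> g) = f g" using i(1) g Z(3) x0(2) by (auto simp: W_def)
 qed
 have "((\<lambda>v. (X (\<Phi> v), X (\<Psi> v))) has_derivative (\<lambda>h. (d\<Phi> l h, d\<Phi> m h))) (at 0)"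
  unfolding d\<Phi>_def by (rule has_derivative_Pair[OF gdiff_chart(1)[OF \<Phi> X(2)] gdiff_chart(1)[OF \<Psi> X(2)]])
 from has_derivative_compose[OF this, of W W'] dW
 have "((\<lambda>v. W (X (\<Phi> v), X (\<Psi> v))) has_derivative (\<lambda>h. W' (d\<Phi> l h, d\<Phi> m h))) (at 0)"
  using X0[OF \<Phi>] X0[OF \<Psi>] by simp
 moreover have "W' (d\<Phi> l h, d\<Phi> m h) = L (l h + m h) e1 f" for h
  using linear_add[OF W'l, of "(d\<Phi> l h, 0)" "(0, d\<Phi> m h)"] 1[of h] 2[of h]
   L_add[OF gdiffD(3)[OF \<Phi>] gdiffD(3)[OF \<Psi>]] by simp
 ultimately have "((\<lambda>v. W (X (\<Phi> v), X (\<Psi> v))) has_derivative (\<lambda>h. L (l h + m h) e1 f)) (at 0)" by simp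
 then show "((\<lambda>v. f (\<Phi> v \<cdot> \<Psi> v)) has_derivative (\<lambda>h. L (l h + m h) e1 f)) (at 0)"
 proof (rule has_derivative_transform_within_open)
  show "open ({v. \<Phi> v \<in> Z} \<inter> {v. \<Psi> v \<in> Z})" "0 \<in> {v. \<Phi> v \<in> Z} \<inter> {v. \<Psi> v \<in> Z}"
   using gdiff_near[OF \<Phi> Z(1,2)] gdiff_near[OF \<Psi> Z(1,2)] by auto
  fix v assume "v \<in> {v. \<Phi> v \<in> Z} \<inter> {v. \<Psi> v \<in> Z}"
  then have "\<Phi> v \<in> Z" "\<Psi> v \<in> Z" by auto
  moreover from this have "\<Phi> v \<in> U" "\<Psi> v \<in> U" using Z(3) by auto
  ultimately show "W (X (\<Phi> v), X (\<Psi> v)) = f (\<Phi> v \<cdot> \<Psi> v)" using X(1) i(1) by (simp add: W_def)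
 qed
 show "continuous_on UNIV (\<lambda>v. f (\<Phi> v \<cdot> \<Psi> v))"
  using continuous_on_smooth_pair[OF cont[OF \<Phi>] cont[OF \<Psi>] F] by (simp add: F_def)
qed

end

section \<open>Tangent directions of the set of reachable elements\<close>

context model begin

text \<open>Multiplying such maps adds their directions and conjugating them by a reachable h
  applies \<open>co h\<close>. Hence the set is a subspace invariant under reachable elements,
  whatever the shape of \<open>reachable\<close>.\<close>

definition reach_tangent :: "'n quad set" where
 "reach_tangent = {b. \<exists>\<Phi>. gdiff \<Phi> (\<lambda>t::real. t *\<^sub>R b) \<and> range \<Phi> \<subseteq> reachable}"

lemma reach_tangent_galg: "b \<in> reach_tangent ==> b \<in> galg"
 unfolding reach_tangent_def using gdiffD(3)[of _ _ 1] by force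

lemma gdiff_linear:
 fixes \<Phi> :: "'v::real_normed_vector => 'g" and T :: "'w::real_normed_vector => 'v"
 assumes \<Phi>: "gdiff \<Phi> l" and T: "bounded_linear T"
 shows "gdiff (\<lambda>v. \<Phi> (T v)) (\<lambda>v. l (T v))"
 unfolding gdiff_def
proof (intro conjI allI impI)
 have T0: "T 0 = 0" by (rule linear_0[OF bounded_linear.linear[OF T]])
 show "\<Phi> (T 0) = e1" unfolding T0 by (rule gdiffD(1)[OF \<Phi>])
 fix f assume f: "smooth_fun A f"
 show "continuous_on UNIV (\<lambda>v. f (\<Phi> (T v)))"
  by (rule continuous_on_compose2[OF gdiffD(4)[OF \<Phi> f] bounded_linear.continuous_on[OF T continuous_on_id]]) simp
 show "((\<lambda>v. f (\<Phi> (T v))) has_derivative (\<lambda>h. L (l (T h)) e1 f)) (at 0)"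
  by (rule has_derivative_compose[OF bounded_linear_imp_has_derivative[OF T]]) (use gdiffD(5)[OF \<Phi> f] T0 in simp)
qed (rule gdiffD[OF \<Phi>])+

lemma reach_tangent_subspace: "subspace reach_tangent"
 unfolding subspace_def
proof (intro conjI ballI allI)
 have "e1 \<in> reachable"
 proof -
  have "hcurve (\<lambda>_. e1) {} (\<lambda>_. 0)"
   unfolding hcurve_def using linear_0[OF linear_horizontal] by (auto intro!: exI[of _ 0])
  then show ?thesis unfolding reachable_def by blast
 qed
 moreover have "gdiff (\<lambda>t::real. e1) (\<lambda>t. t *\<^sub>R 0)"
  unfolding gdiff_def by (simp add: subspace_0[OF subspace_galg] L_zero)
 ultimately show "0 \<in> reach_tangent" unfolding reach_tangent_def by (intro CollectI exI[of _ "\<lambda>_. e1"]) auto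
 fix b c assume "b \<in> reach_tangent" "c \<in> reach_tangent"
 then obtain \<Phi> \<Psi> where p: "gdiff \<Phi> (\<lambda>t::real. t *\<^sub>R b)" "range \<Phi> \<subseteq> reachable"
  "gdiff \<Psi> (\<lambda>t::real. t *\<^sub>R c)" "range \<Psi> \<subseteq> reachable" unfolding reach_tangent_def by blast
 have "gdiff (\<lambda>v. \<Phi> v \<cdot> \<Psi> v) (\<lambda>t. t *\<^sub>R (b + c))"
  using gdiff_mul[OF p(1,3)] by (simp add: scaleR_add_right)
 moreover have "range (\<lambda>v. \<Phi> v \<cdot> \<Psi> v) \<subseteq> reachable" using p(2,4) reachable_mul by blast
 ultimately show "b + c \<in> reach_tangent" unfolding reach_tangent_def by blast
next
 fix r b assume "b \<in> reach_tangent"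
 then obtain \<Phi> where p: "gdiff \<Phi> (\<lambda>t::real. t *\<^sub>R b)" "range \<Phi> \<subseteq> reachable" unfolding reach_tangent_def by blast
 have "gdiff (\<lambda>t. \<Phi> (t * r)) (\<lambda>t. t *\<^sub>R (r *\<^sub>R b))"
  using gdiff_linear[OF p(1) bounded_linear_mult_left[of r]] by simp
 moreover have "range (\<lambda>t. \<Phi> (t * r)) \<subseteq> reachable" using p(2) by blast
 ultimately show "r *\<^sub>R b \<in> reach_tangent" unfolding reach_tangent_def by blast
qed

lemma flow_reachable:
 obtains \<epsilon> c where "\<epsilon> > 0" "c 0 = e1" "\<And>t. \<bar>t\<bar> < \<epsilon> ==> c t \<in> reachable"
  "\<And>t f. \<bar>t\<bar> < \<epsilon> ==> smooth_fun A f ==> ((\<lambda>s. f (c s)) has_real_derivative L (ix x) (c t) f) (at t)"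
proof -
 obtain e c where c: "e > 0" "c 0 = e1" "\<And>t. \<bar>t\<bar> < e ==> c t \<in> CG"
  "\<And>t f. \<bar>t\<bar> < e ==> smooth_fun A f ==> ((\<lambda>s. f (c s)) has_real_derivative L (ix x) (c t) f) (at t)"
  "\<And>r. \<bar>r\<bar> < e ==> hcurve (\<lambda>t. c (r * t)) {} (\<lambda>_. r *\<^sub>R x)"
  by (rule integral_hcurve[of e1 x]) (simp, rule that)
 have "c t \<in> reachable" if "\<bar>t\<bar> < e" for t
  unfolding reachable_def
  by (rule CollectI, rule exI, rule exI, rule exI, rule conjI, rule c(5)[OF that]) (simp add: c(2))
 with c(1,2,4) show ?thesis by (intro that[of e c]) auto
qed

lemma reach_tangent_ix: "ix x \<in> reach_tangent"
proof -
 obtain e c where c: "e > 0" "c 0 = e1" "\<And>t. \<bar>t\<bar> < e ==> c t \<in> reachable"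
  "\<And>t f. \<bar>t\<bar> < e ==> smooth_fun A f ==> ((\<lambda>s. f (c s)) has_real_derivative L (ix x) (c t) f) (at t)"
  by (rule flow_reachable[of x]) (rule that)
 \<comment> \<open>Clamped time, so that the local flow becomes a map on the whole line; it is
   unchanged near 0.\<close>
 define q where "q t = max (- (e / 2)) (min (e / 2) t)" for t :: real
 have q: "\<bar>q t\<bar> < e" for t using c(1) by (auto simp: q_def)
 have q0: "q 0 = 0" using c(1) by (simp add: q_def)
 have "gdiff (\<lambda>t. c (q t)) (\<lambda>t. t *\<^sub>R ix x)"
  unfolding gdiff_def
 proof (intro conjI allI impI)
  show "c (q 0) = e1" by (simp add: q0 c(2))
  show "c (q v) \<in> CG" for v by (rule reachable_CG[OF c(3)[OF q]])
  show "t *\<^sub>R ix x \<in> galg" for t by (rule subspace_scale[OF subspace_galg ix_galg])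
  fix f assume f: "smooth_fun A f"
  have "continuous_on {t. \<bar>t\<bar> < e} (\<lambda>s. f (c s))"
   by (rule DERIV_continuous_on[OF has_field_derivative_at_within[OF c(4)[OF _ f]]]) simp
  moreover have "continuous_on UNIV q" unfolding q_def[abs_def] by (intro continuous_intros)
  ultimately show "continuous_on UNIV (\<lambda>t. f (c (q t)))"
   by (rule continuous_on_compose2) (use q in auto)
  have "((\<lambda>s. f (c s)) has_derivative (\<lambda>h. L (h *\<^sub>R ix x) e1 f)) (at 0)"
   using c(4)[OF _ f, of 0] c(1,2) unfolding has_field_derivative_def L_scale[OF ix_galg] by (simp add: mult.commute[of _ "L (ix x) e1 f"])
  then show "((\<lambda>t. f (c (q t))) has_derivative (\<lambda>h. L (h *\<^sub>R ix x) e1 f)) (at 0)"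
   by (rule has_derivative_transform_within_open[of _ _ _ _ "{- (e / 2)<..<e / 2}"])
    (use c(1) in \<open>auto simp: q_def\<close>)
 qed
 then show ?thesis unfolding reach_tangent_def using c(3)[OF q] by blast
qed

lemma reach_tangent_co:
 assumes b: "b \<in> reach_tangent" and h: "h \<in> reachable"
 shows "co h b \<in> reach_tangent"
proof -
 obtain \<Phi> where p: "gdiff \<Phi> (\<lambda>t::real. t *\<^sub>R b)" "range \<Phi> \<subseteq> reachable" using b unfolding reach_tangent_def by blast
 note hC = reachable_CG[OF h] and bg = reach_tangent_galg[OF b]
 have "gdiff (\<lambda>t. gi h \<cdot> (\<Phi> t \<cdot> h)) (\<lambda>t. t *\<^sub>R co h b)"
  unfolding gdiff_def
 proof (intro conjI allI impI)
  show "gi h \<cdot> (\<Phi> 0 \<cdot> h) = e1" using gdiffD(1)[OF p(1)] hC by simp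
  show "gi h \<cdot> (\<Phi> v \<cdot> h) \<in> CG" for v using gdiffD(2)[OF p(1)] hC by simp
  show "t *\<^sub>R co h b \<in> galg" for t by (rule subspace_scale[OF subspace_galg co_galg[OF hC bg]])
  fix f assume f: "smooth_fun A f"
  have k: "smooth_fun A (\<lambda>y. f (gi h \<cdot> (y \<cdot> h)))"
   using smooth_fun_rmul[OF smooth_fun_lmul[OF f, of "gi h"] hC] hC by simp
  show "continuous_on UNIV (\<lambda>t. f (gi h \<cdot> (\<Phi> t \<cdot> h)))" by (rule gdiffD(4)[OF p(1) k])
  show "((\<lambda>t. f (gi h \<cdot> (\<Phi> t \<cdot> h))) has_derivative (\<lambda>t. L (t *\<^sub>R co h b) e1 f)) (at 0)"
   using gdiffD(5)[OF p(1) k] unfolding L_scale[OF bg] L_scale[OF co_galg[OF hC bg]] co_conj[OF hC bg f] .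
 qed
 moreover have "range (\<lambda>t. gi h \<cdot> (\<Phi> t \<cdot> h)) \<subseteq> reachable"
  using p(2) h reachable_mul reachable_inv by blast
 ultimately show ?thesis unfolding reach_tangent_def by blast
qed

text \<open>Along a horizontal flow c the vectors \<open>co (c t) b\<close> stay in the subspace
  \<open>reach_tangent\<close>, hence so does their derivative \<open>br b (ix x)\<close> at t = 0.
  This is tested on vectors orthogonal to the subspace and takes the place of commutators of
  flows.\<close>

lemma reach_tangent_bracket:
 assumes b: "b \<in> reach_tangent"
 shows "br b (ix x) \<in> reach_tangent"
proof -
 obtain e c where c: "e > 0" "c 0 = e1" "\<And>t. \<bar>t\<bar> < e ==> c t \<in> reachable"
  "\<And>t f. \<bar>t\<bar> < e ==> smooth_fun A f ==> ((\<lambda>s. f (c s)) has_real_derivative L (ix x) (c t) f) (at t)"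
  by (rule flow_reachable[of x]) (rule that)
 note bg = reach_tangent_galg[OF b]
 define \<phi> where "\<phi> t = co (c t) b" for t
 have d: "br b (ix x) \<bullet> w = 0" if w: "\<And>a. a \<in> reach_tangent ==> a \<bullet> w = 0" for w
 proof -
  have "L (ix x) e1 (\<lambda>g. co g b \<bullet> w) = br b (ix x) \<bullet> w"
   using dV_inner[OF pre L_tangent[OF ix_galg] co_smooth[OF bg], of e1 x w] dV_co[OF bg ix_galg, of e1] co_one[OF bg] by simp
  then have "((\<lambda>s. \<phi> s \<bullet> w) has_real_derivative br b (ix x) \<bullet> w) (at 0)"
   using c(4)[of 0, OF _ smooth_vecD[OF co_smooth[OF bg], of w]] c(1,2) by (simp add: \<phi>_def)
  moreover have "((\<lambda>s. \<phi> s \<bullet> w) has_real_derivative 0) (at 0)"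
   by (rule has_field_derivative_transform_within_open[of "\<lambda>_. 0" _ _ "{-e<..<e}"])
    (use c(1) w[OF reach_tangent_co[OF b c(3)]] in \<open>auto simp: \<phi>_def\<close>)
  ultimately show ?thesis by (rule DERIV_unique)
 qed
 show ?thesis
 proof (rule ccontr)
  assume "br b (ix x) \<notin> reach_tangent"
  obtain y z where yz: "y \<in> span reach_tangent" "\<And>w. w \<in> span reach_tangent ==> orthogonal z w" "br b (ix x) = y + z"
   by (rule orthogonal_subspace_decomp_exists[of reach_tangent "br b (ix x)"]) (rule that)
  have sp: "span reach_tangent = reach_tangent" by (rule span_eq_iff[THEN iffD2, OF reach_tangent_subspace])
  have "br b (ix x) \<bullet> z = 0" by (rule d) (use yz(2) sp in \<open>auto simp: orthogonal_def inner_commute\<close>)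
  moreover have "y \<bullet> z = 0" using yz(1,2) by (simp add: orthogonal_def inner_commute)
  ultimately have "z = 0" using yz(3) by (simp add: inner_add_left)
  then show False using \<open>br b (ix x) \<notin> reach_tangent\<close> yz sp by simp
 qed
qed

text \<open>Successive brackets with horizontal elements produce \<open>a^2\<close>, then
  \<open>a^3\<close>, then \<open>k\<close>. The last comes with the factor \<open>a2\<close> and
  next to a multiple of an element of \<open>a^2\<close>, which is subtracted before dividing by
  \<open>a2\<close>.\<close>

lemma reach_tangent_all:
 assumes a2: "a2 \<noteq> 0" and b: "b \<in> galg"
 shows "b \<in> reach_tangent"
proof (rule galg_spanned[OF reach_tangent_subspace reach_tangent_ix _ _ _ b])
 have b1: "br (ix x) (ix y) = (0, wedge x y, 0, 0)" and b2: "br (0, C, 0, 0) (ix y) = (0, 0, C *v y, 0)"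
  and b3: "br (0, 0, x, 0) (ix y) = (0, a1 *\<^sub>R wedge x y, 0, a2 *\<^sub>R wedge x y)" for x y C
  by (simp_all add: comm_zero wedge_zero matrix_vector_mult_0 prod_eq_iff)
 have w: "(0, wedge x y, 0, 0) \<in> reach_tangent" for x y
  using reach_tangent_bracket[OF reach_tangent_ix, of x y] unfolding b1 .
 then show "(0, wedge (axis i 1) (axis j 1), 0, 0) \<in> reach_tangent" for i j .
 have u1: "(0, 0, wedge x y *v z, 0) \<in> reach_tangent" for x y z
  using reach_tangent_bracket[OF w, of x y z] unfolding b2 .
 show u: "(0, 0, axis j 1, 0) \<in> reach_tangent" for j
 proof -
  obtain i where "i \<noteq> j" using other_index by blast
  then show ?thesis using u1[of "axis i 1" "axis j 1" "axis i 1"] by (simp add: wedge_mult inner_axis_axis)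
 qed
 show "ik (wedge (axis i 1) (axis j 1)) \<in> reach_tangent" for i j
 proof -
  have "(0, a1 *\<^sub>R wedge (axis i 1) (axis j 1), 0, a2 *\<^sub>R wedge (axis i 1) (axis j 1)) \<in> reach_tangent"
   using reach_tangent_bracket[OF u[of i], of "axis j 1"] unfolding b3 .
  from subspace_diff[OF reach_tangent_subspace this subspace_scale[OF reach_tangent_subspace w, of a1 "axis i 1" "axis j 1"]]
  have "(0, 0, 0, a2 *\<^sub>R wedge (axis i 1) (axis j 1)) \<in> reach_tangent"
   unfolding scaleR_Pair diff_Pair by simp
  from subspace_scale[OF reach_tangent_subspace this, of "1 / a2"] show ?thesis using a2 by simp
 qed
qed

text \<open>One reachable family for each basis vector, multiplied together, gives a map with
  differential \<open>galgp\<close> at 0, which is onto the tangent space at the identity. Since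
  differentiability is known at 0 only, an open mapping theorem for a derivative at a single point
  replaces the inverse function theorem.\<close>

lemma reachable_neighbourhood:
 assumes a2: "a2 \<noteq> 0"
 obtains N where "openin (mtop A) N" "e1 \<in> N" "N \<subseteq> reachable"
proof -
 have ex: "\<exists>\<Phi>. gdiff \<Phi> (\<lambda>v :: 'n quad. \<Sum>e\<in>I. (v \<bullet> e) *\<^sub>R galgp e) \<and> range \<Phi> \<subseteq> reachable" if "finite I" for I
  using that
 proof (induction I rule: finite_induct)
  case empty
  obtain \<Psi> where "gdiff \<Psi> (\<lambda>t::real. t *\<^sub>R 0)" "range \<Psi> \<subseteq> reachable"
   using subspace_0[OF reach_tangent_subspace] unfolding reach_tangent_def by blast
  then show ?case using gdiff_linear[of \<Psi> "\<lambda>t. t *\<^sub>R 0" "\<lambda>v :: 'n quad. 0"] by fastforce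
 next
  case (insert e I)
  then obtain \<Phi> where p: "gdiff \<Phi> (\<lambda>v :: 'n quad. \<Sum>e\<in>I. (v \<bullet> e) *\<^sub>R galgp e)" "range \<Phi> \<subseteq> reachable" by blast
  obtain \<Psi> where q: "gdiff \<Psi> (\<lambda>t::real. t *\<^sub>R galgp e)" "range \<Psi> \<subseteq> reachable"
   using reach_tangent_all[OF a2 galgp_galg] unfolding reach_tangent_def by blast
  have "gdiff (\<lambda>v. \<Psi> (v \<bullet> e) \<cdot> \<Phi> v) (\<lambda>v. \<Sum>e\<in>insert e I. (v \<bullet> e) *\<^sub>R galgp e)"
   using gdiff_mul[OF gdiff_linear[OF q(1) bounded_linear_inner_left[of e]] p(1)] insert.hyps by simp
  moreover have "range (\<lambda>v. \<Psi> (v \<bullet> e) \<cdot> \<Phi> v) \<subseteq> reachable" using p(2) q(2) reachable_mul by blast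
  ultimately show ?case by blast
 qed
 have "(\<Sum>e\<in>Basis. (v \<bullet> e) *\<^sub>R galgp e) = galgp v" for v :: "'n quad"
  using arg_cong[OF euclidean_representation[of v], of galgp]
  by (simp add: linear_sum[OF galgp_linear] linear_scale[OF galgp_linear])
 with ex[OF finite_Basis] obtain \<Phi> :: "'n quad => 'g" where \<Phi>: "gdiff \<Phi> galgp" "range \<Phi> \<subseteq> reachable" by auto
 obtain U \<phi> Z X where U: "(U, \<phi>) \<in> A" and Z: "openin (mtop A) Z" "e1 \<in> Z" "Z \<subseteq> U"
  and X: "\<And>g. g \<in> Z ==> X g = \<phi> g" "\<And>w. smooth_fun A (\<lambda>g. X g \<bullet> w)"
  by (rule chart_coordinates[OF Mf e1_point]) (rule that)
 note inj = pre_manifoldD(1)[OF pre U]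
 define T where "T h = (\<Sum>b\<in>Basis. L (galgp h) e1 (\<lambda>g. X g \<bullet> b) *\<^sub>R b)" for h
 have dX: "((\<lambda>v. X (\<Phi> v)) has_derivative T) (at 0)" unfolding T_def[abs_def] by (rule gdiff_chart(1)[OF \<Phi>(1) X(2)])
 have linT: "linear T" by (rule has_derivative_linear[OF dX])
 have "\<exists>a. \<xi> = T a" for \<xi>
 proof -
  have eU: "e1 \<in> U" using Z by blast
  obtain a where a: "a \<in> galg" "chart_vec A U \<phi> e1 \<xi> = L a e1"
   by (rule tangent_L[OF _ chart_vec_tangent[OF pre U eU]]) (simp, rule that)
  have "L a e1 (\<lambda>g. X g \<bullet> b) = \<xi> \<bullet> b" for b
   unfolding a(2)[symmetric] by (rule chart_vec_coordinate[OF pre U Z X])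
  then have "T a = \<xi>" unfolding T_def galgp_ident[OF a(1)] by (simp add: euclidean_representation)
  then show ?thesis by blast
 qed
 then have "surj T" unfolding surj_def by blast
 then obtain T' where T': "linear T'" "T o T' = id" using linear_surjective_right_inverse[OF linT] by blast
 have "X (\<Phi> 0) \<in> interior ((\<lambda>v. X (\<Phi> v)) ` {v. \<Phi> v \<in> Z})"
 proof (rule sussmann_open_mapping[of UNIV])
  show "bounded_linear T'" using T'(1) by (simp add: linear_conv_bounded_linear)
  show "0 \<in> interior {v. \<Phi> v \<in> Z}" using gdiff_near[OF \<Phi>(1) Z(1,2)] by (simp add: interior_open)
 qed (use gdiff_chart(2)[OF \<Phi>(1) X(2)] dX T' in auto)
 then obtain W where W: "open W" "\<phi> e1 \<in> W" "W \<subseteq> (\<lambda>v. X (\<Phi> v)) ` {v. \<Phi> v \<in> Z}"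
  using gdiffD(1)[OF \<Phi>(1)] X(1)[OF Z(2)] unfolding interior_def by auto
 show ?thesis
 proof (rule that[of "U \<inter> \<phi> -` W"])
  show "openin (mtop A) (U \<inter> \<phi> -` W)" by (rule openin_chart_vimage[OF pre U W(1)])
  show "e1 \<in> U \<inter> \<phi> -` W" using Z W(2) by auto
  show "U \<inter> \<phi> -` W \<subseteq> reachable"
  proof
   fix g assume g: "g \<in> U \<inter> \<phi> -` W"
   then obtain v where v: "\<phi> g = X (\<Phi> v)" "\<Phi> v \<in> Z" using W(3) by blast
   then have "\<phi> g = \<phi> (\<Phi> v)" using X(1) by simp
   then have "g = \<Phi> v" using inj_onD[OF inj] g v(2) Z(3) by blast
   then show "g \<in> reachable" using \<Phi>(2) by blast
  qed
 qed
qed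

end

section \<open>Nontrivial holonomy\<close>

context model begin

lemma smooth_co_inv:
 assumes "a \<in> galg" shows "smooth_vec A (\<lambda>h. co (gi h) a)"
 unfolding smooth_vec_def
proof
 fix e
 from smooth_map_fun[OF pre pre gi_smooth[OF pre ident_smooth] smooth_vecD[OF co_smooth[OF assms], of e]]
 show "smooth_fun A (\<lambda>h. co (gi h) a \<bullet> e)" by (simp add: o_def)
qed

lemma co_expand:
 assumes g: "g \<in> CG" and a: "a \<in> galg"
 shows "co g a = (\<Sum>e\<in>Basis. (a \<bullet> e) *\<^sub>R co g (galgp e))"
proof -
 have "a = galgp (\<Sum>e\<in>Basis. (a \<bullet> e) *\<^sub>R e)" using galgp_ident[OF a] by (simp add: euclidean_representation)
 also have "\<dots> = (\<Sum>e\<in>Basis. (a \<bullet> e) *\<^sub>R galgp e)"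
  by (simp add: linear_sum[OF galgp_linear] linear_scale[OF galgp_linear])
 finally have "co g a = co g (\<Sum>e\<in>Basis. (a \<bullet> e) *\<^sub>R galgp e)" by (rule arg_cong)
 then show ?thesis unfolding co_sum[OF g finite_Basis galgp_galg] .
qed

text \<open>Differentiate the constant a = co h (co (gi h) a): the argument and \<open>co h\<close>
  both vary, and the second contribution is the bracket of \<open>dV_co\<close>.\<close>

lemma dV_co_inv:
 assumes a: "a \<in> galg" and b: "b \<in> galg" and g: "g \<in> CG"
 shows "co g (dV (L b g) (\<lambda>h. co (gi h) a)) = - br a b"
proof -
 define \<omega> where "\<omega> h = co (gi h) a" for h
 have \<omega>: "smooth_vec A \<omega>" "\<And>h. h \<in> CG ==> \<omega> h \<in> galg"
  unfolding \<omega>_def[abs_def] using smooth_co_inv[OF a] a by simp_all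
 note T = L_tangent[OF b g]
 define d where "d = dV (L b g) \<omega>"
 have d: "d \<in> galg" unfolding d_def by (rule dV_galg[OF T g \<omega>])
 have "(co g d + br a b) \<bullet> w = 0" for w
 proof -
  have s: "smooth_fun A (\<lambda>h. (\<omega> h \<bullet> e) * (co h (galgp e) \<bullet> w))" for e
   by (rule smooth_fun_mult[OF pre smooth_vecD[OF \<omega>(1)] smooth_vecD[OF co_smooth[OF galgp_galg]]])
  have "0 = L b g (\<lambda>h. a \<bullet> w)" using tangent_const[OF T] by simp
  also have "\<dots> = L b g (\<lambda>h. \<Sum>e\<in>Basis. (\<omega> h \<bullet> e) * (co h (galgp e) \<bullet> w))"
  proof (rule L_cong[OF b g])
   fix h assume h: "h \<in> CG"
   have "a = co h (\<omega> h)" unfolding \<omega>_def using co_inv(2)[OF h a] by simp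
   then show "a \<bullet> w = (\<Sum>e\<in>Basis. (\<omega> h \<bullet> e) * (co h (galgp e) \<bullet> w))"
    using co_expand[OF h \<omega>(2)[OF h]] by (simp add: inner_sum_left)
  qed
  also have "\<dots> = (\<Sum>e\<in>Basis. L b g (\<lambda>h. \<omega> h \<bullet> e) * (co g (galgp e) \<bullet> w) + (\<omega> g \<bullet> e) * L b g (\<lambda>h. co h (galgp e) \<bullet> w))"
   using tangent_sum[OF T pre, of Basis "\<lambda>e h. (\<omega> h \<bullet> e) * (co h (galgp e) \<bullet> w)"] s
    tangentD(4)[OF T smooth_vecD[OF \<omega>(1)] smooth_vecD[OF co_smooth[OF galgp_galg]]] by simp
  also have "\<dots> = (\<Sum>e\<in>Basis. (d \<bullet> e) * (co g (galgp e) \<bullet> w) + (\<omega> g \<bullet> e) * (br (co g (galgp e)) b \<bullet> w))"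
   using dV_inner[OF pre T \<omega>(1)] dV_inner[OF pre T co_smooth[OF galgp_galg]] dV_co[OF galgp_galg b g]
   by (simp add: d_def)
  also have "\<dots> = co g d \<bullet> w + br (co g (\<omega> g)) b \<bullet> w"
   unfolding co_expand[OF g d] co_expand[OF g \<omega>(2)[OF g]]
   by (simp add: inner_sum_left sum.distrib linear_sum[OF gbracket_linear_left] linear_scale[OF gbracket_linear_left])
  also have "co g (\<omega> g) = a" unfolding \<omega>_def by (rule co_inv(2)[OF g a])
  finally show ?thesis by (simp add: inner_add_left)
 qed
 then have "co g d + br a b = 0" by (metis inner_eq_zero_iff)
 then show ?thesis unfolding d_def \<omega>_def by (simp add: eq_neg_iff_add_eq_0)
qed

lemma Y_expand:
 assumes g: "g \<in> CG" and a: "a \<in> galg"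
 shows "(\<Sum>e\<in>Basis. (a \<bullet> e) * Y (galgp e) (pr g) f) = Pu g (ix (p1 (co g a))) f"
proof -
 have "p1 (co g a) = (\<Sum>e\<in>Basis. (a \<bullet> e) *\<^sub>R p1 (co g (galgp e)))"
  by (subst co_expand[OF g a]) (simp add: linear_sum[OF p_linear(1)] linear_scale[OF p_linear(1)])
 then show ?thesis
  by (simp add: Y_pr[OF g galgp_galg] Pu_apply linear_sum[OF linear_horizontal] linear_scale[OF linear_horizontal])
qed

end

context model_connection begin

text \<open>In left coordinates the section is the constant z. Written through the fields
  \<open>Y\<close>, its coefficients are the components of \<omega>, the adjoint action of g on z.
  Their derivatives and the covariant derivatives of the fields each contribute \<open>p1\<close> of
  a bracket of horizontal elements, which is zero.\<close>

lemma parallel_hcurve: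
 assumes g: "hcurve g N u"
 shows "parallel_along M nab (pr o g) (\<lambda>t. Pu (g t) (ix z))"
proof -
 obtain e :: "nat => 'n quad" and m where e: "bij_betw e {..<m} Basis"
  using ex_bij_betw_nat_finite[of "Basis :: 'n quad set"] by (auto simp: lessThan_atLeast0)
 have re: "(\<Sum>i<m. f (e i)) = (\<Sum>e\<in>Basis. f e)" for f :: "'n quad => real" by (rule sum.reindex_bij_betw[OF e])
 define \<omega> where "\<omega> h = co (gi h) (ix z)" for h
 have \<omega>: "smooth_vec A \<omega>" "\<And>h. h \<in> CG ==> \<omega> h \<in> galg"
  unfolding \<omega>_def[abs_def] using smooth_co_inv[OF ix_galg] by simp_all
 define a where "a i t = \<omega> (g t) \<bullet> e i" for i t
 define E where "E i = Y (galgp (e i))" for i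
 have co\<omega>: "co h (\<omega> h) = ix z" if "h \<in> CG" for h unfolding \<omega>_def by (rule co_inv(2)[OF that ix_galg])
 have "abs_continuous_on {0..1} (a i)" for i
 proof -
  obtain C where C: "\<And>s t. s \<in> {0..1} ==> t \<in> {0..1} ==>
    \<bar>\<omega> (g t) \<bullet> e i - \<omega> (g s) \<bullet> e i\<bar> \<le> C * \<bar>t - s\<bar>"
   by (rule hcurve_Lipschitz[OF g smooth_vecD[OF \<omega>(1), of "e i"]]) (rule that)
  show ?thesis by (rule Lipschitz_imp_abs_continuous) (unfold a_def, rule C)
 qed
 moreover have "E i \<in> sections M" for i unfolding E_def by (rule Y_section[OF galgp_galg])
 moreover have "Pu (g t) (ix z) = (\<lambda>f. \<Sum>i<m. a i t * E i ((pr o g) t) f)" if t: "t \<in> {0..1}" for t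
 proof
  fix f
  note gt = hcurveD(1)[OF g t]
  show "Pu (g t) (ix z) f = (\<Sum>i<m. a i t * E i ((pr o g) t) f)"
   unfolding a_def E_def o_def re[of "\<lambda>e. (\<omega> (g t) \<bullet> e) * Y (galgp e) (pr (g t)) f"]
    Y_expand[OF gt \<omega>(2)[OF gt]] co\<omega>[OF gt] by simp
 qed
 moreover have "AE t in lebesgue. t \<in> {0..1} --> (\<exists>a'. \<forall>i<m. (a i has_real_derivative a' i) (at t)) \<and>
   (\<forall>f. (\<Sum>i<m. deriv (a i) t * E i ((pr o g) t) f +
    a i t * nab (E i) ((pr o g) t) (velocity B (pr o g) t) f) = 0)"
  using finite_AE_lebesgue[OF hcurveD(2)[OF g]]
 proof (rule eventually_mono, intro impI)
  fix t assume N: "t \<notin> N" and t: "t \<in> {0..1::real}"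
  note gt = hcurveD(1)[OF g t]
  define d where "d = dV (L (ix (u t)) (g t)) \<omega>"
  have d: "d \<in> galg" unfolding d_def by (rule dV_galg[OF L_tangent[OF ix_galg gt] gt \<omega>])
  have cd: "co (g t) d = - br (ix z) (ix (u t))"
   unfolding d_def \<omega>_def[abs_def] by (rule dV_co_inv[OF ix_galg ix_galg gt])
  have da: "(a i has_real_derivative d \<bullet> e i) (at t)" for i
   using hcurveD(3)[OF g t N smooth_vecD[OF \<omega>(1), of "e i"]] dV_inner[OF pre L_tangent[OF ix_galg gt] \<omega>(1)]
   by (simp add: a_def[abs_def] d_def)
  have "(\<Sum>i<m. deriv (a i) t * E i ((pr o g) t) f +
    a i t * nab (E i) ((pr o g) t) (velocity B (pr o g) t) f) = 0" for f
  proof -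
   have "(\<Sum>i<m. deriv (a i) t * E i ((pr o g) t) f) = Pu (g t) (ix (p1 (co (g t) d))) f"
    unfolding DERIV_imp_deriv[OF da] E_def o_def re[of "\<lambda>e. (d \<bullet> e) * Y (galgp e) (pr (g t)) f"]
    by (rule Y_expand[OF gt d])
   also have "\<dots> = 0"
    unfolding cd linear_neg[OF p_linear(1)] p1_br_ix using Pu_ix_zero by simp
   finally have 1: "(\<Sum>i<m. deriv (a i) t * E i ((pr o g) t) f) = 0" .
   have "(\<Sum>i<m. a i t * nab (E i) ((pr o g) t) (velocity B (pr o g) t) f) =
     (\<Sum>e\<in>Basis. (\<omega> (g t) \<bullet> e) * Pu (g t) (ix (p1 (br (co (g t) (galgp e)) (ix (u t))))) f)"
    unfolding hcurve_velocity[OF g t N] unfolding E_def o_def nab_Y_formula[OF gt galgp_galg] a_def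
    by (rule re)
   also have "\<dots> = Pu (g t) (ix (\<Sum>e\<in>Basis. (\<omega> (g t) \<bullet> e) *\<^sub>R p1 (br (co (g t) (galgp e)) (ix (u t))))) f"
    by (simp only: Pu_ix_sum)
   also have "(\<Sum>e\<in>Basis. (\<omega> (g t) \<bullet> e) *\<^sub>R p1 (br (co (g t) (galgp e)) (ix (u t)))) =
     p1 (br (\<Sum>e\<in>Basis. (\<omega> (g t) \<bullet> e) *\<^sub>R co (g t) (galgp e)) (ix (u t)))"
    by (simp only: linear_sum[OF gbracket_linear_left] linear_scale[OF gbracket_linear_left]
      linear_sum[OF p_linear(1)] linear_scale[OF p_linear(1)])
   also have "\<dots> = 0"
    unfolding co_expand[OF gt \<omega>(2)[OF gt], symmetric] co\<omega>[OF gt] by (rule p1_br_ix)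
   finally have 2: "(\<Sum>i<m. a i t * nab (E i) ((pr o g) t) (velocity B (pr o g) t) f) = Pu (g t) (ix 0) f" .
   show ?thesis unfolding sum.distrib 1 2 Pu_ix_zero by (rule add_0)
  qed
  then show "(\<exists>a'. \<forall>i<m. (a i has_real_derivative a' i) (at t)) \<and>
    (\<forall>f. (\<Sum>i<m. deriv (a i) t * E i ((pr o g) t) f +
     a i t * nab (E i) ((pr o g) t) (velocity B (pr o g) t) f) = 0)"
   by (intro conjI exI[of _ "\<lambda>i. d \<bullet> e i"] allI impI da)
 qed
 ultimately show ?thesis unfolding parallel_along_def
  by (intro exI[of _ m] exI[of _ E] exI[of _ a] conjI) auto
qed

lemma holonomy_nontrivial:
 assumes a2: "a2 \<noteq> 0" and x: "x \<in> points B"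
 shows "horizontal_holonomy M nab x \<noteq> {restrict id (dst M x)}"
proof
 assume hol: "horizontal_holonomy M nab x = {restrict id (dst M x)}"
 obtain g0 where g0: "g0 \<in> CG" "x = pr g0" using x by (rule pointE)
 have fix_k: "p1 (co k (ix z)) = z" if k: "k \<in> K" "k \<in> reachable" for k z
 proof -
  obtain \<gamma> N u where \<gamma>: "hcurve \<gamma> N u" "\<gamma> 0 = e1" "\<gamma> 1 = k" using k(2) unfolding reachable_def by blast
  define g where "g t = g0 \<cdot> \<gamma> t" for t
  have g: "hcurve g N u" "g 0 = g0" "g 1 = g0 \<cdot> k"
   unfolding g_def using hcurve_left[OF \<gamma>(1) g0(1)] \<gamma>(2,3) g0 by simp_all
  have pk: "pr (g0 \<cdot> k) = x" using pr_K[OF g0(1) k(1)] g0(2) by simp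
  have D: "dst M x = range (\<lambda>z. Pu g0 (ix z))" unfolding g0(2) by (rule dst_eq[OF g0(1)])
  \<comment> \<open>The map that keeps the left coordinate z and changes the frame from
    \<open>g0\<close> to \<open>g0 \<cdot> k\<close>; both lie over x because k is in
    \<open>K\<close>.\<close>
  define P where "P = restrict (\<lambda>v. Pu (g0 \<cdot> k) (ix (inv_into UNIV (\<lambda>z. Pu g0 (ix z)) v))) (dst M x)"
  have inj: "inj (\<lambda>z. Pu g0 (ix z))" by (rule injI) (rule Pu_ix_inj[OF g0(1)])
  have Pz: "P (Pu g0 (ix z)) = Pu (g0 \<cdot> k) (ix z)" for z
   unfolding P_def using D inv_into_f_f[OF inj, of z] by simp
  have "P \<in> horizontal_holonomy M nab x"
   unfolding horizontal_holonomy_def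
  proof (intro CollectI conjI exI[of _ "pr o g"] ballI)
   show "P \<in> dst M x \<rightarrow>\<^sub>E dst M x"
    using Pu_dst[of "g0 \<cdot> k"] g0(1) k(1) pk by (auto simp: P_def)
   show "horizontal_curve M (pr o g)" by (rule hcurve_horizontal[OF g(1)])
   show "(pr o g) 0 = x" "(pr o g) 1 = x" using g g0 pk by simp_all
   fix v assume "v \<in> dst M x"
   then obtain z where z: "v = Pu g0 (ix z)" unfolding D by blast
   show "parallel_transport M nab (pr o g) v (P v)"
    unfolding parallel_transport_def z Pz
    by (intro exI[of _ "\<lambda>t. Pu (g t) (ix z)"] conjI parallel_hcurve[OF g(1)]) (simp_all add: g)
  qed
  then have "P = restrict id (dst M x)" using hol by blast
  then have "Pu (g0 \<cdot> k) (ix z) = Pu g0 (ix z)" using Pz[of z] D by simp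
  also have "\<dots> = Pu (g0 \<cdot> k) (ix (p1 (co k (ix z))))"
   using Pu_K[OF k(1) g0(1) ix_galg, of z] co_K_ix[OF k(1), of z] by simp
  finally show ?thesis using Pu_ix_inj[of "g0 \<cdot> k"] g0(1) k(1) by simp
 qed
 obtain W where W: "openin (mtop A) W" "e1 \<in> W" "W \<subseteq> reachable"
  by (rule reachable_neighbourhood[OF a2]) (rule that)
 \<comment> \<open>Near the identity the one-parameter subgroup of C consists of reachable elements
   of \<open>K\<close>, which all fix z by \<open>fix_k\<close>; its derivative at 0, which is -C z,
   is therefore zero.\<close>
 have "C *v z = 0" if C: "C \<in> skew" for C :: "real ^ 'n ^ 'n" and z
 proof -
  obtain c where c: "exp_curve G A (L (ik C)) c" "\<forall>t. c t \<in> K" by (rule K_exp_curve[OF C])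
  have c0: "c 0 = e1" using c(1) by (simp add: exp_curve_def)
  have "continuous_on UNIV (\<lambda>t. f (c t))" if "smooth_fun A f" for f
   using exp_curve_deriv[OF c(1) that] by (intro DERIV_continuous_on) (auto simp: o_def)
  then have "continuous_map euclidean (mtop A) c"
   by (intro continuous_map_group) (use c(2) in auto)
  then have op: "open {t. c t \<in> W}" using openin_continuous_map_preimage[OF _ W(1)] by fastforce
  have d: "((\<lambda>t. p1 (co (c t) (ix z))) has_vector_derivative - (C *v z)) (at 0)"
   using exp_curve_vec_derivative[OF c(1) ik_galg[OF C] smooth_p1_co[OF ix_galg], of z 0]
    dV_p1_co[OF ix_galg ik_galg[OF C], of e1 z]
   by (simp add: c0 co_one gbracket_ik)
  have "((\<lambda>t. z) has_vector_derivative - (C *v z)) (at 0)"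
   by (rule has_vector_derivative_transform_within_open[OF d op])
    (use c0 W c(2) fix_k in auto)
  then have "- (C *v z) = 0" by (rule vector_derivative_unique_at) simp
  then show ?thesis by simp
 qed
 then have "axis i 1 = (0 :: real ^ 'n)" for i using skew_annihilated[of "axis i 1"] by blast
 then show False by (simp add: axis_eq_0_iff)
qed

end

theorem mainTheorem10:
  fixes a1 a2 :: real
    and G :: "'g monoid" and A :: "('g, 'e::euclidean_space) atlas"
    and L :: "('n::finite) quad \<Rightarrow> 'g vfield"
    and K :: "'g set" and M :: "('g set, 'm::euclidean_space) subriem"
    and nab :: "'g set pconn" and x :: "'g set"
  assumes "CARD('n) \<ge> 2"
    and "is_model_M a1 a2 G A L K M"
    and "canonical_partial_connection M nab"
    and "x \<in> pts M"
  shows "horizontal_holonomy M nab x = {restrict id (dst M x)} \<longleftrightarrow> a2 = 0"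
proof -
  interpret model_connection a1 a2 G A L K M nab
    using assms(1-3) by unfold_locales (auto simp: is_model_M_def)
  show ?thesis using holonomy_trivial[OF _ assms(4)] holonomy_nontrivial[OF _ assms(4)] by blast
qed

end
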